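(* Let $p\ge 1$ be an integer. There exists a constant $c_p>0$ such that the following holds. Let $x:\mathbb{S}^1\times[0,T)\to\mathbb{R}^2$ be the maximal solution of the $p$-curve shortening flow $$\frac{\partial x}{\partial t}=-\frac1p k^pN$$ starting from a smooth simple closed convex curve, where $0<T<\infty$ is the maximal time of existence, and let $\psi>0$ be the curvature of the initial curve. If $$\hat\psi(0)\ge c_p\|\psi\|_2 ,$$ then the curvature $\tilde k$ of the curves given by the rescaled embeddings $\left(\frac{p}{p+1}\right)^{\frac1{p+1}}(T-t)^{-\frac1{p+1}}x$, with rescaled time parameter $\tau=-\frac1{p+1}\log\left(1-\frac tT\right)$, satisfies for every integer $l\ge 0$ and all $\tau\ge0$ $$\left\|\tilde k(\cdot,\tau)-1\right\|_{C^l(\mathbb{S}^1)}\le C_{p,l}\,e^{-(3p-1)\tau},$$ where $C_{p,l}$ is a constant that depends only on $p$, $l$ and $\psi$.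
   Context: A family of smooth convex embeddings $x(\cdot,t)$ of the unit circle $\mathbb{S}^1$ in $\mathbb{R}^2$ satisfies the $p$-curve shortening flow if $\partial_t x=-\frac1p k^pN$, where $k$ is the curvature of the embedding and $N$ is the normal vector pointing outward from the region bounded by $x(\cdot,t)$. Convex curves have strictly positive curvature and remain convex under the flow. The curvature is regarded as a $2\pi$-periodic function of the (tangent/normal) angle $\theta\in[0,2\pi]$, and the flow is then equivalent to $$\frac{\partial k}{\partial t}=k^2\left(k^{p-1}\frac{\partial^2k}{\partial\theta^2}+(p-1)k^{p-2}\left(\frac{\partial k}{\partial\theta}\right)^2+\frac1pk^p\right),\qquad k(\theta,0)=\psi(\theta),$$ with periodic boundary conditions. The normalised curvature is $\tilde k=\left(\frac{p+1}{p}\right)^{\frac1{p+1}}(T-t)^{\frac1{p+1}}k$. Fourier coefficients: $\hat f(n)=\frac1{2\pi}\int_0^{2\pi}f(\theta)e^{-in\theta}\,d\theta$. Seminorm: $\|f\|_\beta=\max\{\sup_{\xi\in\mathbb{Z}}|\xi|^\beta|\mathrm{Re}\,\hat f(\xi)|,\ \sup_{\xi\in\mathbb{Z}}|\xi|^\beta|\mathrm{Im}\,\hat f(\xi)|\}$; $\|\psi\|_2$ is this seminorm with $\beta=2$ (not an $L^2$ norm). The $C^l$ norm is $\|f\|_{C^l}=\max_{0\le j\le l}\sup_\theta\left|\frac{d^jf}{d\theta^j}\right|$. *)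

theory Defs
  imports "HOL-Analysis.Analysis"
begin

section \<open>Plane curves\<close>

text \<open>
  The plane is \<^typ>\<open>complex\<close> with its real inner product, and a map on the unit circle is a
  \<open>2\<pi>\<close>-periodic map on the real line.
\<close>

definition smooth_curve :: "(real \<Rightarrow> complex) \<Rightarrow> bool" where
  "smooth_curve \<gamma> \<longleftrightarrow>
     (\<exists>D :: nat \<Rightarrow> real \<Rightarrow> complex. D 0 = \<gamma> \<and>
        (\<forall>n u. (D n has_vector_derivative D (Suc n) u) (at u)))"

definition smooth_circle_embedding :: "(real \<Rightarrow> complex) \<Rightarrow> bool" where
  "smooth_circle_embedding \<gamma> \<longleftrightarrow>
     smooth_curve \<gamma> \<and>
     (\<forall>u. \<gamma> (u + 2 * pi) = \<gamma> u) \<and>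
     inj_on \<gamma> {0..<2 * pi} \<and>
     (\<forall>u. vector_derivative \<gamma> (at u) \<noteq> 0)"

text \<open>
  The unit normal pointing out of the bounded region; no orientation of the parametrisation is
  assumed.
\<close>

definition outward_normal :: "(real \<Rightarrow> complex) \<Rightarrow> real \<Rightarrow> complex" where
  "outward_normal \<gamma> u =
     (THE n. norm n = 1 \<and> n \<bullet> vector_derivative \<gamma> (at u) = 0 \<and>
             (\<forall>\<^sub>F s in at_right 0. \<gamma> u + s *\<^sub>R n \<in> outside (range \<gamma>)))"

text \<open>
  With arc length \<open>s\<close> and outward normal \<open>N\<close> the curvature \<open>k\<close> is given by
  \<open>\<partial>\<^sub>s\<^sup>2 \<gamma> = - k N\<close>. The tangential part of the second derivative in an arbitrary parameter is
  orthogonal to \<open>N\<close>, hence the formula below; a circle of radius \<open>r\<close> has curvature \<open>1 / r\<close>.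
\<close>

definition curvature :: "(real \<Rightarrow> complex) \<Rightarrow> real \<Rightarrow> real" where
  "curvature \<gamma> u =
     - (vector_derivative (\<lambda>v. vector_derivative \<gamma> (at v)) (at u) \<bullet> outward_normal \<gamma> u)
       / (norm (vector_derivative \<gamma> (at u)))\<^sup>2"

definition convex_embedding :: "(real \<Rightarrow> complex) \<Rightarrow> bool" where
  "convex_embedding \<gamma> \<longleftrightarrow>
     smooth_circle_embedding \<gamma> \<and> convex (inside (range \<gamma>)) \<and> (\<forall>u. curvature \<gamma> u > 0)"

text \<open>
  The curvature as a function of the normal angle: its value at the point of the curve with
  outward normal \<open>(cos \<theta>, sin \<theta>)\<close>. For a convex embedding there is exactly one such point.
\<close>

definition angle_curvature :: "(real \<Rightarrow> complex) \<Rightarrow> real \<Rightarrow> real" where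
  "angle_curvature \<gamma> \<theta> = (THE \<kappa>. \<exists>u. outward_normal \<gamma> u = cis \<theta> \<and> \<kappa> = curvature \<gamma> u)"


section \<open>The flow\<close>

text \<open>
  A family of curves is \<open>x t u\<close>, with time as the first argument. It is smooth on
  \<open>\<real> \<times> [0, T)\<close> when all mixed partial derivatives (one-sided in time at \<open>t = 0\<close>) exist and are
  continuous; \<open>D i j\<close> is the derivative taken \<open>i\<close> times in \<open>u\<close> and \<open>j\<close> times in \<open>t\<close>. Values of
  \<open>x\<close> outside \<open>[0, T)\<close> are irrelevant.
\<close>

definition smooth_family :: "real \<Rightarrow> (real \<Rightarrow> real \<Rightarrow> complex) \<Rightarrow> bool" where
  "smooth_family T x \<longleftrightarrow>
     (\<exists>D :: nat \<Rightarrow> nat \<Rightarrow> real \<Rightarrow> real \<Rightarrow> complex.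
        (\<forall>t\<in>{0..<T}. \<forall>u. D 0 0 t u = x t u) \<and>
        (\<forall>i j. continuous_on ({0..<T} \<times> UNIV) (\<lambda>(t, u). D i j t u)) \<and>
        (\<forall>i j. \<forall>t\<in>{0..<T}. \<forall>u.
           (D i j t has_vector_derivative D (Suc i) j t u) (at u) \<and>
           ((\<lambda>s. D i j s u) has_vector_derivative D i (Suc j) t u) (at t within {0..<T})))"

definition p_curve_shortening_flow :: "nat \<Rightarrow> real \<Rightarrow> (real \<Rightarrow> real \<Rightarrow> complex) \<Rightarrow> bool" where
  "p_curve_shortening_flow p T x \<longleftrightarrow>
     smooth_family T x \<and>
     (\<forall>t\<in>{0..<T}. convex_embedding (x t)) \<and>
     (\<forall>t\<in>{0..<T}. \<forall>u.
        ((\<lambda>s. x s u) has_vector_derivative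
           (- (1 / real p) * curvature (x t) u ^ p) *\<^sub>R outward_normal (x t) u)
         (at t within {0..<T}))"

definition maximal_p_curve_shortening_flow ::
    "nat \<Rightarrow> real \<Rightarrow> (real \<Rightarrow> real \<Rightarrow> complex) \<Rightarrow> bool" where
  "maximal_p_curve_shortening_flow p T x \<longleftrightarrow>
     p_curve_shortening_flow p T x \<and>
     \<not> (\<exists>T'>T. \<exists>y. p_curve_shortening_flow p T' y \<and> (\<forall>t\<in>{0..<T}. \<forall>u. y t u = x t u))"


section \<open>Rescaling\<close>

text \<open>
  The inverse of the rescaled time \<open>\<tau> = - (1 / (p + 1)) log (1 - t / T)\<close>, which maps \<open>[0, T)\<close> onto
  \<open>[0, \<infinity>)\<close>.
\<close>

definition original_time :: "nat \<Rightarrow> real \<Rightarrow> real \<Rightarrow> real" where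
  "original_time p T \<tau> = T * (1 - exp (- (real p + 1) * \<tau>))"

lemma original_time_iff:
  assumes "T > 0" and "t < T"
  shows "\<tau> = - (1 / (real p + 1)) * ln (1 - t / T) \<longleftrightarrow> t = original_time p T \<tau>"
proof -
  have pos: "1 - t / T > 0"
    using assms by (simp add: field_simps)
  have "\<tau> = - (1 / (real p + 1)) * ln (1 - t / T) \<longleftrightarrow> ln (1 - t / T) = - (real p + 1) * \<tau>"
    by (auto simp: field_simps)
  also have "\<dots> \<longleftrightarrow> 1 - t / T = exp (- (real p + 1) * \<tau>)"
    using pos by (metis exp_ln ln_exp)
  also have "\<dots> \<longleftrightarrow> t = original_time p T \<tau>"
    using assms unfolding original_time_def by (auto simp: field_simps)
  finally show ?thesis .
qed

lemma original_time_in: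
  assumes "T > 0" and "\<tau> \<ge> 0"
  shows "original_time p T \<tau> \<in> {0..<T}"
proof -
  have "exp (- (real p + 1) * \<tau>) \<le> 1"
    using assms by (simp add: mult_nonpos_nonneg)
  then show ?thesis
    using assms by (simp add: original_time_def)
qed

definition rescaled_flow ::
    "nat \<Rightarrow> real \<Rightarrow> (real \<Rightarrow> real \<Rightarrow> complex) \<Rightarrow> real \<Rightarrow> real \<Rightarrow> complex" where
  "rescaled_flow p T x \<tau> u =
     (let t = original_time p T \<tau> in
        ((real p / (real p + 1)) powr (1 / (real p + 1)) *
         (T - t) powr (- (1 / (real p + 1)))) *\<^sub>R x t u)"


section \<open>Norms of \<open>2\<pi>\<close>-periodic functions\<close>

definition fourier_coeff :: "(real \<Rightarrow> real) \<Rightarrow> int \<Rightarrow> complex" where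
  "fourier_coeff f n =
     1 / (2 * pi) * integral {0..2 * pi} (\<lambda>\<theta>. f \<theta> * exp (- (\<i> * of_int n * \<theta>)))"

text \<open>
  The suprema below are real-valued, so they are meaningful only for bounded sets: for
  \<open>\<beta> = 2\<close> it is enough that \<open>f\<close> is periodic and twice continuously differentiable, and for the
  \<open>C\<^sup>l\<close> norm that \<open>f\<close> is periodic and \<open>l\<close> times continuously differentiable.
\<close>

definition fourier_seminorm :: "nat \<Rightarrow> (real \<Rightarrow> real) \<Rightarrow> real" where
  "fourier_seminorm \<beta> f =
     max (SUP \<xi>::int. \<bar>real_of_int \<xi>\<bar> ^ \<beta> * \<bar>Re (fourier_coeff f \<xi>)\<bar>)
         (SUP \<xi>::int. \<bar>real_of_int \<xi>\<bar> ^ \<beta> * \<bar>Im (fourier_coeff f \<xi>)\<bar>)"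

definition Cl_norm :: "nat \<Rightarrow> (real \<Rightarrow> real) \<Rightarrow> real" where
  "Cl_norm l f = Max ((\<lambda>j. SUP \<theta>. \<bar>(deriv ^^ j) f \<theta>\<bar>) ` {0..l})"

end

theory Submission
  imports Defs "HOL-Library.Nat_Bijection"
begin

text \<open>
  The curvature as a function of the normal angle satisfies a quasilinear parabolic equation, and a
  circle is a stationary solution of its rescaling. The Fourier coefficients of the deviation \<open>v\<close>
  from it satisfy \<open>v\<^sub>n' = - \<lambda>\<^sub>n v\<^sub>n + \<dots>\<close> with \<open>\<lambda>\<^sub>n = p n\<^sup>2 - p - 1\<close> and a superlinear remainder: the modes
  \<open>\<bar>n\<bar> \<ge> 2\<close> decay at the rate \<open>3p - 1\<close> or faster, the modes \<open>0, \<plusminus>1\<close> are unstable. A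
  Lyapunov--Perron fixed point gives, for small prescribed modes \<open>\<bar>n\<bar> \<ge> 2\<close>, a solution that decays at
  the rate \<open>3p - 1\<close> together with all derivatives. It starts from a multiple of \<open>\<psi>\<close>: the factor
  takes care of the mode \<open>0\<close>, and the modes \<open>\<plusminus>1\<close> agree because \<open>\<integral> e\<^sup>i\<^sup>\<theta> / \<psi> = 0\<close> for a closed curve.

  Undoing the rescaling gives a curvature profile \<open>\<kappa>\<close> that blows up at an explicit time \<open>Ts\<close>. By the
  maximum principle for support functions the given flow has the curvature \<open>\<kappa>\<close> as long as both
  exist, so \<open>T \<le> Ts\<close>. If \<open>T < Ts\<close>, then the curves with curvature \<open>\<kappa>\<close>, parametrised along the
  trajectories of the tangential speed, continue the flow, against the maximality of \<open>T\<close>.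
\<close>

section \<open>Periodic functions and smooth functions of time and angle\<close>

text \<open>The remainder contains second derivatives of v and so loses two powers of n. The stable
  modes win them back: the Duhamel integral divides by \<lambda>, which grows like n^2. A sup norm
  of the coefficients with weight 1 + n^2 therefore closes the fixed point, and the hypothesis on
  the initial curvature controls this norm of its stable modes relative to its mean. The rate 3p - 1
  is the value of \<lambda> at mode 2; the remainder decays twice as fast and does not disturb it.
  The decaying solution satisfies the closing condition although nothing in its construction asks
  for it. Its discrepancy E to the scaled initial curvature in the modes 1 and -1 is a combination
  of sine and cosine, and the two closing conditions together annihilate the integral of a positive
  multiple of E^2. The comparison is made for support functions, because there the difference of two
  flows obeys a maximum principle that involves no derivative bounds. The flow moves a fixed
  parameter in the normal direction only, whereas a fixed angle also slides tangentially; hence the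
  parametrisation along trajectories in the continuation.\<close>

lemmas real_derivative_vector = has_real_derivative_iff_has_vector_derivative

lemma periodic_shift:
  fixes f :: "real \<Rightarrow> 'a"
  assumes f: "\<And>u. f (u + 2 * pi) = f u" shows "f (x + 2 * pi * of_int k) = f x"
proof (induction k rule: int_induct[where k=0])
  case (step1 i)
  then show ?case using f[of "x + 2 * pi * of_int i"] by (simp add: algebra_simps)
next
  case (step2 i)
  then show ?case using f[of "x + 2 * pi * of_int (i - 1)"] by (simp add: algebra_simps)
qed simp

lemma periodic_Icc:
  fixes f :: "real \<Rightarrow> 'a"
  assumes f: "\<And>u. f (u + 2 * pi) = f u"
  obtains x where "x \<in> {0..2 * pi}" "f u = f x"
proof -
  define j where "j = \<lfloor>u / (2 * pi)\<rfloor>"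
  have "of_int j \<le> u / (2 * pi)" "u / (2 * pi) < of_int j + 1" unfolding j_def by linarith+
  then have "u - 2 * pi * of_int j \<in> {0..2 * pi}" by (simp add: field_simps)
  then show ?thesis
    by (rule that) (use periodic_shift[where f=f, OF f, of "u - 2 * pi * of_int j" j] in simp)
qed

text \<open>Functions of time and angle, in this order; derivatives in time are one-sided at the boundary of \<open>S\<close>.\<close>

type_synonym tfun = "real \<Rightarrow> real \<Rightarrow> real"

definition cont2 :: "real set \<Rightarrow> tfun \<Rightarrow> bool" where
  "cont2 S f \<longleftrightarrow> continuous_on (S \<times> UNIV) (\<lambda>z. f (fst z) (snd z))"

definition partials ::
    "real set \<Rightarrow> tfun \<Rightarrow> tfun \<Rightarrow> tfun \<Rightarrow> bool" where
  "partials S f fu ft \<longleftrightarrow> (\<forall>t\<in>S. \<forall>u. (f t has_real_derivative fu t u) (at u) \<and>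
     ((\<lambda>s. f s u) has_real_derivative ft t u) (at t within S))"

text \<open>The partial derivatives are existentially quantified, so that the closure lemmas are
  inductions that supply witnesses; \<open>partials_unique\<close> identifies these with
  \<open>Du\<close> and \<open>Dt\<close>.\<close>

fun Ck :: "nat \<Rightarrow> real set \<Rightarrow> tfun \<Rightarrow> bool" where
  "Ck 0 S f = cont2 S f"
| "Ck (Suc n) S f = (cont2 S f \<and> (\<exists>fu ft. Ck n S fu \<and> Ck n S ft \<and> partials S f fu ft))"

definition Cinf :: "real set \<Rightarrow> tfun \<Rightarrow> bool" where
  "Cinf S f \<longleftrightarrow> (\<forall>n. Ck n S f)"

text \<open>Covers \<open>{0..<T}\<close> and \<open>{0..}\<close>. Convexity and the point 0 let
  \<open>tint\<close> recover a function from its time derivative; a later point above every t makes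
  one-sided derivatives unique.\<close>

definition time_dom :: "real set \<Rightarrow> bool" where
  "time_dom S \<longleftrightarrow> 0 \<in> S \<and> S \<subseteq> {0..} \<and> convex S \<and> (\<forall>t\<in>S. \<exists>b\<in>S. t < b)"

lemma time_dom_atLeastLessThan: "0 < b \<Longrightarrow> time_dom {0..<b}"
  unfolding time_dom_def
proof (intro conjI ballI)
  fix t assume "0 < b" "t \<in> {0..<b}"
  then show "\<exists>x\<in>{0..<b}. t < x" by (intro bexI[of _ "(t + b) / 2"]) auto
qed auto

lemma time_dom_atLeast: "time_dom {0..}"
  unfolding time_dom_def
proof (intro conjI ballI)
  fix t :: real assume "t \<in> {0..}"
  then show "\<exists>x\<in>{0..}. t < x" by (intro bexI[of _ "t + 1"]) auto
qed auto

lemma time_dom_atLeastAtMost_subset: "time_dom S \<Longrightarrow> t \<in> S \<Longrightarrow> {0..t} \<subseteq> S"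
  unfolding time_dom_def is_interval_convex_1[symmetric] is_interval_1 by auto

lemma time_dom_at_within:
  assumes "time_dom S" "t \<in> S" "b \<in> S" "t < b"
  shows "at t within S = at t within {0..b}"
proof (rule at_within_nhd[of _ "{..<b}"])
  show "S \<inter> {..<b} - {t} = {0..b} \<inter> {..<b} - {t}"
    using time_dom_atLeastAtMost_subset[OF assms(1,3)] assms(1) by (auto simp: time_dom_def)
qed (use assms in auto)

lemma cont2_cong:
  assumes "\<And>t u. t \<in> S \<Longrightarrow> f t u = g t u" "cont2 S f"
  shows "cont2 S g"
  using assms(2) unfolding cont2_def by (rule continuous_on_eq) (use assms(1) in auto)

lemma partials_cong:
  assumes "\<And>t u. t \<in> S \<Longrightarrow> f t u = g t u" "partials S f fu ft"
  shows "partials S g fu ft"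
  unfolding partials_def
proof (intro ballI allI conjI)
  fix t u assume t: "t \<in> S"
  have "f t = g t" using assms(1) t by auto
  then show "(g t has_real_derivative fu t u) (at u)"
    using assms(2) t unfolding partials_def by metis
  have "((\<lambda>s. f s u) has_real_derivative ft t u) (at t within S)"
    using assms(2) t unfolding partials_def by metis
  then show "((\<lambda>s. g s u) has_real_derivative ft t u) (at t within S)"
    by (rule has_field_derivative_transform_within[of _ _ _ _ 1]) (use t assms(1) in auto)
qed

lemma Ck_cong:
  assumes "\<And>t u. t \<in> S \<Longrightarrow> f t u = g t u" "Ck n S f"
  shows "Ck n S g"
proof (cases n)
  case 0
  then show ?thesis using assms cont2_cong[of S f g] by simp
next
  case (Suc m)
  then obtain fu ft where "cont2 S f" "Ck m S fu" "Ck m S ft" "partials S f fu ft"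
    using assms(2) by auto
  then show ?thesis using Suc partials_cong[of S f g fu ft, OF assms(1)] cont2_cong[of S f g, OF assms(1)] by auto
qed

lemma Ck_cont2: "Ck n S f \<Longrightarrow> cont2 S f"
  by (cases n) auto

lemma Ck_SucI: "cont2 S f \<Longrightarrow> partials S f fu ft \<Longrightarrow> Ck n S fu \<Longrightarrow> Ck n S ft \<Longrightarrow> Ck (Suc n) S f"
  by auto

lemma Ck_SucD: "Ck (Suc n) S f \<Longrightarrow> Ck n S f"
proof (induction n arbitrary: f)
  case (Suc n)
  obtain fu ft where D: "Ck (Suc n) S fu" "Ck (Suc n) S ft" "partials S f fu ft" "cont2 S f"
    using iffD1[OF Ck.simps(2) Suc.prems] by blast
  show ?case by (rule Ck_SucI[OF D(4,3) Suc.IH[OF D(1)] Suc.IH[OF D(2)]])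
qed simp

section \<open>Closure of C^k under algebra, composition and elementary functions\<close>

lemma Ck_const: "Ck n S (\<lambda>t u. c)"
proof (induction n arbitrary: c)
  case (Suc n)
  show ?case by (rule Ck_SucI[OF _ _ Suc[of 0] Suc[of 0]]) (auto simp: cont2_def partials_def)
qed (auto simp: cont2_def)

lemma Ck_fst: "Ck n S (\<lambda>t u. t)"
proof (cases n)
  case (Suc m)
  then show ?thesis
    by (simp del: Ck.simps, intro Ck_SucI[OF _ _ Ck_const[of _ _ 0] Ck_const[of _ _ 1]])
      (auto simp: cont2_def partials_def intro!: continuous_intros derivative_eq_intros)
qed (auto simp: cont2_def intro!: continuous_intros)

lemma Ck_snd: "Ck n S (\<lambda>t u. u)"
proof (cases n)
  case (Suc m)
  then show ?thesis
    by (simp del: Ck.simps, intro Ck_SucI[OF _ _ Ck_const[of _ _ 1] Ck_const[of _ _ 0]])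
      (auto simp: cont2_def partials_def intro!: continuous_intros derivative_eq_intros)
qed (auto simp: cont2_def intro!: continuous_intros)

lemma Ck_SucE:
  assumes "Ck (Suc n) S f"
  obtains fu ft where "Ck n S fu" "Ck n S ft" "partials S f fu ft" "cont2 S f"
  using iffD1[OF Ck.simps(2) assms] by blast

lemma Ck_add: "Ck n S f \<Longrightarrow> Ck n S g \<Longrightarrow> Ck n S (\<lambda>t u. f t u + g t u)"
proof (induction n arbitrary: f g)
  case (Suc n)
  obtain fu ft where F: "Ck n S fu" "Ck n S ft" "partials S f fu ft" "cont2 S f"
    by (rule Ck_SucE[OF Suc.prems(1)])
  obtain gu gt where G: "Ck n S gu" "Ck n S gt" "partials S g gu gt" "cont2 S g"
    by (rule Ck_SucE[OF Suc.prems(2)])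
  show ?case
  proof (rule Ck_SucI[OF _ _ Suc.IH[OF F(1) G(1)] Suc.IH[OF F(2) G(2)]])
    show "cont2 S (\<lambda>t u. f t u + g t u)"
      using F(4) G(4) unfolding cont2_def by (rule continuous_on_add)
    show "partials S (\<lambda>t u. f t u + g t u) (\<lambda>t u. fu t u + gu t u) (\<lambda>t u. ft t u + gt t u)"
      using F(3) G(3) unfolding partials_def by (auto intro!: DERIV_add)
  qed
qed (auto simp: cont2_def intro!: continuous_intros)

lemma Ck_mult: "Ck n S f \<Longrightarrow> Ck n S g \<Longrightarrow> Ck n S (\<lambda>t u. f t u * g t u)"
proof (induction n arbitrary: f g)
  case (Suc n)
  obtain fu ft where F: "Ck n S fu" "Ck n S ft" "partials S f fu ft" "cont2 S f"
    by (rule Ck_SucE[OF Suc.prems(1)])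
  obtain gu gt where G: "Ck n S gu" "Ck n S gt" "partials S g gu gt" "cont2 S g"
    by (rule Ck_SucE[OF Suc.prems(2)])
  note f = Ck_SucD[OF Suc.prems(1)] and g = Ck_SucD[OF Suc.prems(2)]
  show ?case
  proof (rule Ck_SucI[OF _ _ Ck_add[OF Suc.IH[OF F(1) g] Suc.IH[OF G(1) f]]
        Ck_add[OF Suc.IH[OF F(2) g] Suc.IH[OF G(2) f]]])
    show "cont2 S (\<lambda>t u. f t u * g t u)"
      using F(4) G(4) unfolding cont2_def by (rule continuous_on_mult)
    show "partials S (\<lambda>t u. f t u * g t u) (\<lambda>t u. fu t u * g t u + gu t u * f t u)
       (\<lambda>t u. ft t u * g t u + gt t u * f t u)"
      using F(3) G(3) unfolding partials_def by (auto intro!: DERIV_mult)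
  qed
qed (auto simp: cont2_def intro!: continuous_intros)

lemma Ck_minus: "Ck n S f \<Longrightarrow> Ck n S (\<lambda>t u. - f t u)"
  using Ck_mult[OF Ck_const[of n S "-1"]] by simp

lemma Ck_diff: "Ck n S f \<Longrightarrow> Ck n S g \<Longrightarrow> Ck n S (\<lambda>t u. f t u - g t u)"
  using Ck_add[of n S f "\<lambda>t u. - g t u"] Ck_minus[of n S g] by simp

lemma Ck_power: "Ck n S f \<Longrightarrow> Ck n S (\<lambda>t u. f t u ^ m)"
proof (induction m)
  case 0
  then show ?case using Ck_const[of n S 1] by simp
next
  case (Suc m)
  then show ?case using Ck_mult[of n S f "\<lambda>t u. f t u ^ m"] by simp
qed

text \<open>Total differentiability from a time derivative at the point and a space derivative that
  is jointly continuous.\<close>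

lemma partials_has_derivative:
  assumes S: "time_dom S" and P: "partials S f fu ft" and c: "cont2 S fu" and t: "t \<in> S"
  shows "((\<lambda>(s, v). f s v) has_derivative (\<lambda>(a, b). ft t u * a + fu t u * b)) (at (t, u) within S \<times> UNIV)"
proof -
  have cu: "continuous (at (t, u) within S \<times> UNIV) (\<lambda>(x, y). blinfun_scaleR_left (fu x y))"
  proof -
    have "continuous_on (S \<times> UNIV) (\<lambda>z. blinfun_scaleR_left (fu (fst z) (snd z)))"
      using c unfolding cont2_def by (auto intro!: continuous_intros)
    then show ?thesis using t by (auto simp: continuous_on_eq_continuous_within case_prod_beta')
  qed
  have *: "((\<lambda>(s, v). f s v) has_derivative (\<lambda>(tx, ty). ft t u * tx + blinfun_apply (blinfun_scaleR_left (fu t u)) ty))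
       (at (t, u) within S \<times> UNIV)"
  proof (rule has_derivative_partialsI[where Y=UNIV and fx="\<lambda>a. ft t u * a"])
    show "((\<lambda>x. f x u) has_derivative (*) (ft t u)) (at t within S)"
      using P t by (auto simp: partials_def has_field_derivative_def)
    fix x y assume "x \<in> S"
    then have "(f x has_real_derivative fu x y) (at y)" using P by (auto simp: partials_def)
    then show "((\<lambda>y. f x y) has_derivative blinfun_apply (blinfun_scaleR_left (fu x y))) (at y within UNIV)"
      unfolding has_field_derivative_def
      by (rule has_derivative_eq_rhs) (auto simp: fun_eq_iff)
  qed (use cu in auto)
  show ?thesis by (rule has_derivative_eq_rhs[OF *]) (auto simp: fun_eq_iff)
qed

lemma partials_chain:
  assumes S: "time_dom S'" and P: "partials S' f fu ft" and c: "cont2 S' fu"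
    and a: "(a has_real_derivative a') (at x within X)" and b: "(b has_real_derivative b') (at x within X)"
    and X: "\<And>x. x \<in> X \<Longrightarrow> a x \<in> S'" "x \<in> X"
  shows "((\<lambda>x. f (a x) (b x)) has_real_derivative ft (a x) (b x) * a' + fu (a x) (b x) * b') (at x within X)"
proof -
  have g: "((\<lambda>x. (a x, b x)) has_derivative (\<lambda>h. (a' * h, b' * h))) (at x within X)"
    using a b by (auto simp: has_field_derivative_def intro!: has_derivative_Pair)
  have f: "((\<lambda>(s, v). f s v) has_derivative (\<lambda>(p, q). ft (a x) (b x) * p + fu (a x) (b x) * q))
      (at (a x, b x) within (\<lambda>x. (a x, b x)) ` X)"
    using partials_has_derivative[OF S P c, of "a x" "b x"] X
    by (auto intro: has_derivative_subset)
  show ?thesis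
    using diff_chain_within[OF g f] unfolding has_field_derivative_def
    by (auto simp: o_def algebra_simps elim!: has_derivative_eq_rhs)
qed

lemma cont2_compose:
  assumes "cont2 S' f" "cont2 S a" "cont2 S b" "\<And>t u. t \<in> S \<Longrightarrow> a t u \<in> S'"
  shows "cont2 S (\<lambda>t u. f (a t u) (b t u))"
  using assms unfolding cont2_def
  by (intro continuous_on_compose2[of "S' \<times> UNIV" "\<lambda>z. f (fst z) (snd z)" _
      "\<lambda>z. (a (fst z) (snd z), b (fst z) (snd z))", simplified]) (auto intro!: continuous_intros)

text \<open>The time argument is replaced by a function as well; this covers restriction to time 0
  and the passage to the rescaled time.\<close>

lemma Ck_compose:
  assumes S': "time_dom S'"
  shows "Ck n S' f \<Longrightarrow> Ck n S a \<Longrightarrow> Ck n S b \<Longrightarrow> (\<And>t u. t \<in> S \<Longrightarrow> a t u \<in> S') \<Longrightarrow>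
    Ck n S (\<lambda>t u. f (a t u) (b t u))"
proof (induction n arbitrary: f)
  case 0
  then show ?case using cont2_compose[of S' f S a b] by auto
next
  case (Suc n)
  obtain fu ft where F: "Ck n S' fu" "Ck n S' ft" "partials S' f fu ft" "cont2 S' f"
    by (rule Ck_SucE[OF Suc.prems(1)])
  obtain au at' where A: "Ck n S au" "Ck n S at'" "partials S a au at'" "cont2 S a"
    by (rule Ck_SucE[OF Suc.prems(2)])
  obtain bu bt where B: "Ck n S bu" "Ck n S bt" "partials S b bu bt" "cont2 S b"
    by (rule Ck_SucE[OF Suc.prems(3)])
  note D = F(1-3) A(1-3) B(1-3) F(4) A(4) B(4)
  note ab = Ck_SucD[OF Suc.prems(2)] Ck_SucD[OF Suc.prems(3)]
  note R = Suc.prems(4)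
  have cu: "cont2 S' fu" using D(1) Ck_cont2 by blast
  show ?case
  proof (rule Ck_SucI)
    show "cont2 S (\<lambda>t u. f (a t u) (b t u))" using cont2_compose D R by blast
    note fu = Suc.IH[OF F(1) ab R] and ft = Suc.IH[OF F(2) ab R]
    show "Ck n S (\<lambda>t u. ft (a t u) (b t u) * au t u + fu (a t u) (b t u) * bu t u)"
      by (rule Ck_add[OF Ck_mult[OF ft A(1)] Ck_mult[OF fu B(1)]])
    show "Ck n S (\<lambda>t u. ft (a t u) (b t u) * at' t u + fu (a t u) (b t u) * bt t u)"
      by (rule Ck_add[OF Ck_mult[OF ft A(2)] Ck_mult[OF fu B(2)]])
    show "partials S (\<lambda>t u. f (a t u) (b t u))
        (\<lambda>t u. ft (a t u) (b t u) * au t u + fu (a t u) (b t u) * bu t u)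
        (\<lambda>t u. ft (a t u) (b t u) * at' t u + fu (a t u) (b t u) * bt t u)"
      unfolding partials_def
    proof (intro ballI allI conjI)
      fix t u assume t: "t \<in> S"
      show "((\<lambda>u. f (a t u) (b t u)) has_real_derivative
          ft (a t u) (b t u) * au t u + fu (a t u) (b t u) * bu t u) (at u)"
        by (rule partials_chain[OF S' D(3) cu]) (use D(6,9) t R in \<open>auto simp: partials_def\<close>)
      show "((\<lambda>s. f (a s u) (b s u)) has_real_derivative
          ft (a t u) (b t u) * at' t u + fu (a t u) (b t u) * bt t u) (at t within S)"
        by (rule partials_chain[OF S' D(3) cu, where a="\<lambda>s. a s u" and b="\<lambda>s. b s u"])
          (use D(6,9) t R in \<open>auto simp: partials_def\<close>)
    qed
  qed
qed

text \<open>Stated for a whole sequence \<open>q\<close> of successive derivatives, because the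
  induction on n moves on to the next index j.\<close>

lemma Ck_outer:
  assumes q: "\<And>j x. x \<in> I \<Longrightarrow> (q j has_real_derivative q (Suc j) x) (at x)"
    and I: "\<And>t u. t \<in> S \<Longrightarrow> f t u \<in> I"
  shows "Ck n S f \<Longrightarrow> Ck n S (\<lambda>t u. q j (f t u))"
proof (induction n arbitrary: j)
  case (0)
  have "continuous_on I (q j)"
    using q by (meson DERIV_isCont continuous_at_imp_continuous_on)
  then show ?case using 0 I
    by (auto simp: cont2_def intro!: continuous_on_compose2[of I "q j"])
next
  case (Suc n)
  obtain fu ft where D: "Ck n S fu" "Ck n S ft" "partials S f fu ft" "cont2 S f"
    by (rule Ck_SucE[OF Suc.prems(1)])
  note f = Ck_SucD[OF Suc.prems(1)]
  have "continuous_on I (q j)"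
    using q by (meson DERIV_isCont continuous_at_imp_continuous_on)
  then have c: "cont2 S (\<lambda>t u. q j (f t u))" using D(4) I
    by (auto simp: cont2_def intro!: continuous_on_compose2[of I "q j"])
  show ?case
  proof (rule Ck_SucI[OF c])
    show "partials S (\<lambda>t u. q j (f t u)) (\<lambda>t u. q (Suc j) (f t u) * fu t u) (\<lambda>t u. q (Suc j) (f t u) * ft t u)"
      unfolding partials_def
    proof (intro ballI allI conjI)
      fix t u assume t: "t \<in> S"
      note qq = q[OF I[OF t, of u], of j]
      show "((\<lambda>u. q j (f t u)) has_real_derivative q (Suc j) (f t u) * fu t u) (at u)"
        using DERIV_chain2[where f="q j" and g="f t" and x=u and s=UNIV, OF qq] D(3) t by (auto simp: partials_def)
      show "((\<lambda>s. q j (f s u)) has_real_derivative q (Suc j) (f t u) * ft t u) (at t within S)"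
        using DERIV_chain2[where f="q j" and g="\<lambda>s. f s u" and x=t and s=S, OF qq] D(3) t by (auto simp: partials_def)
    qed
  qed (rule Ck_mult[OF Suc.IH[OF f]] D)+
qed

lemma Ck_exp: "Ck n S f \<Longrightarrow> Ck n S (\<lambda>t u. exp (f t u))"
  by (rule Ck_outer[where q="\<lambda>_. exp" and I=UNIV and j=0]) auto

lemma Ck_sin: "Ck n S f \<Longrightarrow> Ck n S (\<lambda>t u. sin (f t u))"
\<comment> \<open>The j-th derivative of the sine is the sine shifted by j quarter turns: one
  formula for all j.\<close>
proof (erule Ck_outer[where q="\<lambda>j x. sin (x + real j * (pi/2))" and I=UNIV and j=0, simplified, rotated])
  fix j and x :: real
  have "cos (x + real j * (pi/2)) = sin (x + real (Suc j) * (pi/2))"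
    using sin_add[of "x + pi * real j / 2" "pi / 2"] by (simp add: algebra_simps add_divide_distrib)
  then show "((\<lambda>x. sin (x + real j * pi/2)) has_real_derivative sin (x + (1 + real j) * pi/2)) (at x)"
    by (auto intro!: derivative_eq_intros)
qed

lemma Ck_cos: "Ck n S f \<Longrightarrow> Ck n S (\<lambda>t u. cos (f t u))"
proof -
  assume "Ck n S f"
  then have "Ck n S (\<lambda>t u. sin (pi/2 - f t u))" by (intro Ck_sin Ck_diff Ck_const)
  then show ?thesis by (simp add: cos_sin_eq)
qed

lemma Ck_powr:
  assumes "Ck n S f" "\<And>t u. t \<in> S \<Longrightarrow> f t u > 0"
  shows "Ck n S (\<lambda>t u. f t u powr a)"
proof -
  have *: "((\<lambda>x. (\<Prod>i<j. a - real i) * x powr (a - real j)) has_real_derivative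
      (\<Prod>i<Suc j. a - real i) * x powr (a - real (Suc j))) (at x)" if "x \<in> {0<..}" for j x
    using that by (auto intro!: derivative_eq_intros simp: algebra_simps)
  show ?thesis
    using Ck_outer[where I="{0<..}" and j=0 and q="\<lambda>j x. (\<Prod>i<j. a - real i) * x powr (a - real j)", OF *] assms by (auto simp del: prod.lessThan_Suc)
qed

lemma Ck_inverse:
  assumes "Ck n S f" "\<And>t u. t \<in> S \<Longrightarrow> f t u > 0"
  shows "Ck n S (\<lambda>t u. 1 / f t u)"
  by (rule Ck_cong[OF _ Ck_powr[OF assms, of "-1"]]) (use assms(2) in \<open>auto simp: powr_minus field_simps less_imp_le\<close>)

lemma Ck_divide:
  assumes "Ck n S f" "Ck n S g" "\<And>t u. t \<in> S \<Longrightarrow> g t u > 0"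
  shows "Ck n S (\<lambda>t u. f t u / g t u)"
  using Ck_mult[OF assms(1) Ck_inverse[OF assms(2,3)]] by simp

lemma Ck_sqrt:
  assumes "Ck n S f" "\<And>t u. t \<in> S \<Longrightarrow> f t u > 0"
  shows "Ck n S (\<lambda>t u. sqrt (f t u))"
  by (rule Ck_cong[OF _ Ck_powr[OF assms, of "1/2"]]) (use assms in \<open>auto simp: powr_half_sqrt less_imp_le\<close>)

lemma Ck_ln:
  assumes f: "Ck n S f" and pos: "\<And>t u. t \<in> S \<Longrightarrow> f t u > 0"
  shows "Ck n S (\<lambda>t u. ln (f t u))"
proof (cases n)
  case 0
  then show ?thesis using f pos by (auto simp: cont2_def intro!: continuous_intros) (metis less_irrefl)
next
  case (Suc m)
  obtain fu ft where D: "Ck m S fu" "Ck m S ft" "partials S f fu ft" "cont2 S f"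
    by (rule Ck_SucE[OF f[unfolded Suc]])
  have "Ck m S f" by (rule Ck_SucD[OF f[unfolded Suc]])
  then have "Ck m S (\<lambda>t u. fu t u / f t u)" "Ck m S (\<lambda>t u. ft t u / f t u)"
    using Ck_divide[where f=fu and g=f] Ck_divide[where f=ft and g=f] D(1,2) pos by blast+
  moreover have "cont2 S (\<lambda>t u. ln (f t u))"
    using D(4) pos by (auto simp: cont2_def intro!: continuous_intros) (metis less_irrefl)
  moreover have "partials S (\<lambda>t u. ln (f t u)) (\<lambda>t u. fu t u / f t u) (\<lambda>t u. ft t u / f t u)"
    using D(3) pos unfolding partials_def by (auto intro!: derivative_eq_intros simp: field_simps)
  ultimately show ?thesis using Suc by (auto intro: Ck_SucI simp del: Ck.simps)
qed

lemma cont2_slice_t: "cont2 S f \<Longrightarrow> continuous_on S (\<lambda>s. f s u)"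
  unfolding cont2_def
  by (rule continuous_on_compose2[of "S \<times> UNIV" "\<lambda>z. f (fst z) (snd z)" _ "\<lambda>s. (s, u)", simplified])
    (auto intro!: continuous_intros)

lemma cont2_slice_u: "cont2 S f \<Longrightarrow> t \<in> S \<Longrightarrow> continuous_on A (f t)"
  unfolding cont2_def
  by (rule continuous_on_compose2[of "S \<times> UNIV" "\<lambda>z. f (fst z) (snd z)" _ "\<lambda>u. (t, u)", simplified])
    (auto intro!: continuous_intros)

section \<open>Integration in time and symmetry of mixed derivatives\<close>

definition tint :: "tfun \<Rightarrow> tfun" where
  "tint f t u = integral {0..t} (\<lambda>s. f s u)"

text \<open>The substitution \<open>s = x * t\<close> moves the integral to the fixed interval
  [0, 1], where continuity in (t, u) follows from continuity of the integrand in all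
  variables.\<close>

lemma cont2_tint:
  assumes S: "time_dom S" and c: "cont2 S f"
  shows "cont2 S (tint f)"
proof -
  have sub: "x * t \<in> S" if "x \<in> {0..1}" "t \<in> S" for x t
  proof -
    have "0 \<le> t" using S that by (auto simp: time_dom_def)
    then have "x * t \<in> {0..t}" using that by (auto simp: mult_left_le_one_le)
    then show ?thesis using time_dom_atLeastAtMost_subset[OF S that(2)] by auto
  qed
  have eq: "fst z * integral (cbox 0 1) (\<lambda>x. f (x * fst z) (snd z)) = tint f (fst z) (snd z)"
    if z: "z \<in> S \<times> UNIV" for z
  proof (cases "fst z = 0")
    case False
    then have p: "fst z > 0" using S z by (auto simp: time_dom_def)
    have i: "(\<lambda>s. f s (snd z)) integrable_on {0..fst z}"
      by (rule integrable_continuous_real)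
       (use z in \<open>auto intro!: continuous_on_subset[OF cont2_slice_t[OF c]] dest: time_dom_atLeastAtMost_subset[OF S, THEN subsetD]\<close>)
    have "((\<lambda>s. f s (snd z)) has_integral tint f (fst z) (snd z)) (cbox 0 (fst z))"
      using i by (auto simp: tint_def integrable_integral)
    from has_integral_affinity[OF this, of "fst z" 0]
    have "((\<lambda>x. f (fst z * x) (snd z)) has_integral (1 / fst z) * tint f (fst z) (snd z)) {0..1}"
      using p by (auto simp: image_divide_atLeastAtMost)
    then show ?thesis using p by (auto simp: integral_unique mult.commute)
  qed (auto simp: tint_def)
  have "continuous_on ((S \<times> (UNIV::real set)) \<times> cbox 0 (1::real)) (\<lambda>(z, x). f (x * fst z) (snd z))"
    unfolding split_beta
    by (rule continuous_on_compose2[OF c[unfolded cont2_def],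
        of _ "\<lambda>w. (snd w * fst (fst w), snd (fst w))", simplified])
      (auto intro!: continuous_intros sub)
  from integral_continuous_on_param[OF this]
  have "continuous_on (S \<times> UNIV) (\<lambda>z::real\<times>real. fst z * integral (cbox 0 1) (\<lambda>x. f (x * fst z) (snd z)))"
    by (intro continuous_intros) auto
  then show ?thesis unfolding cont2_def by (rule continuous_on_eq) (use eq in auto)
qed

lemma tint_DERIV_t:
  assumes S: "time_dom S" and c: "cont2 S f" and t: "t \<in> S"
  shows "((\<lambda>s. tint f s u) has_real_derivative f t u) (at t within S)"
proof -
  obtain b where b: "b \<in> S" "t < b" using S t by (auto simp: time_dom_def)
  have "0 \<le> t" using S t by (auto simp: time_dom_def)
  then show ?thesis unfolding tint_def time_dom_at_within[OF S t b]
    using b cont2_slice_t[OF c] time_dom_atLeastAtMost_subset[OF S b(1)]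
    by (intro integral_has_real_derivative) (auto intro: continuous_on_subset)
qed

lemma tint_DERIV_u:
  assumes S: "time_dom S" and c: "cont2 S f" "cont2 S fu" and t: "t \<in> S"
    and d: "\<And>t u. t \<in> S \<Longrightarrow> (f t has_real_derivative fu t u) (at u)"
  shows "(tint f t has_real_derivative tint fu t u) (at u)"
proof -
  have sub: "{0..t} \<subseteq> S" using time_dom_atLeastAtMost_subset[OF S t] .
  have "((\<lambda>x. integral (cbox 0 t) (\<lambda>s. f s x)) has_field_derivative integral (cbox 0 t) (\<lambda>s. fu s u)) (at u within UNIV)"
  proof (rule leibniz_rule_field_derivative)
    show "continuous_on (UNIV \<times> cbox 0 t) (\<lambda>(x, s). fu s x)"
      unfolding split_beta
      by (rule continuous_on_compose2[OF c(2)[unfolded cont2_def], of _ "\<lambda>w. (snd w, fst w)", simplified])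
        (use sub in \<open>auto intro!: continuous_intros\<close>)
    fix x show "(\<lambda>s. f s x) integrable_on cbox 0 t"
      using cont2_slice_t[OF c(1)] sub by (auto intro!: integrable_continuous_real intro: continuous_on_subset)
  qed (use d sub in auto)
  then show ?thesis by (simp add: tint_def[abs_def])
qed

lemma Ck_tint:
  assumes S: "time_dom S"
  shows "Ck n S f \<Longrightarrow> Ck n S (tint f)"
proof (induction n arbitrary: f)
  case 0 then show ?case using cont2_tint[OF S] by auto
next
  case (Suc n)
  obtain fu ft where D: "Ck n S fu" "partials S f fu ft" "cont2 S f"
    by (rule Ck_SucE[OF Suc.prems])
  note f = Ck_SucD[OF Suc.prems]
  have "partials S (tint f) (tint fu) f"
    using D tint_DERIV_t[OF S] tint_DERIV_u[OF S D(3) Ck_cont2[OF D(1)]]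
    unfolding partials_def by blast
  then show ?case using Ck_SucI[OF cont2_tint[OF S D(3)] _ Suc.IH[OF D(1)] f] by blast
qed

definition Du :: "tfun \<Rightarrow> tfun" where
  "Du f t u = deriv (f t) u"

definition Dt :: "real set \<Rightarrow> tfun \<Rightarrow> tfun" where
  "Dt S f t u = vector_derivative (\<lambda>s. f s u) (at t within S)"

lemma time_dom_not_trivial:
  assumes "time_dom S" "t \<in> S" shows "at t within S \<noteq> bot"
proof -
  obtain b where b: "b \<in> S" "t < b" using assms by (auto simp: time_dom_def)
  have "0 \<le> t" using assms by (auto simp: time_dom_def)
  then show ?thesis using time_dom_at_within[OF assms b] b by (simp add: trivial_limit_within)
qed

lemma partials_unique:
  assumes S: "time_dom S" and P: "partials S f fu ft" and t: "t \<in> S"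
  shows "Du f t u = fu t u" "Dt S f t u = ft t u"
proof -
  show "Du f t u = fu t u" using P t unfolding partials_def Du_def by (blast intro: DERIV_imp_deriv)
  have "((\<lambda>s. f s u) has_vector_derivative ft t u) (at t within S)"
    using P t by (auto simp: partials_def real_derivative_vector)
  then show "Dt S f t u = ft t u" unfolding Dt_def
    by (rule vector_derivative_within[OF time_dom_not_trivial[OF S t]])
qed

lemma Ck_D:
  assumes S: "time_dom S" and f: "Ck (Suc n) S f"
  shows "Ck n S (Du f)" "Ck n S (Dt S f)" "partials S f (Du f) (Dt S f)"
proof -
  obtain fu ft where D: "Ck n S fu" "Ck n S ft" "partials S f fu ft" by (rule Ck_SucE[OF f])
  note U = partials_unique[OF S D(3)]
  show "Ck n S (Du f)" "Ck n S (Dt S f)" using Ck_cong[OF _ D(1)] Ck_cong[OF _ D(2)] U by metis+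
  show "partials S f (Du f) (Dt S f)" using D(3) U by (auto simp: partials_def)
qed

lemma Cinf_D:
  assumes S: "time_dom S" and f: "Cinf S f"
  shows "Cinf S (Du f)" "Cinf S (Dt S f)" "partials S f (Du f) (Dt S f)"
  using Ck_D[OF S] f unfolding Cinf_def by blast+

lemma tint_fundamental:
  assumes S: "time_dom S" and t: "t \<in> S" and c: "cont2 S ft"
    and d: "\<And>t. t \<in> S \<Longrightarrow> ((\<lambda>s. f s u) has_real_derivative ft t u) (at t within S)"
  shows "f t u = f 0 u + tint ft t u"
proof -
  have "0 \<in> S" "convex S" using S by (auto simp: time_dom_def)
  have "((\<lambda>s. f s u - tint ft s u) has_real_derivative 0) (at x within S)" if "x \<in> S" for x
    using DERIV_diff[OF d[OF that] tint_DERIV_t[OF S c that, of u]] by simp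
  from has_field_derivative_zero_constant[OF \<open>convex S\<close> this]
  have "f t u - tint ft t u = f 0 u - tint ft 0 u" using t \<open>0 \<in> S\<close> by force
  then show ?thesis by (simp add: tint_def)
qed

text \<open>Schwarz's theorem by integration: write f as its initial value plus
  \<open>tint ft\<close>, differentiate under the integral in space, then in time.\<close>

lemma partials_commute:
  assumes S: "time_dom S" and f: "partials S f fu ft" and c: "cont2 S ft" "cont2 S ftu"
    and fut: "partials S fu fuu fut" and ft: "partials S ft ftu ftt" and t: "t \<in> S"
  shows "ftu t u = fut t u"
proof -
  have 0: "0 \<in> S" using S by (auto simp: time_dom_def)
  have *: "fu s v = fu 0 v + tint ftu s v" if "s \<in> S" for s v
  proof -
    have "f s = (\<lambda>v. f 0 v + tint ft s v)"
      using tint_fundamental[OF S that c(1)] f by (auto simp: partials_def)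
    moreover have "((\<lambda>v. f 0 v + tint ft s v) has_real_derivative fu 0 v + tint ftu s v) (at v)"
      by (intro DERIV_add tint_DERIV_u[OF S c that]) (use f ft 0 in \<open>auto simp: partials_def\<close>)
    ultimately have "(f s has_real_derivative fu 0 v + tint ftu s v) (at v)" by simp
    moreover have "(f s has_real_derivative fu s v) (at v)" using f that by (auto simp: partials_def)
    ultimately show ?thesis by (metis DERIV_unique)
  qed
  have "((\<lambda>s. fu 0 u + tint ftu s u) has_real_derivative 0 + ftu t u) (at t within S)"
    by (intro DERIV_add tint_DERIV_t[OF S c(2) t]) auto
  then have "((\<lambda>s. fu 0 u + tint ftu s u) has_real_derivative ftu t u) (at t within S)" by simp
  then have "((\<lambda>s. fu s u) has_real_derivative ftu t u) (at t within S)"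
    by (rule has_field_derivative_transform_within[of _ _ _ _ 1]) (use t * in auto)
  moreover have "((\<lambda>s. fu s u) has_real_derivative fut t u) (at t within S)"
    using fut t by (auto simp: partials_def)
  ultimately show ?thesis
    using vector_derivative_within[OF time_dom_not_trivial[OF S t]]
    unfolding real_derivative_vector by metis
qed

lemma Cinf_commute:
  assumes S: "time_dom S" and f: "Cinf S f" and t: "t \<in> S"
  shows "Dt S (Du f) t u = Du (Dt S f) t u"
proof -
  have "cont2 S (Dt S f)" "cont2 S (Du (Dt S f))"
    using Cinf_D[OF S f] Cinf_D[OF S, of "Dt S f"] Ck_cont2 unfolding Cinf_def by blast+
  from partials_commute[OF S Cinf_D(3)[OF S f] this Cinf_D(3)[OF S Cinf_D(1)[OF S f]]
      Cinf_D(3)[OF S Cinf_D(2)[OF S f]] t]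
  show ?thesis by simp
qed

lemma Cinf_Du_pow: "time_dom S \<Longrightarrow> Cinf S f \<Longrightarrow> Cinf S ((Du ^^ i) f)"
  by (induction i) (auto intro: Cinf_D)

lemma Cinf_Dt_pow: "time_dom S \<Longrightarrow> Cinf S f \<Longrightarrow> Cinf S ((Dt S ^^ i) f)"
  by (induction i) (auto intro: Cinf_D)

lemma Du_pow_cong: "(\<And>u. f t u = g t u) \<Longrightarrow> (Du ^^ i) f t u = (Du ^^ i) g t u"
proof (induction i arbitrary: u)
  case (Suc i)
  then have "(Du ^^ i) f t = (Du ^^ i) g t" by auto
  then show ?case by (simp add: Du_def[of "(Du ^^ i) _"])
qed auto

lemma Dt_Du_pow:
  assumes S: "time_dom S" and t: "t \<in> S"
  shows "Cinf S f \<Longrightarrow> Dt S ((Du ^^ i) f) t u = (Du ^^ i) (Dt S f) t u"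
proof (induction i arbitrary: f)
  case (Suc i)
  have "Dt S ((Du ^^ Suc i) f) t u = (Du ^^ i) (Dt S (Du f)) t u"
    unfolding funpow_Suc_right o_apply using Suc.IH[OF Cinf_D(1)[OF S Suc.prems]] .
  also have "\<dots> = (Du ^^ i) (Du (Dt S f)) t u"
    by (rule Du_pow_cong) (rule Cinf_commute[OF S Suc.prems t])
  finally show ?case unfolding funpow_Suc_right o_apply .
qed auto

text \<open>The array of derivatives in the format of \<open>smooth_family\<close>; the next two
  lemmas translate between it and \<open>Cinf\<close>.\<close>

definition mixed_partials :: "real set \<Rightarrow> (nat \<Rightarrow> nat \<Rightarrow> real \<Rightarrow> real \<Rightarrow> real) \<Rightarrow> bool" where
  "mixed_partials S D \<longleftrightarrow> (\<forall>i j. cont2 S (D i j) \<and> partials S (D i j) (D (Suc i) j) (D i (Suc j)))"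

lemma Cinf_mixed_partials:
  assumes S: "time_dom S" and f: "Cinf S f"
  shows "mixed_partials S (\<lambda>i j. (Du ^^ i) ((Dt S ^^ j) f))"
  unfolding mixed_partials_def
proof (intro allI conjI)
  fix i j
  have C: "Cinf S ((Dt S ^^ j) f)" using Cinf_Dt_pow[OF S f] .
  note P = Cinf_D[OF S Cinf_Du_pow[OF S C]]
  show "cont2 S ((Du ^^ i) ((Dt S ^^ j) f))"
    using Cinf_Du_pow[OF S C] Ck_cont2 unfolding Cinf_def by blast
  show "partials S ((Du ^^ i) ((Dt S ^^ j) f)) ((Du ^^ Suc i) ((Dt S ^^ j) f)) ((Du ^^ i) ((Dt S ^^ Suc j) f))"
    using P(3)[of i] Dt_Du_pow[OF S _ C] unfolding partials_def by simp
qed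

lemma mixed_partials_Cinf:
  assumes "mixed_partials S D"
  shows "Cinf S (D i j)"
proof -
  have "Ck n S (D i j)" for n
  proof (induction n arbitrary: i j)
    case (Suc n)
    show ?case by (rule Ck_SucI[OF _ _ Suc[of "Suc i" j] Suc[of i "Suc j"]])
      (use assms in \<open>auto simp: mixed_partials_def\<close>)
  qed (use assms in \<open>auto simp: mixed_partials_def\<close>)
  then show ?thesis by (simp add: Cinf_def)
qed

section \<open>Sequences of Fourier coefficients\<close>

definition bra :: "int \<Rightarrow> real" where
  "bra n = 1 + (real_of_int n)\<^sup>2"

text \<open>The total mass of the weight \<open>1 / bra\<close>, the constant in every convolution
  estimate.\<close>

definition S0 :: real where
  "S0 = (\<Sum>\<^sub>\<infinity>n. 1 / bra n)"

type_synonym coeffs = "int \<Rightarrow> complex"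

definition conv :: "coeffs \<Rightarrow> coeffs \<Rightarrow> coeffs" where
  "conv a b n = (\<Sum>\<^sub>\<infinity>m. a m * b (n - m))"

definition submult_weight :: "(int \<Rightarrow> real) \<Rightarrow> bool" where
  "submult_weight \<rho> \<longleftrightarrow> (\<forall>n. 1 \<le> \<rho> n \<and> \<rho> (- n) = \<rho> n) \<and> (\<forall>m n. \<rho> (m + n) \<le> \<rho> m * \<rho> n)"

text \<open>All bounds are proved for an arbitrary submultiplicative weight \<open>\<rho>\<close>, so that one fixed point
  serves all orders of smoothness at once.\<close>

definition EB :: "(int \<Rightarrow> real) \<Rightarrow> real \<Rightarrow> coeffs \<Rightarrow> bool" where
  "EB \<rho> M a \<longleftrightarrow> (\<forall>n. norm (a n) \<le> M / (bra n * \<rho> n))"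

text \<open>Two derivatives weaker than \<open>EB\<close>: the class of the remainder, which
  contains second derivatives.\<close>

definition FB :: "(int \<Rightarrow> real) \<Rightarrow> real \<Rightarrow> coeffs \<Rightarrow> bool" where
  "FB \<rho> M a \<longleftrightarrow> (\<forall>n. norm (a n) \<le> M / \<rho> n)"

lemma bra_ge_1: "1 \<le> bra n" by (simp add: bra_def)

lemma bra_pos [simp]: "0 < bra n" using bra_ge_1[of n] by linarith

lemma bra_minus [simp]: "bra (- n) = bra n" by (simp add: bra_def)

lemma weight_pos: "submult_weight \<rho> \<Longrightarrow> 0 < \<rho> n"
  by (rule less_le_trans[OF zero_less_one]) (simp add: submult_weight_def)

lemma int_summable_on:
  fixes f :: "int \<Rightarrow> real"
  assumes "(\<lambda>n::nat. f (int n)) summable_on UNIV" "(\<lambda>n::nat. f (- int n)) summable_on UNIV"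
  shows "f summable_on UNIV"
proof -
  have "f summable_on range int"
    using summable_on_reindex[of int UNIV f] assms(1) by (simp add: o_def inj_on_def)
  moreover have "f summable_on range (\<lambda>n. - int n)"
    using summable_on_reindex[of "\<lambda>n. - int n" UNIV f] assms(2) by (simp add: o_def inj_on_def)
  then have "f summable_on (range (\<lambda>n. - int n) - range int)"
    by (rule summable_on_subset_banach) auto
  ultimately have "f summable_on (range int \<union> (range (\<lambda>n. - int n) - range int))"
    by (rule summable_on_Un_disjoint) auto
  moreover have "range int \<union> (range (\<lambda>n. - int n) - range int) = UNIV"
  proof -
    have "x \<in> range int \<or> x \<in> range (\<lambda>n. - int n)" for x :: int
      by (cases x rule: int_cases2) auto
    then show ?thesis by blast
  qed
  ultimately show ?thesis by simp
qed

lemma bra_summable: "(\<lambda>n. 1 / bra n) summable_on UNIV"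
proof (rule int_summable_on)
  have "summable (\<lambda>n. 1 / bra (int n))"
  proof (rule summable_comparison_test_ev)
    show "summable (\<lambda>n. inverse (real n ^ 2))" by (rule inverse_power_summable) simp
    show "\<forall>\<^sub>F n in sequentially. norm (1 / bra (int n)) \<le> inverse (real n ^ 2)"
      using eventually_gt_at_top[of 0] by eventually_elim (auto simp: bra_def field_simps power2_eq_square add_pos_nonneg)
  qed
  then have "(\<lambda>n. 1 / bra (int n)) summable_on UNIV"
    by (intro norm_summable_imp_summable_on) (simp add: less_imp_le)
  then show "(\<lambda>n. 1 / bra (int n)) summable_on UNIV" "(\<lambda>n. 1 / bra (- int n)) summable_on UNIV" by simp_all
qed

lemma S0_ge_1: "1 \<le> S0"
proof -
  have "infsum (\<lambda>n. 1 / bra n) {0} \<le> S0" unfolding S0_def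
    by (rule infsum_mono_neutral) (auto simp: bra_summable less_imp_le)
  then show ?thesis by (simp add: bra_def)
qed

lemma infsum_dominated:
  fixes f :: "'a \<Rightarrow> 'b::banach"
  assumes "\<And>x. norm (f x) \<le> g x" "g summable_on UNIV"
  shows "(\<lambda>x. norm (f x)) summable_on UNIV" "f summable_on UNIV" "norm (infsum f UNIV) \<le> infsum g UNIV"
proof -
  show *: "(\<lambda>x. norm (f x)) summable_on UNIV"
    by (rule summable_on_comparison_test[OF assms(2)]) (use assms in auto)
  then show "f summable_on UNIV" by (rule abs_summable_summable)
  show "norm (infsum f UNIV) \<le> infsum g UNIV"
    using norm_infsum_bound[OF *] infsum_mono[OF * assms(2)] assms(1) by (meson order_trans)
qed

lemma bij_diff_int: "bij_betw (\<lambda>m::int. n - m) UNIV UNIV"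
  by (rule bij_betwI[where g="\<lambda>m. n - m"]) auto

lemma bra_shift_summable: "(\<lambda>m. 1 / bra (n - m)) summable_on UNIV"
  and bra_shift_infsum: "(\<Sum>\<^sub>\<infinity>m. 1 / bra (n - m)) = S0"
  using summable_on_reindex_bij_betw[OF bij_diff_int, of "\<lambda>m. 1 / bra m" n] bra_summable
    infsum_reindex_bij_betw[OF bij_diff_int, of "\<lambda>m. 1 / bra m" n]
  by (auto simp: S0_def)

lemma weight_split:
  assumes "submult_weight \<rho>" shows "\<rho> n \<le> \<rho> m * \<rho> (n - m)"
proof -
  have "\<rho> (m + (n - m)) \<le> \<rho> m * \<rho> (n - m)" using assms unfolding submult_weight_def by blast
  then show ?thesis by simp
qed

lemma EB_nonneg:
  assumes "submult_weight \<rho>" "EB \<rho> M a" shows "0 \<le> M"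
proof -
  have "0 \<le> M / (bra 0 * \<rho> 0)"
    using order_trans[OF norm_ge_zero assms(2)[unfolded EB_def, rule_format, of 0]] .
  then show ?thesis using weight_pos[OF assms(1), of 0] by (simp add: zero_le_divide_iff bra_def)
qed

lemma FB_nonneg:
  assumes "submult_weight \<rho>" "FB \<rho> M a" shows "0 \<le> M"
proof -
  have "0 \<le> M / \<rho> 0"
    using order_trans[OF norm_ge_zero assms(2)[unfolded FB_def, rule_format, of 0]] .
  then show ?thesis using weight_pos[OF assms(1), of 0] by (simp add: zero_le_divide_iff)
qed

lemma conv_term_EF:
  assumes w: "submult_weight \<rho>" and a: "EB \<rho> A a" and b: "FB \<rho> B b"
  shows "norm (a m * b (n - m)) \<le> (A * B / \<rho> n) * (1 / bra m)"
proof -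
  note p = weight_pos[OF w]
  have AB: "0 \<le> A" "0 \<le> B" using EB_nonneg FB_nonneg w a b by blast+
  have "norm (a m * b (n - m)) \<le> (A / (bra m * \<rho> m)) * (B / \<rho> (n - m))"
    using a b unfolding norm_mult EB_def FB_def by (intro mult_mono') auto
  also have "\<dots> = (A * B) * (1 / bra m) * (1 / (\<rho> m * \<rho> (n - m)))" by simp
  also have "\<dots> \<le> (A * B) * (1 / bra m) * (1 / \<rho> n)"
    using AB weight_split[OF w, of n m] p by (intro mult_left_mono divide_left_mono) (auto simp: less_imp_le)
  finally show ?thesis by (simp add: mult_ac)
qed

text \<open>Only the factor in \<open>EB\<close> is summed, through \<open>1 / bra\<close>; the
  other one enters through its bound. Submultiplicativity distributes the weight over both
  factors.\<close>

lemma conv_EF: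
  assumes w: "submult_weight \<rho>" and a: "EB \<rho> A a" and b: "FB \<rho> B b"
  shows "FB \<rho> (S0 * A * B) (conv a b)" "(\<lambda>m. a m * b (n - m)) summable_on UNIV"
proof -
  have s: "(\<lambda>m. (A * B / \<rho> n) * (1 / bra m)) summable_on UNIV" for n
    by (rule summable_on_cmult_right[OF bra_summable])
  have "norm (conv a b n) \<le> (A * B / \<rho> n) * S0" for n
    using infsum_dominated(3)[OF conv_term_EF[OF assms] s] infsum_cmult_right[OF bra_summable]
    unfolding conv_def S0_def by metis
  then show "FB \<rho> (S0 * A * B) (conv a b)" by (simp add: FB_def mult_ac)
  show "(\<lambda>m. a m * b (n - m)) summable_on UNIV"
    using infsum_dominated(2)[OF conv_term_EF[OF assms] s] .
qed

lemma EB_FB: "submult_weight \<rho> \<Longrightarrow> EB \<rho> A a \<Longrightarrow> FB \<rho> A a"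
  unfolding EB_def FB_def
proof
  fix n assume w: "submult_weight \<rho>" and a: "\<forall>n. norm (a n) \<le> A / (bra n * \<rho> n)"
  have "0 \<le> A" using EB_nonneg[OF w] a by (auto simp: EB_def)
  have "norm (a n) \<le> A / (bra n * \<rho> n)" using a by blast
  also have "\<dots> \<le> A / \<rho> n"
    using weight_pos[OF w, of n] bra_ge_1[of n] \<open>0 \<le> A\<close> by (intro divide_left_mono) auto
  finally show "norm (a n) \<le> A / \<rho> n" .
qed

text \<open>A form of Peetre's inequality: \<open>bra n\<close> is at most twice
  \<open>bra m + bra (n - m)\<close>. Dividing by the product splits a convolution term into two
  pieces that are summable in m.\<close>

lemma bra_split: "1 / (bra m * bra (n - m)) \<le> (2 / bra n) * (1 / bra m + 1 / bra (n - m))"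
proof -
  have "bra n \<le> 2 * (bra m + bra (n - m))"
    unfolding bra_def using sum_squares_ge_zero[of "real_of_int m - (real_of_int n - real_of_int m)" 0]
    by (simp add: power2_eq_square algebra_simps)
  then have "bra n / (bra m * bra (n - m)) \<le> 2 * (bra m + bra (n - m)) / (bra m * bra (n - m))"
    by (intro divide_right_mono) (auto simp: less_imp_le)
  also have "\<dots> = 2 * (1 / bra m + 1 / bra (n - m))"
    by (simp add: add_divide_distrib distrib_left less_imp_neq[OF bra_pos, symmetric])
  finally show ?thesis using bra_pos[of n] by (simp add: field_simps)
qed

text \<open>The class \<open>EB\<close> is an algebra under convolution. The constant 4 is the 2 of
  \<open>bra_split\<close> times the two sums, each equal to \<open>S0\<close>.\<close>

lemma conv_EE:
  assumes w: "submult_weight \<rho>" and a: "EB \<rho> A a" and b: "EB \<rho> B b"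
  shows "EB \<rho> (4 * S0 * A * B) (conv a b)"
  unfolding EB_def
proof
  fix n
  note p = weight_pos[OF w]
  have AB: "0 \<le> A" "0 \<le> B" using EB_nonneg w a b by blast+
  have t: "norm (a m * b (n - m)) \<le> (2 * A * B / (bra n * \<rho> n)) * (1 / bra m + 1 / bra (n - m))" for m
  proof -
    have "norm (a m * b (n - m)) \<le> (A / (bra m * \<rho> m)) * (B / (bra (n - m) * \<rho> (n - m)))"
      using a b unfolding norm_mult EB_def by (intro mult_mono') auto
    also have "\<dots> = (A * B) * (1 / (bra m * bra (n - m))) * (1 / (\<rho> m * \<rho> (n - m)))" by (simp add: mult_ac)
    also have "\<dots> \<le> (A * B) * ((2 / bra n) * (1 / bra m + 1 / bra (n - m))) * (1 / \<rho> n)"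
      using AB weight_split[OF w, of n m] p bra_split[of m n]
      by (intro mult_mono mult_left_mono divide_left_mono) (auto simp: less_imp_le add_nonneg_nonneg)
    finally show ?thesis by (simp add: mult_ac)
  qed
  have s: "(\<lambda>m. 1 / bra m + 1 / bra (n - m)) summable_on UNIV"
    by (intro summable_on_add bra_summable bra_shift_summable)
  have "(\<Sum>\<^sub>\<infinity>m. 1 / bra m + 1 / bra (n - m)) = 2 * S0"
    using infsum_add[OF bra_summable bra_shift_summable[of n]] bra_shift_infsum[of n] by (simp add: S0_def)
  then have "norm (conv a b n) \<le> (2 * A * B / (bra n * \<rho> n)) * (2 * S0)"
    using infsum_dominated(3)[OF t summable_on_cmult_right[OF s]] infsum_cmult_right[OF s]
    unfolding conv_def by metis
  then show "norm (conv a b n) \<le> 4 * S0 * A * B / (bra n * \<rho> n)" by (simp add: mult_ac)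
qed

lemma has_sum_minus:
  fixes f g :: "'a \<Rightarrow> complex"
  assumes "(f has_sum x) A" "(g has_sum y) A"
  shows "((\<lambda>i. f i - g i) has_sum x - y) A"
  using has_sum_add[OF assms(1), of "\<lambda>i. - g i" "- y"] assms(2) by (simp add: has_sum_uminus)

lemma conv_diff_left:
  assumes "submult_weight \<rho>" "EB \<rho> A a" "EB \<rho> A' a'" "FB \<rho> B b"
  shows "conv (\<lambda>m. a m - a' m) b n = conv a b n - conv a' b n"
proof -
  have "((\<lambda>m. a m * b (n - m) - a' m * b (n - m)) has_sum conv a b n - conv a' b n) UNIV"
    unfolding conv_def
    by (intro has_sum_minus has_sum_infsum conv_EF[OF assms(1,2,4)] conv_EF[OF assms(1,3,4)])
  then show ?thesis unfolding conv_def left_diff_distrib by (rule infsumI)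
qed

lemma conv_diff_right:
  assumes "submult_weight \<rho>" "EB \<rho> A a" "FB \<rho> B b" "FB \<rho> B' b'"
  shows "conv a (\<lambda>m. b m - b' m) n = conv a b n - conv a b' n"
proof -
  have "((\<lambda>m. a m * b (n - m) - a m * b' (n - m)) has_sum conv a b n - conv a b' n) UNIV"
    unfolding conv_def
    by (intro has_sum_minus has_sum_infsum conv_EF[OF assms(1,2,3)] conv_EF[OF assms(1,2,4)])
  then show ?thesis unfolding conv_def right_diff_distrib by (rule infsumI)
qed

lemma EB_add: "EB \<rho> A a \<Longrightarrow> EB \<rho> B b \<Longrightarrow> EB \<rho> (A + B) (\<lambda>n. a n + b n)"
  unfolding EB_def add_divide_distrib by (meson norm_triangle_mono)

lemma EB_cmult: "EB \<rho> A a \<Longrightarrow> EB \<rho> (norm c * A) (\<lambda>n. c * a n)"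
  unfolding EB_def norm_mult times_divide_eq_right[symmetric] by (blast intro: mult_left_mono norm_ge_zero)

lemma EB_mono: "submult_weight \<rho> \<Longrightarrow> EB \<rho> A a \<Longrightarrow> A \<le> B \<Longrightarrow> EB \<rho> B a"
  unfolding EB_def
  by (blast intro: order_trans divide_right_mono less_imp_le mult_pos_pos bra_pos weight_pos)

lemma EB_zero: "submult_weight \<rho> \<Longrightarrow> 0 \<le> A \<Longrightarrow> EB \<rho> A (\<lambda>n. 0)"
  unfolding EB_def by (simp add: weight_pos less_imp_le)

lemma FB_add: "FB \<rho> A a \<Longrightarrow> FB \<rho> B b \<Longrightarrow> FB \<rho> (A + B) (\<lambda>n. a n + b n)"
  unfolding FB_def add_divide_distrib by (meson norm_triangle_mono)

lemma conv_diff_EE: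
  assumes w: "submult_weight \<rho>" and a: "EB \<rho> A a" "EB \<rho> A' a'" "EB \<rho> dA (\<lambda>n. a n - a' n)"
    and b: "EB \<rho> B b" "EB \<rho> B' b'" "EB \<rho> dB (\<lambda>n. b n - b' n)"
  shows "EB \<rho> (4 * S0 * (A * dB + dA * B')) (\<lambda>n. conv a b n - conv a' b' n)"
proof -
  have "conv a b n - conv a' b' n = conv a (\<lambda>n. b n - b' n) n + conv (\<lambda>n. a n - a' n) b' n" for n
    using conv_diff_left[OF w a(1,2) EB_FB[OF w b(2)]] conv_diff_right[OF w a(1) EB_FB[OF w b(1)] EB_FB[OF w b(2)]]
    by simp
  then show ?thesis
    using EB_add[OF conv_EE[OF w a(1) b(3)] conv_EE[OF w a(3) b(2)]] by (simp add: algebra_simps)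
qed

lemma conv_diff_EF:
  assumes w: "submult_weight \<rho>" and a: "EB \<rho> A a" "EB \<rho> A' a'" "EB \<rho> dA (\<lambda>n. a n - a' n)"
    and b: "FB \<rho> B b" "FB \<rho> B' b'" "FB \<rho> dB (\<lambda>n. b n - b' n)"
  shows "FB \<rho> (S0 * (A * dB + dA * B')) (\<lambda>n. conv a b n - conv a' b' n)"
proof -
  have "conv a b n - conv a' b' n = conv a (\<lambda>n. b n - b' n) n + conv (\<lambda>n. a n - a' n) b' n" for n
    using conv_diff_left[OF w a(1,2) b(2)] conv_diff_right[OF w a(1) b(1) b(2)]
    by simp
  then show ?thesis
    using FB_add[OF conv_EF(1)[OF w a(1) b(3)] conv_EF(1)[OF w a(3) b(2)]] by (simp add: algebra_simps)
qed

definition D2 :: "coeffs \<Rightarrow> coeffs" where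
  "D2 a n = - (of_int n)\<^sup>2 * a n"

lemma D2_FB:
  assumes w: "submult_weight \<rho>" and a: "EB \<rho> A a"
  shows "FB \<rho> A (D2 a)"
  unfolding FB_def
proof
  fix n
  have "(real_of_int n)\<^sup>2 * norm (a n) \<le> bra n * (A / (bra n * \<rho> n))"
    using a unfolding EB_def bra_def by (intro mult_mono) auto
  then show "norm (D2 a n) \<le> A / \<rho> n" using bra_pos[of n] by (simp add: D2_def norm_mult norm_power)
qed

lemma D2_diff: "D2 (\<lambda>n. a n - b n) = (\<lambda>n. D2 a n - D2 b n)"
  by (auto simp: D2_def algebra_simps)

text \<open>
  For the Fourier coefficients \<open>a\<close> of a function \<open>v\<close>, \<open>Tc j a\<close> are those of \<open>(1 + v)\<^sup>j - 1 - j v\<close>, and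
  \<open>nonlin p a\<close> those of \<open>(1 + v)\<^sup>2 (((1 + v)\<^sup>p)'' + (1 + v)\<^sup>p) - (1 + v) - p v'' - (p + 1) v\<close>.
\<close>

fun Tc :: "nat \<Rightarrow> coeffs \<Rightarrow> coeffs" where
  "Tc 0 a = (\<lambda>n. 0)"
| "Tc (Suc j) a = (\<lambda>n. Tc j a n + (conv a (Tc j a) n + of_nat j * conv a a n))"

definition nonlin :: "nat \<Rightarrow> coeffs \<Rightarrow> coeffs" where
  "nonlin p a n = conv (\<lambda>m. 2 * a m + conv a a m) (D2 (\<lambda>m. of_nat p * a m + Tc p a m)) n
     + (D2 (Tc p a) n + Tc (p + 2) a n)"

lemma Tc_zero: "Tc j (\<lambda>n. 0) = (\<lambda>n. 0)"
  by (induction j) (auto simp: conv_def)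

text \<open>\<open>Tc j\<close> starts with quadratic terms, so its Lipschitz constant on the ball
  of radius M is proportional to M. The constant c is chosen before the weight \<rho>, which is what
  makes one fixed point serve all weights.\<close>

lemma Tc_lipschitz:
  "\<exists>c\<ge>0. \<forall>\<rho> a b M d. submult_weight \<rho> \<and> M \<le> 1 \<and> EB \<rho> M a \<and> EB \<rho> M b \<and> EB \<rho> d (\<lambda>n. a n - b n) \<longrightarrow>
     EB \<rho> (c * M * d) (\<lambda>n. Tc j a n - Tc j b n)"
proof (induction j)
  case 0
  then show ?case by (intro exI[of _ 0]) (auto simp: EB_def)
next
  case (Suc j)
  then obtain c where c: "c \<ge> 0" and IH: "\<And>\<rho> a b M d. submult_weight \<rho> \<Longrightarrow> M \<le> 1 \<Longrightarrow> EB \<rho> M a \<Longrightarrow> EB \<rho> M b \<Longrightarrow>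
     EB \<rho> d (\<lambda>n. a n - b n) \<Longrightarrow> EB \<rho> (c * M * d) (\<lambda>n. Tc j a n - Tc j b n)" by blast
  show ?case
  proof (intro exI[of _ "c + 8 * S0 * c + 8 * S0 * real j"] conjI allI impI)
    show "0 \<le> c + 8 * S0 * c + 8 * S0 * real j" using c S0_ge_1 by simp
    fix \<rho> a b M d
    assume H: "submult_weight \<rho> \<and> M \<le> 1 \<and> EB \<rho> M a \<and> EB \<rho> M b \<and> EB \<rho> d (\<lambda>n. a n - b n)"
    then have w: "submult_weight \<rho>" and a: "EB \<rho> M a" and b: "EB \<rho> M b" and ab: "EB \<rho> d (\<lambda>n. a n - b n)" by auto
    have M: "0 \<le> M" "M \<le> 1" and d: "0 \<le> d" using H EB_nonneg[OF w] by auto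
    \<comment> \<open>The comparison with the zero sequence turns the Lipschitz bound into a
      quadratic bound on \<open>Tc j\<close> itself.\<close>
    have T: "EB \<rho> (c * M * M) (Tc j x)" if "EB \<rho> M x" for x
      using IH[OF w M(2) that EB_zero[OF w M(1)], of M] that by (simp add: Tc_zero)
    note dT = IH[OF w M(2) a b ab]
    have "EB \<rho> (c * M * d + (4 * S0 * (M * (c * M * d) + d * (c * M * M)) + norm (of_nat j :: complex) * (4 * S0 * (M * d + d * M))))
       (\<lambda>n. (Tc j a n - Tc j b n) + ((conv a (Tc j a) n - conv b (Tc j b) n) + of_nat j * (conv a a n - conv b b n)))"
      by (rule EB_add[OF dT EB_add[OF conv_diff_EE[OF w a b ab T[OF a] T[OF b] dT] EB_cmult[OF conv_diff_EE[OF w a b ab a b ab]]]])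
    moreover have "c * M * d + (4 * S0 * (M * (c * M * d) + d * (c * M * M)) + norm (of_nat j :: complex) * (4 * S0 * (M * d + d * M)))
      \<le> (c + 8 * S0 * c + 8 * S0 * real j) * M * d"
    proof -
      have "S0 * c * M * d * M \<le> S0 * c * M * d * 1"
        using M d c S0_ge_1 by (intro mult_left_mono) auto
      then show ?thesis by (simp add: algebra_simps)
    qed
    ultimately have "EB \<rho> ((c + 8 * S0 * c + 8 * S0 * real j) * M * d)
       (\<lambda>n. (Tc j a n - Tc j b n) + ((conv a (Tc j a) n - conv b (Tc j b) n) + of_nat j * (conv a a n - conv b b n)))"
      using EB_mono[OF w] by blast
    then show "EB \<rho> ((c + 8 * S0 * c + 8 * S0 * real j) * M * d) (\<lambda>n. Tc (Suc j) a n - Tc (Suc j) b n)"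
      by (simp add: algebra_simps)
  qed
qed

text \<open>The input difference is measured in \<open>EB\<close>, the output only in
  \<open>FB\<close>, because of \<open>D2\<close>. The integration in \<open>LP_lipschitz\<close>
  makes up for this loss.\<close>

lemma nonlin_lipschitz:
  "\<exists>C\<ge>0. \<forall>\<rho> a b M d. submult_weight \<rho> \<and> M \<le> 1 \<and> EB \<rho> M a \<and> EB \<rho> M b \<and> EB \<rho> d (\<lambda>n. a n - b n) \<longrightarrow>
     FB \<rho> (C * M * d) (\<lambda>n. nonlin p a n - nonlin p b n)"
proof -
  obtain c where c: "c \<ge> 0" and T1: "\<And>\<rho> a b M d. submult_weight \<rho> \<Longrightarrow> M \<le> 1 \<Longrightarrow> EB \<rho> M a \<Longrightarrow> EB \<rho> M b \<Longrightarrow>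
     EB \<rho> d (\<lambda>n. a n - b n) \<Longrightarrow> EB \<rho> (c * M * d) (\<lambda>n. Tc p a n - Tc p b n)"
    using Tc_lipschitz[of p] by blast
  obtain c' where c': "c' \<ge> 0" and T2: "\<And>\<rho> a b M d. submult_weight \<rho> \<Longrightarrow> M \<le> 1 \<Longrightarrow> EB \<rho> M a \<Longrightarrow> EB \<rho> M b \<Longrightarrow>
     EB \<rho> d (\<lambda>n. a n - b n) \<Longrightarrow> EB \<rho> (c' * M * d) (\<lambda>n. Tc (p + 2) a n - Tc (p + 2) b n)"
    using Tc_lipschitz[of "p + 2"] by blast
  \<comment> \<open>The first summand is twice (2 + 8 S0)(p + c), one for each half of the product
    difference; c and c' come from the two terms outside the product.\<close>
  define C where "C = S0 * (4 + 16 * S0) * (real p + c) + c + c'"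
  show ?thesis
  proof (intro exI[of _ C] conjI allI impI)
    show "0 \<le> C" using c c' S0_ge_1 by (simp add: C_def)
    fix \<rho> a b M d
    assume H: "submult_weight \<rho> \<and> M \<le> 1 \<and> EB \<rho> M a \<and> EB \<rho> M b \<and> EB \<rho> d (\<lambda>n. a n - b n)"
    then have w: "submult_weight \<rho>" and a: "EB \<rho> M a" and b: "EB \<rho> M b" and ab: "EB \<rho> d (\<lambda>n. a n - b n)" by auto
    have M: "0 \<le> M" "M \<le> 1" and d: "0 \<le> d" using H EB_nonneg[OF w] by auto
    have le1: "x * M * y \<le> x * y" if "0 \<le> x" "0 \<le> y" for x y
      using M that mult_right_mono[of "x * M" x y] mult_left_le[of M x] by auto
    have TM: "EB \<rho> (c * M * M) (Tc p x)" if "EB \<rho> M x" for x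
      using T1[OF w M(2) that EB_zero[OF w M(1)], of M] that by (simp add: Tc_zero)
    define P where "P x = (\<lambda>m. 2 * x m + conv x x m)" for x
    define Q where "Q x = (\<lambda>m. of_nat p * x m + Tc p x m)" for x
    have P: "EB \<rho> ((2 + 8 * S0) * M) (P x)" if "EB \<rho> M x" for x
    proof -
      have "EB \<rho> (norm (2::complex) * M + 4 * S0 * M * M) (P x)"
        unfolding P_def by (rule EB_add[OF EB_cmult[OF that] conv_EE[OF w that that]])
      moreover have "4 * S0 * M * M \<le> 8 * S0 * M"
        using le1[of "4 * S0" M] S0_ge_1 M(1) by (smt (verit) mult_right_mono)
      ultimately show ?thesis by (elim EB_mono[OF w]) (simp add: distrib_right)
    qed
    have dP: "EB \<rho> ((2 + 8 * S0) * d) (\<lambda>n. P a n - P b n)"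
    proof -
      have "EB \<rho> (norm (2::complex) * d + 4 * S0 * (M * d + d * M)) (\<lambda>n. 2 * (a n - b n) + (conv a a n - conv b b n))"
        by (rule EB_add[OF EB_cmult[OF ab] conv_diff_EE[OF w a b ab a b ab]])
      then have "EB \<rho> ((2 + 8 * S0) * d) (\<lambda>n. 2 * (a n - b n) + (conv a a n - conv b b n))"
        using le1[of "8 * S0" d] S0_ge_1 d by (elim EB_mono[OF w]) (simp add: algebra_simps)
      then show ?thesis by (simp add: P_def algebra_simps)
    qed
    have Q: "EB \<rho> ((real p + c) * M) (Q x)" if "EB \<rho> M x" for x
    proof -
      have "EB \<rho> (norm (of_nat p::complex) * M + c * M * M) (Q x)"
        unfolding Q_def by (rule EB_add[OF EB_cmult[OF that] TM[OF that]])
      then show ?thesis using le1[of c M] c M(1) by (elim EB_mono[OF w]) (simp add: algebra_simps)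
    qed
    have dQ: "EB \<rho> ((real p + c) * d) (\<lambda>n. Q a n - Q b n)"
    proof -
      have "EB \<rho> (norm (of_nat p::complex) * d + c * M * d) (\<lambda>n. of_nat p * (a n - b n) + (Tc p a n - Tc p b n))"
        by (rule EB_add[OF EB_cmult[OF ab] T1[OF w M(2) a b ab]])
      then have "EB \<rho> ((real p + c) * d) (\<lambda>n. of_nat p * (a n - b n) + (Tc p a n - Tc p b n))"
        using le1[of c d] c d by (elim EB_mono[OF w]) (simp add: algebra_simps)
      then show ?thesis by (simp add: Q_def algebra_simps)
    qed
    have "FB \<rho> (S0 * ((2 + 8 * S0) * M * ((real p + c) * d) + (2 + 8 * S0) * d * ((real p + c) * M)) + (c * M * d + c' * M * d))
       (\<lambda>n. (conv (P a) (D2 (Q a)) n - conv (P b) (D2 (Q b)) n) + ((D2 (Tc p a) n - D2 (Tc p b) n) + (Tc (p + 2) a n - Tc (p + 2) b n)))"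
      by (rule FB_add[OF conv_diff_EF[OF w P[OF a] P[OF b] dP D2_FB[OF w Q[OF a]] D2_FB[OF w Q[OF b]] D2_FB[OF w dQ, unfolded D2_diff]]
          FB_add[OF D2_FB[OF w T1[OF w M(2) a b ab], unfolded D2_diff] EB_FB[OF w T2[OF w M(2) a b ab]]]])
    moreover have "S0 * ((2 + 8 * S0) * M * ((real p + c) * d) + (2 + 8 * S0) * d * ((real p + c) * M)) + (c * M * d + c' * M * d) = C * M * d"
      by (simp add: C_def algebra_simps)
    ultimately show "FB \<rho> (C * M * d) (\<lambda>n. nonlin p a n - nonlin p b n)"
      by (simp add: nonlin_def P_def Q_def algebra_simps)
  qed
qed

lemma nonlin_zero: "nonlin p (\<lambda>n. 0) = (\<lambda>n. 0)"
  by (rule ext) (simp add: nonlin_def Tc_zero conv_def D2_def)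

section \<open>Coefficient sequences of real-valued functions\<close>

definition cnj_sym :: "coeffs \<Rightarrow> bool" where
  "cnj_sym a \<longleftrightarrow> (\<forall>n. a (- n) = cnj (a n))"

lemma bij_uminus_int: "bij_betw (\<lambda>m::int. - m) UNIV UNIV"
  by (rule bij_betwI[where g=uminus]) auto

lemma conv_cnj_sym:
  assumes "cnj_sym a" "cnj_sym b" shows "cnj_sym (conv a b)"
  unfolding cnj_sym_def
proof
  fix n
  have "conv a b (- n) = (\<Sum>\<^sub>\<infinity>m. a (- m) * b (- n - (- m)))"
    unfolding conv_def by (rule infsum_reindex_bij_betw[OF bij_uminus_int, symmetric])
  also have "\<dots> = (\<Sum>\<^sub>\<infinity>m. cnj (a m * b (n - m)))"
  proof (rule infsum_cong)
    fix m
    have "- n - (- m) = - (n - m)" by simp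
    then show "a (- m) * b (- n - (- m)) = cnj (a m * b (n - m))"
      using assms unfolding cnj_sym_def by (metis complex_cnj_mult)
  qed
  finally show "conv a b (- n) = cnj (conv a b n)" by (simp only: conv_def infsum_cnj)
qed

lemma D2_cnj_sym: "cnj_sym a \<Longrightarrow> cnj_sym (D2 a)"
  by (simp add: cnj_sym_def D2_def)

lemma Tc_cnj_sym: "cnj_sym a \<Longrightarrow> cnj_sym (Tc j a)"
proof (induction j)
  case (Suc j)
  then show ?case using conv_cnj_sym[of a a] conv_cnj_sym[of a "Tc j a"] by (simp add: cnj_sym_def)
qed (simp add: cnj_sym_def)

lemma nonlin_cnj_sym:
  assumes "cnj_sym a" shows "cnj_sym (nonlin p a)"
proof -
  have "cnj_sym (\<lambda>m. 2 * a m + conv a a m)" "cnj_sym (\<lambda>m. of_nat p * a m + Tc p a m)"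
    using assms conv_cnj_sym[of a a] Tc_cnj_sym[of a p] by (auto simp: cnj_sym_def)
  then have "cnj_sym (conv (\<lambda>m. 2 * a m + conv a a m) (D2 (\<lambda>m. of_nat p * a m + Tc p a m)))"
    by (intro conv_cnj_sym D2_cnj_sym)
  then show ?thesis
    using Tc_cnj_sym[OF assms, of "p + 2"] D2_cnj_sym[OF Tc_cnj_sym[OF assms, of p]]
    unfolding cnj_sym_def nonlin_def by simp
qed

section \<open>Continuity in time of the nonlinear terms\<close>

lemma infsum_continuous_on:
  fixes f :: "'a \<Rightarrow> 'b::topological_space \<Rightarrow> 'c::banach"
  assumes "\<And>x y. y \<in> Y \<Longrightarrow> norm (f x y) \<le> M x" "M summable_on UNIV" "\<And>x. continuous_on Y (f x)"
  shows "continuous_on Y (\<lambda>y. \<Sum>\<^sub>\<infinity>x. f x y)"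
proof (rule uniform_limit_theorem[OF _ Weierstrass_m_test_general[of UNIV Y f M]])
  show "\<forall>\<^sub>F X in finite_subsets_at_top UNIV. continuous_on Y (\<lambda>y. \<Sum>x\<in>X. f x y)"
    by (intro always_eventually allI continuous_on_sum assms)
qed (use assms in auto)

lemma conv_continuous_on:
  assumes w: "submult_weight \<rho>" and a: "\<And>t. t \<in> S \<Longrightarrow> EB \<rho> A (a t)" and b: "\<And>t. t \<in> S \<Longrightarrow> FB \<rho> B (b t)"
    and c: "\<And>n. continuous_on S (\<lambda>t. a t n)" "\<And>n. continuous_on S (\<lambda>t. b t n)"
  shows "continuous_on S (\<lambda>t. conv (a t) (b t) n)"
  unfolding conv_def
  by (rule infsum_continuous_on[OF conv_term_EF[OF w a b] summable_on_cmult_right[OF bra_summable]])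
    (auto intro!: continuous_intros c)

lemma Tc_EB:
  "\<exists>c\<ge>0. \<forall>\<rho> a M. submult_weight \<rho> \<and> M \<le> 1 \<and> EB \<rho> M a \<longrightarrow> EB \<rho> (c * M * M) (Tc j a)"
proof -
  obtain c where c: "c \<ge> 0" and T: "\<And>\<rho> a b M d. submult_weight \<rho> \<Longrightarrow> M \<le> 1 \<Longrightarrow> EB \<rho> M a \<Longrightarrow> EB \<rho> M b \<Longrightarrow>
     EB \<rho> d (\<lambda>n. a n - b n) \<Longrightarrow> EB \<rho> (c * M * d) (\<lambda>n. Tc j a n - Tc j b n)"
    using Tc_lipschitz[of j] by blast
  have "EB \<rho> (c * M * M) (Tc j a)" if "submult_weight \<rho>" "M \<le> 1" "EB \<rho> M a" for \<rho> a M
    using T[OF that EB_zero[OF that(1) EB_nonneg[OF that(1,3)]], of M] that by (simp add: Tc_zero)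
  then show ?thesis using c by blast
qed

lemma Tc_continuous_on:
  assumes w: "submult_weight \<rho>" and M: "M \<le> 1" and a: "\<And>t. t \<in> S \<Longrightarrow> EB \<rho> M (a t)"
    and c: "\<And>n. continuous_on S (\<lambda>t. a t n)"
  shows "continuous_on S (\<lambda>t. Tc j (a t) n)"
proof (induction j arbitrary: n)
  case (Suc j)
  obtain k where T: "\<And>t. t \<in> S \<Longrightarrow> EB \<rho> (k * M * M) (Tc j (a t))" using Tc_EB[of j] w M a by blast
  have "continuous_on S (\<lambda>t. conv (a t) (Tc j (a t)) n)"
    by (rule conv_continuous_on[OF w a EB_FB[OF w T] c Suc.IH])
  moreover have "continuous_on S (\<lambda>t. conv (a t) (a t) n)"
    by (rule conv_continuous_on[OF w a EB_FB[OF w a] c c])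
  ultimately show ?case unfolding Tc.simps by (intro continuous_intros Suc.IH)
qed auto

lemma nonlin_continuous_on:
  assumes w: "submult_weight \<rho>" and M: "M \<le> 1" and a: "\<And>t. t \<in> S \<Longrightarrow> EB \<rho> M (a t)"
    and c: "\<And>n. continuous_on S (\<lambda>t. a t n)"
  shows "continuous_on S (\<lambda>t. nonlin p (a t) n)"
proof -
  obtain k where T: "\<And>t. t \<in> S \<Longrightarrow> EB \<rho> (k * M * M) (Tc p (a t))" using Tc_EB[of p] w M a by blast
  have cT: "continuous_on S (\<lambda>t. Tc j (a t) n)" for j n by (rule Tc_continuous_on[OF w M a c])
  have cc: "continuous_on S (\<lambda>t. conv (a t) (a t) n)" for n
    by (rule conv_continuous_on[OF w a EB_FB[OF w a] c c])
  have 1: "EB \<rho> (norm (2::complex) * M + 4 * S0 * M * M) (\<lambda>m. 2 * a t m + conv (a t) (a t) m)" if "t \<in> S" for t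
    by (rule EB_add[OF EB_cmult[OF a[OF that]] conv_EE[OF w a[OF that] a[OF that]]])
  have 2: "FB \<rho> (norm (of_nat p :: complex) * M + k * M * M) (D2 (\<lambda>m. of_nat p * a t m + Tc p (a t) m))" if "t \<in> S" for t
    by (rule D2_FB[OF w EB_add[OF EB_cmult[OF a[OF that]] T[OF that]]])
  have "continuous_on S (\<lambda>t. conv (\<lambda>m. 2 * a t m + conv (a t) (a t) m) (D2 (\<lambda>m. of_nat p * a t m + Tc p (a t) m)) n)"
    by (rule conv_continuous_on[OF w 1 2]) (auto simp: D2_def intro!: continuous_intros c cc cT)
  then show ?thesis unfolding nonlin_def
    by (intro continuous_intros cT) (auto simp: D2_def intro!: continuous_intros cT)
qed

section \<open>The Lyapunov--Perron equation\<close>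

text \<open>Minus the Fourier symbol of p v'' + (p + 1) v, the linearisation at the unit
  circle.\<close>

definition lam :: "nat \<Rightarrow> int \<Rightarrow> real" where
  "lam p n = real p * (real_of_int n)\<^sup>2 - real p - 1"

text \<open>The value of \<open>lam p\<close> at the slowest stable modes 2 and -2.\<close>

definition mu :: "nat \<Rightarrow> real" where
  "mu p = 3 * real p - 1"

text \<open>The Duhamel integral without its outer factor e^(-\<lambda> \<tau>), so that it has a
  limit at infinity for the unstable modes.\<close>

definition Jint :: "nat \<Rightarrow> (real \<Rightarrow> coeffs) \<Rightarrow> int \<Rightarrow> real \<Rightarrow> complex" where
  "Jint p v n \<tau> = integral {0..\<tau>} (\<lambda>s. exp (lam p n * s) *\<^sub>R nonlin p (v s) n)"

text \<open>
  The Lyapunov--Perron operator: the stable modes \<open>\<bar>n\<bar> \<ge> 2\<close> carry the prescribed initial values, the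
  initial values of the unstable modes are those for which the solution decays.
\<close>

definition LPinit :: "nat \<Rightarrow> coeffs \<Rightarrow> (real \<Rightarrow> coeffs) \<Rightarrow> coeffs" where
  "LPinit p \<beta> v n = (if 2 \<le> \<bar>n\<bar> then (1 + v 0 0) * \<beta> n else - Lim at_top (Jint p v n))"

definition LP :: "nat \<Rightarrow> coeffs \<Rightarrow> (real \<Rightarrow> coeffs) \<Rightarrow> real \<Rightarrow> coeffs" where
  "LP p \<beta> v \<tau> n = exp (- lam p n * \<tau>) *\<^sub>R (LPinit p \<beta> v n + Jint p v n \<tau>)"

definition decaying :: "nat \<Rightarrow> (int \<Rightarrow> real) \<Rightarrow> real \<Rightarrow> (real \<Rightarrow> coeffs) \<Rightarrow> bool" where
  "decaying p \<rho> M v \<longleftrightarrow> (\<forall>\<tau>\<ge>0. EB \<rho> (M * exp (- mu p * \<tau>)) (v \<tau>))"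

definition modes_continuous :: "(real \<Rightarrow> coeffs) \<Rightarrow> bool" where
  "modes_continuous v \<longleftrightarrow> (\<forall>n. continuous_on {0..} (\<lambda>\<tau>. v \<tau> n))"

lemma bra_nonzero [simp]: "bra n \<noteq> 0" using bra_pos[of n] by linarith

lemma bra_nonneg [simp]: "0 \<le> bra n" using bra_pos[of n] by linarith

lemma lam_minus [simp]: "lam p (- n) = lam p n" by (simp add: lam_def)

text \<open>At modes 2 and -2, \<lambda> equals \<mu>; from modes 3 and -3 on it is at least 8p - 1,
  beyond 2 \<mu>. \<open>stable_mode_bound\<close> is arranged around this gap. The constant 5/2 is
  attained at mode 2 for p = 1.\<close>

lemma lam_stable:
  assumes "1 \<le> p" "2 \<le> \<bar>n\<bar>"
  shows "mu p \<le> lam p n" "lam p n = mu p \<or> 2 * mu p \<le> lam p n" "bra n \<le> 5/2 * lam p n" "0 < lam p n"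
proof -
  have p: "1 \<le> real p" using assms by simp
  have n2: "4 \<le> (real_of_int n)\<^sup>2"
  proof -
    have "2\<^sup>2 \<le> \<bar>real_of_int n\<bar>\<^sup>2" using assms(2) by (intro power_mono) linarith+
    then show ?thesis by simp
  qed
  have "real p * 4 \<le> real p * (real_of_int n)\<^sup>2" using n2 by (intro mult_left_mono) auto
  then show mu: "mu p \<le> lam p n" by (simp add: lam_def mu_def)
  then show "0 < lam p n" using p by (simp add: mu_def)
  have "(real_of_int n)\<^sup>2 - 1 \<le> real p * ((real_of_int n)\<^sup>2 - 1)"
    using mult_right_mono[OF p, of "(real_of_int n)\<^sup>2 - 1"] n2 by simp
  then have "(real_of_int n)\<^sup>2 - 2 \<le> lam p n" by (simp add: lam_def algebra_simps)
  then show "bra n \<le> 5/2 * lam p n" using n2 unfolding bra_def by linarith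
  show "lam p n = mu p \<or> 2 * mu p \<le> lam p n"
  proof (cases "\<bar>n\<bar> = 2")
    case True
    then have "\<bar>real_of_int n\<bar>\<^sup>2 = 2\<^sup>2" by (metis of_int_abs of_int_numeral)
    then have "(real_of_int n)\<^sup>2 = 4" by simp
    then show ?thesis by (simp add: lam_def mu_def)
  next
    case False
    then have "3\<^sup>2 \<le> \<bar>real_of_int n\<bar>\<^sup>2" using assms(2) by (intro power_mono) linarith+
    then have "real p * 9 \<le> real p * (real_of_int n)\<^sup>2" by (intro mult_left_mono) auto
    moreover have "lam p n - 2 * mu p = real p * (real_of_int n)\<^sup>2 - real p * 9 + (2 * real p + 1)"
      by (simp add: lam_def mu_def)
    ultimately have "2 * mu p \<le> lam p n" using p by linarith
    then show ?thesis by blast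
  qed
qed

lemma lam_unstable:
  assumes "1 \<le> p" "\<not> 2 \<le> \<bar>n\<bar>"
  shows "lam p n < 0" "bra n \<le> 2"
proof -
  have "\<bar>real_of_int n\<bar>\<^sup>2 \<le> 1\<^sup>2" using assms(2) by (intro power_mono) linarith+
  then have n2: "(real_of_int n)\<^sup>2 \<le> 1" by simp
  then show "bra n \<le> 2" by (simp add: bra_def)
  have "real p * (real_of_int n)\<^sup>2 \<le> real p * 1" using n2 by (intro mult_left_mono) auto
  then show "lam p n < 0" by (simp add: lam_def)
qed

lemma exp_integral:
  fixes a :: real assumes "a \<noteq> 0" "x \<le> y"
  shows "((\<lambda>s. exp (a * s)) has_integral (exp (a * y) - exp (a * x)) / a) {x..y}"
proof -
  have "((\<lambda>s. exp (a * s)) has_integral (exp (a * y) / a - exp (a * x) / a)) {x..y}"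
    using assms by (intro fundamental_theorem_of_calculus)
     (auto intro!: derivative_eq_intros simp: real_derivative_vector[symmetric])
  then show ?thesis by (simp add: diff_divide_distrib)
qed

lemma weighted_integral_bound:
  fixes g :: "real \<Rightarrow> complex"
  assumes g: "continuous_on {0..} g" and b: "\<And>s. 0 \<le> s \<Longrightarrow> norm (g s) \<le> B * exp (- b * s)"
    and ab: "a - b \<noteq> 0" and xy: "0 \<le> x" "x \<le> y"
  shows "norm (integral {x..y} (\<lambda>s. exp (a * s) *\<^sub>R g s)) \<le> B * ((exp ((a - b) * y) - exp ((a - b) * x)) / (a - b))"
proof -
  have i: "((\<lambda>s. B * exp ((a - b) * s)) has_integral B * ((exp ((a - b) * y) - exp ((a - b) * x)) / (a - b))) {x..y}"
    by (intro has_integral_mult_right exp_integral ab xy)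
  have "norm (integral {x..y} (\<lambda>s. exp (a * s) *\<^sub>R g s)) \<le> integral {x..y} (\<lambda>s. B * exp ((a - b) * s))"
  proof (rule Henstock_Kurzweil_Integration.integral_norm_bound_integral)
    show "(\<lambda>s. exp (a * s) *\<^sub>R g s) integrable_on {x..y}"
      using xy by (intro integrable_continuous_real continuous_intros continuous_on_subset[OF g]) auto
    show "(\<lambda>s. B * exp ((a - b) * s)) integrable_on {x..y}" using i by blast
    fix s assume "s \<in> {x..y}"
    then have "exp (a * s) * norm (g s) \<le> exp (a * s) * (B * exp (- b * s))"
      using xy by (intro mult_left_mono b) auto
    also have "\<dots> = B * exp ((a - b) * s)" by (simp add: exp_add[symmetric] algebra_simps)
    finally show "norm (exp (a * s) *\<^sub>R g s) \<le> B * exp ((a - b) * s)" by simp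
  qed
  then show ?thesis using integral_unique[OF i] by (simp only:)
qed

text \<open>The factor 1/l is the gain of two derivatives. For l = m the full decay of g is used.
  For l at least 2 m the exponent l - 2 m may vanish, so only the weaker decay e^(-m s) is used, and
  l - m is at least l / 2.\<close>

lemma stable_mode_bound:
  fixes g :: "real \<Rightarrow> complex"
  assumes g: "continuous_on {0..} g" and b: "\<And>s. 0 \<le> s \<Longrightarrow> norm (g s) \<le> B * exp (- (2 * m) * s)"
    and m: "0 < m" "l = m \<or> 2 * m \<le> l" and t: "0 \<le> t"
  shows "norm (exp (- l * t) *\<^sub>R integral {0..t} (\<lambda>s. exp (l * s) *\<^sub>R g s)) \<le> 2 * B / l * exp (- m * t)"
proof -
  have B: "0 \<le> B" using order_trans[OF norm_ge_zero b[of 0]] by simp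
  have "norm (integral {0..t} (\<lambda>s. exp (l * s) *\<^sub>R g s)) \<le> 2 * B / l * exp ((l - m) * t)"
    using m(2)
  proof
    assume l: "l = m"
    have "norm (integral {0..t} (\<lambda>s. exp (l * s) *\<^sub>R g s)) \<le> B * ((exp ((l - 2 * m) * t) - exp ((l - 2 * m) * 0)) / (l - 2 * m))"
      by (rule weighted_integral_bound[OF g b]) (use m l t in auto)
    also have "\<dots> = B * ((1 - exp (- (m * t))) / m)" using l m by (simp add: field_simps)
    also have "\<dots> \<le> B * (2 / m)" using B m by (intro mult_left_mono divide_right_mono) (auto intro: order_trans[of _ 0])
    finally show ?thesis using l by (simp add: mult_ac)
  next
    assume l: "2 * m \<le> l"
    have b': "norm (g s) \<le> B * exp (- m * s)" if "0 \<le> s" for s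
      by (rule order_trans[OF b[OF that]], rule mult_left_mono) (use B m that in \<open>auto simp: mult_right_mono\<close>)
    have "norm (integral {0..t} (\<lambda>s. exp (l * s) *\<^sub>R g s)) \<le> B * ((exp ((l - m) * t) - exp ((l - m) * 0)) / (l - m))"
      by (rule weighted_integral_bound[OF g b']) (use m l t in auto)
    also have "\<dots> \<le> B * (exp ((l - m) * t) / (l / 2))"
      using B m l by (intro mult_left_mono frac_le) auto
    finally show ?thesis by (simp add: mult_ac)
  qed
  then have "exp (- l * t) * norm (integral {0..t} (\<lambda>s. exp (l * s) *\<^sub>R g s)) \<le> exp (- l * t) * (2 * B / l * exp ((l - m) * t))"
    by (rule mult_left_mono) auto
  also have "\<dots> = 2 * B / l * (exp (- l * t) * exp ((l - m) * t))" by (simp only: mult_ac)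
  also have "exp (- l * t) * exp ((l - m) * t) = exp (- m * t)" by (simp add: exp_add[symmetric] algebra_simps)
  finally show ?thesis by simp
qed

text \<open>For negative l the integrand decays and the integral has a limit. Once the limit is
  subtracted only a tail is left, and it decays faster than the factor e^(-l t) grows.\<close>

lemma unstable_mode_bound:
  fixes g :: "real \<Rightarrow> complex"
  assumes g: "continuous_on {0..} g" and b: "\<And>s. 0 \<le> s \<Longrightarrow> norm (g s) \<le> B * exp (- (2 * m) * s)"
    and m: "0 < m" "l < 0"
  obtains L where "((\<lambda>t. integral {0..t} (\<lambda>s. exp (l * s) *\<^sub>R g s)) \<longlongrightarrow> L) at_top"
    "\<And>t. 0 \<le> t \<Longrightarrow> norm (exp (- l * t) *\<^sub>R (integral {0..t} (\<lambda>s. exp (l * s) *\<^sub>R g s) - L)) \<le> B / m * exp (- m * t)"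
proof -
  define F where "F t = integral {0..t} (\<lambda>s. exp (l * s) *\<^sub>R g s)" for t
  define c where "c = 2 * m - l"
  have c: "m \<le> c" "0 < c" using m by (auto simp: c_def)
  have B: "0 \<le> B" using order_trans[OF norm_ge_zero b[of 0]] by simp
  have diff: "norm (F y - F x) \<le> B / m * exp (- c * x)" if "0 \<le> x" "x \<le> y" for x y
  proof -
    have "(\<lambda>s. exp (l * s) *\<^sub>R g s) integrable_on {0..y}"
      by (intro integrable_continuous_real continuous_intros continuous_on_subset[OF g]) auto
    then have "F y - F x = integral {x..y} (\<lambda>s. exp (l * s) *\<^sub>R g s)"
      unfolding F_def using Henstock_Kurzweil_Integration.integral_combine[of 0 x y] that by (metis add_diff_cancel_left')
    moreover have "norm (integral {x..y} (\<lambda>s. exp (l * s) *\<^sub>R g s)) \<le>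
       B * ((exp ((l - 2 * m) * y) - exp ((l - 2 * m) * x)) / (l - 2 * m))"
      by (rule weighted_integral_bound[OF g b]) (use m that in auto)
    moreover have "(exp ((l - 2 * m) * y) - exp ((l - 2 * m) * x)) / (l - 2 * m) = (exp (- c * x) - exp (- c * y)) / c"
      unfolding c_def by (subst minus_divide_divide[symmetric]) simp
    moreover have "(exp (- c * x) - exp (- c * y)) / c \<le> exp (- c * x) / m"
      using c m by (intro frac_le) auto
    ultimately show ?thesis using B by (smt (verit) mult_left_mono times_divide_eq_left times_divide_eq_right)
  qed
  have e0: "(\<lambda>N. B / m * exp (- c * real N)) \<longlonglongrightarrow> 0"
  proof -
    have "((\<lambda>x. exp (- c * x)) \<longlongrightarrow> 0) at_top"
      using c by (intro filterlim_compose[OF exp_at_bot] filterlim_tendsto_neg_mult_at_bot[OF tendsto_const _ filterlim_ident]) auto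
    from tendsto_mult_left[OF filterlim_compose[OF this filterlim_real_sequentially], of "B / m"] show ?thesis by simp
  qed
  \<comment> \<open>The limit is found along integer times; \<open>diff\<close> then compares every
    real time with it.\<close>
  have "Cauchy (\<lambda>N. F (real N))"
  proof (rule CauchyI')
    fix e :: real assume "0 < e"
    with e0 have "\<forall>\<^sub>F N in sequentially. B / m * exp (- c * real N) < e" by (rule order_tendstoD)
    then obtain N0 where N0: "\<And>N. N \<ge> N0 \<Longrightarrow> B / m * exp (- c * real N) < e" by (auto simp: eventually_sequentially)
    show "\<exists>M. \<forall>k\<ge>M. \<forall>n>k. dist (F (real k)) (F (real n)) < e"
    proof (intro exI[of _ N0] allI impI)
      fix k n assume "N0 \<le> k" "k < n"
      then show "dist (F (real k)) (F (real n)) < e"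
        using diff[of "real k" "real n"] N0[of k] by (simp add: dist_norm norm_minus_commute)
    qed
  qed
  then obtain L where L: "(\<lambda>N. F (real N)) \<longlonglongrightarrow> L" using Cauchy_convergent convergentD by blast
  have lim: "norm (F t - L) \<le> B / m * exp (- c * t)" if "0 \<le> t" for t
  proof (rule tendsto_upperbound)
    show "(\<lambda>N. norm (F t - F (real N))) \<longlonglongrightarrow> norm (F t - L)" by (intro tendsto_intros L)
    show "\<forall>\<^sub>F N in sequentially. norm (F t - F (real N)) \<le> B / m * exp (- c * t)"
      using eventually_ge_at_top[of "nat \<lceil>t\<rceil>"]
    proof eventually_elim
      case (elim N)
      then have "t \<le> real N" by linarith
      from diff[OF that this] show ?case by (simp only: norm_minus_commute)
    qed
  qed auto
  show ?thesis
  proof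
    have "((\<lambda>t. B / m * exp (- c * t)) \<longlongrightarrow> B / m * 0) at_top"
      using c by (intro tendsto_mult tendsto_const filterlim_compose[OF exp_at_bot]
          filterlim_tendsto_neg_mult_at_bot[OF tendsto_const _ filterlim_ident]) auto
    then have "((\<lambda>t. B / m * exp (- c * t)) \<longlongrightarrow> 0) at_top" by simp
    then have "((\<lambda>t. F t - L) \<longlongrightarrow> 0) at_top"
      by (rule Lim_null_comparison[rotated]) (rule eventually_mono[OF eventually_ge_at_top[of 0] lim])
    then show "((\<lambda>t. integral {0..t} (\<lambda>s. exp (l * s) *\<^sub>R g s)) \<longlongrightarrow> L) at_top"
      unfolding F_def[symmetric] by (simp add: LIM_zero_iff)
  next
    fix t :: real assume t: "0 \<le> t"
    have "exp (- l * t) * norm (F t - L) \<le> exp (- l * t) * (B / m * exp (- c * t))"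
      by (intro mult_left_mono lim t) auto
    also have "\<dots> = B / m * (exp (- l * t) * exp (- c * t))" by (simp only: mult_ac)
    also have "exp (- l * t) * exp (- c * t) = exp (- (2 * m) * t)" by (simp add: exp_add[symmetric] c_def algebra_simps)
    also have "B / m * exp (- (2 * m) * t) \<le> B / m * exp (- m * t)"
      using B m t by (intro mult_left_mono) (auto simp: mult_right_mono)
    finally show "norm (exp (- l * t) *\<^sub>R (integral {0..t} (\<lambda>s. exp (l * s) *\<^sub>R g s) - L)) \<le> B / m * exp (- m * t)"
      by (simp add: F_def)
  qed
qed

lemma Jint_has_derivative:
  assumes g: "continuous_on {0..} (\<lambda>s. nonlin p (v s) n)" and t: "0 \<le> t"
  shows "(Jint p v n has_vector_derivative exp (lam p n * t) *\<^sub>R nonlin p (v t) n) (at t within {0..})"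
proof -
  have "at t within {0..} = at t within {0..t+1}"
    using t by (intro time_dom_at_within[OF time_dom_atLeast]) auto
  then show ?thesis unfolding Jint_def using t
    by (auto intro!: integral_has_vector_derivative continuous_intros continuous_on_subset[OF g])
qed

lemma decaying_EB:
  assumes w: "submult_weight \<rho>" and v: "decaying p \<rho> M v" and M: "M \<le> 1" and p: "1 \<le> p" and t: "0 \<le> t"
  shows "EB \<rho> (M * exp (- mu p * t)) (v t)" "M * exp (- mu p * t) \<le> 1" "EB \<rho> M (v t)" "0 \<le> M"
proof -
  show e: "EB \<rho> (M * exp (- mu p * t)) (v t)" using v t by (auto simp: decaying_def)
  have "EB \<rho> (M * exp (- mu p * 0)) (v 0)" using v unfolding decaying_def by (metis order_refl)
  then show M0: "0 \<le> M" using EB_nonneg[OF w] by fastforce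
  have "exp (- mu p * t) \<le> 1" using t p by (simp add: mu_def mult_nonpos_nonneg)
  then have *: "M * exp (- mu p * t) \<le> M" using M0 by (rule mult_left_le)
  then show "M * exp (- mu p * t) \<le> 1" using M by linarith
  show "EB \<rho> M (v t)" using EB_mono[OF w e *] .
qed

lemma decaying_nonlin_continuous:
  assumes "submult_weight \<rho>" "decaying p \<rho> M v" "M \<le> 1" "1 \<le> p" "modes_continuous v"
  shows "continuous_on {0..} (\<lambda>s. nonlin p (v s) n)"
  using assms(5) by (intro nonlin_continuous_on[OF assms(1,3)] decaying_EB(3)[OF assms(1-4)])
    (auto simp: modes_continuous_def)

lemma LP_has_derivative:
  assumes v: "submult_weight \<rho>" "decaying p \<rho> M v" "M \<le> 1" "1 \<le> p" "modes_continuous v" and t: "0 \<le> t"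
  shows "((\<lambda>t. LP p \<beta> v t n) has_vector_derivative (- lam p n) *\<^sub>R LP p \<beta> v t n + nonlin p (v t) n) (at t within {0..})"
proof -
  note J = Jint_has_derivative[where p=p and v=v and n=n, OF decaying_nonlin_continuous[OF v] t]
  have e: "((\<lambda>t. exp (- lam p n * t)) has_real_derivative exp (- lam p n * t) * (- lam p n)) (at t within {0..})"
    by (auto intro!: derivative_eq_intros)
  have "((\<lambda>t. exp (- lam p n * t) *\<^sub>R (LPinit p \<beta> v n + Jint p v n t)) has_vector_derivative
     exp (- lam p n * t) *\<^sub>R (0 + exp (lam p n * t) *\<^sub>R nonlin p (v t) n) +
     (exp (- lam p n * t) * (- lam p n)) *\<^sub>R (LPinit p \<beta> v n + Jint p v n t)) (at t within {0..})"
    by (intro has_vector_derivative_scaleR has_vector_derivative_add has_vector_derivative_const J e)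
  moreover have "exp (- lam p n * t) * exp (lam p n * t) = 1" by (simp add: exp_add[symmetric])
  ultimately show ?thesis by (simp add: LP_def algebra_simps)
qed

lemma LP_modes_continuous:
  assumes v: "submult_weight \<rho>" "decaying p \<rho> M v" "M \<le> 1" "1 \<le> p" "modes_continuous v"
  shows "modes_continuous (LP p \<beta> v)"
  unfolding modes_continuous_def
proof
  fix n
  show "continuous_on {0..} (\<lambda>t. LP p \<beta> v t n)"
    by (rule continuous_on_vector_derivative) (rule LP_has_derivative[OF v], simp)
qed

text \<open>The remainder decays like e^(-2 \<mu> s): its Lipschitz constant and the distance of
  \<open>u s\<close> from 0 contribute e^(-\<mu> s) each.\<close>

lemma Jint_convergent:
  assumes W: "submult_weight \<rho>" and u: "decaying p \<rho> M u" and M: "M \<le> 1" and p: "1 \<le> p"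
    and cu: "modes_continuous u" and l: "lam p n < 0"
  shows "\<exists>L. (Jint p u n \<longlongrightarrow> L) at_top"
proof -
  obtain C where C: "C \<ge> 0" and NL: "\<And>\<rho> a b M d. submult_weight \<rho> \<Longrightarrow> M \<le> 1 \<Longrightarrow> EB \<rho> M a \<Longrightarrow> EB \<rho> M b \<Longrightarrow>
     EB \<rho> d (\<lambda>n. a n - b n) \<Longrightarrow> FB \<rho> (C * M * d) (\<lambda>n. nonlin p a n - nonlin p b n)"
    using nonlin_lipschitz[of p] by blast
  have M0: "0 \<le> M" using decaying_EB(4)[OF W u M p] by auto
  have mu: "0 < mu p" using p by (auto simp: mu_def)
  have b: "norm (nonlin p (u s) n) \<le> (C * M * M / \<rho> n) * exp (- (2 * mu p) * s)" if "0 \<le> s" for s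
  proof -
    have "EB \<rho> (M * exp (- mu p * s)) (\<lambda>n. 0)" using M0 by (intro EB_zero W) auto
    from NL[OF W decaying_EB(2)[OF W u M p that] decaying_EB(1)[OF W u M p that] this, of "M * exp (- mu p * s)"]
    have "norm (nonlin p (u s) n) \<le> C * (M * exp (- mu p * s)) * (M * exp (- mu p * s)) / \<rho> n"
      using decaying_EB(1)[OF W u M p that] by (simp add: nonlin_zero FB_def)
    also have "\<dots> = (C * M * M / \<rho> n) * (exp (- mu p * s) * exp (- mu p * s))" by simp
    also have "exp (- mu p * s) * exp (- mu p * s) = exp (- (2 * mu p) * s)" by (simp add: exp_add[symmetric])
    finally show ?thesis .
  qed
  show ?thesis
    using unstable_mode_bound[OF decaying_nonlin_continuous[OF W u M p cu] b mu l]
    unfolding Jint_def[abs_def] by blast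
qed

text \<open>The prescribed modes contribute \<eta>, since they are multiplied by
  \<open>1 + v 0 0\<close>, which differs for v and w. The integrals contribute a multiple of M.
  Division by \<lambda> takes the remainder from \<open>FB\<close> back to
  \<open>EB\<close>.\<close>

lemma LP_lipschitz:
  assumes p: "1 \<le> p"
  shows "\<exists>K\<ge>0. \<forall>\<rho> \<beta> \<eta> M v w d. submult_weight \<rho> \<and> M \<le> 1 \<and> EB \<rho> \<eta> \<beta> \<and> decaying p \<rho> M v \<and> decaying p \<rho> M w \<and>
     modes_continuous v \<and> modes_continuous w \<and> decaying p \<rho> d (\<lambda>\<tau> n. v \<tau> n - w \<tau> n) \<longrightarrow>
     decaying p \<rho> ((\<eta> + K * M) * d) (\<lambda>\<tau> n. LP p \<beta> v \<tau> n - LP p \<beta> w \<tau> n)"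
proof -
  obtain C where C: "C \<ge> 0" and NL: "\<And>\<rho> a b M d. submult_weight \<rho> \<Longrightarrow> M \<le> 1 \<Longrightarrow> EB \<rho> M a \<Longrightarrow> EB \<rho> M b \<Longrightarrow>
     EB \<rho> d (\<lambda>n. a n - b n) \<Longrightarrow> FB \<rho> (C * M * d) (\<lambda>n. nonlin p a n - nonlin p b n)"
    using nonlin_lipschitz[of p] by blast
  show ?thesis
  \<comment> \<open>5 is the factor 2 of \<open>stable_mode_bound\<close> times the 5/2 relating
    \<open>bra\<close> to \<open>lam\<close>. It also covers the unstable modes, where
    \<open>bra\<close> is at most 2.\<close>
  proof (intro exI[of _ "5 * C"] conjI allI impI)
    show "0 \<le> 5 * C" using C by simp
    fix \<rho> \<beta> \<eta> M v w d
    assume H: "submult_weight \<rho> \<and> M \<le> 1 \<and> EB \<rho> \<eta> \<beta> \<and> decaying p \<rho> M v \<and> decaying p \<rho> M w \<and>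
      modes_continuous v \<and> modes_continuous w \<and> decaying p \<rho> d (\<lambda>\<tau> n. v \<tau> n - w \<tau> n)"
    then have W: "submult_weight \<rho>" and M: "M \<le> 1" and \<beta>: "EB \<rho> \<eta> \<beta>" and v: "decaying p \<rho> M v" and w: "decaying p \<rho> M w"
      and cv: "modes_continuous v" and cw: "modes_continuous w" and d: "decaying p \<rho> d (\<lambda>\<tau> n. v \<tau> n - w \<tau> n)" by auto
    have M0: "0 \<le> M" using decaying_EB(4)[OF W v M p] by auto
    have \<eta>: "0 \<le> \<eta>" using EB_nonneg[OF W \<beta>] .
    have "EB \<rho> (d * exp (- mu p * 0)) (\<lambda>n. v 0 n - w 0 n)" using d unfolding decaying_def by (metis order_refl)
    then have ed: "EB \<rho> d (\<lambda>n. v 0 n - w 0 n)" by simp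
    have d0: "0 \<le> d" using EB_nonneg[OF W ed] .
    have mu: "0 < mu p" "1 \<le> mu p" using p by (auto simp: mu_def)
    show "decaying p \<rho> ((\<eta> + 5 * C * M) * d) (\<lambda>\<tau> n. LP p \<beta> v \<tau> n - LP p \<beta> w \<tau> n)"
      unfolding decaying_def EB_def
    proof (intro allI impI)
      fix \<tau> :: real and n assume \<tau>: "0 \<le> \<tau>"
      define g where "g = (\<lambda>s. nonlin p (v s) n - nonlin p (w s) n)"
      define B where "B = C * M * d / \<rho> n"
      have r: "0 < \<rho> n" using weight_pos[OF W] .
      have B0: "0 \<le> B" using C M0 d0 r by (simp add: B_def)
      note cgv = decaying_nonlin_continuous[OF W v M p cv, of n] and cgw = decaying_nonlin_continuous[OF W w M p cw, of n]
      have cg: "continuous_on {0..} g" unfolding g_def by (intro continuous_intros cgv cgw)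
      have gb: "norm (g s) \<le> B * exp (- (2 * mu p) * s)" if "0 \<le> s" for s
      proof -
        have "EB \<rho> (d * exp (- mu p * s)) (\<lambda>n. v s n - w s n)" using d that by (auto simp: decaying_def)
        from NL[OF W decaying_EB(2)[OF W v M p that] decaying_EB(1)[OF W v M p that] decaying_EB(1)[OF W w M p that] this]
        have "norm (g s) \<le> C * (M * exp (- mu p * s)) * (d * exp (- mu p * s)) / \<rho> n"
          by (auto simp: FB_def g_def)
        also have "\<dots> = B * (exp (- mu p * s) * exp (- mu p * s))" by (simp add: B_def)
        also have "exp (- mu p * s) * exp (- mu p * s) = exp (- (2 * mu p) * s)" by (simp add: exp_add[symmetric])
        finally show ?thesis .
      qed
      have Jd: "Jint p v n t - Jint p w n t = integral {0..t} (\<lambda>s. exp (lam p n * s) *\<^sub>R g s)" for t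
        unfolding Jint_def g_def scaleR_diff_right
        by (intro Henstock_Kurzweil_Integration.integral_diff[symmetric] integrable_continuous_real continuous_intros
            continuous_on_subset[OF cgv] continuous_on_subset[OF cgw]) auto
      show "norm (LP p \<beta> v \<tau> n - LP p \<beta> w \<tau> n) \<le> (\<eta> + 5 * C * M) * d * exp (- mu p * \<tau>) / (bra n * \<rho> n)"
      proof (cases "2 \<le> \<bar>n\<bar>")
        case True
        note l = lam_stable[OF p True]
        have "LP p \<beta> v \<tau> n - LP p \<beta> w \<tau> n = exp (- lam p n * \<tau>) *\<^sub>R ((v 0 0 - w 0 0) * \<beta> n) +
            exp (- lam p n * \<tau>) *\<^sub>R integral {0..\<tau>} (\<lambda>s. exp (lam p n * s) *\<^sub>R g s)"
          unfolding LP_def LPinit_def Jd[symmetric] using True by (simp add: algebra_simps)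
        moreover have "norm (exp (- lam p n * \<tau>) *\<^sub>R ((v 0 0 - w 0 0) * \<beta> n)) \<le> exp (- mu p * \<tau>) * (d * (\<eta> / (bra n * \<rho> n)))"
        proof -
          have "norm (v 0 0 - w 0 0) \<le> d / (bra 0 * \<rho> 0)" using ed by (auto simp: EB_def)
          also have "\<dots> \<le> d / 1"
            using d0 W by (intro divide_left_mono) (auto simp: bra_def submult_weight_def weight_pos)
          finally have "norm (v 0 0 - w 0 0) \<le> d" by simp
          moreover have "norm (\<beta> n) \<le> \<eta> / (bra n * \<rho> n)" using \<beta> by (auto simp: EB_def)
          moreover have "exp (- lam p n * \<tau>) \<le> exp (- mu p * \<tau>)" using l(1) \<tau> by (simp add: mult_right_mono)
          ultimately show ?thesis unfolding norm_scaleR norm_mult abs_exp_cancel by (intro mult_mono) (use d0 in auto)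
        qed
        moreover have "norm (exp (- lam p n * \<tau>) *\<^sub>R integral {0..\<tau>} (\<lambda>s. exp (lam p n * s) *\<^sub>R g s)) \<le> 2 * B / lam p n * exp (- mu p * \<tau>)"
          by (rule stable_mode_bound[OF cg gb mu(1) l(2) \<tau>])
        moreover have "2 * B / lam p n * exp (- mu p * \<tau>) \<le> 5 * B / bra n * exp (- mu p * \<tau>)"
        proof (rule mult_right_mono)
          have "2 * B * bra n \<le> 2 * B * (5/2 * lam p n)" using l(3) B0 by (intro mult_left_mono) auto
          then show "2 * B / lam p n \<le> 5 * B / bra n" using l(4) bra_pos[of n] by (simp add: field_simps)
        qed auto
        moreover have "exp (- mu p * \<tau>) * (d * (\<eta> / (bra n * \<rho> n))) + 5 * B / bra n * exp (- mu p * \<tau>)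
           = (\<eta> + 5 * C * M) * d * exp (- mu p * \<tau>) / (bra n * \<rho> n)"
          by (simp add: B_def add_divide_distrib algebra_simps)
        ultimately show ?thesis using norm_triangle_ineq by (smt (verit))
      next
        case False
        note l = lam_unstable[OF p False]
        obtain L where L: "((\<lambda>t. integral {0..t} (\<lambda>s. exp (lam p n * s) *\<^sub>R g s)) \<longlongrightarrow> L) at_top"
          "\<And>t. 0 \<le> t \<Longrightarrow> norm (exp (- lam p n * t) *\<^sub>R (integral {0..t} (\<lambda>s. exp (lam p n * s) *\<^sub>R g s) - L)) \<le> B / mu p * exp (- mu p * t)"
          using unstable_mode_bound[OF cg gb mu(1) l(1)] by blast
        note lim = Jint_convergent[OF W _ M p _ l(1)]
        obtain Lv where Lv: "(Jint p v n \<longlongrightarrow> Lv) at_top" using lim[OF v cv] by blast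
        obtain Lw where Lw: "(Jint p w n \<longlongrightarrow> Lw) at_top" using lim[OF w cw] by blast
        have "((\<lambda>t. Jint p v n t - Jint p w n t) \<longlongrightarrow> Lv - Lw) at_top" by (intro tendsto_diff Lv Lw)
        \<comment> \<open>The limits exist separately, so the \<open>Lim\<close> in
          \<open>LPinit\<close> is a genuine limit and the difference of initial values cancels the
          limit of the difference.\<close>
        then have "L = Lv - Lw" using L(1) unfolding Jd by (intro tendsto_unique[OF _ L(1)]) auto
        moreover have "Lim at_top (Jint p v n) = Lv" "Lim at_top (Jint p w n) = Lw"
          by (intro tendsto_Lim Lv Lw trivial_limit_at_top_linorder)+
        ultimately have "LP p \<beta> v \<tau> n - LP p \<beta> w \<tau> n = exp (- lam p n * \<tau>) *\<^sub>R (integral {0..\<tau>} (\<lambda>s. exp (lam p n * s) *\<^sub>R g s) - L)"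
          unfolding LP_def LPinit_def Jd[symmetric] using False
          by (simp add: scaleR_diff_right[symmetric] del: scaleR_diff_right)
        then have "norm (LP p \<beta> v \<tau> n - LP p \<beta> w \<tau> n) \<le> B / mu p * exp (- mu p * \<tau>)" using L(2)[OF \<tau>] by simp
        also have "\<dots> \<le> (\<eta> + 5 * C * M) * d / (bra n * \<rho> n) * exp (- mu p * \<tau>)"
        proof (rule mult_right_mono)
          have "B / mu p \<le> B / 1" using B0 mu by (intro divide_left_mono) auto
          also have "\<dots> \<le> (5 * C * M * d / \<rho> n) / bra n"
          proof -
            have "B * bra n \<le> B * 5" using B0 l(2) by (intro mult_left_mono) auto
            then have "B * bra n \<le> 5 * C * M * d / \<rho> n" by (simp add: B_def mult_ac)
            then show ?thesis unfolding pos_le_divide_eq[OF bra_pos] by simp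
          qed
          also have "\<dots> \<le> (\<eta> + 5 * C * M) * d / (bra n * \<rho> n)"
            using \<eta> d0 r by (simp add: algebra_simps add_divide_distrib divide_right_mono)
          finally show "B / mu p \<le> (\<eta> + 5 * C * M) * d / (bra n * \<rho> n)" .
        qed auto
        finally show ?thesis by simp
      qed
    qed
  qed
qed

lemma EB_const_le: "submult_weight \<rho> \<Longrightarrow> EB \<rho> A a \<Longrightarrow> EB (\<lambda>_. 1) A a"
  unfolding EB_def
proof
  fix n assume w: "submult_weight \<rho>" and a: "\<forall>n. norm (a n) \<le> A / (bra n * \<rho> n)"
  have "0 \<le> A" using EB_nonneg[OF w] a by (auto simp: EB_def)
  have "bra n * 1 \<le> bra n * \<rho> n" using w by (intro mult_left_mono) (auto simp: submult_weight_def less_imp_le)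
  then have "A / (bra n * \<rho> n) \<le> A / (bra n * 1)" using \<open>0 \<le> A\<close> weight_pos[OF w] by (intro divide_left_mono) auto
  then show "norm (a n) \<le> A / (bra n * 1)" using a by (meson order_trans)
qed

lemma weight_one: "submult_weight (\<lambda>_. 1)" by (simp add: submult_weight_def)

lemma Jint_cnj:
  assumes "\<And>s. 0 \<le> s \<Longrightarrow> cnj_sym (v s)"
  shows "Jint p v (- n) \<tau> = cnj (Jint p v n \<tau>)"
  unfolding Jint_def Henstock_Kurzweil_Integration.integral_cnj
proof (rule integral_cong)
  fix s assume "s \<in> {0..\<tau>}"
  then have "cnj_sym (nonlin p (v s))" using assms by (intro nonlin_cnj_sym) auto
  then show "exp (lam p (- n) * s) *\<^sub>R nonlin p (v s) (- n) = cnj (exp (lam p n * s) *\<^sub>R nonlin p (v s) n)"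
    by (simp add: cnj_sym_def)
qed

lemma LP_cnj_sym:
  assumes v: "submult_weight \<rho>" "decaying p \<rho> M v" "M \<le> 1" "1 \<le> p" "modes_continuous v"
    and sym: "\<And>s. 0 \<le> s \<Longrightarrow> cnj_sym (v s)" and \<beta>: "cnj_sym \<beta>"
  shows "cnj_sym (LP p \<beta> v \<tau>)"
proof -
  have "LPinit p \<beta> v (- n) = cnj (LPinit p \<beta> v n)" for n
  proof (cases "2 \<le> \<bar>n\<bar>")
    case True
    have "cnj (v 0 0) = v 0 0" using sym[of 0] unfolding cnj_sym_def by (metis minus_zero order_refl)
    then show ?thesis using True \<beta> by (simp add: LPinit_def cnj_sym_def)
  next
    case False
    obtain L where L: "(Jint p v n \<longlongrightarrow> L) at_top"
      using Jint_convergent[OF v lam_unstable(1)[OF v(4) False]] by blast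
    have "Jint p v (- n) = (\<lambda>t. cnj (Jint p v n t))" by (rule ext) (rule Jint_cnj[OF sym])
    then have "(Jint p v (- n) \<longlongrightarrow> cnj L) at_top" using tendsto_cnj[OF L] by simp
    then have "Lim at_top (Jint p v (- n)) = cnj (Lim at_top (Jint p v n))"
      using L by (simp add: tendsto_Lim trivial_limit_at_top_linorder)
    then show ?thesis using False by (simp add: LPinit_def)
  qed
  then show ?thesis by (simp add: cnj_sym_def LP_def Jint_cnj[OF sym])
qed

lemma LP_zero: "LP p \<beta> (\<lambda>\<tau> n. 0) \<tau> n = exp (- lam p n * \<tau>) *\<^sub>R (if 2 \<le> \<bar>n\<bar> then \<beta> n else 0)"
proof -
  have "Jint p (\<lambda>\<tau> n. 0) = (\<lambda>n t. 0)" by (intro ext) (simp add: Jint_def nonlin_zero)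
  then show ?thesis by (auto simp: LP_def LPinit_def tendsto_Lim)
qed

lemma LP_zero_decaying:
  assumes w: "submult_weight \<rho>" and p: "1 \<le> p" and \<beta>: "EB \<rho> \<eta> \<beta>"
  shows "decaying p \<rho> \<eta> (LP p \<beta> (\<lambda>\<tau> n. 0))"
  unfolding decaying_def EB_def
proof (intro allI impI)
  fix \<tau> :: real and n assume t: "0 \<le> \<tau>"
  have \<eta>: "0 \<le> \<eta>" using EB_nonneg[OF w \<beta>] .
  show "norm (LP p \<beta> (\<lambda>\<tau> n. 0) \<tau> n) \<le> \<eta> * exp (- mu p * \<tau>) / (bra n * \<rho> n)"
  proof (cases "2 \<le> \<bar>n\<bar>")
    case True
    have "exp (- lam p n * \<tau>) * norm (\<beta> n) \<le> exp (- mu p * \<tau>) * (\<eta> / (bra n * \<rho> n))"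
      using lam_stable(1)[OF p True] t \<beta> by (intro mult_mono) (auto simp: EB_def mult_right_mono)
    then show ?thesis using True by (simp add: LP_zero mult_ac)
  next
    case False
    then show ?thesis using \<eta> weight_pos[OF w, of n] by (simp add: LP_zero less_imp_le)
  qed
qed

section \<open>The weighted Banach space of mode families and the fixed point\<close>

type_synonym modes = "(int \<times> real) \<Rightarrow>\<^sub>C complex"

text \<open>Multiplying by the decay and dividing by the weight turns the sup norm into the norm
  behind \<open>decaying p \<rho>\<close>; completeness is inherited from the bounded continuous
  functions.\<close>

definition dec_modes :: "nat \<Rightarrow> (int \<Rightarrow> real) \<Rightarrow> modes \<Rightarrow> real \<Rightarrow> coeffs" where
  "dec_modes p \<rho> z \<tau> n = (exp (- mu p * \<tau>) / (bra n * \<rho> n)) *\<^sub>R apply_bcontfun z (n, \<tau>)"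

text \<open>Inverse of \<open>dec_modes\<close> on nonnegative times. The functions in
  \<open>modes\<close> live on the whole time axis, and \<open>max 0\<close> freezes a family at its
  initial value for negative times.\<close>

definition enc_modes :: "nat \<Rightarrow> (int \<Rightarrow> real) \<Rightarrow> (real \<Rightarrow> coeffs) \<Rightarrow> modes" where
  "enc_modes p \<rho> v = Bcontfun (\<lambda>x. (bra (fst x) * \<rho> (fst x) * exp (mu p * max 0 (snd x))) *\<^sub>R v (max 0 (snd x)) (fst x))"

lemma apply_enc_modes:
  assumes w: "submult_weight \<rho>" and v: "decaying p \<rho> M v" "modes_continuous v"
  shows "apply_bcontfun (enc_modes p \<rho> v) (n, \<tau>) = (bra n * \<rho> n * exp (mu p * max 0 \<tau>)) *\<^sub>R v (max 0 \<tau>) n"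
    and "norm (apply_bcontfun (enc_modes p \<rho> v) (n, \<tau>)) \<le> M"
proof -
  define f where "f x = (bra (fst x) * \<rho> (fst x) * exp (mu p * max 0 (snd x))) *\<^sub>R v (max 0 (snd x)) (fst x)" for x :: "int \<times> real"
  have b: "norm (f (n, \<tau>)) \<le> M" for n \<tau>
  proof -
    have r: "0 < bra n * \<rho> n" using weight_pos[OF w] by simp
    have "norm (v (max 0 \<tau>) n) \<le> M * exp (- mu p * max 0 \<tau>) / (bra n * \<rho> n)"
      using v(1) by (auto simp: decaying_def EB_def)
    then have "(bra n * \<rho> n * exp (mu p * max 0 \<tau>)) * norm (v (max 0 \<tau>) n) \<le>
        (bra n * \<rho> n * exp (mu p * max 0 \<tau>)) * (M * exp (- mu p * max 0 \<tau>) / (bra n * \<rho> n))"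
      using r by (intro mult_left_mono) auto
    also have "\<dots> = M * (exp (mu p * max 0 \<tau>) * exp (- mu p * max 0 \<tau>))" using r by (auto simp: field_simps)
    also have "\<dots> = M" by (simp add: exp_add[symmetric])
    finally show ?thesis using weight_pos[OF w, of n] by (simp add: f_def abs_mult)
  qed
  have "continuous_on (\<Union>n\<in>UNIV. {n} \<times> UNIV) f"
  proof (rule continuous_on_open_UN)
    fix n :: int
    have c: "continuous_on {0..} (\<lambda>\<tau>. v \<tau> n)" using v(2) by (auto simp: modes_continuous_def)
    have "continuous_on ({n} \<times> UNIV) (\<lambda>x::int\<times>real. (bra n * \<rho> n * exp (mu p * max 0 (snd x))) *\<^sub>R v (max 0 (snd x)) n)"
      by (intro continuous_intros continuous_on_compose2[OF c]) auto
    then show "continuous_on ({n} \<times> UNIV) f" by (rule continuous_on_eq) (auto simp: f_def)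
  qed (auto intro: open_Times open_discrete)
  moreover have "(\<Union>n\<in>UNIV. {n} \<times> UNIV) = (UNIV :: (int \<times> real) set)" by auto
  ultimately have "continuous_on UNIV f" by simp
  then have "f \<in> bcontfun" using b by (intro bcontfun_normI) auto
  then have *: "apply_bcontfun (enc_modes p \<rho> v) = f"
    unfolding enc_modes_def f_def by (rule Bcontfun_inverse)
  show "apply_bcontfun (enc_modes p \<rho> v) (n, \<tau>) = (bra n * \<rho> n * exp (mu p * max 0 \<tau>)) *\<^sub>R v (max 0 \<tau>) n"
    by (simp add: * f_def)
  show "norm (apply_bcontfun (enc_modes p \<rho> v) (n, \<tau>)) \<le> M" using b * by simp
qed

lemma dec_enc_modes:
  assumes w: "submult_weight \<rho>" and v: "decaying p \<rho> M v" "modes_continuous v" and t: "0 \<le> \<tau>"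
  shows "dec_modes p \<rho> (enc_modes p \<rho> v) \<tau> n = v \<tau> n"
proof -
  have "exp (- mu p * \<tau>) * exp (mu p * \<tau>) = 1" by (simp add: exp_add[symmetric])
  then show ?thesis using weight_pos[OF w, of n] bra_pos[of n] t
    by (simp add: dec_modes_def apply_enc_modes[OF w v])
qed

lemma dec_modes_decaying:
  assumes w: "submult_weight \<rho>"
  shows "decaying p \<rho> (dist z z') (\<lambda>\<tau> n. dec_modes p \<rho> z \<tau> n - dec_modes p \<rho> z' \<tau> n)"
  unfolding decaying_def EB_def
proof (intro allI impI)
  fix \<tau> :: real and n
  have r: "0 < bra n * \<rho> n" using weight_pos[OF w] by simp
  have "norm (apply_bcontfun z (n, \<tau>) - apply_bcontfun z' (n, \<tau>)) \<le> dist z z'"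
    using dist_bounded[of z "(n, \<tau>)" z'] by (simp add: dist_norm)
  then have "exp (- mu p * \<tau>) / (bra n * \<rho> n) * norm (apply_bcontfun z (n, \<tau>) - apply_bcontfun z' (n, \<tau>))
     \<le> exp (- mu p * \<tau>) / (bra n * \<rho> n) * dist z z'" using r by (intro mult_left_mono) auto
  then show "norm (dec_modes p \<rho> z \<tau> n - dec_modes p \<rho> z' \<tau> n) \<le> dist z z' * exp (- mu p * \<tau>) / (bra n * \<rho> n)"
    unfolding dec_modes_def scaleR_diff_right[symmetric] using r by (simp add: mult_ac)
qed

lemma dec_modes_continuous: "modes_continuous (dec_modes p \<rho> z)"
  unfolding modes_continuous_def dec_modes_def divide_inverse
  by (auto intro!: continuous_intros continuous_on_compose2[OF continuous_on_apply_bcontfun[of UNIV z]])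

lemma dec_modes_zero: "dec_modes p \<rho> 0 = (\<lambda>\<tau> n. 0)"
  by (simp add: dec_modes_def[abs_def])

text \<open>The library has this only for a metric domain, and \<^typ>\<open>int\<close> is not an instance.\<close>

lemma complete_UNIV_bcontfun: "complete (UNIV :: ('a::topological_space \<Rightarrow>\<^sub>C 'b::complete_space) set)"
  unfolding complete_def
proof (intro allI impI)
  fix f :: "nat \<Rightarrow> ('a \<Rightarrow>\<^sub>C 'b)" assume "(\<forall>n. f n \<in> UNIV) \<and> Cauchy f"
  then have "\<forall>e>0. \<exists>M. \<forall>m\<ge>M. \<forall>n\<ge>M. dist (f m) (f n) < e" by (simp add: Cauchy_def)
  then have "\<exists>g. \<forall>e>0. \<exists>N. \<forall>n x. N \<le> n \<and> True \<longrightarrow> dist (f n x) (g x) < e"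
    unfolding uniformly_convergent_eq_cauchy[of "\<lambda>_. True" f]
    using dist_fun_lt_imp_dist_val_lt by metis
  then obtain g where g: "\<forall>e>0. \<exists>N. \<forall>n x. N \<le> n \<and> True \<longrightarrow> dist (f n x) (g x) < e" by blast
  have "uniform_limit UNIV f g sequentially"
    unfolding uniform_limit_sequentially_iff using g by simp
  from uniform_limit_bcontfunE[OF this sequentially_bot]
  obtain l where "f \<longlonglongrightarrow> l" by metis
  then show "\<exists>l\<in>UNIV. f \<longlonglongrightarrow> l" by blast
qed

lemma zero_decaying: "submult_weight \<rho> \<Longrightarrow> 0 \<le> M \<Longrightarrow> decaying p \<rho> M (\<lambda>\<tau> n. 0)"
  unfolding decaying_def by (simp add: EB_zero)

text \<open>M and \<eta> do not depend on the weight. The fixed point for weight 1 is the one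
  returned; for every weight in which \<beta> is small a further one is constructed and identified
  with it by uniqueness in weight 1, so a single v has all the decay.\<close>

lemma LP_fixed_point:
  assumes p: "1 \<le> p" and M0: "0 < M0"
  shows "\<exists>M \<eta>. 0 < M \<and> M \<le> M0 \<and> 0 < \<eta> \<and> (\<forall>\<beta>. cnj_sym \<beta> \<and> EB (\<lambda>_. 1) \<eta> \<beta> \<longrightarrow>
    (\<exists>v. modes_continuous v \<and> (\<forall>\<tau>\<ge>0. cnj_sym (v \<tau>)) \<and> (\<forall>\<tau>\<ge>0. v \<tau> = LP p \<beta> v \<tau>) \<and>
      (\<forall>\<rho>. submult_weight \<rho> \<and> EB \<rho> \<eta> \<beta> \<longrightarrow> decaying p \<rho> M v)))"
proof -
  obtain K where K: "0 \<le> K" and lip: "\<And>\<rho> \<beta> \<eta> M v w d. submult_weight \<rho> \<Longrightarrow> M \<le> 1 \<Longrightarrow> EB \<rho> \<eta> \<beta> \<Longrightarrow>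
     decaying p \<rho> M v \<Longrightarrow> decaying p \<rho> M w \<Longrightarrow> modes_continuous v \<Longrightarrow> modes_continuous w \<Longrightarrow>
     decaying p \<rho> d (\<lambda>\<tau> n. v \<tau> n - w \<tau> n) \<Longrightarrow> decaying p \<rho> ((\<eta> + K * M) * d) (\<lambda>\<tau> n. LP p \<beta> v \<tau> n - LP p \<beta> w \<tau> n)"
    using LP_lipschitz[OF p] by blast
  \<comment> \<open>Small enough for K M at most 1/4; the 1 in the denominator covers K = 0.\<close>
  define M where "M = min M0 (min 1 (1 / (4 * K + 1)))"
  have M: "0 < M" "M \<le> 1" "M \<le> M0" using K M0 unfolding M_def by (simp, linarith, linarith)
  have "K * M \<le> K * (1 / (4 * K + 1))" using K by (intro mult_left_mono) (auto simp: M_def)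
  also have "\<dots> \<le> 1 / 4" using K by (simp add: field_simps)
  finally have KM: "K * M \<le> 1 / 4" .
  \<comment> \<open>Gives the contraction factor \<eta> + K M at most 1/2 and also M / 2 + \<eta> at
    most M, which maps the ball into itself.\<close>
  define \<eta> where "\<eta> = M / 4"
  have \<eta>: "0 < \<eta>" "\<eta> + K * M \<le> 1 / 2" using M KM by (auto simp: \<eta>_def)
  have decaying_mono: "decaying p \<rho> B v" if "submult_weight \<rho>" "decaying p \<rho> A v" "A \<le> B" for \<rho> A B v
    unfolding decaying_def
  proof (intro allI impI)
    fix \<tau> :: real assume "0 \<le> \<tau>"
    then have "EB \<rho> (A * exp (- mu p * \<tau>)) (v \<tau>)" using that(2) by (simp add: decaying_def)
    then show "EB \<rho> (B * exp (- mu p * \<tau>)) (v \<tau>)"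
      by (rule EB_mono[OF that(1)]) (use that(3) in \<open>auto simp: mult_right_mono\<close>)
  qed
  have contr: "decaying p \<rho> (d / 2) (\<lambda>\<tau> n. LP p \<beta> v \<tau> n - LP p \<beta> w \<tau> n)"
    if "submult_weight \<rho>" "EB \<rho> \<eta> \<beta>" "decaying p \<rho> M v" "decaying p \<rho> M w" "modes_continuous v" "modes_continuous w"
     "decaying p \<rho> d (\<lambda>\<tau> n. v \<tau> n - w \<tau> n)" for \<rho> \<beta> v w d
  proof (rule decaying_mono[OF that(1) lip[OF that(1) M(2) that(2-7)]])
    have "EB \<rho> (d * exp (- mu p * 0)) (\<lambda>n. v 0 n - w 0 n)" using that(7) unfolding decaying_def by (metis order_refl)
    then have "0 \<le> d" using EB_nonneg[OF that(1)] by fastforce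
    then show "(\<eta> + K * M) * d \<le> d / 2" using mult_right_mono[OF \<eta>(2)] by fastforce
  qed
  have self: "decaying p \<rho> M (LP p \<beta> v)"
    if "submult_weight \<rho>" "EB \<rho> \<eta> \<beta>" "decaying p \<rho> M v" "modes_continuous v" for \<rho> \<beta> v
  proof -
    have "decaying p \<rho> (M / 2) (\<lambda>\<tau> n. LP p \<beta> v \<tau> n - LP p \<beta> (\<lambda>\<tau> n. 0) \<tau> n)"
      by (rule contr[OF that(1-3) zero_decaying[OF that(1)] that(4)]) (use M that in \<open>auto simp: modes_continuous_def\<close>)
    moreover have "decaying p \<rho> \<eta> (LP p \<beta> (\<lambda>\<tau> n. 0))" by (rule LP_zero_decaying[OF that(1) p that(2)])
    ultimately have "EB \<rho> (M / 2 * exp (- mu p * \<tau>) + \<eta> * exp (- mu p * \<tau>)) (LP p \<beta> v \<tau>)" if "0 \<le> \<tau>" for \<tau>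
      using that EB_add unfolding decaying_def by fastforce
    then have "decaying p \<rho> (M / 2 + \<eta>) (LP p \<beta> v)" by (simp add: decaying_def distrib_right)
    then show ?thesis by (rule decaying_mono[OF that(1)]) (use M in \<open>auto simp: \<eta>_def\<close>)
  qed
  have ex: "\<exists>v. modes_continuous v \<and> (\<forall>\<tau>\<ge>0. cnj_sym (v \<tau>)) \<and> (\<forall>\<tau>\<ge>0. v \<tau> = LP p \<beta> v \<tau>) \<and> decaying p \<rho> M v"
    if w: "submult_weight \<rho>" and \<beta>: "EB \<rho> \<eta> \<beta>" "cnj_sym \<beta>" for \<rho> \<beta>
  proof -
    define S where "S = {z::modes. norm z \<le> M \<and> (\<forall>n \<tau>. apply_bcontfun z (- n, \<tau>) = cnj (apply_bcontfun z (n, \<tau>)))}"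
    have ev: "continuous_on UNIV (\<lambda>z::modes. apply_bcontfun z x)" for x
      by (rule continuous_at_imp_continuous_on)
        (auto simp: continuous_at_eps_delta intro: le_less_trans[OF dist_bounded])
    have "S = cball 0 M \<inter> (\<Inter>n. \<Inter>\<tau>. {z. apply_bcontfun z (- n, \<tau>) = cnj (apply_bcontfun z (n, \<tau>))})"
      by (auto simp: S_def dist_norm)
    then have "closed S" by (auto intro!: closed_Int closed_INT closed_Collect_eq ev continuous_on_cnj)
    then have cS: "complete S" using complete_closed_subset[OF _ subset_UNIV complete_UNIV_bcontfun] by blast
    have dec: "decaying p \<rho> M (dec_modes p \<rho> z)" if "z \<in> S" for z
    proof -
      have "decaying p \<rho> (dist z 0) (\<lambda>\<tau> n. dec_modes p \<rho> z \<tau> n - dec_modes p \<rho> 0 \<tau> n)"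
        by (rule dec_modes_decaying[OF w])
      then have "decaying p \<rho> (norm z) (dec_modes p \<rho> z)" by (simp add: dec_modes_zero)
      then show ?thesis by (rule decaying_mono[OF w]) (use that in \<open>auto simp: S_def\<close>)
    qed
    note cont = dec_modes_continuous[of p \<rho>]
    have sym: "cnj_sym (dec_modes p \<rho> z \<tau>)" if "z \<in> S" for z \<tau>
      using that w by (auto simp: S_def cnj_sym_def dec_modes_def submult_weight_def)
    define \<Phi> where "\<Phi> z = enc_modes p \<rho> (LP p \<beta> (dec_modes p \<rho> z))" for z
    note LPd = self[OF w \<beta>(1) dec cont] and LPc = LP_modes_continuous[OF w dec M(2) p cont]
    have 1: "\<Phi> ` S \<subseteq> S"
    proof
      fix y assume "y \<in> \<Phi> ` S"
      then obtain z where z: "z \<in> S" "y = \<Phi> z" by blast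
      note a = apply_enc_modes[OF w LPd[OF z(1)] LPc[OF z(1)]]
      have "norm y \<le> M" unfolding z(2) \<Phi>_def by (rule norm_bound) (use a(2) in auto)
      moreover have "cnj_sym (LP p \<beta> (dec_modes p \<rho> z) t)" for t
        by (rule LP_cnj_sym[OF w dec[OF z(1)] M(2) p cont sym[OF z(1)] \<beta>(2)])
      ultimately show "y \<in> S" unfolding S_def z(2) \<Phi>_def using w
        by (auto simp: a(1) cnj_sym_def submult_weight_def)
    qed
    have 2: "dist (\<Phi> z) (\<Phi> z') \<le> 1/2 * dist z z'" if z: "z \<in> S" "z' \<in> S" for z z'
    proof (rule dist_bound)
      fix x :: "int \<times> real"
      obtain n \<tau> where x: "x = (n, \<tau>)" by (cases x)
      note a = apply_enc_modes(1)[OF w LPd LPc]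
      have d: "decaying p \<rho> (dist z z' / 2) (\<lambda>\<tau> n. LP p \<beta> (dec_modes p \<rho> z) \<tau> n - LP p \<beta> (dec_modes p \<rho> z') \<tau> n)"
        by (rule contr[OF w \<beta>(1) dec[OF z(1)] dec[OF z(2)] cont cont dec_modes_decaying[OF w]])
      have c: "modes_continuous (\<lambda>\<tau> n. LP p \<beta> (dec_modes p \<rho> z) \<tau> n - LP p \<beta> (dec_modes p \<rho> z') \<tau> n)"
        using LPc[OF z(1)] LPc[OF z(2)] unfolding modes_continuous_def by (auto intro!: continuous_intros)
      show "dist (apply_bcontfun (\<Phi> z) x) (apply_bcontfun (\<Phi> z') x) \<le> 1/2 * dist z z'"
        using apply_enc_modes(2)[OF w d c, of n \<tau>]
        unfolding x \<Phi>_def dist_norm a[OF z(1) z(1)] a[OF z(2) z(2)] apply_enc_modes(1)[OF w d c]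
        by (simp add: scaleR_diff_right)
    qed
    have "0 \<in> S" using M by (auto simp: S_def)
    then obtain z where z: "z \<in> S" "\<Phi> z = z"
      using Banach_fix[OF cS _ _ _ 1, of "1/2"] 2 by auto
    have fixp: "dec_modes p \<rho> z \<tau> = LP p \<beta> (dec_modes p \<rho> z) \<tau>" if "0 \<le> \<tau>" for \<tau>
      using dec_enc_modes[OF w LPd[OF z(1)] LPc[OF z(1)] that] z(2) unfolding \<Phi>_def by auto
    show ?thesis by (intro exI[of _ "dec_modes p \<rho> z"] conjI allI impI cont sym[OF z(1)] fixp dec[OF z(1)])
  qed
  have unique: "v \<tau> = w \<tau>"
    if \<beta>: "EB (\<lambda>_. 1) \<eta> \<beta>" and v: "modes_continuous v" "\<forall>\<tau>\<ge>0. v \<tau> = LP p \<beta> v \<tau>" "decaying p (\<lambda>_. 1) M v"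
    and w: "modes_continuous w" "\<forall>\<tau>\<ge>0. w \<tau> = LP p \<beta> w \<tau>" "decaying p (\<lambda>_. 1) M w" and \<tau>: "0 \<le> \<tau>" for \<beta> v w \<tau>
  proof -
    \<comment> \<open>Each application of the contraction halves the distance of the two fixed
      points, starting from 2 M.\<close>
    have k: "decaying p (\<lambda>_. 1) (2 * M / 2 ^ k) (\<lambda>\<tau> n. v \<tau> n - w \<tau> n)" for k
    proof (induction k)
      case 0
      have "norm (v t n - w t n) \<le> 2 * (M * exp (- mu p * t) / (bra n * 1))" if "0 \<le> t" for t n
        using v(3) w(3) that norm_triangle_ineq4[of "v t n" "w t n"] unfolding decaying_def EB_def by (smt (verit))
      then show ?case by (simp add: decaying_def EB_def mult_ac)
    next
      case (Suc k)
      have "decaying p (\<lambda>_. 1) (2 * M / 2 ^ k / 2) (\<lambda>\<tau> n. LP p \<beta> v \<tau> n - LP p \<beta> w \<tau> n)"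
        by (rule contr[OF weight_one \<beta> v(3) w(3) v(1) w(1) Suc])
      then show ?case using v(2) w(2) by (simp add: decaying_def)
    qed
    have "v \<tau> n = w \<tau> n" for n
    proof -
      have le: "norm (v \<tau> n - w \<tau> n) \<le> 2 * M * exp (- mu p * \<tau>) / bra n * (1 / 2) ^ k" for k
        using k[of k] \<tau> by (simp add: decaying_def EB_def power_divide field_simps)
      have "(\<lambda>k. 2 * M * exp (- mu p * \<tau>) / bra n * (1 / 2) ^ k) \<longlonglongrightarrow> 2 * M * exp (- mu p * \<tau>) / bra n * 0"
        by (intro tendsto_mult tendsto_const LIMSEQ_realpow_zero) auto
      then have "norm (v \<tau> n - w \<tau> n) \<le> 2 * M * exp (- mu p * \<tau>) / bra n * 0"
        by (rule LIMSEQ_le_const) (use le in blast)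
      then show ?thesis by simp
    qed
    then show ?thesis by blast
  qed
  have to_one: "decaying p (\<lambda>_. 1) M v" if "submult_weight \<rho>" "decaying p \<rho> M v" for \<rho> v
    using that EB_const_le unfolding decaying_def by blast
  show ?thesis
  proof (rule exI[of _ M], rule exI[of _ \<eta>], intro conjI allI impI)
    fix \<beta> assume \<beta>: "cnj_sym \<beta> \<and> EB (\<lambda>_. 1) \<eta> \<beta>"
    then obtain v where v: "modes_continuous v" "\<forall>\<tau>\<ge>0. cnj_sym (v \<tau>)" "\<forall>\<tau>\<ge>0. v \<tau> = LP p \<beta> v \<tau>" "decaying p (\<lambda>_. 1) M v"
      using ex[OF weight_one, of \<beta>] by blast
    have "decaying p \<rho> M v" if r: "submult_weight \<rho>" "EB \<rho> \<eta> \<beta>" for \<rho>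
    proof -
      obtain w where w: "modes_continuous w" "\<forall>\<tau>\<ge>0. w \<tau> = LP p \<beta> w \<tau>" "decaying p \<rho> M w"
        using ex[OF r] \<beta> by blast
      have "v \<tau> = w \<tau>" if "0 \<le> \<tau>" for \<tau>
        using unique[OF _ v(1,3,4) w(1,2) to_one[OF r(1) w(3)] that] \<beta> by blast
      then show ?thesis using w(3) by (simp add: decaying_def)
    qed
    then show "\<exists>v. modes_continuous v \<and> (\<forall>\<tau>\<ge>0. cnj_sym (v \<tau>)) \<and> (\<forall>\<tau>\<ge>0. v \<tau> = LP p \<beta> v \<tau>) \<and>
      (\<forall>\<rho>. submult_weight \<rho> \<and> EB \<rho> \<eta> \<beta> \<longrightarrow> decaying p \<rho> M v)" using v by blast
  qed (use M \<eta> in auto)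
qed

section \<open>Fourier series\<close>

text \<open>Termwise differentiation for series over the naturals, transported along the bijection
  \<open>int_decode\<close>; absolute summability makes the order irrelevant.\<close>

lemma has_field_derivative_infsum_int:
  fixes f :: "int \<Rightarrow> real \<Rightarrow> real"
  assumes S: "convex S" "x \<in> S" and d: "\<And>n x. x \<in> S \<Longrightarrow> (f n has_real_derivative f' n x) (at x within S)"
    and M: "\<And>n x. x \<in> S \<Longrightarrow> \<bar>f' n x\<bar> \<le> M n" "M summable_on UNIV"
    and s: "\<And>x. x \<in> S \<Longrightarrow> (\<lambda>n. f n x) summable_on UNIV"
  shows "((\<lambda>x. \<Sum>\<^sub>\<infinity>n. f n x) has_real_derivative (\<Sum>\<^sub>\<infinity>n. f' n x)) (at x within S)"
proof -
  have e: "bij_betw int_decode UNIV UNIV" using bij_int_decode by simp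
  have M': "(\<lambda>k. M (int_decode k)) summable_on UNIV"
    using summable_on_reindex_bij_betw[OF e, of M] M(2) by simp
  have sums: "(\<lambda>k. g (int_decode k)) sums (\<Sum>\<^sub>\<infinity>n. g n)" if "g summable_on UNIV" for g :: "int \<Rightarrow> real"
  proof -
    have "((\<lambda>k. g (int_decode k)) has_sum (\<Sum>\<^sub>\<infinity>n. g n)) UNIV"
      using has_sum_infsum[OF that] has_sum_reindex_bij_betw[OF e, of g] by simp
    then show ?thesis by (rule has_sum_imp_sums)
  qed
  have s': "(\<lambda>n. f' n y) summable_on UNIV" if "y \<in> S" for y
    by (rule infsum_dominated(2)[OF _ M(2)]) (use M(1) that in auto)
  have "uniform_limit S (\<lambda>k x. \<Sum>i<k. f' (int_decode i) x) (\<lambda>x. \<Sum>i. f' (int_decode i) x) sequentially"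
    by (rule Weierstrass_m_test[where M="\<lambda>k. M (int_decode k)"])
      (use M(1) summable_on_imp_summable[OF M'] in auto)
  then have ul: "uniform_limit S (\<lambda>k x. \<Sum>i<k. f' (int_decode i) x) (\<lambda>x. \<Sum>\<^sub>\<infinity>n. f' n x) sequentially"
    by (rule uniform_limit_cong'[THEN iffD1, rotated 2]) (use sums[OF s'] in \<open>auto simp: sums_iff\<close>)
  obtain g where g: "\<forall>x\<in>S. (\<lambda>k. f (int_decode k) x) sums g x \<and> (g has_real_derivative (\<Sum>\<^sub>\<infinity>n. f' n x)) (at x within S)"
    using has_field_derivative_series[of S "\<lambda>k. f (int_decode k)" "\<lambda>k. f' (int_decode k)", OF S(1) d ul S(2)]
      sums[OF s[OF S(2)]] by (auto simp: sums_iff)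
  have eq: "g y = (\<Sum>\<^sub>\<infinity>n. f n y)" if "y \<in> S" for y
    using g that sums[OF s[OF that]] sums_unique2 by blast
  have "(g has_real_derivative (\<Sum>\<^sub>\<infinity>n. f' n x)) (at x within S)" using g S(2) by blast
  then show ?thesis
    by (rule has_field_derivative_transform_within[of g _ x S 1]) (use S eq in auto)
qed

definition rapid1 :: "coeffs \<Rightarrow> bool" where
  "rapid1 c \<longleftrightarrow> (\<forall>j. \<exists>A. \<forall>n. \<bar>of_int n\<bar> ^ j * norm (c n) \<le> A / bra n)"

definition rapid :: "(real \<Rightarrow> coeffs) \<Rightarrow> bool" where
  "rapid a \<longleftrightarrow> (\<forall>j. \<exists>A. \<forall>\<tau>\<ge>0. \<forall>n. \<bar>of_int n\<bar> ^ j * norm (a \<tau> n) \<le> A / bra n)"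

text \<open>The n-th term of the j-th derivative of the Fourier series. The real part makes the sum
  a real function for every c; under \<open>cnj_sym\<close> it is the full sum, see
  \<open>cser_real\<close>.\<close>

definition ser_term :: "coeffs \<Rightarrow> nat \<Rightarrow> int \<Rightarrow> real \<Rightarrow> real" where
  "ser_term c j n \<theta> = Re ((\<i> * of_int n) ^ j * c n * cis (of_int n * \<theta>))"

definition ser :: "coeffs \<Rightarrow> nat \<Rightarrow> real \<Rightarrow> real" where
  "ser c j \<theta> = (\<Sum>\<^sub>\<infinity>n. ser_term c j n \<theta>)"

lemma rapid_rapid1: "rapid a \<Longrightarrow> 0 \<le> \<tau> \<Longrightarrow> rapid1 (a \<tau>)"
  unfolding rapid_def rapid1_def by blast

lemma ser_term_bound: "\<bar>ser_term c j n \<theta>\<bar> \<le> \<bar>of_int n\<bar> ^ j * norm (c n)"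
proof -
  have "\<bar>ser_term c j n \<theta>\<bar> \<le> norm ((\<i> * of_int n) ^ j * c n * cis (of_int n * \<theta>))"
    unfolding ser_term_def by (rule abs_Re_le_cmod)
  also have "\<dots> = \<bar>of_int n\<bar> ^ j * norm (c n)" by (simp add: norm_mult norm_power)
  finally show ?thesis .
qed

lemma bra_summable_mult: "(\<lambda>n. A / bra n) summable_on UNIV"
  using summable_on_cmult_right[OF bra_summable, of A] by simp

lemma bra_infsum_mult: "(\<Sum>\<^sub>\<infinity>n. A / bra n) = A * S0"
  using infsum_cmult_right[OF bra_summable, of A] by (simp add: S0_def)

lemma ser_summable:
  assumes "rapid1 c" shows "(\<lambda>n. ser_term c j n \<theta>) summable_on UNIV"
proof -
  obtain A where "\<And>n. \<bar>of_int n\<bar> ^ j * norm (c n) \<le> A / bra n"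
    using assms unfolding rapid1_def by blast
  then have "norm (ser_term c j n \<theta>) \<le> A / bra n" for n
    unfolding real_norm_def by (rule order_trans[OF ser_term_bound])
  then show ?thesis by (rule infsum_dominated(2)[OF _ bra_summable_mult])
qed

lemma ser_bound:
  assumes "\<And>n. \<bar>of_int n\<bar> ^ j * norm (c n) \<le> A / bra n"
  shows "\<bar>ser c j \<theta>\<bar> \<le> A * S0"
proof -
  have "norm (ser_term c j n \<theta>) \<le> A / bra n" for n
    unfolding real_norm_def by (rule order_trans[OF ser_term_bound assms])
  from infsum_dominated(3)[OF this bra_summable_mult] show ?thesis by (simp add: ser_def bra_infsum_mult)
qed

lemma ser_term_DERIV: "(ser_term c j n has_real_derivative ser_term c (Suc j) n \<theta>) (at \<theta>)"
proof -
  have "ser_term c j n = (\<lambda>\<theta>. Re ((\<i> * of_int n) ^ j * c n) * cos (real_of_int n * \<theta>)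
     - Im ((\<i> * of_int n) ^ j * c n) * sin (real_of_int n * \<theta>))"
    by (rule ext) (simp add: ser_term_def)
  moreover have "ser_term c (Suc j) n \<theta> = Re (\<i> * of_int n * ((\<i> * of_int n) ^ j * c n) * cis (of_int n * \<theta>))"
    by (simp add: ser_term_def mult_ac)
  ultimately show ?thesis
    by (auto intro!: derivative_eq_intros simp: algebra_simps)
qed

lemma ser_DERIV:
  assumes "rapid1 c" shows "(ser c j has_real_derivative ser c (Suc j) \<theta>) (at \<theta>)"
proof -
  obtain A where A: "\<And>n. \<bar>real_of_int n\<bar> ^ Suc j * norm (c n) \<le> A / bra n"
    using assms unfolding rapid1_def by blast
  have "((\<lambda>\<theta>. \<Sum>\<^sub>\<infinity>n. ser_term c j n \<theta>) has_real_derivative (\<Sum>\<^sub>\<infinity>n. ser_term c (Suc j) n \<theta>)) (at \<theta> within UNIV)"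
  proof (rule has_field_derivative_infsum_int[where M="\<lambda>n. A / bra n"])
    show "\<bar>ser_term c (Suc j) n x\<bar> \<le> A / bra n" for n x
      using order_trans[OF ser_term_bound A] .
  qed (auto intro: ser_summable assms ser_term_DERIV bra_summable_mult)
  then show ?thesis unfolding ser_def[abs_def] by simp
qed

lemma ser_cont2:
  assumes r: "rapid a" and c: "modes_continuous a"
  shows "cont2 {0..} (\<lambda>\<tau>. ser (a \<tau>) j)"
proof -
  obtain A where A: "\<And>\<tau> n. 0 \<le> \<tau> \<Longrightarrow> \<bar>of_int n\<bar> ^ j * norm (a \<tau> n) \<le> A / bra n"
    using r unfolding rapid_def by blast
  have c': "continuous_on ({0..} \<times> UNIV) (\<lambda>z::real\<times>real. a (fst z) n)" for n
    by (rule continuous_on_compose2[of "{0..}" "\<lambda>\<tau>. a \<tau> n"])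
      (use c in \<open>auto simp: modes_continuous_def intro!: continuous_intros\<close>)
  show ?thesis unfolding cont2_def ser_def
  proof (rule infsum_continuous_on[where M="\<lambda>n. A / bra n"])
    fix n and z :: "real \<times> real" assume "z \<in> {0..} \<times> UNIV"
    then show "norm (ser_term (a (fst z)) j n (snd z)) \<le> A / bra n"
      using order_trans[OF ser_term_bound[of "a (fst z)" j n "snd z"] A] by auto
  next
    fix n
    show "continuous_on ({0..} \<times> UNIV) (\<lambda>z. ser_term (a (fst z)) j n (snd z))"
      unfolding ser_term_def by (intro continuous_intros c' continuous_on_compose2[OF continuous_on_cis]) auto
  qed (rule bra_summable_mult)
qed

lemma ser_DERIV_time:
  assumes r: "rapid a" "rapid b" and t: "0 \<le> \<tau>"
    and d: "\<And>\<tau> n. 0 \<le> \<tau> \<Longrightarrow> ((\<lambda>\<tau>. a \<tau> n) has_vector_derivative b \<tau> n) (at \<tau> within {0..})"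
  shows "((\<lambda>\<tau>. ser (a \<tau>) j \<theta>) has_real_derivative ser (b \<tau>) j \<theta>) (at \<tau> within {0..})"
proof -
  obtain A where A: "\<And>\<tau> n. 0 \<le> \<tau> \<Longrightarrow> \<bar>of_int n\<bar> ^ j * norm (b \<tau> n) \<le> A / bra n"
    using r(2) unfolding rapid_def by blast
  show ?thesis unfolding ser_def
  proof (rule has_field_derivative_infsum_int[where M="\<lambda>n. A / bra n"])
    fix n x assume x: "x \<in> {0::real..}"
    show "\<bar>ser_term (b x) j n \<theta>\<bar> \<le> A / bra n"
      using order_trans[OF ser_term_bound[of "b x" j n \<theta>] A] x by auto
    show "((\<lambda>\<tau>. ser_term (a \<tau>) j n \<theta>) has_real_derivative ser_term (b x) j n \<theta>) (at x within {0..})"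
      unfolding ser_term_def real_derivative_vector
      by (rule bounded_linear.has_vector_derivative[OF bounded_linear_Re
          has_vector_derivative_mult_left[OF has_vector_derivative_mult_right[OF d]]]) (use x in auto)
  qed (use t in \<open>auto intro: ser_summable rapid_rapid1 r bra_summable_mult\<close>)
qed

lemma ser_periodic: "ser c j (\<theta> + 2 * pi) = ser c j \<theta>"
proof -
  have "cis (of_int n * (\<theta> + 2 * pi)) = cis (of_int n * \<theta>)" for n
  proof -
    have "cis (of_int n * (\<theta> + 2 * pi)) = cis (of_int n * \<theta>) * cis (2 * pi * real_of_int n)"
      by (simp add: cis_mult algebra_simps)
    then show ?thesis by (simp add: cis_multiple_2pi)
  qed
  then show ?thesis unfolding ser_def ser_term_def by (simp only:)
qed

section \<open>Products of Fourier series\<close>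

definition cser :: "coeffs \<Rightarrow> real \<Rightarrow> complex" where
  "cser c \<theta> = (\<Sum>\<^sub>\<infinity>n. c n * cis (of_int n * \<theta>))"

lemma cser_summable:
  assumes "(\<lambda>n. norm (c n)) summable_on UNIV"
  shows "(\<lambda>n. norm (c n * cis (of_int n * \<theta>))) summable_on UNIV" "(\<lambda>n. c n * cis (of_int n * \<theta>)) summable_on UNIV"
  using infsum_dominated(1,2)[OF _ assms, of "\<lambda>n. c n * cis (of_int n * \<theta>)"] by (auto simp: norm_mult)

text \<open>Cauchy product: the double series of products is absolutely summable after the shift of
  n by m, so the two summations may be exchanged.\<close>

lemma cser_conv:
  assumes c: "(\<lambda>n. norm (c n)) summable_on UNIV" and d: "(\<lambda>n. norm (d n)) summable_on UNIV"
  shows "cser (conv c d) \<theta> = cser c \<theta> * cser d \<theta>"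
proof -
  define C where "C n = c n * cis (of_int n * \<theta>)" for n
  define D where "D n = d n * cis (of_int n * \<theta>)" for n
  have C: "(\<lambda>n. norm (C n)) summable_on UNIV" "C summable_on UNIV" using cser_summable[OF c] by (simp_all add: C_def[abs_def])
  have D: "(\<lambda>n. norm (D n)) summable_on UNIV" "D summable_on UNIV" using cser_summable[OF d] by (simp_all add: D_def[abs_def])
  have bij: "bij_betw (\<lambda>n. n - m) UNIV UNIV" for m :: int
    by (rule bij_betwI[where g="\<lambda>n. n + m"]) auto
  have Dm: "(\<lambda>n. norm (D (n - m))) summable_on UNIV" "(\<Sum>\<^sub>\<infinity>n. norm (D (n - m))) = (\<Sum>\<^sub>\<infinity>n. norm (D n))"
     "(\<lambda>n. D (n - m)) summable_on UNIV" "(\<Sum>\<^sub>\<infinity>n. D (n - m)) = (\<Sum>\<^sub>\<infinity>n. D n)" for m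
    using summable_on_reindex_bij_betw[OF bij, of "\<lambda>n. norm (D n)" m] infsum_reindex_bij_betw[OF bij, of "\<lambda>n. norm (D n)" m]
      summable_on_reindex_bij_betw[OF bij, of D m] infsum_reindex_bij_betw[OF bij, of D m] D by auto
  have sum2: "(\<lambda>(m, n). C m * D (n - m)) summable_on (UNIV \<times> UNIV)"
  proof (rule abs_summable_summable)
    have 1: "(\<lambda>n. norm (C m * D (n - m))) summable_on UNIV" for m
      unfolding norm_mult by (intro summable_on_cmult_right Dm)
    have "(\<Sum>\<^sub>\<infinity>n. norm (C m * D (n - m))) = norm (C m) * (\<Sum>\<^sub>\<infinity>n. norm (D n))" for m
      unfolding norm_mult Dm(2)[of m, symmetric] by (intro infsum_cmult_right Dm)
    then have 2: "(\<lambda>m. norm (\<Sum>\<^sub>\<infinity>n. norm (C m * D (n - m)))) summable_on UNIV"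
      using summable_on_cmult_left[OF C(1), of "\<Sum>\<^sub>\<infinity>n. norm (D n)"]
      by (simp add: abs_mult infsum_nonneg)
    show "(\<lambda>x. norm (case x of (m, n) \<Rightarrow> C m * D (n - m))) summable_on UNIV \<times> UNIV"
      using Infinite_Sum.abs_summable_on_Sigma_iff[of "\<lambda>(m, n). C m * D (n - m)" UNIV "\<lambda>_. UNIV"] 1 2 by simp
  qed
  have "cser c \<theta> * cser d \<theta> = (\<Sum>\<^sub>\<infinity>m. C m * (\<Sum>\<^sub>\<infinity>n. D n))"
    unfolding cser_def C_def[symmetric] D_def[symmetric] by (rule infsum_cmult_left[symmetric]) (rule C)
  also have "\<dots> = (\<Sum>\<^sub>\<infinity>m. \<Sum>\<^sub>\<infinity>n. C m * D (n - m))"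
    by (intro infsum_cong) (simp only: infsum_cmult_right' Dm(4))
  also have "\<dots> = (\<Sum>\<^sub>\<infinity>n. \<Sum>\<^sub>\<infinity>m. C m * D (n - m))"
    by (rule infsum_swap_banach) (rule sum2)
  also have "\<dots> = cser (conv c d) \<theta>" unfolding cser_def
  proof (rule infsum_cong)
    fix n
    have *: "C m * D (n - m) = c m * d (n - m) * cis (of_int n * \<theta>)" for m
    proof -
      have "real_of_int n * \<theta> = real_of_int m * \<theta> + real_of_int (n - m) * \<theta>" by (simp add: algebra_simps)
      then show ?thesis by (simp only: C_def D_def cis_mult[symmetric] mult_ac)
    qed
    show "(\<Sum>\<^sub>\<infinity>m. C m * D (n - m)) = conv c d n * cis (of_int n * \<theta>)"
      unfolding * conv_def by (rule infsum_cmult_left')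
  qed
  finally show ?thesis ..
qed

lemma ser_Re_cser:
  assumes "(\<lambda>n. norm (c n)) summable_on UNIV"
  shows "ser c 0 \<theta> = Re (cser c \<theta>)"
  unfolding ser_def cser_def ser_term_def using infsum_Re[OF cser_summable(2)[OF assms]] by simp

lemma cser_real:
  assumes "(\<lambda>n. norm (c n)) summable_on UNIV" "cnj_sym c"
  shows "Im (cser c \<theta>) = 0"
proof -
  have "cser c \<theta> = (\<Sum>\<^sub>\<infinity>n. c (- n) * cis (of_int (- n) * \<theta>))"
    unfolding cser_def by (rule infsum_reindex_bij_betw[OF bij_uminus_int, symmetric])
  also have "\<dots> = (\<Sum>\<^sub>\<infinity>n. cnj (c n * cis (of_int n * \<theta>)))"
    using assms(2) by (intro infsum_cong) (simp add: cnj_sym_def cis_cnj)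
  also have "\<dots> = cnj (cser c \<theta>)" by (simp only: cser_def infsum_cnj)
  finally have "Im (cser c \<theta>) = Im (cnj (cser c \<theta>))" by simp
  then show ?thesis by simp
qed

lemma rapid1_summable:
  assumes "rapid1 c" shows "(\<lambda>n. norm (c n)) summable_on UNIV"
proof -
  obtain A where "\<And>n. \<bar>real_of_int n\<bar> ^ 0 * norm (c n) \<le> A / bra n"
    using assms unfolding rapid1_def by blast
  then show ?thesis by (intro infsum_dominated(1)[OF _ bra_summable_mult, of c A]) auto
qed

lemma ser_conv:
  assumes "rapid1 c" "rapid1 d" "cnj_sym c" "cnj_sym d" "rapid1 (conv c d)"
  shows "ser (conv c d) 0 \<theta> = ser c 0 \<theta> * ser d 0 \<theta>"
  using assms by (simp add: ser_Re_cser rapid1_summable cser_conv cser_real)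

lemma ser_D2: "ser (D2 c) j \<theta> = ser c (Suc (Suc j)) \<theta>"
  unfolding ser_def ser_term_def D2_def
  by (intro infsum_cong) (simp add: power2_eq_square algebra_simps)

lemma ser_add:
  assumes "rapid1 c" "rapid1 d"
  shows "ser (\<lambda>n. c n + d n) j \<theta> = ser c j \<theta> + ser d j \<theta>"
proof -
  have "ser_term (\<lambda>n. c n + d n) j = (\<lambda>n \<theta>. ser_term c j n \<theta> + ser_term d j n \<theta>)"
    by (intro ext) (simp add: ser_term_def algebra_simps)
  then show ?thesis unfolding ser_def using infsum_add[OF ser_summable[OF assms(1)] ser_summable[OF assms(2)]] by simp
qed

lemma ser_scale:
  "ser (\<lambda>n. of_real r * c n) j \<theta> = r * ser c j \<theta>"
proof -
  have "ser_term (\<lambda>n. of_real r * c n) j = (\<lambda>n \<theta>. r * ser_term c j n \<theta>)"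
    by (intro ext) (simp add: ser_term_def algebra_simps)
  then show ?thesis unfolding ser_def by (simp add: infsum_cmult_right')
qed

text \<open>A Sobolev-type weight with a scale \<delta>. Small \<delta> keeps it close to 1 on any
  finite set of modes, so that small data stay small in the weight of any order j; see
  \<open>pweight_choice\<close>.\<close>

definition pweight :: "real \<Rightarrow> nat \<Rightarrow> int \<Rightarrow> real" where
  "pweight \<delta> j n = (1 + \<delta> * \<bar>real_of_int n\<bar>) ^ j"

lemma pweight_submult: "0 \<le> \<delta> \<Longrightarrow> submult_weight (pweight \<delta> j)"
  unfolding submult_weight_def
proof (intro conjI allI)
  fix m n :: int assume d: "0 \<le> \<delta>"
  show "1 \<le> pweight \<delta> j n" using d by (simp add: pweight_def)
  show "pweight \<delta> j (- n) = pweight \<delta> j n" by (simp add: pweight_def)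
  have "1 + \<delta> * \<bar>real_of_int (m + n)\<bar> \<le> 1 + \<delta> * (\<bar>real_of_int m\<bar> + \<bar>real_of_int n\<bar>)"
    using d by (intro add_left_mono mult_left_mono) auto
  also have "\<dots> \<le> (1 + \<delta> * \<bar>real_of_int m\<bar>) * (1 + \<delta> * \<bar>real_of_int n\<bar>)"
    using d by (simp add: algebra_simps)
  finally have "(1 + \<delta> * \<bar>real_of_int (m + n)\<bar>) ^ j \<le> ((1 + \<delta> * \<bar>real_of_int m\<bar>) * (1 + \<delta> * \<bar>real_of_int n\<bar>)) ^ j"
    using d by (intro power_mono) auto
  then show "pweight \<delta> j (m + n) \<le> pweight \<delta> j m * pweight \<delta> j n" by (simp add: pweight_def power_mult_distrib)
qed

lemma pweight_ge:
  assumes "0 < \<delta>" "i \<le> j" shows "\<delta> ^ i * \<bar>real_of_int n\<bar> ^ i \<le> pweight \<delta> j n"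
proof -
  have "(\<delta> * \<bar>real_of_int n\<bar>) ^ i \<le> (1 + \<delta> * \<bar>real_of_int n\<bar>) ^ i" using assms by (intro power_mono) auto
  also have "\<dots> \<le> (1 + \<delta> * \<bar>real_of_int n\<bar>) ^ j" using assms by (intro power_increasing) auto
  finally show ?thesis by (simp add: pweight_def power_mult_distrib)
qed

lemma EB_pweight:
  assumes d: "0 < \<delta>" and c: "EB (pweight \<delta> j) A c"
  shows "\<bar>of_int n\<bar> ^ j * norm (c n) \<le> (A / \<delta> ^ j) / bra n"
proof -
  have w: "submult_weight (pweight \<delta> j)" using d by (simp add: pweight_submult)
  have A: "0 \<le> A" using EB_nonneg[OF w c] .
  have r: "0 < pweight \<delta> j n" using weight_pos[OF w] .
  have "\<delta> ^ j * \<bar>of_int n\<bar> ^ j * norm (c n) \<le> pweight \<delta> j n * (A / (bra n * pweight \<delta> j n))"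
    using pweight_ge[OF d order_refl, of j n] c r d unfolding EB_def by (intro mult_mono) auto
  also have "\<dots> = A / bra n" using r by simp
  finally have "\<delta> ^ j * \<bar>of_int n\<bar> ^ j * norm (c n) / \<delta> ^ j \<le> A / bra n / \<delta> ^ j" using d by (intro divide_right_mono) auto
  then show ?thesis using d by (simp add: mult_ac)
qed

text \<open>Two extra powers in the weight replace the factor \<open>bra n\<close> that
  \<open>FB\<close> lacks.\<close>

lemma FB_pweight:
  assumes d: "0 < \<delta>" and c: "FB (pweight \<delta> (j + 2)) A c"
  shows "\<bar>of_int n\<bar> ^ j * norm (c n) \<le> (A * (1 / \<delta> ^ j + 1 / \<delta> ^ (j + 2))) / bra n"
proof -
  have w: "submult_weight (pweight \<delta> (j + 2))" using d by (simp add: pweight_submult)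
  have A: "0 \<le> A" using FB_nonneg[OF w c] .
  have r: "0 < pweight \<delta> (j + 2) n" using weight_pos[OF w] .
  have *: "\<bar>real_of_int n\<bar> ^ i * norm (c n) \<le> A / \<delta> ^ i" if "i \<le> j + 2" for i
  proof -
    have "\<delta> ^ i * \<bar>real_of_int n\<bar> ^ i * norm (c n) \<le> pweight \<delta> (j + 2) n * (A / pweight \<delta> (j + 2) n)"
      using pweight_ge[OF d that, of n] c r d unfolding FB_def by (intro mult_mono) auto
    then have "\<delta> ^ i * \<bar>real_of_int n\<bar> ^ i * norm (c n) / \<delta> ^ i \<le> A / \<delta> ^ i" using r d by (intro divide_right_mono) auto
    then show ?thesis using d by simp
  qed
  have "bra n * \<bar>real_of_int n\<bar> ^ j = \<bar>real_of_int n\<bar> ^ j + \<bar>real_of_int n\<bar> ^ (j + 2)"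
    by (simp add: bra_def distrib_right power_add power2_eq_square)
  then have "bra n * (\<bar>of_int n\<bar> ^ j * norm (c n)) = \<bar>of_int n\<bar> ^ j * norm (c n) + \<bar>of_int n\<bar> ^ (j + 2) * norm (c n)"
    by (simp only: mult.assoc[symmetric] distrib_right)
  also have "\<dots> \<le> A / \<delta> ^ j + A / \<delta> ^ (j + 2)" by (intro add_mono *) auto
  also have "\<dots> = A * (1 / \<delta> ^ j + 1 / \<delta> ^ (j + 2))" by (simp add: distrib_left)
  finally show ?thesis unfolding pos_le_divide_eq[OF bra_pos] by (simp only: mult.commute)
qed

text \<open>The bound M is common to all orders j; only the scale \<delta> of the weight may shrink
  with j.\<close>

definition smooth_seq :: "real \<Rightarrow> coeffs \<Rightarrow> bool" where
  "smooth_seq M c \<longleftrightarrow> M \<le> 1 \<and> cnj_sym c \<and> (\<forall>j. \<exists>\<delta>>0. EB (pweight \<delta> j) M c)"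

lemma rapid1_EB:
  assumes "\<And>j. \<exists>\<delta>>0. \<exists>A. EB (pweight \<delta> j) A c" shows "rapid1 c"
  unfolding rapid1_def
proof
  fix j obtain \<delta> A where "0 < \<delta>" "EB (pweight \<delta> j) A c" using assms by blast
  then show "\<exists>A. \<forall>n. \<bar>of_int n\<bar> ^ j * norm (c n) \<le> A / bra n" using EB_pweight by blast
qed

lemma rapid1_FB:
  assumes "\<And>j. \<exists>\<delta>>0. \<exists>A. FB (pweight \<delta> (j + 2)) A c" shows "rapid1 c"
  unfolding rapid1_def
proof
  fix j obtain \<delta> A where "0 < \<delta>" "FB (pweight \<delta> (j + 2)) A c" using assms by blast
  then show "\<exists>A. \<forall>n. \<bar>of_int n\<bar> ^ j * norm (c n) \<le> A / bra n" using FB_pweight by blast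
qed

lemma smooth_seq_EB:
  assumes c: "smooth_seq M c"
  obtains \<delta> where "0 < \<delta>" "submult_weight (pweight \<delta> j)" "EB (pweight \<delta> j) M c"
    "EB (pweight \<delta> j) (4 * S0 * M * M) (conv c c)"
proof -
  obtain \<delta> where d: "0 < \<delta>" "EB (pweight \<delta> j) M c" using c by (auto simp: smooth_seq_def)
  then have w: "submult_weight (pweight \<delta> j)" by (simp add: pweight_submult)
  show ?thesis using that[OF d(1) w d(2) conv_EE[OF w d(2) d(2)]] .
qed

text \<open>Every series occurring in the remainder converges together with its derivatives, so
  \<open>ser\<close> may be multiplied and differentiated termwise.\<close>

lemma smooth_seq_rapid1:
  assumes c: "smooth_seq M c"
  shows "rapid1 c" "rapid1 (conv c c)" "rapid1 (Tc k c)" "rapid1 (conv c (Tc k c))"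
    "rapid1 (\<lambda>n. of_nat p * c n + Tc p c n)" "rapid1 (\<lambda>n. 2 * c n + conv c c n)"
    "rapid1 (D2 (\<lambda>n. of_nat p * c n + Tc p c n))"
    "rapid1 (conv (\<lambda>n. 2 * c n + conv c c n) (D2 (\<lambda>n. of_nat p * c n + Tc p c n)))"
    "rapid1 (D2 (Tc k c))" "rapid1 (nonlin p c)" "rapid1 (D2 c)"
proof -
  have M: "M \<le> 1" using c by (simp add: smooth_seq_def)
  obtain K where K: "\<And>\<rho> a M. submult_weight \<rho> \<Longrightarrow> M \<le> 1 \<Longrightarrow> EB \<rho> M a \<Longrightarrow> EB \<rho> (K * M * M) (Tc k a)"
    using Tc_EB[of k] by blast
  obtain L where L: "\<And>\<rho> a M. submult_weight \<rho> \<Longrightarrow> M \<le> 1 \<Longrightarrow> EB \<rho> M a \<Longrightarrow> EB \<rho> (L * M * M) (Tc p a)"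
    using Tc_EB[of p] by blast
  obtain L' where L': "\<And>\<rho> a M. submult_weight \<rho> \<Longrightarrow> M \<le> 1 \<Longrightarrow> EB \<rho> M a \<Longrightarrow> EB \<rho> (L' * M * M) (Tc (p + 2) a)"
    using Tc_EB[of "p + 2"] by blast
  show "rapid1 c" by (rule rapid1_EB) (metis smooth_seq_EB[OF c])
  show "rapid1 (conv c c)" by (rule rapid1_EB) (metis smooth_seq_EB[OF c])
  show "rapid1 (Tc k c)" by (rule rapid1_EB) (metis smooth_seq_EB[OF c] K[OF _ M])
  show "rapid1 (conv c (Tc k c))" by (rule rapid1_EB) (metis smooth_seq_EB[OF c] K[OF _ M] conv_EE)
  have Q: "\<exists>\<delta>>0. submult_weight (pweight \<delta> j) \<and> (\<exists>A. EB (pweight \<delta> j) A (\<lambda>n. of_nat p * c n + Tc p c n)) \<and>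
     (\<exists>A. EB (pweight \<delta> j) A (\<lambda>n. 2 * c n + conv c c n)) \<and> (\<exists>A. EB (pweight \<delta> j) A (Tc p c)) \<and> (\<exists>A. EB (pweight \<delta> j) A (Tc k c))
     \<and> (\<exists>A. EB (pweight \<delta> j) A (Tc (p + 2) c)) \<and> EB (pweight \<delta> j) M c" for j
  proof -
    obtain \<delta> where d: "0 < \<delta>" "submult_weight (pweight \<delta> j)" "EB (pweight \<delta> j) M c"
      "EB (pweight \<delta> j) (4 * S0 * M * M) (conv c c)" using smooth_seq_EB[OF c] by blast
    show ?thesis
      using d(1,2,3) EB_add[OF EB_cmult[OF d(3)] L[OF d(2) M d(3)]] EB_add[OF EB_cmult[OF d(3)] d(4)]
        L[OF d(2) M d(3)] K[OF d(2) M d(3)] L'[OF d(2) M d(3)] by blast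
  qed
  show "rapid1 (\<lambda>n. of_nat p * c n + Tc p c n)" by (rule rapid1_EB) (use Q in blast)
  show "rapid1 (\<lambda>n. 2 * c n + conv c c n)" by (rule rapid1_EB) (use Q in blast)
  have DQ: "\<exists>\<delta>>0. \<exists>A. FB (pweight \<delta> j) A (D2 (\<lambda>n. of_nat p * c n + Tc p c n))" for j
    using Q[of j] D2_FB by blast
  then show "rapid1 (D2 (\<lambda>n. of_nat p * c n + Tc p c n))" by (rule rapid1_FB)
  show "rapid1 (D2 c)" by (rule rapid1_FB) (use Q D2_FB in blast)
  show "rapid1 (D2 (Tc k c))" by (rule rapid1_FB) (use Q D2_FB in blast)
  have PQ: "\<exists>\<delta>>0. \<exists>A. FB (pweight \<delta> j) A (conv (\<lambda>n. 2 * c n + conv c c n) (D2 (\<lambda>n. of_nat p * c n + Tc p c n)))" for j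
    using Q[of j] D2_FB conv_EF(1) by metis
  then show "rapid1 (conv (\<lambda>n. 2 * c n + conv c c n) (D2 (\<lambda>n. of_nat p * c n + Tc p c n)))" by (rule rapid1_FB)
  show "rapid1 (nonlin p c)"
  proof (rule rapid1_FB)
    fix j
    obtain \<delta> A B D E where d: "0 < \<delta>" "submult_weight (pweight \<delta> (j+2))" "EB (pweight \<delta> (j+2)) A (\<lambda>n. of_nat p * c n + Tc p c n)"
     "EB (pweight \<delta> (j+2)) B (\<lambda>n. 2 * c n + conv c c n)" "EB (pweight \<delta> (j+2)) D (Tc p c)" "EB (pweight \<delta> (j+2)) E (Tc (p + 2) c)"
      using Q[of "j + 2"] by blast
    show "\<exists>\<delta>>0. \<exists>A. FB (pweight \<delta> (j + 2)) A (nonlin p c)"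
      using d(1) FB_add[OF conv_EF(1)[OF d(2) d(4) D2_FB[OF d(2,3)]] FB_add[OF D2_FB[OF d(2,5)] EB_FB[OF d(2,6)]]]
      unfolding nonlin_def[symmetric] by blast
  qed
qed

lemma rapid1_scale:
  assumes a: "rapid1 a" shows "rapid1 (\<lambda>n. of_real r * a n)"
  unfolding rapid1_def
proof
  fix j obtain A where A: "\<And>n. \<bar>of_int n\<bar> ^ j * norm (a n) \<le> A / bra n"
    using a unfolding rapid1_def by blast
  have "\<bar>of_int n\<bar> ^ j * norm (of_real r * a n) \<le> \<bar>r\<bar> * A / bra n" for n
    using mult_left_mono[OF A[of n], of "\<bar>r\<bar>"] by (simp add: norm_mult mult_ac)
  then show "\<exists>A. \<forall>n. \<bar>of_int n\<bar> ^ j * norm (of_real r * a n) \<le> A / bra n" by blast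
qed

lemma rapid1_add:
  assumes a: "rapid1 a" and b: "rapid1 b" shows "rapid1 (\<lambda>n. a n + b n)"
  unfolding rapid1_def
proof
  fix j
  obtain A where A: "\<And>n. \<bar>of_int n\<bar> ^ j * norm (a n) \<le> A / bra n" using a unfolding rapid1_def by blast
  obtain B where B: "\<And>n. \<bar>of_int n\<bar> ^ j * norm (b n) \<le> B / bra n" using b unfolding rapid1_def by blast
  have "\<bar>of_int n\<bar> ^ j * norm (a n + b n) \<le> (A + B) / bra n" for n
  proof -
    have "\<bar>of_int n\<bar> ^ j * norm (a n + b n) \<le> \<bar>real_of_int n\<bar> ^ j * (norm (a n) + norm (b n))"
      by (intro mult_left_mono norm_triangle_ineq) auto
    then show ?thesis using A[of n] B[of n] by (simp add: distrib_left add_divide_distrib)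
  qed
  then show "\<exists>A. \<forall>n. \<bar>of_int n\<bar> ^ j * norm (a n + b n) \<le> A / bra n" by blast
qed

lemma ser_Tc:
  assumes c: "smooth_seq M c"
  shows "ser (Tc k c) 0 \<theta> = (1 + ser c 0 \<theta>) ^ k - 1 - real k * ser c 0 \<theta>"
proof (induction k)
  case 0
  then show ?case by (simp add: ser_def ser_term_def)
next
  case (Suc k)
  note R = smooth_seq_rapid1[OF c]
  have s: "cnj_sym c" using c by (simp add: smooth_seq_def)
  have kcc: "rapid1 (\<lambda>n. of_nat k * conv c c n)" using rapid1_scale[OF R(2), of "real k"] by simp
  note add = rapid1_add
  have "ser (Tc (Suc k) c) 0 \<theta> = ser (Tc k c) 0 \<theta> + (ser c 0 \<theta> * ser (Tc k c) 0 \<theta> + real k * (ser c 0 \<theta> * ser c 0 \<theta>))"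
    unfolding Tc.simps using ser_scale[of "real k" "conv c c" 0 \<theta>]
    by (simp add: ser_add R kcc add ser_conv[OF R(1) R(3) s Tc_cnj_sym[OF s] R(4)] ser_conv[OF R(1) R(1) s s R(2)])
  then show ?case unfolding Suc.IH by (simp add: algebra_simps)
qed

section \<open>The rescaled curvature equation\<close>

text \<open>The second derivative of (1 + v)^p, where x, y, z stand for v, v', v''. For p = 1 the
  exponent p - 2 is truncated, but the factor p - 1 removes that summand.\<close>

definition Ypart :: "nat \<Rightarrow> real \<Rightarrow> real \<Rightarrow> real \<Rightarrow> real" where
  "Ypart p x y z = real p * real (p - 1) * (1 + x) ^ (p - 2) * y\<^sup>2 + real p * (1 + x) ^ (p - 1) * z"

text \<open>The right-hand side of the rescaled curvature equation, written for v, the normalised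
  curvature minus 1.\<close>

definition Gpart :: "nat \<Rightarrow> real \<Rightarrow> real \<Rightarrow> real \<Rightarrow> real" where
  "Gpart p x y z = (1 + x)\<^sup>2 * Ypart p x y z + (1 + x) ^ (p + 2) - (1 + x)"

lemma Ypart_derivative:
  assumes v: "\<And>\<theta>. (v0 has_real_derivative v1 \<theta>) (at \<theta>)" "\<And>\<theta>. (v1 has_real_derivative v2 \<theta>) (at \<theta>)"
  shows "((\<lambda>\<theta>. (1 + v0 \<theta>) ^ p) has_real_derivative real p * (1 + v0 \<theta>) ^ (p - 1) * v1 \<theta>) (at \<theta>)"
    "((\<lambda>\<theta>. real p * (1 + v0 \<theta>) ^ (p - 1) * v1 \<theta>) has_real_derivative Ypart p (v0 \<theta>) (v1 \<theta>) (v2 \<theta>)) (at \<theta>)"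
proof -
  have d: "((\<lambda>\<theta>. (1 + v0 \<theta>) ^ k) has_real_derivative real k * (1 + v0 \<theta>) ^ (k - 1) * v1 \<theta>) (at \<theta>)" for k
    using DERIV_power[OF DERIV_add[OF DERIV_const[of 1] v(1)[of \<theta>]], of k] by (simp add: mult_ac)
  show "((\<lambda>\<theta>. (1 + v0 \<theta>) ^ p) has_real_derivative real p * (1 + v0 \<theta>) ^ (p - 1) * v1 \<theta>) (at \<theta>)" by (rule d)
  have "p - 1 - 1 = p - 2" by simp
  then show "((\<lambda>\<theta>. real p * (1 + v0 \<theta>) ^ (p - 1) * v1 \<theta>) has_real_derivative Ypart p (v0 \<theta>) (v1 \<theta>) (v2 \<theta>)) (at \<theta>)"
    using DERIV_mult[OF DERIV_cmult[OF d[of "p - 1"], of "real p"] v(2)[of \<theta>]]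
    by (simp add: Ypart_def power2_eq_square algebra_simps)
qed

text \<open>The identity \<open>ser_Tc\<close> holds for all angles, so it may be differentiated
  twice; termwise derivatives agree with these by uniqueness of derivatives.\<close>

lemma ser_Tc2:
  assumes c: "smooth_seq M c"
  shows "ser (Tc p c) (Suc (Suc 0)) \<theta> = Ypart p (ser c 0 \<theta>) (ser c (Suc 0) \<theta>) (ser c (Suc (Suc 0)) \<theta>) - real p * ser c (Suc (Suc 0)) \<theta>"
proof -
  note R = smooth_seq_rapid1[OF c]
  have d: "(ser c j has_real_derivative ser c (Suc j) \<theta>) (at \<theta>)" for j \<theta> by (rule ser_DERIV[OF R(1)])
  note Y = Ypart_derivative[OF d[of 0] d[of "Suc 0"], where p=p]
  have E0: "ser (Tc p c) 0 = (\<lambda>\<theta>. (1 + ser c 0 \<theta>) ^ p - 1 - real p * ser c 0 \<theta>)" using ser_Tc[OF c] by blast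
  have D0: "((\<lambda>\<theta>. (1 + ser c 0 \<theta>) ^ p - 1 - real p * ser c 0 \<theta>) has_real_derivative
     real p * (1 + ser c 0 \<theta>) ^ (p - 1) * ser c (Suc 0) \<theta> - 0 - real p * ser c (Suc 0) \<theta>) (at \<theta>)" for \<theta>
    by (intro DERIV_diff Y(1) DERIV_const DERIV_cmult d)
  have "ser (Tc p c) (Suc 0) \<theta> = real p * (1 + ser c 0 \<theta>) ^ (p - 1) * ser c (Suc 0) \<theta> - real p * ser c (Suc 0) \<theta>" for \<theta>
    using DERIV_unique[OF ser_DERIV[OF R(3)[where k=p], of 0 \<theta>, unfolded E0] D0[of \<theta>]] by simp
  then have E1: "ser (Tc p c) (Suc 0) = (\<lambda>\<theta>. real p * (1 + ser c 0 \<theta>) ^ (p - 1) * ser c (Suc 0) \<theta> - real p * ser c (Suc 0) \<theta>)" by blast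
  show ?thesis
    by (rule DERIV_unique[OF ser_DERIV[OF R(3)[where k=p], of "Suc 0" \<theta>, unfolded E1]]) (intro DERIV_diff Y(2) DERIV_cmult d)
qed

text \<open>Translates the system of mode equations back into the partial differential
  equation.\<close>

lemma ser_rhs:
  assumes c: "smooth_seq M c"
  shows "ser (\<lambda>n. (- lam p n) *\<^sub>R c n + nonlin p c n) 0 \<theta> = Gpart p (ser c 0 \<theta>) (ser c (Suc 0) \<theta>) (ser c (Suc (Suc 0)) \<theta>)"
    "rapid1 (\<lambda>n. (- lam p n) *\<^sub>R c n + nonlin p c n)"
proof -
  note R = smooth_seq_rapid1[OF c]
  have s: "cnj_sym c" using c by (simp add: smooth_seq_def)
  note scale = rapid1_scale and add = rapid1_add
  define X where "X = ser c 0 \<theta>"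
  define X2 where "X2 = ser c (Suc (Suc 0)) \<theta>"
  define P where "P = (\<lambda>n. 2 * c n + conv c c n)"
  define Q where "Q = (\<lambda>n. of_nat p * c n + Tc p c n)"
  note R' = R(5)[where p=p, folded Q_def] R(6)[folded P_def] R(7)[where p=p, folded Q_def] R(8)[where p=p, folded P_def Q_def]
  have sP: "cnj_sym P" "cnj_sym (D2 Q)"
    using s conv_cnj_sym[OF s s] Tc_cnj_sym[OF s, of p] D2_cnj_sym[of Q] by (auto simp: P_def Q_def cnj_sym_def)
  have P: "ser P 0 \<theta> = 2 * X + X * X"
    unfolding P_def X_def using ser_add[OF scale[OF R(1), where r=2] R(2), where j=0 and \<theta>=\<theta>] ser_scale[of 2 c 0 \<theta>] ser_conv[OF R(1) R(1) s s R(2)] by simp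
  have Q: "ser (D2 Q) 0 \<theta> = real p * X2 + ser (Tc p c) (Suc (Suc 0)) \<theta>"
    unfolding ser_D2 unfolding Q_def X2_def
    using ser_add[OF scale[OF R(1), where r="real p"] R(3)[where k=p], where j="Suc (Suc 0)" and \<theta>=\<theta>] ser_scale[of "real p" c "Suc (Suc 0)" \<theta>] by simp
  have N: "nonlin p c = (\<lambda>n. conv P (D2 Q) n + (D2 (Tc p c) n + Tc (p + 2) c n))"
    by (simp add: nonlin_def[abs_def] P_def Q_def)
  have "ser (nonlin p c) 0 \<theta> = (2 * X + X * X) * (real p * X2 + ser (Tc p c) (Suc (Suc 0)) \<theta>) + (ser (Tc p c) (Suc (Suc 0)) \<theta> + ser (Tc (p + 2) c) 0 \<theta>)"
    unfolding N ser_add[OF R'(4) add[OF R(9) R(3)]] ser_add[OF R(9) R(3)]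
      ser_conv[OF R'(2) R'(3) sP R'(4)] P Q
    unfolding ser_D2 by simp
  moreover have L: "(\<lambda>n. (- lam p n) *\<^sub>R c n + nonlin p c n) =
     (\<lambda>n. of_real (real p) * D2 c n + (of_real (real p + 1) * c n + nonlin p c n))"
    by (rule ext) (simp add: lam_def D2_def scaleR_conv_of_real algebra_simps)
  ultimately show "ser (\<lambda>n. (- lam p n) *\<^sub>R c n + nonlin p c n) 0 \<theta> = Gpart p (ser c 0 \<theta>) (ser c (Suc 0) \<theta>) (ser c (Suc (Suc 0)) \<theta>)"
    unfolding L ser_add[OF scale[OF R(11)] add[OF scale[OF R(1)] R(10)]] ser_add[OF scale[OF R(1)] R(10)] ser_scale ser_D2
      ser_Tc2[OF c] ser_Tc[OF c] Gpart_def X_def X2_def by (simp add: power2_eq_square algebra_simps)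
  show "rapid1 (\<lambda>n. (- lam p n) *\<^sub>R c n + nonlin p c n)"
    unfolding L by (rule add[OF scale[OF R(11)] add[OF scale[OF R(1)] R(10)]])
qed

text \<open>Differential polynomials: if V lists the successive space derivatives of one function,
  the class is closed under the space derivative (\<open>Pol_DERIV\<close>).\<close>

inductive Pol :: "(nat \<Rightarrow> tfun) \<Rightarrow> tfun \<Rightarrow> bool" for V where
  const: "Pol V (\<lambda>t u. c)"
| var: "Pol V (V j)"
| add: "Pol V f \<Longrightarrow> Pol V g \<Longrightarrow> Pol V (\<lambda>t u. f t u + g t u)"
| mult: "Pol V f \<Longrightarrow> Pol V g \<Longrightarrow> Pol V (\<lambda>t u. f t u * g t u)"

lemma Pol_power: "Pol V f \<Longrightarrow> Pol V (\<lambda>t u. f t u ^ k)"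
proof (induction k)
  case 0
  show ?case using Pol.const[of V 1] by simp
next
  case (Suc k)
  then show ?case using Pol.mult[of V f "\<lambda>t u. f t u ^ k"] by simp
qed

lemma Pol_Ck:
  assumes "\<And>j. Ck k S (V j)" shows "Pol V f \<Longrightarrow> Ck k S f"
proof (induction rule: Pol.induct)
  case (const c) show ?case by (rule Ck_const)
next
  case (var j) show ?case by (rule assms)
next
  case (add f g) show ?case by (rule Ck_add[OF add.IH])
next
  case (mult f g) show ?case by (rule Ck_mult[OF mult.IH])
qed

lemma Pol_DERIV:
  assumes d: "\<And>j t u. t \<in> S \<Longrightarrow> (V j t has_real_derivative V (Suc j) t u) (at u)"
  shows "Pol V f \<Longrightarrow> \<exists>g. Pol V g \<and> (\<forall>t\<in>S. \<forall>u. (f t has_real_derivative g t u) (at u))"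
proof (induction rule: Pol.induct)
  case (const c)
  show ?case by (intro exI[of _ "\<lambda>t u. 0"]) (auto intro: Pol.const)
next
  case (var j)
  show ?case by (intro exI[of _ "V (Suc j)"]) (auto intro: Pol.var d)
next
  case (add f g)
  then obtain f' g' where D: "Pol V f'" "Pol V g'" "\<forall>t\<in>S. \<forall>u. (f t has_real_derivative f' t u) (at u)"
    "\<forall>t\<in>S. \<forall>u. (g t has_real_derivative g' t u) (at u)" by blast
  show ?case
    by (rule exI[of _ "\<lambda>t u. f' t u + g' t u"]) (use D in \<open>auto intro!: Pol.add DERIV_add\<close>)
next
  case (mult f g)
  then obtain f' g' where D: "Pol V f'" "Pol V g'" "\<forall>t\<in>S. \<forall>u. (f t has_real_derivative f' t u) (at u)"
    "\<forall>t\<in>S. \<forall>u. (g t has_real_derivative g' t u) (at u)" by blast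
  have "Pol V (\<lambda>t u. f' t u * g t u + g' t u * f t u)"
    by (rule Pol.add[OF Pol.mult[OF D(1) mult.hyps(2)] Pol.mult[OF D(2) mult.hyps(1)]])
  then show ?case
    by (intro exI[of _ "\<lambda>t u. f' t u * g t u + g' t u * f t u"]) (use D(3,4) in \<open>auto intro!: DERIV_mult\<close>)
qed

text \<open>Time regularity is read off the equation: each time derivative is a polynomial in the space derivatives.\<close>

lemma evolution_Cinf:
  assumes c: "\<And>j. cont2 S (V j)"
    and du: "\<And>j t u. t \<in> S \<Longrightarrow> (V j t has_real_derivative V (Suc j) t u) (at u)"
    and dt: "\<And>j t u. t \<in> S \<Longrightarrow> ((\<lambda>s. V j s u) has_real_derivative W j t u) (at t within S)"
    and dW: "\<And>j t u. t \<in> S \<Longrightarrow> (W j t has_real_derivative W (Suc j) t u) (at u)"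
    and f: "Pol V f" "\<And>t u. t \<in> S \<Longrightarrow> W 0 t u = f t u"
  shows "Cinf S (V j)"
proof -
  have W: "\<exists>f. Pol V f \<and> (\<forall>t\<in>S. \<forall>u. W j t u = f t u)" for j
  proof (induction j)
    case (Suc j)
    then obtain f where f: "Pol V f" "\<forall>t\<in>S. \<forall>u. W j t u = f t u" by blast
    obtain g where g: "Pol V g" "\<forall>t\<in>S. \<forall>u. (f t has_real_derivative g t u) (at u)"
      using Pol_DERIV[of S V, OF du f(1)] by blast
    have "W (Suc j) t u = g t u" if "t \<in> S" for t u
    proof -
      have "W j t = f t" using f(2) that by blast
      then show ?thesis using dW[OF that, of j u] g(2) that DERIV_unique by metis
    qed
    then show ?case using g(1) by blast
  qed (use f in blast)
  have "\<forall>j. Ck k S (V j)" for k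
  proof (induction k)
    case 0
    then show ?case using c by simp
  next
    case (Suc k)
    show ?case
    proof
      fix j
      obtain f where f: "Pol V f" "\<forall>t\<in>S. \<forall>u. W j t u = f t u" using W by blast
      have "Ck k S f" by (rule Pol_Ck[OF _ f(1)]) (use Suc in blast)
      then have Wk: "Ck k S (W j)" by (rule Ck_cong[rotated]) (use f(2) in simp)
      have "partials S (V j) (V (Suc j)) (W j)" using du dt unfolding partials_def by blast
      then show "Ck (Suc k) S (V j)" using Ck_SucI[OF c _ spec[OF Suc] Wk] by blast
    qed
  qed
  then show ?thesis by (simp add: Cinf_def)
qed

text \<open>What \<open>LP_fixed_point\<close> delivers. The smallness of \<open>M * S0\<close>
  bounds the sum of the series by 1/2, which keeps 1 + v away from 0.\<close>

locale lp_solution =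
  fixes p :: nat and \<beta> :: coeffs and v :: "real \<Rightarrow> coeffs" and M :: real
  assumes p: "1 \<le> p" and cont: "modes_continuous v" and sym: "\<And>\<tau>. 0 \<le> \<tau> \<Longrightarrow> cnj_sym (v \<tau>)"
    and fixed: "\<And>\<tau>. 0 \<le> \<tau> \<Longrightarrow> v \<tau> = LP p \<beta> v \<tau>" and M: "M \<le> 1" "M * S0 \<le> 1/2"
    and decay: "\<And>j. \<exists>\<delta>>0. decaying p (pweight \<delta> j) M v"
begin

definition V :: "nat \<Rightarrow> tfun" where
  "V j \<tau> = ser (v \<tau>) j"

definition rhs :: "real \<Rightarrow> coeffs" where
  "rhs \<tau> n = (- lam p n) *\<^sub>R v \<tau> n + nonlin p (v \<tau>) n"

lemma decay0: "decaying p (\<lambda>_. 1) M v"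
proof -
  obtain \<delta> where "0 < \<delta>" "decaying p (pweight \<delta> 0) M v" using decay by blast
  then show ?thesis unfolding decaying_def pweight_def[abs_def] by simp
qed

lemma smooth: "0 \<le> \<tau> \<Longrightarrow> smooth_seq M (v \<tau>)"
  unfolding smooth_seq_def
proof (intro conjI allI)
  fix j assume t: "0 \<le> \<tau>"
  obtain \<delta> where d: "0 < \<delta>" "decaying p (pweight \<delta> j) M v" using decay by blast
  then show "\<exists>\<delta>>0. EB (pweight \<delta> j) M (v \<tau>)"
    using decaying_EB(3)[OF pweight_submult d(2) M(1) p t] by auto
qed (use M sym in auto)

lemma mode_bound: "\<exists>A. \<forall>\<tau>\<ge>0. \<forall>n. \<bar>of_int n\<bar> ^ j * norm (v \<tau> n) \<le> A * exp (- mu p * \<tau>) / bra n"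
proof -
  obtain \<delta> where d: "0 < \<delta>" "decaying p (pweight \<delta> j) M v" using decay by blast
  have "\<bar>of_int n\<bar> ^ j * norm (v \<tau> n) \<le> M / \<delta> ^ j * exp (- mu p * \<tau>) / bra n" if "0 \<le> \<tau>" for \<tau> n
  proof -
    have "EB (pweight \<delta> j) (M * exp (- mu p * \<tau>)) (v \<tau>)" using d(2) that by (simp add: decaying_def)
    from EB_pweight[OF d(1) this, of n] show ?thesis by simp
  qed
  then show ?thesis by blast
qed

lemma exp_mu_le_1: "0 \<le> \<tau> \<Longrightarrow> exp (- mu p * \<tau>) \<le> 1"
  using p by (simp add: mu_def mult_nonpos_nonneg)

lemma rapid_v: "rapid v"
  unfolding rapid_def
proof
  fix j
  obtain A where A: "\<forall>\<tau>\<ge>0. \<forall>n. \<bar>of_int n\<bar> ^ j * norm (v \<tau> n) \<le> A * exp (- mu p * \<tau>) / bra n"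
    using mode_bound by blast
  have "\<bar>of_int n\<bar> ^ j * norm (v \<tau> n) \<le> \<bar>A\<bar> / bra n" if t: "0 \<le> \<tau>" for \<tau> n
  proof -
    have "A * exp (- mu p * \<tau>) \<le> \<bar>A\<bar> * exp (- mu p * \<tau>)" by (intro mult_right_mono) auto
    also have "\<dots> \<le> \<bar>A\<bar> * 1" using exp_mu_le_1[OF t] by (intro mult_left_mono) auto
    finally have "A * exp (- mu p * \<tau>) \<le> \<bar>A\<bar>" by simp
    then have "A * exp (- mu p * \<tau>) / bra n \<le> \<bar>A\<bar> / bra n" by (intro divide_right_mono) auto
    then show ?thesis using A t by (meson order_trans)
  qed
  then show "\<exists>A. \<forall>\<tau>\<ge>0. \<forall>n. \<bar>of_int n\<bar> ^ j * norm (v \<tau> n) \<le> A / bra n" by blast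
qed

lemma rapid_rhs: "rapid rhs"
  unfolding rapid_def
proof
  fix j
  obtain C where C: "C \<ge> 0" and NL: "\<And>\<rho> a b M d. submult_weight \<rho> \<Longrightarrow> M \<le> 1 \<Longrightarrow> EB \<rho> M a \<Longrightarrow> EB \<rho> M b \<Longrightarrow>
     EB \<rho> d (\<lambda>n. a n - b n) \<Longrightarrow> FB \<rho> (C * M * d) (\<lambda>n. nonlin p a n - nonlin p b n)"
    using nonlin_lipschitz[of p] by blast
  obtain \<delta> where d: "0 < \<delta>" "decaying p (pweight \<delta> (j + 2)) M v" using decay by blast
  have w: "submult_weight (pweight \<delta> (j + 2))" using d by (simp add: pweight_submult)
  obtain A where A: "\<And>\<tau> n. 0 \<le> \<tau> \<Longrightarrow> \<bar>of_int n\<bar> ^ j * norm (v \<tau> n) \<le> A / bra n"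
    using rapid_v unfolding rapid_def by blast
  obtain A' where A': "\<And>\<tau> n. 0 \<le> \<tau> \<Longrightarrow> \<bar>of_int n\<bar> ^ (j + 2) * norm (v \<tau> n) \<le> A' / bra n"
    using rapid_v unfolding rapid_def by blast
  define B where "B = (C * M * M) * (1 / \<delta> ^ j + 1 / \<delta> ^ (j + 2))"
  have "\<bar>of_int n\<bar> ^ j * norm (rhs \<tau> n) \<le> (real p * A' + (real p + 1) * A + B) / bra n" if t: "0 \<le> \<tau>" for \<tau> n
  proof -
    note E = decaying_EB(3)[OF w d(2) M(1) p t]
    have "FB (pweight \<delta> (j + 2)) (C * M * M) (\<lambda>n. nonlin p (v \<tau>) n)"
      using NL[OF w M(1) E EB_zero[OF w EB_nonneg[OF w E]], of M] E by (simp add: nonlin_zero)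
    from FB_pweight[OF d(1) this, of n]
    have 1: "\<bar>of_int n\<bar> ^ j * norm (nonlin p (v \<tau>) n) \<le> B / bra n" by (simp add: B_def)
    have "norm (rhs \<tau> n) \<le> \<bar>lam p n\<bar> * norm (v \<tau> n) + norm (nonlin p (v \<tau>) n)"
      unfolding rhs_def by (rule order_trans[OF norm_triangle_ineq]) simp
    also have "\<bar>lam p n\<bar> \<le> real p * \<bar>real_of_int n\<bar> ^ 2 + (real p + 1)" by (simp add: lam_def abs_le_iff)
    finally have "norm (rhs \<tau> n) \<le> (real p * \<bar>real_of_int n\<bar> ^ 2 + (real p + 1)) * norm (v \<tau> n) + norm (nonlin p (v \<tau>) n)"
      by (simp add: mult_right_mono)
    then have "\<bar>of_int n\<bar> ^ j * norm (rhs \<tau> n) \<le> \<bar>real_of_int n\<bar> ^ j *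
      ((real p * \<bar>real_of_int n\<bar> ^ 2 + (real p + 1)) * norm (v \<tau> n) + norm (nonlin p (v \<tau>) n))"
      by (intro mult_left_mono) auto
    also have "\<dots> = real p * (\<bar>of_int n\<bar> ^ (j + 2) * norm (v \<tau> n)) + (real p + 1) * (\<bar>of_int n\<bar> ^ j * norm (v \<tau> n))
        + \<bar>of_int n\<bar> ^ j * norm (nonlin p (v \<tau>) n)" by (simp only: power_add algebra_simps)
    also have "\<dots> \<le> real p * (A' / bra n) + (real p + 1) * (A / bra n) + B / bra n"
      by (intro add_mono mult_left_mono A[OF t] A'[OF t] 1) auto
    finally show ?thesis by (simp add: add_divide_distrib)
  qed
  then show "\<exists>A. \<forall>\<tau>\<ge>0. \<forall>n. \<bar>of_int n\<bar> ^ j * norm (rhs \<tau> n) \<le> A / bra n" by blast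
qed

lemma mode_derivative:
  assumes t: "0 \<le> \<tau>" shows "((\<lambda>\<tau>. v \<tau> n) has_vector_derivative rhs \<tau> n) (at \<tau> within {0..})"
proof -
  have "((\<lambda>\<tau>. LP p \<beta> v \<tau> n) has_vector_derivative rhs \<tau> n) (at \<tau> within {0..})"
    using LP_has_derivative[OF weight_one decay0 M(1) p cont t, of \<beta> n] fixed[OF t] by (simp add: rhs_def)
  then show ?thesis
    by (rule has_vector_derivative_transform[rotated 2]) (use t fixed in auto)
qed

lemma V_cont2: "cont2 {0..} (V j)"
  unfolding V_def[abs_def] by (rule ser_cont2[OF rapid_v cont])

lemma V_DERIV: "0 \<le> \<tau> \<Longrightarrow> (V j \<tau> has_real_derivative V (Suc j) \<tau> \<theta>) (at \<theta>)"
  unfolding V_def by (rule ser_DERIV[OF rapid_rapid1[OF rapid_v]])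

lemma V_periodic: "V j \<tau> (\<theta> + 2 * pi) = V j \<tau> \<theta>"
  by (simp add: V_def ser_periodic)

lemma V_time_DERIV_ser: "0 \<le> \<tau> \<Longrightarrow> ((\<lambda>\<tau>. V j \<tau> \<theta>) has_real_derivative ser (rhs \<tau>) j \<theta>) (at \<tau> within {0..})"
  unfolding V_def by (rule ser_DERIV_time[OF rapid_v rapid_rhs _ mode_derivative])

lemma ser_rhs_Gpart: "0 \<le> \<tau> \<Longrightarrow> ser (rhs \<tau>) 0 \<theta> = Gpart p (V 0 \<tau> \<theta>) (V 1 \<tau> \<theta>) (V 2 \<tau> \<theta>)"
  using ser_rhs(1)[OF smooth, of \<tau> p \<theta>] by (simp add: V_def rhs_def[abs_def] numeral_2_eq_2)

lemma V_time_DERIV: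
  "0 \<le> \<tau> \<Longrightarrow> ((\<lambda>\<tau>. V 0 \<tau> \<theta>) has_real_derivative Gpart p (V 0 \<tau> \<theta>) (V 1 \<tau> \<theta>) (V 2 \<tau> \<theta>)) (at \<tau> within {0..})"
  using V_time_DERIV_ser[of \<tau> 0 \<theta>] ser_rhs_Gpart[of \<tau> \<theta>] by simp

lemma V_Cinf: "Cinf {0..} (V j)"
proof (rule evolution_Cinf[where W="\<lambda>j \<tau>. ser (rhs \<tau>) j"])
  let ?x = "\<lambda>t u. 1 + V 0 t u"
  note x = Pol.add[OF Pol.const[of V 1] Pol.var[of V 0]]
  note Y = Pol.add[OF Pol.mult[OF Pol.mult[OF Pol.const[of V "real p * real (p - 1)"] Pol_power[OF x, of "p - 2"]] Pol_power[OF Pol.var[of V 1], of 2]]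
     Pol.mult[OF Pol.mult[OF Pol.const[of V "real p"] Pol_power[OF x, of "p - 1"]] Pol.var[of V 2]]]
  show "Pol V (\<lambda>t u. Gpart p (V 0 t u) (V 1 t u) (V 2 t u))"
    unfolding Gpart_def Ypart_def diff_conv_add_uminus
    using Pol.add[OF Pol.add[OF Pol.mult[OF Pol_power[OF x, of 2] Y] Pol_power[OF x, of "p + 2"]]
        Pol.mult[OF Pol.const[of V "- 1"] x]] by (simp add: mult_ac)
qed (auto intro: V_cont2 V_DERIV V_time_DERIV_ser ser_DERIV rapid_rapid1 rapid_rhs ser_rhs_Gpart[unfolded One_nat_def])

lemma V_decay: "\<exists>A. \<forall>\<tau>\<ge>0. \<forall>\<theta>. \<bar>V j \<tau> \<theta>\<bar> \<le> A * exp (- mu p * \<tau>)"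
proof -
  obtain A where A: "\<And>\<tau> n. 0 \<le> \<tau> \<Longrightarrow> \<bar>of_int n\<bar> ^ j * norm (v \<tau> n) \<le> A * exp (- mu p * \<tau>) / bra n"
    using mode_bound by blast
  have "\<bar>V j \<tau> \<theta>\<bar> \<le> A * S0 * exp (- mu p * \<tau>)" if "0 \<le> \<tau>" for \<tau> \<theta>
    using ser_bound[OF A[OF that], of \<theta>] by (simp add: V_def mult_ac)
  then show ?thesis by blast
qed

lemma V_small: assumes t: "0 \<le> \<tau>" shows "\<bar>V 0 \<tau> \<theta>\<bar> \<le> 1/2"
proof -
  have "EB (\<lambda>_. 1) M (v \<tau>)" by (rule decaying_EB(3)[OF weight_one decay0 M(1) p t])
  then have "\<bar>real_of_int n\<bar> ^ 0 * norm (v \<tau> n) \<le> M / bra n" for n by (simp add: EB_def)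
  from ser_bound[of 0, OF this] M(2) show ?thesis unfolding V_def by (meson order_trans)
qed

text \<open>The integral grows like \<open>e\<^sup>\<tau>\<close> along the equation, but it is bounded.\<close>

lemma closing_integral_zero: "integral {0..2 * pi} (\<lambda>\<theta>. sin (\<theta> + c) / (1 + V 0 0 \<theta>)) = 0"
proof -
  define I where "I \<tau> = integral {0..2 * pi} (\<lambda>\<theta>. sin (\<theta> + c) / (1 + V 0 \<tau> \<theta>))" for \<tau>
  have pos: "1/2 \<le> 1 + V 0 \<tau> \<theta>" if "0 \<le> \<tau>" for \<tau> \<theta> using V_small[OF that, of \<theta>] by linarith
  have cV: "continuous_on ({0..} \<times> {0..2 * pi}) (\<lambda>x. V j (fst x) (snd x))" for j
    using V_cont2[of j] unfolding cont2_def by (rule continuous_on_subset) auto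
  define Y where "Y \<tau> \<theta> = Ypart p (V 0 \<tau> \<theta>) (V 1 \<tau> \<theta>) (V 2 \<tau> \<theta>)" for \<tau> \<theta>
  have cVt: "continuous_on A (V j \<tau>)" if "0 \<le> \<tau>" for A \<tau> j
    using cont2_slice_u[OF V_cont2, of \<tau> A j] that by auto
  have dI: "(I has_real_derivative I \<tau>) (at \<tau> within {0..})" if t: "0 \<le> \<tau>" for \<tau>
  proof -
    \<comment> \<open>The time derivative of the integrand. The equation gives (1/q)' = 1/q -
      ((q^p)'' + q^p) for q = 1 + v, so F is the integrand itself minus a term that integrates to
      0.\<close>
    define F where "F \<tau> \<theta> = sin (\<theta> + c) / (1 + V 0 \<tau> \<theta>) - sin (\<theta> + c) * (Y \<tau> \<theta> + (1 + V 0 \<tau> \<theta>) ^ p)" for \<tau> \<theta>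
    have "((\<lambda>x. integral (cbox 0 (2 * pi)) (\<lambda>\<theta>. sin (\<theta> + c) / (1 + V 0 x \<theta>))) has_field_derivative
        integral (cbox 0 (2 * pi)) (F \<tau>)) (at \<tau> within {0..})"
    proof (rule leibniz_rule_field_derivative)
      fix x \<theta> :: real assume x: "x \<in> {0..}"
      have x0: "1 + V 0 x \<theta> \<noteq> 0" using pos[of x \<theta>] x by auto
      have aux: "s / q - s * R = - (s * (q\<^sup>2 * R - q)) / q\<^sup>2" if "q \<noteq> 0" for s q R :: real
        using that by (simp add: field_simps power2_eq_square)
      have "Gpart p (V 0 x \<theta>) (V 1 x \<theta>) (V 2 x \<theta>) = (1 + V 0 x \<theta>)\<^sup>2 * (Y x \<theta> + (1 + V 0 x \<theta>) ^ p) - (1 + V 0 x \<theta>)"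
        by (simp add: Gpart_def Y_def power_add power2_eq_square algebra_simps)
      then have "F x \<theta> = - (sin (\<theta> + c) * Gpart p (V 0 x \<theta>) (V 1 x \<theta>) (V 2 x \<theta>)) / (1 + V 0 x \<theta>)\<^sup>2"
        unfolding F_def by (simp only: aux[OF x0])
      moreover have "((\<lambda>x. sin (\<theta> + c) / (1 + V 0 x \<theta>)) has_field_derivative
          - (sin (\<theta> + c) * Gpart p (V 0 x \<theta>) (V 1 x \<theta>) (V 2 x \<theta>)) / (1 + V 0 x \<theta>)\<^sup>2) (at x within {0..})"
        using V_time_DERIV[of x \<theta>] x x0 by (auto intro!: derivative_eq_intros simp: power2_eq_square)
      ultimately show "((\<lambda>x. sin (\<theta> + c) / (1 + V 0 x \<theta>)) has_field_derivative F x \<theta>) (at x within {0..})" by simp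
    next
      fix x :: real assume "x \<in> {0..}"
      then show "(\<lambda>\<theta>. sin (\<theta> + c) / (1 + V 0 x \<theta>)) integrable_on cbox 0 (2 * pi)"
        using pos[of x] by (intro integrable_continuous continuous_intros cVt) (auto, smt (verit))
    next
      show "continuous_on ({0..} \<times> cbox 0 (2 * pi)) (\<lambda>(x, \<theta>). F x \<theta>)"
        unfolding F_def Y_def Ypart_def split_beta cbox_interval
      proof (intro continuous_intros cV)
        show "\<forall>x\<in>{0..} \<times> {0..2 * pi}. 1 + V 0 (fst x) (snd x) \<noteq> 0" using pos by (auto, smt (verit))
      qed
    qed (use t in auto)
    moreover have "integral {0..2 * pi} (F \<tau>) = I \<tau>"
    proof -
      \<comment> \<open>Antiderivative of sin(\<theta> + c) (f'' + f) for f = (1 + v)^p: the shifted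
        sine lies in the kernel of the operator, and H is periodic.\<close>
      define H where "H \<theta> = real p * (1 + V 0 \<tau> \<theta>) ^ (p - 1) * V 1 \<tau> \<theta> * sin (\<theta> + c) - (1 + V 0 \<tau> \<theta>) ^ p * cos (\<theta> + c)" for \<theta>
      have d1: "(V 0 \<tau> has_real_derivative V 1 \<tau> \<theta>) (at \<theta>)" for \<theta> using V_DERIV[OF t, of 0 \<theta>] by simp
      have d2: "(V 1 \<tau> has_real_derivative V 2 \<tau> \<theta>) (at \<theta>)" for \<theta>
        using V_DERIV[OF t, of 1 \<theta>] by (simp add: numeral_2_eq_2)
      have s: "((\<lambda>\<theta>. sin (\<theta> + c)) has_real_derivative cos (\<theta> + c)) (at \<theta>)"
        "((\<lambda>\<theta>. cos (\<theta> + c)) has_real_derivative - sin (\<theta> + c)) (at \<theta>)" for \<theta>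
        by (auto intro!: derivative_eq_intros)
      note YD = Ypart_derivative[OF d1 d2, where p=p]
      have "(H has_real_derivative sin (\<theta> + c) * (Y \<tau> \<theta> + (1 + V 0 \<tau> \<theta>) ^ p)) (at \<theta>)" for \<theta>
        unfolding H_def[abs_def] Y_def
        by (rule DERIV_cong[OF DERIV_diff[OF DERIV_mult[OF YD(2) s(1)] DERIV_mult[OF YD(1) s(2)]]]) (simp add: algebra_simps)
      then have "((\<lambda>\<theta>. sin (\<theta> + c) * (Y \<tau> \<theta> + (1 + V 0 \<tau> \<theta>) ^ p)) has_integral H (2 * pi) - H 0) {0..2 * pi}"
        by (intro fundamental_theorem_of_calculus)
          (auto simp: real_derivative_vector[symmetric] intro: DERIV_subset)
      moreover have "H (2 * pi) = H 0"
        using V_periodic[of 0 \<tau> 0] V_periodic[of 1 \<tau> 0] sin_periodic[of c] cos_periodic[of c]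
        by (simp add: H_def add.commute)
      ultimately have Z: "((\<lambda>\<theta>. sin (\<theta> + c) * (Y \<tau> \<theta> + (1 + V 0 \<tau> \<theta>) ^ p)) has_integral 0) {0..2 * pi}" by simp
      have i: "(\<lambda>\<theta>. sin (\<theta> + c) / (1 + V 0 \<tau> \<theta>)) integrable_on {0..2 * pi}"
        using pos[OF t] by (intro integrable_continuous_real continuous_intros cVt t) (auto, smt (verit))
      show ?thesis unfolding F_def[abs_def] I_def
        using has_integral_diff[OF integrable_integral[OF i] Z] by (simp add: integral_unique)
    qed
    ultimately show ?thesis by (simp add: I_def[abs_def])
  qed
  have ID: "((\<lambda>\<tau>. exp (- \<tau>) * I \<tau>) has_real_derivative 0) (at \<tau> within {0..})" if "\<tau> \<in> {0..}" for \<tau>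
  proof -
    have "((\<lambda>\<tau>. exp (- \<tau>)) has_real_derivative - exp (- \<tau>)) (at \<tau> within {0..})" by (auto intro!: derivative_eq_intros)
    from DERIV_mult[OF this dI, of] that show ?thesis by (simp add: mult.commute)
  qed
  have I: "I 0 = exp (- \<tau>) * I \<tau>" if "0 \<le> \<tau>" for \<tau>
    using has_field_derivative_zero_constant[of "{0..}", OF _ ID] that by force
  have bI: "\<bar>I \<tau>\<bar> \<le> 2 * (2 * pi - 0)" if t: "0 \<le> \<tau>" for \<tau>
    unfolding I_def real_norm_def[symmetric]
  proof (rule integral_bound)
    show "continuous_on {0..2 * pi} (\<lambda>\<theta>. sin (\<theta> + c) / (1 + V 0 \<tau> \<theta>))"
      using pos[OF t] by (intro continuous_intros cVt t) (auto, smt (verit))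
    fix \<theta>
    have "\<bar>sin (\<theta> + c)\<bar> / (1 + V 0 \<tau> \<theta>) \<le> 1 / (1/2)" using pos[OF t, of \<theta>] by (intro frac_le) auto
    then show "norm (sin (\<theta> + c) / (1 + V 0 \<tau> \<theta>)) \<le> 2" using pos[OF t, of \<theta>] by (simp add: abs_divide)
  qed auto
  have "\<bar>I 0\<bar> \<le> exp (- real n) * (4 * pi)" for n :: nat
    using I[of "real n"] bI[of "real n"] by (auto simp: abs_mult intro!: mult_left_mono)
  moreover have "(\<lambda>n. exp (- real n) * (4 * pi)) \<longlonglongrightarrow> 0 * (4 * pi)"
    by (intro tendsto_mult tendsto_const filterlim_compose[OF exp_at_bot]
        filterlim_compose[OF filterlim_uminus_at_bot_at_top] filterlim_real_sequentially)
  ultimately have "\<bar>I 0\<bar> \<le> 0 * (4 * pi)" by (intro LIMSEQ_le_const) blast+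
  then show ?thesis by (simp add: I_def)
qed

end

section \<open>Uniqueness of Fourier coefficients and the initial value\<close>

lemma has_integral_reflect_2pi:
  fixes f :: "real \<Rightarrow> 'a::euclidean_space"
  assumes "(f has_integral I) {0..2 * pi}"
  shows "((\<lambda>\<theta>. f (2 * pi - \<theta>)) has_integral I) {0..2 * pi}"
proof -
  have "(f has_integral I) (cbox 0 (2 * pi))" using assms by simp
  from has_integral_affinity[OF this, of "-1" "2 * pi"]
  have "((\<lambda>x. f (2 * pi - x)) has_integral I) ((\<lambda>x. 2 * pi - x) ` {0..2 * pi})" by simp
  moreover have "(\<lambda>x. 2 * pi - x) ` {0..2 * pi} = {0..2 * pi}" by simp
  ultimately show ?thesis by simp
qed

definition no_modes :: "(real \<Rightarrow> real) \<Rightarrow> bool" where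
  "no_modes f \<longleftrightarrow> (\<forall>m::int. ((\<lambda>\<theta>. of_real (f \<theta>) * cis (of_int m * \<theta>)) has_integral 0) {0..2 * pi})"

lemma no_modes_mult:
  assumes f: "no_modes f" and g: "\<And>\<theta>. complex_of_real (g \<theta>) = a * cis \<theta> + b * cis (- \<theta>)"
  shows "no_modes (\<lambda>\<theta>. f \<theta> * g \<theta>)"
  unfolding no_modes_def
proof
  fix m
  have eq: "of_real (f \<theta> * g \<theta>) * cis (of_int m * \<theta>) =
    a * (of_real (f \<theta>) * cis (of_int (m + 1) * \<theta>)) + b * (of_real (f \<theta>) * cis (of_int (m - 1) * \<theta>))" for \<theta>
  proof -
    have "cis (of_int (m + 1) * \<theta>) = cis \<theta> * cis (of_int m * \<theta>)" "cis (of_int (m - 1) * \<theta>) = cis (- \<theta>) * cis (of_int m * \<theta>)"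
      by (simp_all add: cis_mult algebra_simps)
    then show ?thesis unfolding of_real_mult g by (simp add: algebra_simps)
  qed
  have "((\<lambda>\<theta>. a * (of_real (f \<theta>) * cis (of_int (m + 1) * \<theta>)) + b * (of_real (f \<theta>) * cis (of_int (m - 1) * \<theta>)))
      has_integral a * 0 + b * 0) {0..2 * pi}"
    using f unfolding no_modes_def by (intro has_integral_mult_right has_integral_add) blast+
  then show "((\<lambda>\<theta>. of_real (f \<theta> * g \<theta>) * cis (of_int m * \<theta>)) has_integral 0) {0..2 * pi}"
    unfolding eq by simp
qed

lemma no_modes_cos: "no_modes f \<Longrightarrow> no_modes (\<lambda>\<theta>. f \<theta> * cos \<theta>)"
  by (rule no_modes_mult[where a="1/2" and b="1/2"]) (simp_all add: complex_eq_iff)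

lemma no_modes_sin: "no_modes f \<Longrightarrow> no_modes (\<lambda>\<theta>. f \<theta> * sin \<theta>)"
  by (rule no_modes_mult[where a="- \<i> / 2" and b="\<i> / 2"]) (simp_all add: complex_eq_iff)

lemma no_modes_cos_power: "no_modes f \<Longrightarrow> no_modes (\<lambda>\<theta>. f \<theta> * cos \<theta> ^ k)"
proof (induction k)
  case (Suc k)
  from no_modes_cos[OF Suc.IH[OF Suc.prems]] show ?case by (simp add: mult_ac)
qed simp

lemma no_modes_integral: assumes "no_modes f" shows "(f has_integral 0) {0..2 * pi}"
proof -
  have "((\<lambda>\<theta>. complex_of_real (f \<theta>)) has_integral 0) {0..2 * pi}"
    using assms[unfolded no_modes_def, rule_format, of 0] by simp
  from has_integral_Re[OF this] show ?thesis by simp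
qed

lemma no_modes_poly:
  assumes f: "no_modes f" and g: "real_polynomial_function g"
  shows "((\<lambda>\<theta>. f \<theta> * g (cos \<theta>)) has_integral 0) {0..2 * pi}"
proof -
  obtain a n where g: "g = (\<lambda>x. \<Sum>i\<le>n. a i * x ^ i)"
    using g real_polynomial_function_iff_sum by blast
  have "((\<lambda>\<theta>. \<Sum>i\<le>n. a i * (f \<theta> * cos \<theta> ^ i)) has_integral (\<Sum>i\<le>n. a i * 0)) {0..2 * pi}"
    by (intro has_integral_sum has_integral_mult_right no_modes_integral no_modes_cos_power f) auto
  then show ?thesis by (simp add: g sum_distrib_left mult_ac)
qed

text \<open>The part of f that is even about pi is a continuous function of the cosine. Polynomials
  in the cosine are orthogonal to it, so by Weierstrass approximation on [-1, 1] it is orthogonal to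
  itself.\<close>

lemma no_modes_even_part:
  assumes c: "continuous_on {0..2 * pi} f" and f: "no_modes f" and t: "\<theta> \<in> {0..2 * pi}"
  shows "f \<theta> + f (2 * pi - \<theta>) = 0"
proof -
  define F where "F \<theta> = f \<theta> + f (2 * pi - \<theta>)" for \<theta>
  define G where "G x = F (arccos x)" for x
  have cr: "continuous_on {0..2 * pi} (\<lambda>\<theta>. f (2 * pi - \<theta>))"
    by (rule continuous_on_compose2[OF c]) (auto intro!: continuous_intros)
  have cF: "continuous_on {0..2 * pi} F" unfolding F_def[abs_def] by (intro continuous_intros c cr)
  have cG: "continuous_on {-1..1} G"
    unfolding G_def[abs_def]
  proof (rule continuous_on_compose2[OF cF continuous_on_arccos'])
    show "arccos ` {- 1..1} \<subseteq> {0..2 * pi}"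
    proof
      fix y assume "y \<in> arccos ` {- 1..1}"
      then have "0 \<le> y \<and> y \<le> pi" using arccos_bounded by auto
      then show "y \<in> {0..2 * pi}" by auto
    qed
  qed
  have FG: "F \<theta> = G (cos \<theta>)" if "\<theta> \<in> {0..2 * pi}" for \<theta>
  proof (cases "\<theta> \<le> pi")
    case True
    then show ?thesis using that by (simp add: G_def arccos_cos)
  next
    case False
    have "arccos (cos \<theta>) = arccos (cos (2 * pi - \<theta>))" by (simp add: cos_diff)
    also have "\<dots> = 2 * pi - \<theta>" using False that by (intro arccos_cos) auto
    finally show ?thesis by (simp add: G_def F_def)
  qed
  have P: "((\<lambda>\<theta>. F \<theta> * g (cos \<theta>)) has_integral 0) {0..2 * pi}" if "real_polynomial_function g" for g
  proof -
    have "((\<lambda>\<theta>. f \<theta> * g (cos \<theta>) + f (2 * pi - \<theta>) * g (cos (2 * pi - \<theta>))) has_integral 0 + 0) {0..2 * pi}"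
      by (intro has_integral_add no_modes_poly[OF f that] has_integral_reflect_2pi[OF no_modes_poly[OF f that]])
    moreover have "cos (2 * pi - \<theta>) = cos \<theta>" for \<theta> by (simp add: cos_diff)
    ultimately show ?thesis by (simp add: F_def distrib_right)
  qed
  define K where "K = integral {0..2 * pi} (\<lambda>\<theta>. \<bar>F \<theta>\<bar>)"
  have iF: "(\<lambda>\<theta>. F \<theta> * F \<theta>) integrable_on {0..2 * pi}" "(\<lambda>\<theta>. \<bar>F \<theta>\<bar>) integrable_on {0..2 * pi}"
    by (intro integrable_continuous_real continuous_intros cF)+
  have le: "integral {0..2 * pi} (\<lambda>\<theta>. F \<theta> * F \<theta>) \<le> e * K" if e: "0 < e" for e
  proof -
    obtain g where g: "real_polynomial_function g" "\<And>x. x \<in> {-1..1} \<Longrightarrow> \<bar>G x - g x\<bar> < e"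
      using Stone_Weierstrass_real_polynomial_function[OF compact_Icc cG e] by blast
    have "((\<lambda>\<theta>. F \<theta> * F \<theta> - F \<theta> * g (cos \<theta>)) has_integral integral {0..2 * pi} (\<lambda>\<theta>. F \<theta> * F \<theta>) - 0) {0..2 * pi}"
      by (intro has_integral_diff integrable_integral iF P g)
    moreover have "((\<lambda>\<theta>. e * \<bar>F \<theta>\<bar>) has_integral e * K) {0..2 * pi}"
      unfolding K_def by (intro has_integral_mult_right integrable_integral iF)
    ultimately have "integral {0..2 * pi} (\<lambda>\<theta>. F \<theta> * F \<theta>) - 0 \<le> e * K"
    proof (rule has_integral_le)
      fix \<theta> assume t: "\<theta> \<in> {0..2 * pi}"
      have "F \<theta> * (F \<theta> - g (cos \<theta>)) \<le> \<bar>F \<theta>\<bar> * \<bar>F \<theta> - g (cos \<theta>)\<bar>" by (metis abs_ge_self abs_mult)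
      also have "\<dots> \<le> \<bar>F \<theta>\<bar> * e" using g(2)[of "cos \<theta>"] FG[OF t] by (intro mult_left_mono) auto
      finally show "F \<theta> * F \<theta> - F \<theta> * g (cos \<theta>) \<le> e * \<bar>F \<theta>\<bar>" by (simp add: algebra_simps)
    qed
    then show ?thesis by simp
  qed
  have K: "0 \<le> K" unfolding K_def by (intro integral_nonneg iF) auto
  have "integral {0..2 * pi} (\<lambda>\<theta>. F \<theta> * F \<theta>) \<le> 0"
  proof (rule field_le_epsilon)
    fix e :: real assume e: "0 < e"
    have "integral {0..2 * pi} (\<lambda>\<theta>. F \<theta> * F \<theta>) \<le> e / (K + 1) * K" using le[of "e / (K + 1)"] e K by simp
    also have "\<dots> \<le> e" using e K by (simp add: field_simps)
    finally show "integral {0..2 * pi} (\<lambda>\<theta>. F \<theta> * F \<theta>) \<le> 0 + e" by simp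
  qed
  moreover have "0 \<le> integral {0..2 * pi} (\<lambda>\<theta>. F \<theta> * F \<theta>)" by (intro integral_nonneg iF) auto
  ultimately have "integral {0..2 * pi} (\<lambda>\<theta>. F \<theta> * F \<theta>) = 0" by simp
  then have "F \<theta> * F \<theta> = 0"
    using integral_eq_0_iff[OF continuous_on_mult[OF cF cF]] t by simp
  then show ?thesis by (simp add: F_def)
qed

text \<open>The even part vanishes for f and for f times the sine; the latter deals with the odd
  part of f wherever the sine is nonzero. The three remaining points do not affect the integral of
  f^2, and continuity finishes.\<close>

lemma no_modes_zero:
  assumes c: "continuous_on {0..2 * pi} f" and f: "no_modes f" and t: "\<theta> \<in> {0..2 * pi}"
  shows "f \<theta> = 0"
proof -
  have z: "f x = 0" if x: "x \<in> {0..2 * pi}" "sin x \<noteq> 0" for x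
  proof -
    have "f x * sin x + f (2 * pi - x) * sin (2 * pi - x) = 0"
      by (rule no_modes_even_part[OF continuous_on_mult[OF c continuous_on_sin[OF continuous_on_id]] no_modes_sin[OF f] x(1)])
    moreover have "f (2 * pi - x) = - f x" using no_modes_even_part[OF c f x(1)] by linarith
    moreover have "sin (2 * pi - x) = - sin x" by (simp add: sin_diff)
    ultimately have "2 * (f x * sin x) = 0" by (simp only:)
    then show ?thesis using x(2) by simp
  qed
  have "((\<lambda>x. f x * f x) has_integral 0) {0..2 * pi}"
  proof (rule has_integral_spike_finite[of "{0, pi, 2 * pi}"])
    fix x assume x: "x \<in> {0..2 * pi} - {0, pi, 2 * pi}"
    have "sin x \<noteq> 0"
    proof (cases "x < pi")
      case True then show ?thesis using x sin_gt_zero[of x] by auto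
    next
      case False then show ?thesis using x sin_lt_zero[of x] by auto
    qed
    then show "f x * f x = 0" using z x by auto
  qed auto
  then have "integral {0..2 * pi} (\<lambda>x. f x * f x) = 0" by (rule integral_unique)
  then have "f \<theta> * f \<theta> = 0"
    using integral_eq_0_iff[OF continuous_on_mult[OF c c]] t by simp
  then show ?thesis by simp
qed

lemma cis_integral:
  "((\<lambda>\<theta>. cis (of_int k * \<theta>)) has_integral (if k = 0 then 2 * pi else 0)) {0..2 * pi}"
proof (cases "k = 0")
  case True
  then show ?thesis using has_integral_const_real[of "1::complex" 0 "2 * pi"] by (simp add: scaleR_conv_of_real)
next
  case False
  define F where "F \<theta> = cis (of_int k * \<theta>) / (\<i> * of_int k)" for \<theta>
  have "(F has_vector_derivative cis (of_int k * \<theta>)) (at \<theta> within {0..2 * pi})" for \<theta>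
  proof -
    have "((\<lambda>\<theta>. cis (of_int k * \<theta>)) has_vector_derivative (real_of_int k) *\<^sub>R (\<i> * cis (of_int k * \<theta>))) (at \<theta> within {0..2 * pi})"
      by (rule vector_diff_chain_within[where g=cis and f="\<lambda>\<theta>. real_of_int k * \<theta>", unfolded o_def])
        (auto intro!: derivative_eq_intros simp: has_vector_derivative_complex_iff real_derivative_vector[symmetric])
    from has_vector_derivative_divide[OF this, of "\<i> * of_int k"] show ?thesis
      using False by (simp add: F_def[abs_def] scaleR_conv_of_real)
  qed
  then have "((\<lambda>\<theta>. cis (of_int k * \<theta>)) has_integral F (2 * pi) - F 0) {0..2 * pi}"
    by (intro fundamental_theorem_of_calculus) auto
  moreover have "cis (of_int k * (2 * pi)) = 1" using cis_multiple_2pi[of "real_of_int k"] by (simp add: mult_ac)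
  ultimately show ?thesis using False by (simp add: F_def)
qed

lemma fourier_coeff_cis:
  "fourier_coeff f n = 1 / (2 * pi) * integral {0..2 * pi} (\<lambda>\<theta>. of_real (f \<theta>) * cis (of_int (- n) * \<theta>))"
proof -
  have "exp (- (\<i> * of_int n * of_real \<theta>)) = cis (of_int (- n) * \<theta>)" for \<theta>
    by (simp add: cis_conv_exp mult_ac)
  then show ?thesis by (simp add: fourier_coeff_def)
qed

text \<open>Termwise integration by uniform convergence: the integral of a finite partial sum is
  already final once the index set contains n.\<close>

lemma fourier_coeff_ser:
  fixes c :: coeffs
  assumes c: "rapid1 c" "cnj_sym c"
  shows "((\<lambda>\<theta>. of_real (ser c 0 \<theta>) * cis (of_int (- n) * \<theta>)) has_integral 2 * pi * c n) {0..2 * pi}"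
proof -
  obtain A where A: "\<And>n. \<bar>real_of_int n\<bar> ^ 0 * norm (c n) \<le> A / bra n"
    using c(1) unfolding rapid1_def by blast
  have eq: "of_real (ser c 0 \<theta>) * cis (of_int (- n) * \<theta>) = (\<Sum>\<^sub>\<infinity>m. c m * cis (of_int (m - n) * \<theta>))" for \<theta>
  proof -
    have "of_real (ser c 0 \<theta>) = cser c \<theta>"
      using ser_Re_cser[OF rapid1_summable[OF c(1)], of \<theta>] cser_real[OF rapid1_summable[OF c(1)] c(2), of \<theta>]
      by (simp add: complex_eq_iff)
    then have "of_real (ser c 0 \<theta>) * cis (of_int (- n) * \<theta>) = (\<Sum>\<^sub>\<infinity>m. c m * cis (of_int m * \<theta>) * cis (of_int (- n) * \<theta>))"
      by (simp add: cser_def infsum_cmult_left')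
    also have "\<dots> = (\<Sum>\<^sub>\<infinity>m. c m * cis (of_int (m - n) * \<theta>))"
      by (intro infsum_cong) (simp add: mult.assoc cis_mult left_diff_distrib)
    finally show ?thesis .
  qed
  have u: "uniform_limit {0..2 * pi} (\<lambda>X \<theta>. \<Sum>m\<in>X. c m * cis (of_int (m - n) * \<theta>))
     (\<lambda>\<theta>. \<Sum>\<^sub>\<infinity>m. c m * cis (of_int (m - n) * \<theta>)) (finite_subsets_at_top UNIV)"
    by (rule Weierstrass_m_test_general[OF _ bra_summable_mult[of A]]) (use A in \<open>auto simp: norm_mult\<close>)
  have cc: "continuous_on {0..2 * pi} (\<lambda>\<theta>. \<Sum>m\<in>X. c m * cis (of_int (m - n) * \<theta>))" for X
    by (intro continuous_intros continuous_on_compose2[OF continuous_on_cis]) auto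
  obtain I J where I: "\<And>X. ((\<lambda>\<theta>. \<Sum>m\<in>X. c m * cis (of_int (m - n) * \<theta>)) has_integral I X) {0..2 * pi}"
    and J: "((\<lambda>\<theta>. \<Sum>\<^sub>\<infinity>m. c m * cis (of_int (m - n) * \<theta>)) has_integral J) {0..2 * pi}"
    and IJ: "(I \<longlongrightarrow> J) (finite_subsets_at_top UNIV)"
    by (rule uniform_limit_integral[OF u cc]) auto
  have "I X = 2 * pi * c n" if "finite X" "n \<in> X" for X
  proof -
    have "((\<lambda>\<theta>. \<Sum>m\<in>X. c m * cis (of_int (m - n) * \<theta>)) has_integral (\<Sum>m\<in>X. c m * of_real (if m - n = 0 then 2 * pi else 0))) {0..2 * pi}"
      using that by (intro has_integral_sum has_integral_mult_right cis_integral) auto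
    then have "I X = (\<Sum>m\<in>X. c m * of_real (if m - n = 0 then 2 * pi else 0))" using I has_integral_unique by blast
    also have "\<dots> = (\<Sum>m\<in>X. if m = n then c m * of_real (2 * pi) else 0)" by (intro sum.cong) auto
    also have "\<dots> = c n * of_real (2 * pi)" using that by (simp add: sum.delta)
    finally show ?thesis by simp
  qed
  then have "\<forall>\<^sub>F X in finite_subsets_at_top UNIV. I X = 2 * pi * c n"
    unfolding eventually_finite_subsets_at_top by (intro exI[of _ "{n}"]) auto
  then have "(I \<longlongrightarrow> 2 * pi * c n) (finite_subsets_at_top UNIV)" by (rule tendsto_eventually)
  then have "J = 2 * pi * c n" using IJ tendsto_unique by (metis finite_subsets_at_top_neq_bot)
  then show ?thesis using J unfolding eq by simp
qed

section \<open>Decay of the Fourier coefficients of smooth functions\<close>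

lemma fourier_coeff_derivative:
  assumes D: "\<And>u. (f has_real_derivative f' u) (at u)" and f': "continuous_on UNIV f'"
    and per: "f (2 * pi) = f 0"
  shows "fourier_coeff f' n = \<i> * of_int n * fourier_coeff f n"
proof -
  define e where "e \<theta> = cis (of_int (- n) * \<theta>)" for \<theta>
  have cf: "continuous_on UNIV f" using D DERIV_continuous_on by blast
  have ce: "continuous_on A e" for A
    unfolding e_def[abs_def] by (intro continuous_on_compose2[OF continuous_on_cis, of UNIV]) (auto intro!: continuous_intros)
  have de: "(e has_vector_derivative - (\<i> * of_int n) * e \<theta>) (at \<theta> within S)" for \<theta> S
  proof -
    have "(e has_vector_derivative (real_of_int (- n)) *\<^sub>R (\<i> * e \<theta>)) (at \<theta> within S)"
      unfolding e_def[abs_def]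
      by (rule vector_diff_chain_within[where g=cis and f="\<lambda>\<theta>. real_of_int (- n) * \<theta>", unfolded o_def])
        (auto intro!: derivative_eq_intros simp: has_vector_derivative_complex_iff real_derivative_vector[symmetric])
    then show ?thesis by (simp add: scaleR_conv_of_real mult_ac)
  qed
  have df: "((\<lambda>\<theta>. complex_of_real (f \<theta>)) has_vector_derivative of_real (f' \<theta>)) (at \<theta> within S)" for \<theta> S
    using D[of \<theta>] by (intro has_vector_derivative_of_real)
      (auto simp: real_derivative_vector intro: has_vector_derivative_at_within)
  have "((\<lambda>\<theta>. of_real (f \<theta>) * e \<theta>) has_vector_derivative
     of_real (f \<theta>) * (- (\<i> * of_int n) * e \<theta>) + of_real (f' \<theta>) * e \<theta>) (at \<theta> within {0..2 * pi})" for \<theta>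
    by (rule has_vector_derivative_mult[OF df de])
  then have "((\<lambda>\<theta>. of_real (f \<theta>) * (- (\<i> * of_int n) * e \<theta>) + of_real (f' \<theta>) * e \<theta>) has_integral
     of_real (f (2 * pi)) * e (2 * pi) - of_real (f 0) * e 0) {0..2 * pi}"
    by (intro fundamental_theorem_of_calculus) auto
  moreover have "e (2 * pi) = e 0"
    using cis_multiple_2pi[of "real_of_int (- n)"] by (simp add: e_def mult_ac)
  ultimately have 1: "((\<lambda>\<theta>. of_real (f \<theta>) * (- (\<i> * of_int n) * e \<theta>) + of_real (f' \<theta>) * e \<theta>) has_integral 0) {0..2 * pi}"
    using per by simp
  have i: "(\<lambda>\<theta>. of_real (f \<theta>) * e \<theta>) integrable_on {0..2 * pi}"
    by (intro integrable_continuous_real continuous_intros ce continuous_on_subset[OF cf]) auto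
  have "((\<lambda>\<theta>. (\<i> * of_int n) * (of_real (f \<theta>) * e \<theta>)) has_integral (\<i> * of_int n) * integral {0..2 * pi} (\<lambda>\<theta>. of_real (f \<theta>) * e \<theta>)) {0..2 * pi}"
    by (intro has_integral_mult_right integrable_integral i)
  from has_integral_add[OF 1 this]
  have "((\<lambda>\<theta>. of_real (f' \<theta>) * e \<theta>) has_integral (\<i> * of_int n) * integral {0..2 * pi} (\<lambda>\<theta>. of_real (f \<theta>) * e \<theta>)) {0..2 * pi}"
    by (simp add: algebra_simps)
  then have "integral {0..2 * pi} (\<lambda>\<theta>. of_real (f' \<theta>) * e \<theta>) = (\<i> * of_int n) * integral {0..2 * pi} (\<lambda>\<theta>. of_real (f \<theta>) * e \<theta>)"
    by (rule integral_unique)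
  then show ?thesis unfolding fourier_coeff_cis e_def by simp
qed

lemma fourier_coeff_bound:
  assumes c: "continuous_on {0..2 * pi} f"
  shows "\<exists>B. \<forall>n. norm (fourier_coeff f n) \<le> B"
proof -
  obtain B where B: "\<forall>x\<in>f ` {0..2 * pi}. norm x \<le> B"
    using compact_imp_bounded[OF compact_continuous_image[OF c compact_Icc]] unfolding bounded_iff by blast
  have "norm (fourier_coeff f n) \<le> B" for n
  proof -
    have "norm (integral {0..2 * pi} (\<lambda>\<theta>. of_real (f \<theta>) * cis (of_int (- n) * \<theta>))) \<le> B * (2 * pi - 0)"
      by (rule integral_bound) (use B in \<open>auto intro!: continuous_intros continuous_on_compose2[OF continuous_on_cis, of UNIV] c simp: norm_mult\<close>)
    then show ?thesis unfolding fourier_coeff_cis by (simp add: norm_mult norm_divide field_simps)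
  qed
  then show ?thesis by blast
qed

lemma smooth_fourier_decay:
  assumes D: "\<And>j u. (D j has_real_derivative D (Suc j) u) (at u)" and per: "\<And>u. D 0 (u + 2 * pi) = D 0 u"
  shows "\<exists>B. \<forall>n. \<bar>of_int n\<bar> ^ j * norm (fourier_coeff (D 0) n) \<le> B"
proof -
  have c: "continuous_on UNIV (D j)" for j using D DERIV_continuous_on by blast
  have perj: "D j (u + 2 * pi) = D j u" for j u
  proof (induction j arbitrary: u)
    case (Suc j)
    have "((\<lambda>u. D j (u + 2 * pi)) has_real_derivative D (Suc j) (u + 2 * pi)) (at u)"
      using D[of j "u + 2 * pi"] DERIV_shift[of "D j" "D (Suc j) (u + 2 * pi)" u "2 * pi"] by simp
    moreover have "(\<lambda>u. D j (u + 2 * pi)) = D j" using Suc.IH by blast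
    ultimately show ?case using D[of j u] DERIV_unique by metis
  qed (rule per)
  have "fourier_coeff (D j) n = (\<i> * of_int n) ^ j * fourier_coeff (D 0) n" for n
  proof (induction j)
    case (Suc j)
    have "D j (2 * pi) = D j 0" using perj[of j 0] by simp
    from fourier_coeff_derivative[OF D c this, of n] Suc show ?case by (simp add: mult_ac)
  qed simp
  then have "norm (fourier_coeff (D j) n) = \<bar>of_int n\<bar> ^ j * norm (fourier_coeff (D 0) n)" for n
    by (simp add: norm_mult norm_power)
  then show ?thesis using fourier_coeff_bound[of "D j"] continuous_on_subset[OF c] by (metis subset_UNIV)
qed

text \<open>Up to a threshold R the weight is at most 2 by the choice of \<delta>, which uses up the
  factor 1/2 in the hypothesis. Beyond R the rapid decay of \<beta> beats the weight.\<close>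

lemma pweight_choice:
  assumes \<eta>: "0 < \<eta>" and b: "EB (\<lambda>_. 1) (\<eta> / 2) \<beta>" and B: "\<And>k. \<exists>B. \<forall>n. \<bar>of_int n\<bar> ^ k * norm (\<beta> n) \<le> B"
  shows "\<exists>\<delta>>0. EB (pweight \<delta> j) \<eta> \<beta>"
proof -
  obtain B where B: "\<And>n. \<bar>of_int n\<bar> ^ (j + 3) * norm (\<beta> n) \<le> B" using B by blast
  \<comment> \<open>Of the j + 3 powers in the bound B, j pay for the weight and 2 for
    \<open>bra\<close>; the last one supplies the factor R.\<close>
  define R where "R = max 1 (2 ^ (j + 1) * B / \<eta>)"
  \<comment> \<open>Ensures (1 + \<delta> R)^j \<le> e^(j \<delta> R) \<le> 2; the 1 in the
    denominator covers j = 0.\<close>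
  define \<delta> where "\<delta> = min 1 (ln 2 / (real j * R + 1))"
  have R: "1 \<le> R" "2 ^ (j + 1) * B \<le> \<eta> * R"
  proof -
    have "2 ^ (j + 1) * B / \<eta> \<le> R" by (simp add: R_def)
    then show "2 ^ (j + 1) * B \<le> \<eta> * R" using \<eta> by (simp add: field_simps)
  qed (simp add: R_def)
  have jR: "0 < real j * R + 1" using R by (simp add: add_nonneg_pos)
  have d: "0 < \<delta>" "\<delta> \<le> 1" "\<delta> * (real j * R + 1) \<le> ln 2"
  proof -
    have "\<delta> * (real j * R + 1) \<le> ln 2 / (real j * R + 1) * (real j * R + 1)"
      using jR by (intro mult_right_mono) (auto simp: \<delta>_def)
    then show "\<delta> * (real j * R + 1) \<le> ln 2" using jR by simp
  qed (use jR in \<open>auto simp: \<delta>_def\<close>)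
  have "norm (\<beta> n) \<le> \<eta> / (bra n * pweight \<delta> j n)" for n
  proof (cases "\<bar>real_of_int n\<bar> \<le> R")
    case True
    have "1 + \<delta> * \<bar>real_of_int n\<bar> \<le> exp (\<delta> * R)"
    proof -
      have "\<delta> * \<bar>real_of_int n\<bar> \<le> \<delta> * R" using True d by (intro mult_left_mono) auto
      then show ?thesis using exp_ge_add_one_self[of "\<delta> * R"] by linarith
    qed
    then have "pweight \<delta> j n \<le> exp (\<delta> * R) ^ j" unfolding pweight_def using d by (intro power_mono) auto
    also have "\<dots> = exp (\<delta> * (real j * R))" by (simp add: exp_of_nat_mult[symmetric] mult_ac)
    also have "\<dots> \<le> exp (ln 2)"
      using d R unfolding exp_le_cancel_iff by (simp add: distrib_left)
    finally have 2: "pweight \<delta> j n \<le> 2" by simp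
    have p: "0 < pweight \<delta> j n" using weight_pos[OF pweight_submult] d by auto
    have "norm (\<beta> n) \<le> \<eta> / 2 / (bra n * 1)" using b by (simp add: EB_def)
    also have "\<dots> \<le> \<eta> / (bra n * pweight \<delta> j n)"
    proof -
      have "\<eta> / (bra n * 2) \<le> \<eta> / (bra n * pweight \<delta> j n)"
        using 2 p \<eta> by (intro divide_left_mono mult_left_mono) auto
      then show ?thesis by (simp add: mult_ac)
    qed
    finally show ?thesis .
  next
    case False
    define x where "x = \<bar>real_of_int n\<bar>"
    have x: "1 \<le> x" "R < x" using False R by (auto simp: x_def)
    have p: "0 < pweight \<delta> j n" using weight_pos[OF pweight_submult] d by auto
    have "1 + \<delta> * x \<le> 2 * x" using x mult_right_mono[OF d(2), of x] by linarith
    then have "pweight \<delta> j n \<le> (2 * x) ^ j" unfolding pweight_def x_def[symmetric] using d x by (intro power_mono) auto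
    moreover have "bra n \<le> 2 * x\<^sup>2" using x power_mono[of 1 x 2] by (simp add: bra_def x_def)
    ultimately have "bra n * pweight \<delta> j n \<le> (2 * x\<^sup>2) * (2 * x) ^ j" using p by (intro mult_mono) auto
    also have "\<dots> = 2 ^ (j + 1) * x ^ (j + 2)" by (simp add: power_mult_distrib power_add power2_eq_square)
    finally have "bra n * pweight \<delta> j n * norm (\<beta> n) * x \<le> 2 ^ (j + 1) * x ^ (j + 2) * norm (\<beta> n) * x"
      using x by (intro mult_right_mono) auto
    also have "\<dots> = 2 ^ (j + 1) * (x ^ (j + 3) * norm (\<beta> n))" by (simp add: power_add power3_eq_cube power2_eq_square)
    also have "\<dots> \<le> 2 ^ (j + 1) * B" using B by (intro mult_left_mono) (auto simp: x_def)
    also have "\<dots> \<le> \<eta> * x" using R(2) x \<eta> mult_left_mono[of R x \<eta>] by linarith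
    finally have "bra n * pweight \<delta> j n * norm (\<beta> n) \<le> \<eta>" using x by simp
    then show ?thesis using p by (simp add: pos_le_divide_eq mult_ac)
  qed
  then show ?thesis using d(1) unfolding EB_def by blast
qed

lemma fourier_coeff_cnj: "fourier_coeff f (- n) = cnj (fourier_coeff f n)"
proof -
  have "cnj (integral {0..2 * pi} (\<lambda>\<theta>. of_real (f \<theta>) * cis (of_int (- n) * \<theta>))) =
      integral {0..2 * pi} (\<lambda>\<theta>. of_real (f \<theta>) * cis (of_int n * \<theta>))"
    unfolding Henstock_Kurzweil_Integration.integral_cnj by (simp add: cis_cnj)
  then show ?thesis by (simp add: fourier_coeff_cis)
qed

text \<open>Smoothness makes the sets in \<open>fourier_seminorm\<close> bounded, so each element is
  below the supremum. The factor 2 comes from bounding the modulus by the real and imaginary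
  parts.\<close>

lemma fourier_seminorm_2_le:
  assumes D: "\<And>j u. (D j has_real_derivative D (Suc j) u) (at u)" and per: "\<And>u. D 0 (u + 2 * pi) = D 0 u"
  shows "(real_of_int n)\<^sup>2 * norm (fourier_coeff (D 0) n) \<le> 2 * fourier_seminorm 2 (D 0)"
proof -
  obtain B where B: "\<And>n. \<bar>real_of_int n\<bar> ^ 2 * norm (fourier_coeff (D 0) n) \<le> B"
    using smooth_fourier_decay[OF D per] by blast
  have "\<bar>real_of_int n\<bar> ^ 2 * \<bar>Re (fourier_coeff (D 0) n)\<bar> \<le> B" "\<bar>real_of_int n\<bar> ^ 2 * \<bar>Im (fourier_coeff (D 0) n)\<bar> \<le> B" for n
    using B[of n] mult_left_mono[OF abs_Re_le_cmod[of "fourier_coeff (D 0) n"], of "\<bar>real_of_int n\<bar> ^ 2"]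
     mult_left_mono[OF abs_Im_le_cmod[of "fourier_coeff (D 0) n"], of "\<bar>real_of_int n\<bar> ^ 2"] by auto
  then have bd: "bdd_above (range (\<lambda>\<xi>. \<bar>real_of_int \<xi>\<bar> ^ 2 * \<bar>Re (fourier_coeff (D 0) \<xi>)\<bar>))"
     "bdd_above (range (\<lambda>\<xi>. \<bar>real_of_int \<xi>\<bar> ^ 2 * \<bar>Im (fourier_coeff (D 0) \<xi>)\<bar>))"
    by (auto intro!: bdd_aboveI)
  have "\<bar>real_of_int n\<bar> ^ 2 * \<bar>Re (fourier_coeff (D 0) n)\<bar> \<le> fourier_seminorm 2 (D 0)"
    "\<bar>real_of_int n\<bar> ^ 2 * \<bar>Im (fourier_coeff (D 0) n)\<bar> \<le> fourier_seminorm 2 (D 0)"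
    unfolding fourier_seminorm_def
    using cSUP_upper[OF UNIV_I bd(1), of n] cSUP_upper[OF UNIV_I bd(2), of n] by linarith+
  moreover have "\<bar>real_of_int n\<bar> ^ 2 * norm (fourier_coeff (D 0) n) \<le>
     \<bar>real_of_int n\<bar> ^ 2 * (\<bar>Re (fourier_coeff (D 0) n)\<bar> + \<bar>Im (fourier_coeff (D 0) n)\<bar>)"
    by (intro mult_left_mono cmod_le) auto
  ultimately show ?thesis by (simp add: distrib_left)
qed

lemma fourier_coeff_0_pos:
  assumes c: "continuous_on {0..2 * pi} \<psi>" and pos: "\<And>u. 0 < \<psi> u"
  shows "0 < Re (fourier_coeff \<psi> 0)"
proof -
  have "integral {0..2 * pi} \<psi> \<noteq> 0"
  proof
    assume "integral {0..2 * pi} \<psi> = 0"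
    then have "\<forall>x\<in>{0..2 * pi}. \<psi> x = 0"
      using integral_eq_0_iff[of 0 "2 * pi" \<psi>, OF c] pos by (simp add: less_imp_le)
    then have "\<psi> 0 = 0" by simp
    then show False using pos[of 0] by simp
  qed
  moreover have "0 \<le> integral {0..2 * pi} \<psi>"
    using pos by (intro integral_nonneg integrable_continuous_real c) (auto simp: less_imp_le)
  ultimately have I: "0 < integral {0..2 * pi} \<psi>" by simp
  have "fourier_coeff \<psi> 0 = 1 / (2 * pi) * of_real (integral {0..2 * pi} \<psi>)"
  proof -
    have "(\<psi> has_integral integral {0..2 * pi} \<psi>) {0..2 * pi}"
      by (intro integrable_integral integrable_continuous_real c)
    from has_integral_linear[OF this bounded_linear_of_real[where 'a=complex]]
    show ?thesis unfolding fourier_coeff_cis by (simp add: o_def integral_unique)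
  qed
  also have "\<dots> = of_real (1 / (2 * pi) * integral {0..2 * pi} \<psi>)" by simp
  finally have "Re (fourier_coeff \<psi> 0) = 1 / (2 * pi) * integral {0..2 * pi} \<psi>"
    by (simp only: Re_complex_of_real)
  then show ?thesis using I by simp
qed

lemma rapid1_finite:
  assumes "\<And>n. n \<notin> {- 1, 0, 1} \<Longrightarrow> c n = 0"
  shows "rapid1 c"
  unfolding rapid1_def
proof
  fix j
  have "\<bar>of_int n\<bar> ^ j * norm (c n) \<le> 2 * (norm (c (- 1)) + norm (c 0) + norm (c 1)) / bra n" for n
  proof (cases "n \<in> {- 1, 0, 1}")
    case True
    have b: "bra n \<le> 2" using True by (auto simp: bra_def)
    have "\<bar>of_int n\<bar> ^ j * norm (c n) \<le> 1 * norm (c n)" using True by (intro mult_right_mono) (auto simp: power_0_left)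
    also have "\<dots> \<le> norm (c (- 1)) + norm (c 0) + norm (c 1)" using True by auto
    finally have 1: "\<bar>of_int n\<bar> ^ j * norm (c n) \<le> norm (c (- 1)) + norm (c 0) + norm (c 1)" .
    have "\<bar>of_int n\<bar> ^ j * norm (c n) * bra n \<le> (norm (c (- 1)) + norm (c 0) + norm (c 1)) * 2"
      using 1 b by (intro mult_mono) auto
    then show ?thesis by (simp add: pos_le_divide_eq mult_ac)
  qed (use assms in simp)
  then show "\<exists>A. \<forall>n. \<bar>of_int n\<bar> ^ j * norm (c n) \<le> A / bra n" by blast
qed

text \<open>The list V consists of the normalised curvature minus 1 and its space derivatives. The
  factor a scales \<psi> to the initial value of the decaying solution; it determines the blow-up
  time.\<close>

locale rescaled_solution =
  fixes p :: nat and a :: real and \<psi> :: "real \<Rightarrow> real" and V :: "nat \<Rightarrow> tfun"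
  assumes p1: "1 \<le> p" and a: "0 < a" and V_Cinf: "Cinf {0..} (V j)"
    and V_du: "\<And>j \<tau> \<theta>. 0 \<le> \<tau> \<Longrightarrow> (V j \<tau> has_real_derivative V (Suc j) \<tau> \<theta>) (at \<theta>)"
    and V_dt: "\<And>\<tau> \<theta>. 0 \<le> \<tau> \<Longrightarrow> ((\<lambda>s. V 0 s \<theta>) has_real_derivative Gpart p (V 0 \<tau> \<theta>) (V 1 \<tau> \<theta>) (V 2 \<tau> \<theta>)) (at \<tau> within {0..})"
    and V_small: "\<And>\<tau> \<theta>. 0 \<le> \<tau> \<Longrightarrow> \<bar>V 0 \<tau> \<theta>\<bar> \<le> 1 / 2" and V_per: "\<And>\<tau> \<theta>. V 0 \<tau> (\<theta> + 2 * pi) = V 0 \<tau> \<theta>"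
    and V_init: "\<And>\<theta>. a * \<psi> \<theta> = 1 + V 0 0 \<theta>"

text \<open>The initial value of the fixed point has the stable modes of \<open>a * \<psi>\<close>
  and, by the choice of a, its mean. The discrepancy E in the modes 1 and -1 is removed by
  subtracting the closing integrals of \<psi> and of the solution.\<close>

theorem rescaled_solution_exists:
  assumes p: "1 \<le> p"
  shows "\<exists>c>0. \<forall>\<psi> D. D 0 = \<psi> \<and> (\<forall>j u. (D j has_real_derivative D (Suc j) u) (at u)) \<and> (\<forall>u. \<psi> (u + 2 * pi) = \<psi> u) \<and>
    (\<forall>u. 0 < \<psi> u) \<and> (\<forall>r. integral {0..2 * pi} (\<lambda>\<theta>. sin (\<theta> + r) / \<psi> \<theta>) = 0) \<and>
    c * fourier_seminorm 2 \<psi> \<le> Re (fourier_coeff \<psi> 0) \<longrightarrow>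
    (\<exists>a V. rescaled_solution p a \<psi> V \<and> (\<forall>j. \<exists>A. \<forall>\<tau>\<ge>0. \<forall>\<theta>. \<bar>V j \<tau> \<theta>\<bar> \<le> A * exp (- mu p * \<tau>)))"
proof -
  have "0 < min 1 (1 / (2 * S0))" using S0_ge_1 by simp
  from LP_fixed_point[OF p this] obtain M \<eta> where FP: "0 < M \<and> M \<le> min 1 (1 / (2 * S0)) \<and> 0 < \<eta> \<and> (\<forall>\<beta>. cnj_sym \<beta> \<and> EB (\<lambda>_. 1) \<eta> \<beta> \<longrightarrow>
    (\<exists>v. modes_continuous v \<and> (\<forall>\<tau>\<ge>0. cnj_sym (v \<tau>)) \<and> (\<forall>\<tau>\<ge>0. v \<tau> = LP p \<beta> v \<tau>) \<and>
      (\<forall>\<rho>. submult_weight \<rho> \<and> EB \<rho> \<eta> \<beta> \<longrightarrow> decaying p \<rho> M v)))"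
    by (elim exE)
  then have M: "0 < M" "M \<le> min 1 (1 / (2 * S0))" and \<eta>: "0 < \<eta>" by simp_all
  have MS: "M * S0 \<le> 1/2"
  proof -
    have "M * S0 \<le> 1 / (2 * S0) * S0" using M S0_ge_1 by (intro mult_right_mono) auto
    then show ?thesis using S0_ge_1 by simp
  qed
  show ?thesis
  \<comment> \<open>For |n| \<ge> 2, \<open>bra n\<close> is at most 2 n^2 and n^2 times the
    coefficient at most twice the seminorm; the remaining factor 2 reaches \<eta> / 2, as
    \<open>pweight_choice\<close> requires.\<close>
  proof (rule exI[of _ "8 / \<eta>"], intro conjI allI impI)
    show "0 < 8 / \<eta>" using \<eta> by simp
    fix \<psi> :: "real \<Rightarrow> real" and D
    assume H: "D 0 = \<psi> \<and> (\<forall>j u. (D j has_real_derivative D (Suc j) u) (at u)) \<and> (\<forall>u. \<psi> (u + 2 * pi) = \<psi> u) \<and>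
      (\<forall>u. 0 < \<psi> u) \<and> (\<forall>r. integral {0..2 * pi} (\<lambda>\<theta>. sin (\<theta> + r) / \<psi> \<theta>) = 0) \<and>
      8 / \<eta> * fourier_seminorm 2 \<psi> \<le> Re (fourier_coeff \<psi> 0)"
    then have D0: "D 0 = \<psi>" and D: "\<And>j u. (D j has_real_derivative D (Suc j) u) (at u)" and per: "\<And>u. \<psi> (u + 2 * pi) = \<psi> u"
      and pos: "\<And>u. 0 < \<psi> u" and closing: "\<And>r. integral {0..2 * pi} (\<lambda>\<theta>. sin (\<theta> + r) / \<psi> \<theta>) = 0"
      and small: "8 / \<eta> * fourier_seminorm 2 \<psi> \<le> Re (fourier_coeff \<psi> 0)" by auto
    have c\<psi>: "continuous_on A \<psi>" for A
      using D[of 0] DERIV_continuous_on[of UNIV \<psi> "D 1"] D0 continuous_on_subset by (metis One_nat_def subset_UNIV)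
    define q where "q = Re (fourier_coeff \<psi> 0)"
    have q0: "fourier_coeff \<psi> 0 = of_real q"
      using fourier_coeff_cnj[of \<psi> 0] by (simp add: q_def complex_eq_iff)
    have q: "0 < q" unfolding q_def by (rule fourier_coeff_0_pos[OF c\<psi> pos])
    \<comment> \<open>The stable modes relative to the mean q. \<open>LPinit\<close> multiplies them
      by 1 + v_0(0), which is the mean of the initial value of the solution, so the result is the
      stable part of one multiple of \<psi>.\<close>
    define \<beta> where "\<beta> n = (if 2 \<le> \<bar>n\<bar> then fourier_coeff \<psi> n / of_real q else 0)" for n
    have sym: "cnj_sym \<beta>" by (simp add: cnj_sym_def \<beta>_def fourier_coeff_cnj)
    have \<beta>1: "EB (\<lambda>_. 1) (\<eta> / 2) \<beta>"
      unfolding EB_def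
    proof
      fix n show "norm (\<beta> n) \<le> \<eta> / 2 / (bra n * 1)"
      proof (cases "2 \<le> \<bar>n\<bar>")
        case True
        have "1 \<le> \<bar>real_of_int n\<bar>" using True by linarith
        then have "1 \<le> (real_of_int n)\<^sup>2" by (metis one_le_power power2_abs)
        then have "bra n * norm (fourier_coeff \<psi> n) \<le> 2 * ((real_of_int n)\<^sup>2 * norm (fourier_coeff \<psi> n))"
          unfolding mult.assoc[symmetric] by (intro mult_right_mono) (auto simp: bra_def)
        also have "\<dots> \<le> 4 * fourier_seminorm 2 \<psi>"
          using fourier_seminorm_2_le[of D n, OF D] per D0 by (simp add: mult.commute)
        also have "\<dots> \<le> \<eta> / 2 * q" using small \<eta> by (simp add: q_def field_simps)
        finally have "bra n * norm (fourier_coeff \<psi> n) / q \<le> \<eta> / 2" using q by (simp add: pos_divide_le_eq)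
        then show ?thesis using True q by (simp add: \<beta>_def norm_divide pos_le_divide_eq mult_ac)
      next
        case False
        then show ?thesis using \<eta> by (simp add: \<beta>_def less_imp_le)
      qed
    qed
    have \<beta>fast: "\<exists>B. \<forall>n. \<bar>of_int n\<bar> ^ k * norm (\<beta> n) \<le> B" for k
    proof -
      obtain B where B: "\<And>n. \<bar>of_int n\<bar> ^ k * norm (fourier_coeff \<psi> n) \<le> B"
        using smooth_fourier_decay[of D, OF D] per D0 by metis
      have B0: "0 \<le> B" using order_trans[OF _ B[of 0]] by simp
      have "\<bar>of_int n\<bar> ^ k * norm (\<beta> n) \<le> B / q" for n
        using B[of n] B0 q by (auto simp: \<beta>_def norm_divide divide_right_mono)
      then show ?thesis by blast
    qed
    have \<beta>\<eta>: "EB (\<lambda>_. 1) \<eta> \<beta>" by (rule EB_mono[OF weight_one \<beta>1]) (use \<eta> in simp)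
    from FP[THEN conjunct2, THEN conjunct2, THEN conjunct2, rule_format, OF conjI[OF sym \<beta>\<eta>]]
    obtain v where v': "modes_continuous v \<and> (\<forall>\<tau>\<ge>0. cnj_sym (v \<tau>)) \<and> (\<forall>\<tau>\<ge>0. v \<tau> = LP p \<beta> v \<tau>) \<and>
      (\<forall>\<rho>. submult_weight \<rho> \<and> EB \<rho> \<eta> \<beta> \<longrightarrow> decaying p \<rho> M v)" by (elim exE)
    then have v: "modes_continuous v" "\<And>\<tau>. 0 \<le> \<tau> \<Longrightarrow> cnj_sym (v \<tau>)"
      "\<And>\<tau>. 0 \<le> \<tau> \<Longrightarrow> v \<tau> = LP p \<beta> v \<tau>" "\<And>\<rho>. submult_weight \<rho> \<Longrightarrow> EB \<rho> \<eta> \<beta> \<Longrightarrow> decaying p \<rho> M v"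
      by blast+
    interpret S: lp_solution p \<beta> v M
    proof
      show "\<exists>\<delta>>0. decaying p (pweight \<delta> j) M v" for j
      proof -
        obtain \<delta> where "0 < \<delta>" "EB (pweight \<delta> j) \<eta> \<beta>" using pweight_choice[OF \<eta> \<beta>1 \<beta>fast] by blast
        then show ?thesis using v(4)[OF pweight_submult] by (meson less_imp_le)
      qed
      show "0 \<le> \<tau> \<Longrightarrow> cnj_sym (v \<tau>)" "0 \<le> \<tau> \<Longrightarrow> v \<tau> = LP p \<beta> v \<tau>" for \<tau>
        by (rule v; assumption)+
    qed (use p v(1) M MS in auto)
    \<comment> \<open>The multiple of \<psi> whose mean is that of 1 + v at time 0. It is known only
      after the fixed point has fixed the mode 0.\<close>
    define a where "a = (1 + Re (v 0 0)) / q"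
    have v00: "v 0 0 = of_real (Re (v 0 0))"
    proof -
      have "v 0 (- 0) = cnj (v 0 0)" using v(2)[OF order_refl] unfolding cnj_sym_def by blast
      then have "Im (v 0 0) = Im (cnj (v 0 0))" by simp
      then show ?thesis by (simp add: complex_eq_iff)
    qed
    have vn: "v 0 n = of_real a * fourier_coeff \<psi> n" if "2 \<le> \<bar>n\<bar>" for n
    proof -
      have "v 0 n = (1 + v 0 0) * \<beta> n" using arg_cong[OF v(3)[of 0], of "\<lambda>f. f n"] that by (simp add: LP_def LPinit_def Jint_def)
      also have "\<dots> = (1 + of_real (Re (v 0 0))) * \<beta> n" using v00 by simp
      finally show ?thesis using that q by (simp add: \<beta>_def a_def)
    qed
    have aq: "a * q = 1 + Re (v 0 0)" using q by (simp add: a_def)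
    \<comment> \<open>The coefficients of \<open>a * \<psi> - 1 - v\<close>, a priori nonzero only
      at n = 1 and n = -1.\<close>
    define \<epsilon> where "\<epsilon> n = of_real a * fourier_coeff \<psi> n - (if n = 0 then 1 else 0) - v 0 n" for n
    have \<epsilon>0: "\<epsilon> n = 0" if "n \<noteq> 1" "n \<noteq> - 1" for n
    proof (cases "n = 0")
      case True
      have "of_real a * fourier_coeff \<psi> 0 = of_real (a * q)" using q0 by simp
      then show ?thesis using True v00 aq by (simp add: \<epsilon>_def)
    next
      case False
      then show ?thesis using vn[of n] that by (simp add: \<epsilon>_def)
    qed
    define w where "w n = (if n = 0 then 1 else 0) + (v 0 n + \<epsilon> n)" for n
    have r1: "rapid1 (\<lambda>n. if n = 0 then 1 else 0)" by (rule rapid1_finite) auto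
    have r2: "rapid1 (v 0)" using rapid_rapid1[OF S.rapid_v] by simp
    have r3: "rapid1 \<epsilon>" by (rule rapid1_finite) (use \<epsilon>0 in auto)
    have rw: "rapid1 w" unfolding w_def[abs_def] by (intro rapid1_add r1 r2 r3)
    have ser_w: "ser w 0 \<theta> = 1 + V0 + ser \<epsilon> 0 \<theta>" if "V0 = S.V 0 0 \<theta>" for \<theta> V0
    proof -
      have "ser (\<lambda>n. if n = 0 then 1 else 0) 0 \<theta> = infsum (\<lambda>n. ser_term (\<lambda>n. if n = 0 then 1 else 0) 0 n \<theta>) {0}"
        unfolding ser_def by (rule infsum_cong_neutral) (auto simp: ser_term_def)
      then have "ser (\<lambda>n. if n = 0 then 1 else 0) 0 \<theta> = 1" by (simp add: ser_term_def)
      then show ?thesis unfolding w_def[abs_def] that S.V_def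
        by (simp add: ser_add[OF r1 rapid1_add[OF r2 r3]] ser_add[OF r2 r3])
    qed
    have w\<psi>: "w n = of_real a * fourier_coeff \<psi> n" for n by (simp add: w_def \<epsilon>_def)
    have sw: "cnj_sym w" by (simp add: cnj_sym_def w\<psi> fourier_coeff_cnj)
    \<comment> \<open>The function \<open>a * \<psi>\<close> and the series w have the same Fourier
      coefficients, hence are equal pointwise.\<close>
    have nm: "no_modes (\<lambda>\<theta>. a * \<psi> \<theta> - ser w 0 \<theta>)"
      unfolding no_modes_def
    proof
      fix m :: int
      have i: "(\<lambda>\<theta>. of_real (\<psi> \<theta>) * cis (of_int (- (- m)) * \<theta>)) integrable_on {0..2 * pi}"
        by (intro integrable_continuous_real continuous_intros c\<psi> continuous_on_compose2[OF continuous_on_cis, of UNIV]) auto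
      have "integral {0..2 * pi} (\<lambda>\<theta>. of_real (\<psi> \<theta>) * cis (of_int (- (- m)) * \<theta>)) = 2 * pi * fourier_coeff \<psi> (- m)"
        unfolding fourier_coeff_cis by simp
      then have "((\<lambda>\<theta>. of_real (\<psi> \<theta>) * cis (of_int (- (- m)) * \<theta>)) has_integral 2 * pi * fourier_coeff \<psi> (- m)) {0..2 * pi}"
        using integrable_integral[OF i] by simp
      from has_integral_diff[OF has_integral_mult_right[OF this, of "of_real a"] fourier_coeff_ser[OF rw sw, of "- m"]]
      show "((\<lambda>\<theta>. of_real (a * \<psi> \<theta> - ser w 0 \<theta>) * cis (of_int m * \<theta>)) has_integral 0) {0..2 * pi}"
        by (simp add: w\<psi> algebra_simps)
    qed
    have "continuous_on UNIV (ser w 0)" using ser_DERIV[OF rw] DERIV_continuous_on by blast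
    then have csw: "continuous_on {0..2 * pi} (ser w 0)" by (rule continuous_on_subset) simp
    have eq1: "a * \<psi> \<theta> = 1 + S.V 0 0 \<theta> + ser \<epsilon> 0 \<theta>" if "\<theta> \<in> {0..2 * pi}" for \<theta>
    proof -
      have "a * \<psi> \<theta> - ser w 0 \<theta> = 0" by (rule no_modes_zero[OF _ nm that]) (intro continuous_intros c\<psi> csw)
      then show ?thesis using ser_w[OF refl, of \<theta>] by simp
    qed
    have s\<epsilon>: "\<epsilon> (- 1) = cnj (\<epsilon> 1)"
      using v(2)[of 0] fourier_coeff_cnj[of \<psi> 1] by (simp add: \<epsilon>_def cnj_sym_def)
    have eq2: "ser \<epsilon> 0 \<theta> = 2 * (Re (\<epsilon> 1) * cos \<theta> - Im (\<epsilon> 1) * sin \<theta>)" for \<theta>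
    proof -
      have "ser \<epsilon> 0 \<theta> = infsum (\<lambda>n. ser_term \<epsilon> 0 n \<theta>) {- 1, 1}"
        unfolding ser_def by (rule infsum_cong_neutral) (auto simp: ser_term_def \<epsilon>0)
      then show ?thesis by (simp add: ser_term_def s\<epsilon> algebra_simps)
    qed
    define E where "E \<theta> = ser \<epsilon> 0 \<theta>" for \<theta>
    have posV: "0 < 1 + S.V 0 0 \<theta>" for \<theta> using S.V_small[of 0 \<theta>] by (simp add: abs_le_iff)
    have "\<bar>Re (v 0 0)\<bar> \<le> 1/2"
    proof -
      have "norm (v 0 0) \<le> M / (bra 0 * 1)"
        using decaying_EB(3)[OF weight_one S.decay0 S.M(1) p, of 0] unfolding EB_def by simp
      moreover have "M * 1 \<le> M * S0" using S0_ge_1 M by (intro mult_left_mono) auto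
      ultimately show ?thesis using MS abs_Re_le_cmod[of "v 0 0"] by (simp add: bra_def)
    qed
    then have a: "0 < a" using q by (simp add: a_def)
    have cV: "continuous_on {0..2 * pi} (\<lambda>\<theta>. S.V 0 0 \<theta>)" by (rule cont2_slice_u[OF S.V_cont2]) simp
    have cE: "continuous_on {0..2 * pi} E" unfolding E_def eq2 by (intro continuous_intros)
    \<comment> \<open>The difference of 1 / (1 + V) and 1 / (a \<psi>) is E over the product of the
      denominators, so the two closing conditions make E orthogonal to every shifted sine with a
      positive weight.\<close>
    have z: "((\<lambda>\<theta>. sin (\<theta> + r) * E \<theta> / (a * \<psi> \<theta> * (1 + S.V 0 0 \<theta>))) has_integral 0) {0..2 * pi}" for r
    proof -
      have i1: "((\<lambda>\<theta>. sin (\<theta> + r) / \<psi> \<theta>) has_integral 0) {0..2 * pi}"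
      proof -
        have "(\<lambda>\<theta>. sin (\<theta> + r) / \<psi> \<theta>) integrable_on {0..2 * pi}"
          using pos by (intro integrable_continuous_real continuous_intros c\<psi>) (metis less_irrefl)
        from integrable_integral[OF this] closing[of r] show ?thesis by simp
      qed
      have i2: "((\<lambda>\<theta>. sin (\<theta> + r) / (1 + S.V 0 0 \<theta>)) has_integral 0) {0..2 * pi}"
      proof -
        have "(\<lambda>\<theta>. sin (\<theta> + r) / (1 + S.V 0 0 \<theta>)) integrable_on {0..2 * pi}"
          using posV by (intro integrable_continuous_real continuous_intros cV) (metis less_irrefl)
        from integrable_integral[OF this] S.closing_integral_zero[of r] show ?thesis by simp
      qed
      have "((\<lambda>\<theta>. sin (\<theta> + r) / (1 + S.V 0 0 \<theta>) - (1 / a) * (sin (\<theta> + r) / \<psi> \<theta>)) has_integral 0 - (1 / a) * 0) {0..2 * pi}"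
        by (intro has_integral_diff has_integral_mult_right i1 i2)
      moreover have "sin (\<theta> + r) / (1 + S.V 0 0 \<theta>) - (1 / a) * (sin (\<theta> + r) / \<psi> \<theta>) =
        sin (\<theta> + r) * E \<theta> / (a * \<psi> \<theta> * (1 + S.V 0 0 \<theta>))" if "\<theta> \<in> {0..2 * pi}" for \<theta>
      proof -
        have "E \<theta> = a * \<psi> \<theta> - (1 + S.V 0 0 \<theta>)" using eq1[OF that] by (simp add: E_def)
        moreover have "s / g - 1 / a * (s / f) = s * (a * f - g) / (a * f * g)" if "0 < f" "0 < g" for s f g
          using that a by (simp add: field_simps)
        ultimately show ?thesis using pos posV by presburger
      qed
      ultimately show ?thesis by (subst has_integral_cong[symmetric]) (assumption, simp)
    qed
    \<comment> \<open>E is itself a combination of the sine and the cosine, that is of the shifts r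
      = 0 and r = pi / 2; this combination tests E against itself.\<close>
    have "((\<lambda>\<theta>. 2 * Re (\<epsilon> 1) * (sin (\<theta> + pi / 2) * E \<theta> / (a * \<psi> \<theta> * (1 + S.V 0 0 \<theta>))) -
       2 * Im (\<epsilon> 1) * (sin (\<theta> + 0) * E \<theta> / (a * \<psi> \<theta> * (1 + S.V 0 0 \<theta>)))) has_integral 2 * Re (\<epsilon> 1) * 0 - 2 * Im (\<epsilon> 1) * 0) {0..2 * pi}"
      by (intro has_integral_diff has_integral_mult_right z)
    moreover have "2 * Re (\<epsilon> 1) * (sin (\<theta> + pi / 2) * E \<theta> / (a * \<psi> \<theta> * (1 + S.V 0 0 \<theta>))) -
       2 * Im (\<epsilon> 1) * (sin (\<theta> + 0) * E \<theta> / (a * \<psi> \<theta> * (1 + S.V 0 0 \<theta>))) = E \<theta> * E \<theta> / (a * \<psi> \<theta> * (1 + S.V 0 0 \<theta>))" for \<theta>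
      by (simp add: E_def eq2 sin_add diff_divide_distrib[symmetric]) (simp add: algebra_simps)
    ultimately have "((\<lambda>\<theta>. E \<theta> * E \<theta> / (a * \<psi> \<theta> * (1 + S.V 0 0 \<theta>))) has_integral 0) {0..2 * pi}" by simp
    then have I0: "integral {0..2 * pi} (\<lambda>\<theta>. E \<theta> * E \<theta> / (a * \<psi> \<theta> * (1 + S.V 0 0 \<theta>))) = 0" by (rule integral_unique)
    have den: "0 < a * \<psi> \<theta> * (1 + S.V 0 0 \<theta>)" for \<theta> using a pos posV by simp
    have cont: "continuous_on {0..2 * pi} (\<lambda>\<theta>. E \<theta> * E \<theta> / (a * \<psi> \<theta> * (1 + S.V 0 0 \<theta>)))"
      using den by (intro continuous_intros cE cV c\<psi>) (metis less_irrefl)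
    have E0: "E \<theta> = 0" if "\<theta> \<in> {0..2 * pi}" for \<theta>
    proof -
      have "E \<theta> * E \<theta> / (a * \<psi> \<theta> * (1 + S.V 0 0 \<theta>)) = 0"
        using integral_eq_0_iff[OF cont] I0 that den by (simp add: less_imp_le)
      then show ?thesis using den[of \<theta>] by auto
    qed
    have "Re (\<epsilon> 1) = 0" using E0[of 0] by (simp add: E_def eq2)
    moreover have "Im (\<epsilon> 1) = 0" using E0[of "pi / 2"] by (simp add: E_def eq2)
    ultimately have E00: "ser \<epsilon> 0 \<theta> = 0" for \<theta> by (simp add: eq2)
    have "a * \<psi> \<theta> = 1 + S.V 0 0 \<theta>" for \<theta>
    proof -
      have "a * \<psi> (u + 2 * pi) - S.V 0 0 (u + 2 * pi) = a * \<psi> u - S.V 0 0 u" for u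
        by (simp add: per S.V_periodic)
      then obtain x where x: "x \<in> {0..2 * pi}" "a * \<psi> \<theta> - S.V 0 0 \<theta> = a * \<psi> x - S.V 0 0 x"
        using periodic_Icc[where f="\<lambda>\<theta>. a * \<psi> \<theta> - S.V 0 0 \<theta>" and u=\<theta>] by metis
      then show ?thesis using eq1[OF x(1)] E00[of x] by simp
    qed
    then have "rescaled_solution p a \<psi> S.V"
      using p a S.V_Cinf S.V_DERIV S.V_time_DERIV S.V_small S.V_periodic by unfold_locales auto
    then show "\<exists>a V. rescaled_solution p a \<psi> V \<and> (\<forall>j. \<exists>A. \<forall>\<tau>\<ge>0. \<forall>\<theta>. \<bar>V j \<tau> \<theta>\<bar> \<le> A * exp (- mu p * \<tau>))"
      using S.V_decay by blast
  qed
qed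

section \<open>Convex curves\<close>

lemma inner_complex: "x \<bullet> y = Re x * Re y + Im x * Im y" for x y :: complex
  by (simp add: inner_complex_def)

lemma of_real_inner: "(of_real a * z) \<bullet> w = a * (z \<bullet> w)" "w \<bullet> (of_real a * z) = a * (w \<bullet> z)" for a :: real and z w :: complex
  by (simp_all add: inner_complex algebra_simps)

lemma plane_orthogonal:
  fixes a n x :: complex
  assumes "x \<noteq> 0" "a \<bullet> x = 0" "n \<bullet> x = 0" "norm n = 1"
  shows "a = (a \<bullet> n) *\<^sub>R n"
proof -
  have n: "Re n * Re n + Im n * Im n = 1"
    using assms(4) by (metis inner_complex norm_eq_1)
  have e: "Re a * Re x + Im a * Im x = 0" "Re n * Re x + Im n * Im x = 0" using assms by (auto simp: inner_complex)
  have "(Re a * Im n - Im a * Re n) * Re x = Im n * (Re a * Re x + Im a * Im x) - Im a * (Re n * Re x + Im n * Im x)"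
    "(Re a * Im n - Im a * Re n) * Im x = Re a * (Re n * Re x + Im n * Im x) - Re n * (Re a * Re x + Im a * Im x)"
    by (simp_all add: algebra_simps)
  then have cross: "Re a * Im n = Im a * Re n" using e assms(1) by (auto simp: complex_eq_iff)
  have "Re a = Re a * (Re n * Re n + Im n * Im n)" using n by simp
  also have "\<dots> = (Re a * Re n) * Re n + (Re a * Im n) * Im n" by (simp add: algebra_simps)
  also have "\<dots> = (a \<bullet> n) * Re n" unfolding cross by (simp add: inner_complex algebra_simps)
  finally have 1: "Re a = (a \<bullet> n) * Re n" .
  have "Im a = Im a * (Re n * Re n + Im n * Im n)" using n by simp
  also have "\<dots> = (Im a * Re n) * Re n + (Im a * Im n) * Im n" by (simp add: algebra_simps)
  also have "\<dots> = (a \<bullet> n) * Im n" unfolding cross[symmetric] by (simp add: inner_complex algebra_simps)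
  finally have "Im a = (a \<bullet> n) * Im n" .
  with 1 show ?thesis by (simp add: complex_eq_iff)
qed

text \<open>The curve is viewed as the frontier of a convex body K, so that separation by lines
  gives normals; later K is the closure of the inside.\<close>

locale convex_curve =
  fixes \<gamma> \<gamma>' :: "real \<Rightarrow> complex" and K :: "complex set"
  assumes der: "\<And>u. (\<gamma> has_vector_derivative \<gamma>' u) (at u)" and der_nonzero: "\<And>u. \<gamma>' u \<noteq> 0"
    and K: "convex K" "compact K" "interior K \<noteq> {}" and frontier: "range \<gamma> = frontier K"
begin

lemma vector_derivative_eq: "vector_derivative \<gamma> (at u) = \<gamma>' u"
  using der vector_derivative_at by blast

lemma on_curve: "\<gamma> u \<in> K" "\<gamma> u \<notin> interior K"
proof -
  have "\<gamma> u \<in> frontier K" using frontier by blast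
  then show "\<gamma> u \<in> K" "\<gamma> u \<notin> interior K"
    using compact_imp_closed[OF K(2)] by (auto simp: frontier_def)
qed

lemma outside_eq: "outside (range \<gamma>) = - K"
  unfolding frontier using outside_frontier_eq_complement_closure[OF compact_imp_bounded[OF K(2)] K(1)]
  by (simp add: compact_imp_closed[OF K(2)])

definition supports :: "complex \<Rightarrow> real \<Rightarrow> bool" where
  "supports n u \<longleftrightarrow> norm n = 1 \<and> (\<forall>z\<in>K. n \<bullet> (z - \<gamma> u) \<le> 0)"

text \<open>A line separating R from the interior of K passes through \<open>\<gamma> u\<close>,
  because this point lies in the closures of both. It is used for the point alone and for a short
  segment leaving K.\<close>

lemma separate:
  assumes R: "convex R" "R \<noteq> {}" "R \<inter> interior K = {}" and u: "\<gamma> u \<in> closure R"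
  obtains n where "supports n u" "\<And>z. z \<in> R \<Longrightarrow> 0 \<le> n \<bullet> (z - \<gamma> u)"
proof -
  obtain a b where ab: "a \<noteq> 0" "\<forall>x\<in>interior K. a \<bullet> x \<le> b" "\<forall>x\<in>R. b \<le> a \<bullet> x"
    using separating_hyperplane_sets[OF convex_interior[OF K(1)] R(1) K(3) R(2)] R(3) by blast
  have "interior K \<subseteq> {x. a \<bullet> x \<le> b}" using ab by blast
  then have "closure (interior K) \<subseteq> {x. a \<bullet> x \<le> b}" by (intro closure_minimal closed_halfspace_le)
  then have k: "a \<bullet> x \<le> b" if "x \<in> K" for x
    using that convex_closure_interior[OF K(1,3)] closure_subset by fastforce
  have "R \<subseteq> {x. b \<le> a \<bullet> x}" using ab by blast
  then have "closure R \<subseteq> {x. b \<le> a \<bullet> x}" by (intro closure_minimal) (simp_all add: closed_halfspace_ge)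
  then have "b \<le> a \<bullet> \<gamma> u" using u by blast
  then have b: "a \<bullet> \<gamma> u = b" using k[OF on_curve(1)] by (simp add: antisym)
  have pos: "0 < inverse (norm a)" using ab(1) by simp
  show ?thesis
  proof
    show "supports (a /\<^sub>R norm a) u" unfolding supports_def
      using k ab(1) pos b by (auto simp: inner_diff_right mult_le_0_iff simp flip: right_diff_distrib)
    show "0 \<le> (a /\<^sub>R norm a) \<bullet> (z - \<gamma> u)" if "z \<in> R" for z
      using ab(3) that pos b by (auto simp: inner_diff_right simp flip: right_diff_distrib)
  qed
qed

lemma supports_exists: "\<exists>n. supports n u"
proof -
  have "{\<gamma> u} \<inter> interior K = {}" using on_curve(2) by blast
  from separate[OF _ _ this] show ?thesis by auto
qed

lemma supports_tangent: assumes "supports n u" shows "n \<bullet> \<gamma>' u = 0"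
proof -
  have "((\<lambda>v. n \<bullet> \<gamma> v) has_real_derivative n \<bullet> \<gamma>' u) (at u)"
    unfolding real_derivative_vector
    by (rule bounded_linear.has_vector_derivative[OF bounded_linear_inner_right der])
  moreover have "n \<bullet> \<gamma> v \<le> n \<bullet> \<gamma> u" for v
    using assms on_curve(1)[of v] unfolding supports_def by (simp add: inner_diff_right)
  ultimately show ?thesis using DERIV_local_max[of _ _ u 1] by (metis zero_less_one)
qed

lemma supports_strict:
  assumes s: "supports n u" and z: "z \<in> interior K" shows "n \<bullet> (z - \<gamma> u) < 0"
proof -
  obtain e where e: "0 < e" "ball z e \<subseteq> K" using z mem_interior by blast
  have "norm n = 1" using s by (simp add: supports_def)
  then have "z + (e / 2) *\<^sub>R n \<in> K" using e by (intro subsetD[OF e(2)]) (simp add: dist_norm)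
  then have "n \<bullet> (z + (e / 2) *\<^sub>R n - \<gamma> u) \<le> 0" using s by (simp add: supports_def)
  moreover have "n \<bullet> n = 1" using \<open>norm n = 1\<close> by (simp add: norm_eq_1)
  ultimately show ?thesis using e by (simp add: inner_diff_right inner_add_right)
qed

text \<open>Uniqueness is the harder half: a second candidate n' yields an open segment outside K,
  separation gives a supporting m, and m is parallel to n' since both are orthogonal to the tangent,
  so m = n'. An interior point lies on the negative side of both n and n', hence n = n'.\<close>

lemma outward_normal_eq:
  assumes s: "supports n u" shows "outward_normal \<gamma> u = n"
  unfolding outward_normal_def
proof (rule the_equality)
  have n: "norm n = 1" "n \<bullet> n = 1" using s by (auto simp: supports_def norm_eq_1)
  have "\<gamma> u + r *\<^sub>R n \<in> outside (range \<gamma>)" if "0 < r" for r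
  proof -
    have "n \<bullet> (\<gamma> u + r *\<^sub>R n - \<gamma> u) > 0" using that n by simp
    then show ?thesis using s unfolding outside_eq supports_def by force
  qed
  then show "norm n = 1 \<and> n \<bullet> vector_derivative \<gamma> (at u) = 0 \<and> (\<forall>\<^sub>F r in at_right 0. \<gamma> u + r *\<^sub>R n \<in> outside (range \<gamma>))"
    using n supports_tangent[OF s] by (auto simp: vector_derivative_eq eventually_at_right_field intro!: exI[of _ 1])
next
  fix n' assume H: "norm n' = 1 \<and> n' \<bullet> vector_derivative \<gamma> (at u) = 0 \<and> (\<forall>\<^sub>F r in at_right 0. \<gamma> u + r *\<^sub>R n' \<in> outside (range \<gamma>))"
  have n: "norm n = 1" "n \<bullet> n = 1" "n \<bullet> \<gamma>' u = 0" using s supports_tangent by (auto simp: supports_def norm_eq_1)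
  obtain e where e: "0 < e" "\<And>r. 0 < r \<Longrightarrow> r < e \<Longrightarrow> \<gamma> u + r *\<^sub>R n' \<notin> K"
    using H unfolding outside_eq eventually_at_right_field by auto
  define R where "R = {\<gamma> u + r *\<^sub>R n' |r. 0 < r \<and> r < e}"
  have R: "R = (\<lambda>r. \<gamma> u + r *\<^sub>R n') ` {0<..<e}" by (auto simp: R_def)
  have "convex R"
  proof -
    have "R = (+) (\<gamma> u) ` ((\<lambda>r. r *\<^sub>R n') ` {0<..<e})" by (auto simp: R image_image)
    then show ?thesis by (simp add: convex_translation_eq convex_linear_image linear_scaleR_left)
  qed
  moreover have "R \<noteq> {}" using e by (auto simp: R)
  moreover have "R \<inter> interior K = {}" using e(2) interior_subset[of K] unfolding R_def by blast
  moreover have "\<gamma> u \<in> closure R"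
  proof -
    have lim: "((\<lambda>r. \<gamma> u + r *\<^sub>R n') \<longlongrightarrow> \<gamma> u + 0 *\<^sub>R n') (at_right 0)" by (intro tendsto_intros)
    have "\<gamma> u + r *\<^sub>R n' \<in> closure R" if "0 < r" "r < e" for r
      using that closure_subset[of R] unfolding R_def by blast
    then have ev: "\<forall>\<^sub>F r in at_right 0. \<gamma> u + r *\<^sub>R n' \<in> closure R"
      unfolding eventually_at_right_field using e(1) by blast
    have "\<gamma> u + 0 *\<^sub>R n' \<in> closure R"
      by (rule Lim_in_closed_set[OF closed_closure ev trivial_limit_at_right_real lim])
    then show ?thesis by simp
  qed
  ultimately obtain m where m: "supports m u" "\<And>z. z \<in> R \<Longrightarrow> 0 \<le> m \<bullet> (z - \<gamma> u)"
    using separate[of R u] by metis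
  have m': "m = (m \<bullet> n') *\<^sub>R n'" "n = (n \<bullet> n') *\<^sub>R n'"
    using plane_orthogonal[of "\<gamma>' u" _ n'] der_nonzero H supports_tangent[OF m(1)] n(3) vector_derivative_eq by auto
  have "0 \<le> m \<bullet> n'"
  proof -
    have "\<gamma> u + (e / 2) *\<^sub>R n' \<in> R" unfolding R_def using e(1) by (intro CollectI exI[of _ "e / 2"]) simp
    from m(2)[OF this] show ?thesis using e(1) by (simp add: zero_le_mult_iff)
  qed
  moreover have "\<bar>m \<bullet> n'\<bar> = 1" using arg_cong[OF m'(1), of norm] m(1) H by (simp add: supports_def)
  ultimately have "m = n'" using m'(1) by (metis abs_of_nonneg scaleR_one)
  obtain z where z: "z \<in> interior K" using K(3) by blast
  have "n' \<bullet> (z - \<gamma> u) < 0" using supports_strict[OF m(1) z] \<open>m = n'\<close> by simp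
  moreover have "n \<bullet> (z - \<gamma> u) < 0" using supports_strict[OF s z] .
  ultimately have "(n \<bullet> n') * (n' \<bullet> (z - \<gamma> u)) < 0" using m'(2) by (metis inner_scaleR_left)
  then have "0 < n \<bullet> n'" using \<open>n' \<bullet> (z - \<gamma> u) < 0\<close> by (simp add: mult_less_0_iff)
  moreover have "\<bar>n \<bullet> n'\<bar> = 1" using arg_cong[OF m'(2), of norm] n(1) H by simp
  ultimately show "n' = n" using m'(2) by (metis abs_of_pos scaleR_one)
qed

lemma outward_normal_supports: "supports (outward_normal \<gamma> u) u"
  using supports_exists[of u] outward_normal_eq[of _ u] by auto

text \<open>For an interior point z the product of the rotated tangent with
  \<open>z - \<gamma> u\<close> never vanishes, because the strict support inequality holds at every
  u. Being continuous in u it keeps its sign, and so does the orientation.\<close>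

lemma outward_normal_sign:
  assumes c: "continuous_on UNIV \<gamma>'"
  shows "\<exists>\<sigma>. (\<sigma> = 1 \<or> \<sigma> = -1) \<and> (\<forall>u. outward_normal \<gamma> u = of_real (\<sigma> / norm (\<gamma>' u)) * (- \<i> * \<gamma>' u))"
proof -
  obtain z where z: "z \<in> interior K" using K(3) by blast
  define f where "f u = (- \<i> * \<gamma>' u) \<bullet> (z - \<gamma> u)" for u
  have c\<gamma>: "continuous_on UNIV \<gamma>" using der by (meson continuous_at_imp_continuous_on has_vector_derivative_continuous)
  have cf: "continuous_on UNIV f" unfolding f_def[abs_def] by (intro continuous_intros c c\<gamma>)
  have N: "- \<i> * \<gamma>' u = ((- \<i> * \<gamma>' u) \<bullet> outward_normal \<gamma> u) *\<^sub>R outward_normal \<gamma> u" for u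
    by (rule plane_orthogonal[of "\<gamma>' u"])
      (use der_nonzero outward_normal_supports[of u] supports_tangent[OF outward_normal_supports, of u] in
        \<open>auto simp: supports_def inner_complex\<close>)
  define g where "g u = (- \<i> * \<gamma>' u) \<bullet> outward_normal \<gamma> u" for u
  have ng: "\<bar>g u\<bar> = norm (\<gamma>' u)" for u
    using arg_cong[OF N[of u], of norm] outward_normal_supports[of u] by (simp add: g_def supports_def norm_mult)
  have fg: "f u = g u * (outward_normal \<gamma> u \<bullet> (z - \<gamma> u))" for u
    unfolding f_def by (subst N) (simp add: g_def)
  have neg: "outward_normal \<gamma> u \<bullet> (z - \<gamma> u) < 0" for u by (rule supports_strict[OF outward_normal_supports z])
  have f0: "f u \<noteq> 0" for u using fg[of u] neg[of u] ng[of u] der_nonzero[of u] by auto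
  have "connected (f ` UNIV)" using cf by (rule connected_continuous_image) simp
  then have sgn: "(\<forall>u. f u < 0) \<or> (\<forall>u. 0 < f u)"
    unfolding connected_iff_interval using f0 by (metis UNIV_I image_iff linorder_neqE_linordered_idom less_imp_le)
  have N2: "outward_normal \<gamma> u = of_real (1 / g u) * (- \<i> * \<gamma>' u)" for u
  proof -
    have "g u \<noteq> 0" using ng[of u] der_nonzero[of u] by auto
    then show ?thesis using N[of u] unfolding g_def[symmetric] scaleR_conv_of_real by (metis divide_self_if mult.assoc mult.left_neutral of_real_1 of_real_mult times_divide_eq_left)
  qed
  show ?thesis using sgn
  proof
    assume "\<forall>u. f u < 0"
    then have "0 < g u" for u using fg[of u] neg[of u] by (metis mult_neg_neg not_less_iff_gr_or_eq mult_zero_left order_less_irrefl)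
    then have "g u = norm (\<gamma>' u)" for u using ng[of u] by (metis abs_of_pos)
    then show ?thesis using N2 by (intro exI[of _ 1]) auto
  next
    assume "\<forall>u. 0 < f u"
    then have "g u < 0" for u using fg[of u] neg[of u] by (metis mult_pos_neg not_less_iff_gr_or_eq mult_zero_left order_less_irrefl)
    then have "g u = - norm (\<gamma>' u)" for u using ng[of u] by (metis abs_of_neg minus_minus)
    then show ?thesis using N2 by (intro exI[of _ "-1"]) auto
  qed
qed

end

section \<open>The Jordan curve theorem for periodic embeddings\<close>

lemma circle_loop:
  fixes \<gamma> :: "real \<Rightarrow> complex"
  assumes c: "continuous_on UNIV \<gamma>" and per: "\<And>u. \<gamma> (u + 2 * pi) = \<gamma> u" and inj: "inj_on \<gamma> {0..<2 * pi}"
  shows "simple_path (\<lambda>s. \<gamma> (2 * pi * s))" "path_image (\<lambda>s. \<gamma> (2 * pi * s)) = range \<gamma>"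
    "pathfinish (\<lambda>s. \<gamma> (2 * pi * s)) = pathstart (\<lambda>s. \<gamma> (2 * pi * s))"
proof -
  have p0: "\<gamma> (2 * pi) = \<gamma> 0" using per[of 0] by simp
  show "pathfinish (\<lambda>s. \<gamma> (2 * pi * s)) = pathstart (\<lambda>s. \<gamma> (2 * pi * s))" by (simp add: pathfinish_def pathstart_def p0)
  have pa: "path (\<lambda>s. \<gamma> (2 * pi * s))"
    unfolding path_def by (rule continuous_on_compose2[OF c]) (auto intro!: continuous_intros)
  have "x = y \<or> x = 0 \<and> y = 1 \<or> x = 1 \<and> y = 0"
    if "x \<in> {0..1}" "y \<in> {0..1}" "\<gamma> (2 * pi * x) = \<gamma> (2 * pi * y)" for x y
  proof -
    define r where "r x = (if x = 1 then 0 else x)" for x :: real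
    have r: "\<gamma> (2 * pi * r x) = \<gamma> (2 * pi * x)" "2 * pi * r x \<in> {0..<2 * pi}" if "x \<in> {0..1}" for x
      using that p0 by (auto simp: r_def)
    have "2 * pi * r x = 2 * pi * r y"
      using inj_onD[OF inj _ r(2)[OF that(1)] r(2)[OF that(2)]] r(1) that by metis
    then have "r x = r y" by simp
    then show ?thesis by (auto simp: r_def split: if_splits)
  qed
  then show "simple_path (\<lambda>s. \<gamma> (2 * pi * s))" using pa unfolding simple_path_def loop_free_def by blast
  show "path_image (\<lambda>s. \<gamma> (2 * pi * s)) = range \<gamma>"
  proof
    show "range \<gamma> \<subseteq> path_image (\<lambda>s. \<gamma> (2 * pi * s))"
    proof
      fix z assume "z \<in> range \<gamma>"
      then obtain u where u: "z = \<gamma> u" by blast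
      obtain y where y: "y \<in> {0..2 * pi}" "\<gamma> u = \<gamma> y" by (rule periodic_Icc[where f=\<gamma>, OF per])
      then have "y / (2 * pi) \<in> {0..1}" "z = \<gamma> (2 * pi * (y / (2 * pi)))" using u by simp_all
      then show "z \<in> path_image (\<lambda>s. \<gamma> (2 * pi * s))" unfolding path_image_def by blast
    qed
  qed (auto simp: path_image_def)
qed

lemma embedding_inside:
  fixes \<gamma> :: "real \<Rightarrow> complex"
  assumes c: "continuous_on UNIV \<gamma>" and per: "\<And>u. \<gamma> (u + 2 * pi) = \<gamma> u" and inj: "inj_on \<gamma> {0..<2 * pi}"
  shows "inside (range \<gamma>) \<noteq> {}" "open (inside (range \<gamma>))" "bounded (inside (range \<gamma>))" "frontier (inside (range \<gamma>)) = range \<gamma>"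
  using Jordan_inside_outside[OF circle_loop(1,3)[OF assms]] circle_loop(2)[OF assms] by auto

section \<open>Parametrisation by the normal angle\<close>

lemma cis_inner [simp]: "cis a \<bullet> cis b = cos (a - b)" "cis a \<bullet> (\<i> * cis b) = sin (a - b)"
    "(\<i> * cis a) \<bullet> cis b = - sin (a - b)" "(\<i> * cis a) \<bullet> (\<i> * cis b) = cos (a - b)"
  by (simp_all add: inner_complex cos_diff sin_diff algebra_simps)

lemma cis_basis: "z = of_real (z \<bullet> cis \<theta>) * cis \<theta> + of_real (z \<bullet> (\<i> * cis \<theta>)) * (\<i> * cis \<theta>)"
proof -
  have "(cos \<theta>)\<^sup>2 + (sin \<theta>)\<^sup>2 = 1" by simp
  then have "Re z * (cos \<theta>)\<^sup>2 + Re z * (sin \<theta>)\<^sup>2 = Re z" "Im z * (cos \<theta>)\<^sup>2 + Im z * (sin \<theta>)\<^sup>2 = Im z"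
    by (metis distrib_left mult.right_neutral)+
  then show ?thesis by (simp add: complex_eq_iff inner_complex algebra_simps power2_eq_square)
qed

lemma cis_has_vector_derivative: "(cis has_vector_derivative \<i> * cis \<theta>) (at \<theta> within S)"
  by (auto simp: has_vector_derivative_complex_iff real_derivative_vector[symmetric]
      intro!: derivative_eq_intros)

lemma has_real_derivative_inner:
  fixes f g :: "real \<Rightarrow> complex"
  assumes "(f has_vector_derivative f') (at x within S)" "(g has_vector_derivative g') (at x within S)"
  shows "((\<lambda>x. f x \<bullet> g x) has_real_derivative f x \<bullet> g' + f' \<bullet> g x) (at x within S)"
  unfolding real_derivative_vector
  using bounded_bilinear.has_vector_derivative[OF bounded_bilinear_inner assms] .

lemma cis_eq_iff: "cis a = cis b \<longleftrightarrow> (\<exists>k::int. a = b + 2 * pi * of_int k)"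
proof
  assume e: "cis a = cis b"
  then have "cos a = cos b" "sin a = sin b" by (simp_all add: complex_eq_iff)
  then show "\<exists>k::int. a = b + 2 * pi * of_int k"
    using sin_cos_eq_iff[of a b] by (metis mult.commute mult.left_commute)
next
  assume "\<exists>k::int. a = b + 2 * pi * of_int k"
  then obtain k :: int where "a = b + 2 * pi * of_int k" by blast
  then show "cis a = cis b" by (simp add: cis_mult[symmetric] cis_multiple_2pi)
qed

section \<open>The normal angle as a coordinate on the universal cover\<close>

locale angle_map =
  fixes \<phi> \<phi>' :: "real \<Rightarrow> real" and turn :: real
  assumes deriv: "\<And>u. (\<phi> has_real_derivative \<phi>' u) (at u)" and sign: "(\<forall>u. 0 < \<phi>' u) \<or> (\<forall>u. \<phi>' u < 0)"
    and shift: "\<And>u. \<phi> (u + 2 * pi) = \<phi> u + turn"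
begin

lemma \<phi>'_nonzero: "\<phi>' u \<noteq> 0" using sign by (metis less_irrefl)

lemma cont\<phi>: "continuous_on A \<phi>" "isCont \<phi> u"
  using deriv DERIV_isCont by (blast intro: continuous_at_imp_continuous_on)+

lemma inj\<phi>: "inj \<phi>"
proof (rule injI)
  have less: "\<phi> x \<noteq> \<phi> y" if xy: "x < y" for x y
  proof
    assume "\<phi> x = \<phi> y"
    moreover obtain z where "\<phi> y - \<phi> x = (y - x) * \<phi>' z" using MVT2[OF xy deriv] by blast
    ultimately show False using \<phi>'_nonzero[of z] xy by simp
  qed
  fix x y assume "\<phi> x = \<phi> y"
  then show "x = y" using less[of x y] less[of y x] by (metis linorder_neqE_linordered_idom)
qed

lemma turn_nonzero: "turn \<noteq> 0"
proof
  assume "turn = 0"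
  then have "\<phi> (2 * pi) = \<phi> 0" using shift[of 0] by simp
  then have "2 * pi = 0" using inj\<phi> by (meson injD)
  then show False by simp
qed

lemma \<phi>_shift_int: "\<phi> (u + 2 * pi * of_int j) = \<phi> u + turn * of_int j"
proof -
  have "\<phi> (u + 2 * pi) - turn / (2 * pi) * (u + 2 * pi) = \<phi> u - turn / (2 * pi) * u" for u
    unfolding shift by (simp add: field_simps)
  from periodic_shift[of "\<lambda>u. \<phi> u - turn / (2 * pi) * u", OF this, of u j]
  have "\<phi> (u + 2 * pi * of_int j) = \<phi> u + turn / (2 * pi) * (2 * pi * of_int j)" by (simp add: distrib_left)
  then show ?thesis by simp
qed

lemma surj\<phi>: "\<exists>u. \<phi> u = \<theta>"
proof -
  define j where "j = \<lceil>(\<bar>\<theta>\<bar> + \<bar>\<phi> 0\<bar>) / \<bar>turn\<bar>\<rceil>"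
  have "(\<bar>\<theta>\<bar> + \<bar>\<phi> 0\<bar>) / \<bar>turn\<bar> \<le> of_int j" unfolding j_def by linarith
  then have j: "\<bar>\<theta>\<bar> + \<bar>\<phi> 0\<bar> \<le> \<bar>turn\<bar> * of_int j" using turn_nonzero by (simp add: pos_divide_le_eq mult.commute)
  have e: "\<phi> (2 * pi * of_int i) = \<phi> 0 + turn * of_int i" for i using \<phi>_shift_int[of 0 i] by simp
  have "\<exists>a b. \<phi> a \<le> \<theta> \<and> \<theta> \<le> \<phi> b"
  proof (cases "0 < turn")
    case True
    then show ?thesis using j e[of j] e[of "- j"] by (intro exI[of _ "2 * pi * of_int (- j)"] exI[of _ "2 * pi * of_int j"]) auto
  next
    case False
    then show ?thesis using j e[of j] e[of "- j"] by (intro exI[of _ "2 * pi * of_int j"] exI[of _ "2 * pi * of_int (- j)"]) auto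
  qed
  then obtain a b where ab: "\<phi> a \<le> \<theta>" "\<theta> \<le> \<phi> b" by blast
  show ?thesis
  proof (cases "a \<le> b")
    case True then show ?thesis using IVT'[of \<phi> a \<theta> b] ab cont\<phi> by blast
  next
    case False then show ?thesis using IVT2'[of \<phi> a \<theta> b] ab cont\<phi> by fastforce
  qed
qed

end

text \<open>Here \<phi> is a continuous lift of the normal angle; the first assumption is the Frenet
  equation, with arc length speed |\<phi>'| / k. The sign of \<phi>' is the orientation of the
  parametrisation.\<close>

locale angle_curve =
  fixes \<gamma> :: "real \<Rightarrow> complex" and \<phi> \<phi>' k :: "real \<Rightarrow> real"
  assumes d\<gamma>: "\<And>u. (\<gamma> has_vector_derivative of_real (\<phi>' u / k u) * (\<i> * cis (\<phi> u))) (at u)"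
    and d\<phi>: "\<And>u. (\<phi> has_real_derivative \<phi>' u) (at u)"
    and k_pos: "\<And>u. 0 < k u" and mono: "(\<forall>u. 0 < \<phi>' u) \<or> (\<forall>u. \<phi>' u < 0)"
    and \<phi>'_per: "\<And>u. \<phi>' (u + 2 * pi) = \<phi>' u" and per: "\<And>u. \<gamma> (u + 2 * pi) = \<gamma> u"
    and inj: "inj_on \<gamma> {0..<2 * pi}" and cis_per: "\<And>u. cis (\<phi> (u + 2 * pi)) = cis (\<phi> u)"
    and support: "\<And>u v. cis (\<phi> u) \<bullet> (\<gamma> v - \<gamma> u) \<le> 0"
begin

definition turn :: real where "turn = \<phi> (2 * pi) - \<phi> 0"

lemma \<phi>_shift: "\<phi> (u + 2 * pi) = \<phi> u + turn"
proof -
  have "((\<lambda>u. \<phi> (u + 2 * pi) - \<phi> u) has_real_derivative 0) (at u)" for u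
    using DERIV_diff[OF DERIV_shift[THEN iffD1, OF d\<phi>[of "u + 2 * pi"]] d\<phi>[of u]] \<phi>'_per by simp
  from DERIV_isconst_all[of "\<lambda>u. \<phi> (u + 2 * pi) - \<phi> u" u 0] this show ?thesis by (simp add: turn_def)
qed

sublocale angle_map \<phi> \<phi>' turn
  by unfold_locales (rule d\<phi> mono \<phi>_shift)+

definition U :: "real \<Rightarrow> real" where "U \<theta> = inv \<phi> \<theta>"

lemma \<phi>U [simp]: "\<phi> (U \<theta>) = \<theta>" unfolding U_def using surj\<phi> by (metis f_inv_into_f rangeI)

lemma U\<phi> [simp]: "U (\<phi> u) = u" unfolding U_def using inj\<phi> by simp

lemma dU: "(U has_real_derivative 1 / \<phi>' (U \<theta>)) (at \<theta>)"
proof -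
  have "isCont U (\<phi> (U \<theta>))" by (rule isCont_inverse_function[of 1]) (simp_all add: cont\<phi>)
  then have "isCont U \<theta>" by simp
  then have "(U has_real_derivative inverse (\<phi>' (U \<theta>))) (at \<theta>)"
    by (intro DERIV_inverse_function[where f=\<phi> and g=U and x=\<theta> and a="\<theta> - 1" and b="\<theta> + 1"] d\<phi> \<phi>'_nonzero) auto
  then show ?thesis by (simp add: inverse_eq_divide)
qed

definition X :: "real \<Rightarrow> complex" where "X \<theta> = \<gamma> (U \<theta>)"

definition kap :: "real \<Rightarrow> real" where "kap \<theta> = k (U \<theta>)"

lemma kap_pos: "0 < kap \<theta>" by (simp add: kap_def k_pos)

lemma \<gamma>_X: "\<gamma> u = X (\<phi> u)" by (simp add: X_def)

lemma dX: "(X has_vector_derivative of_real (1 / kap \<theta>) * (\<i> * cis \<theta>)) (at \<theta>)"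
proof -
  have "((\<gamma> \<circ> U) has_vector_derivative (1 / \<phi>' (U \<theta>)) *\<^sub>R (of_real (\<phi>' (U \<theta>) / k (U \<theta>)) * (\<i> * cis (\<phi> (U \<theta>))))) (at \<theta>)"
    by (rule vector_diff_chain_at[OF dU[unfolded real_derivative_vector] d\<gamma>])
  moreover have "(1 / \<phi>' (U \<theta>)) *\<^sub>R (of_real (\<phi>' (U \<theta>) / k (U \<theta>)) * (\<i> * cis (\<phi> (U \<theta>)))) = of_real (1 / kap \<theta>) * (\<i> * cis \<theta>)"
    using \<phi>'_nonzero[of "U \<theta>"] by (simp add: scaleR_conv_of_real kap_def)
  ultimately show ?thesis by (simp add: X_def[abs_def] o_def)
qed

lemma X_support: "cis \<theta> \<bullet> (X \<theta>' - X \<theta>) \<le> 0"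
  using support[of "U \<theta>" "U \<theta>'"] by (simp add: X_def)

lemma dX_shift: "((\<lambda>\<theta>. X (\<theta> + 2 * pi)) has_vector_derivative of_real (1 / kap (\<theta> + 2 * pi)) * (\<i> * cis (\<theta> + 2 * pi))) (at \<theta>)"
proof -
  have "((\<lambda>\<theta>. \<theta> + 2 * pi) has_vector_derivative 1) (at \<theta>)"
    by (auto simp: real_derivative_vector[symmetric] intro!: derivative_eq_intros)
  from vector_diff_chain_at[OF this dX[of "\<theta> + 2 * pi"]] show ?thesis by (simp add: o_def)
qed

text \<open>The support inequalities at \<theta> and \<theta> + 2 pi make the difference D
  orthogonal to \<open>cis \<theta>\<close>. Since D' is parallel to
  \<open>\<i> * cis \<theta>\<close>, differentiating this relation makes D orthogonal to
  \<open>\<i> * cis \<theta>\<close> too, hence zero. The rotation index of the curve is deduced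
  from this in \<open>turn_2pi\<close>.\<close>

lemma X_periodic: "X (\<theta> + 2 * pi) = X \<theta>"
proof -
  define D where "D \<theta> = X (\<theta> + 2 * pi) - X \<theta>" for \<theta>
  have cis2: "cis (\<theta> + 2 * pi) = cis \<theta>" for \<theta> by (simp add: complex_eq_iff)
  have D0: "cis \<theta> \<bullet> D \<theta> = 0" for \<theta>
    using X_support[of \<theta> "\<theta> + 2 * pi"] X_support[of "\<theta> + 2 * pi" \<theta>] cis2 by (simp add: D_def inner_diff_right)
  have "((\<lambda>\<theta>. X (\<theta> + 2 * pi)) has_vector_derivative of_real (1 / kap (\<theta> + 2 * pi)) * (\<i> * cis \<theta>)) (at \<theta>)" for \<theta>
    using dX_shift[of \<theta>] unfolding cis2 .
  from has_vector_derivative_diff[OF this dX]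
  have dD: "(D has_vector_derivative of_real (1 / kap (\<theta> + 2 * pi) - 1 / kap \<theta>) * (\<i> * cis \<theta>)) (at \<theta>)" for \<theta>
    unfolding D_def[abs_def] by (simp add: left_diff_distrib)
  have "((\<lambda>\<theta>. cis \<theta> \<bullet> D \<theta>) has_real_derivative
      cis \<theta> \<bullet> (of_real (1 / kap (\<theta> + 2 * pi) - 1 / kap \<theta>) * (\<i> * cis \<theta>)) + (\<i> * cis \<theta>) \<bullet> D \<theta>) (at \<theta>)" for \<theta>
    by (rule has_real_derivative_inner[OF cis_has_vector_derivative dD])
  moreover have "cis \<theta> \<bullet> (of_real r * (\<i> * cis \<theta>)) = 0" for r \<theta>
    by (simp add: scaleR_conv_of_real[symmetric])
  ultimately have "((\<lambda>\<theta>. 0) has_real_derivative (\<i> * cis \<theta>) \<bullet> D \<theta>) (at \<theta>)" for \<theta>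
    by (simp add: D0 del: of_real_diff of_real_divide)
  then have "(\<i> * cis \<theta>) \<bullet> D \<theta> = 0" by (metis DERIV_const DERIV_unique)
  then have "D \<theta> = 0" using cis_basis[of "D \<theta>" \<theta>] D0[of \<theta>] by (simp add: inner_commute)
  then show ?thesis by (simp add: D_def)
qed

lemma kap_periodic: "kap (\<theta> + 2 * pi) = kap \<theta>"
proof -
  have "(X has_vector_derivative of_real (1 / kap (\<theta> + 2 * pi)) * (\<i> * cis (\<theta> + 2 * pi))) (at \<theta>)"
    using dX_shift[of \<theta>] unfolding X_periodic .
  from vector_derivative_unique_at[OF this dX]
  have "of_real (1 / kap (\<theta> + 2 * pi)) * (\<i> * cis \<theta>) = of_real (1 / kap \<theta>) * (\<i> * cis \<theta>)" by (simp add: complex_eq_iff)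
  then have "complex_of_real (kap (\<theta> + 2 * pi)) = complex_of_real (kap \<theta>)" by simp
  then show ?thesis by (simp only: of_real_eq_iff)
qed

lemma curvature_at_normal:
  assumes "cis (\<phi> u) = cis \<theta>" shows "k u = kap \<theta>"
proof -
  obtain j :: int where "\<phi> u = \<theta> + 2 * pi * of_int j" using assms cis_eq_iff by blast
  then have "k u = kap (\<theta> + 2 * pi * of_int j)" by (metis kap_def U\<phi>)
  then show ?thesis using periodic_shift[of kap, OF kap_periodic] by simp
qed

text \<open>The support function; \<open>dh\<close> and \<open>dh1\<close> give h'' + h = 1 /
  kap.\<close>

definition h :: "real \<Rightarrow> real" where "h \<theta> = X \<theta> \<bullet> cis \<theta>"

definition h1 :: "real \<Rightarrow> real" where "h1 \<theta> = X \<theta> \<bullet> (\<i> * cis \<theta>)"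

lemma dh: "(h has_real_derivative h1 \<theta>) (at \<theta>)"
proof -
  have "((\<lambda>\<theta>. X \<theta> \<bullet> cis \<theta>) has_real_derivative X \<theta> \<bullet> (\<i> * cis \<theta>) + (of_real (1 / kap \<theta>) * (\<i> * cis \<theta>)) \<bullet> cis \<theta>) (at \<theta>)"
    by (rule has_real_derivative_inner[OF dX cis_has_vector_derivative])
  then show ?thesis by (simp add: h_def[abs_def] h1_def scaleR_conv_of_real[symmetric] del: of_real_divide)
qed

lemma dh1: "(h1 has_real_derivative 1 / kap \<theta> - h \<theta>) (at \<theta>)"
proof -
  have d: "((\<lambda>\<theta>. \<i> * cis \<theta>) has_vector_derivative \<i> * (\<i> * cis \<theta>)) (at \<theta>)"
    by (rule has_vector_derivative_mult_right[OF cis_has_vector_derivative])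
  have "((\<lambda>\<theta>. X \<theta> \<bullet> (\<i> * cis \<theta>)) has_real_derivative X \<theta> \<bullet> (\<i> * (\<i> * cis \<theta>)) + (of_real (1 / kap \<theta>) * (\<i> * cis \<theta>)) \<bullet> (\<i> * cis \<theta>)) (at \<theta>)"
    by (rule has_real_derivative_inner[OF dX d])
  moreover have "\<i> * (\<i> * cis \<theta>) = - cis \<theta>" by (simp add: mult.assoc[symmetric])
  ultimately show ?thesis by (simp add: h_def h1_def[abs_def] scaleR_conv_of_real[symmetric] del: of_real_divide)
qed

lemma h_periodic: "h (\<theta> + 2 * pi) = h \<theta>"
  unfolding h_def X_periodic by (simp add: inner_complex)

text \<open>The integrand is the derivative of a fixed component of the position vector, and the
  curve closes up.\<close>

lemma closing: "integral {0..2 * pi} (\<lambda>\<theta>. sin (\<theta> + r) / kap \<theta>) = 0"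
proof -
  define m where "m = - cis (- r)"
  have "((\<lambda>\<theta>. X \<theta> \<bullet> m) has_real_derivative X \<theta> \<bullet> 0 + (of_real (1 / kap \<theta>) * (\<i> * cis \<theta>)) \<bullet> m) (at \<theta>)" for \<theta>
    by (rule has_real_derivative_inner[OF dX has_vector_derivative_const])
  moreover have "(of_real (1 / kap \<theta>) * (\<i> * cis \<theta>)) \<bullet> m = sin (\<theta> + r) / kap \<theta>" for \<theta>
    by (simp add: m_def scaleR_conv_of_real[symmetric] del: of_real_divide)
  ultimately have "((\<lambda>\<theta>. X \<theta> \<bullet> m) has_real_derivative sin (\<theta> + r) / kap \<theta>) (at \<theta>)" for \<theta> by simp
  then have "((\<lambda>\<theta>. sin (\<theta> + r) / kap \<theta>) has_integral X (2 * pi) \<bullet> m - X 0 \<bullet> m) {0..2 * pi}"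
    by (intro fundamental_theorem_of_calculus)
      (auto simp: real_derivative_vector[symmetric] intro: DERIV_subset)
  then show ?thesis using X_periodic[of 0] by (simp add: integral_unique)
qed

text \<open>The point with angle \<phi> 0 + 2 pi coincides with \<gamma> 0, so by injectivity its
  parameter is j periods and turn * j = 2 pi. Since also turn = 2 pi m with an integer m, m j =
  1.\<close>

lemma turn_2pi: "\<bar>turn\<bar> = 2 * pi"
proof -
  obtain m :: int where m: "turn = 2 * pi * of_int m"
    using cis_per[of 0] cis_eq_iff[of "\<phi> (0 + 2 * pi)" "\<phi> 0"] by (auto simp: turn_def)
  define u where "u = U (\<phi> 0 + 2 * pi)"
  have "\<gamma> u = \<gamma> 0" using X_periodic[of "\<phi> 0"] by (simp add: u_def X_def)
  define j where "j = \<lfloor>u / (2 * pi)\<rfloor>"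
  have "of_int j \<le> u / (2 * pi)" "u / (2 * pi) < of_int j + 1" unfolding j_def by linarith+
  then have r: "u - 2 * pi * of_int j \<in> {0..<2 * pi}" by (simp add: field_simps)
  have "\<gamma> (u - 2 * pi * of_int j) = \<gamma> u"
    using periodic_shift[of \<gamma>, OF per, of "u - 2 * pi * of_int j" j] by simp
  then have "u - 2 * pi * of_int j = 0" using inj_onD[OF inj _ r, of 0] \<open>\<gamma> u = \<gamma> 0\<close> by simp
  then have "u = 0 + 2 * pi * of_int j" by simp
  then have "\<phi> u = \<phi> 0 + turn * of_int j" using \<phi>_shift_int[of 0 j] by simp
  then have "turn * of_int j = 2 * pi" by (simp add: u_def)
  then have "of_int (m * j) = (1::real)" using m by simp
  then have "m * j = 1" by linarith
  then have "\<bar>m\<bar> = 1" by (metis abs_mult abs_1 zmult_eq_1_iff abs_ge_zero abs_minus_cancel)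
  then show ?thesis using m by (simp add: abs_mult flip: of_int_abs)
qed

text \<open>The derivative with respect to the angle is (1 / \<phi>') d/du, iterated. Functions of u
  alone are treated as constant in time, to reuse the calculus of \<open>Ck\<close>.\<close>

lemma smooth_of_angle:
  assumes f: "Cinf {0..} (\<lambda>t. f)" and \<phi>': "Cinf {0..} (\<lambda>t. \<phi>')"
  shows "\<exists>D. D 0 = (\<lambda>\<theta>. f (U \<theta>)) \<and> (\<forall>j \<theta>. (D j has_real_derivative D (Suc j) \<theta>) (at \<theta>))"
proof -
  have S: "time_dom {0::real..}" by (rule time_dom_atLeast)
  \<comment> \<open>\<open>Ck_inverse\<close> applies to positive functions, so the sign of \<phi>'
    is split off.\<close>
  define \<sigma> :: real where "\<sigma> = (if \<forall>u. 0 < \<phi>' u then 1 else - 1)"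
  have \<sigma>: "0 < \<sigma> * \<phi>' u" "\<sigma> * \<sigma> = 1" for u
    using mono by (cases "\<forall>u. 0 < \<phi>' u"; auto simp: \<sigma>_def)+
  have inv: "Cinf {0..} (\<lambda>t u. 1 / \<phi>' u)"
  proof -
    have "Ck n {0..} (\<lambda>t u. \<sigma> * (1 / (\<sigma> * \<phi>' u)))" for n
      using \<phi>' \<sigma>(1) unfolding Cinf_def by (intro Ck_mult[OF Ck_const Ck_inverse[OF Ck_mult[OF Ck_const]]]) auto
    moreover have "\<sigma> * (1 / (\<sigma> * \<phi>' u)) = 1 / \<phi>' u" for u using \<sigma>(2) by (auto simp: divide_simps)
    ultimately show ?thesis by (simp add: Cinf_def)
  qed
  define G where "G = rec_nat (\<lambda>t::real. f) (\<lambda>j g t u. Du g t u * (1 / \<phi>' u))"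
  have G0: "G 0 = (\<lambda>t. f)" and GS: "G (Suc j) = (\<lambda>t u. Du (G j) t u * (1 / \<phi>' u))" for j by (simp_all add: G_def)
  have G: "Cinf {0..} (G j)" for j
  proof (induction j)
    case (Suc j)
    show ?case unfolding GS Cinf_def using Cinf_D(1)[OF S Suc] inv unfolding Cinf_def by (intro allI Ck_mult) auto
  qed (simp add: G0 f)
  have "((\<lambda>\<theta>. G j 0 (U \<theta>)) has_real_derivative G (Suc j) 0 (U \<theta>)) (at \<theta>)" for j \<theta>
  proof -
    have "(G j 0 has_real_derivative Du (G j) 0 (U \<theta>)) (at (U \<theta>))"
      using Cinf_D(3)[OF S G[of j]] by (auto simp: partials_def)
    from DERIV_chain2[OF this dU] show ?thesis by (simp add: GS)
  qed
  then show ?thesis by (intro exI[of _ "\<lambda>j \<theta>. G j 0 (U \<theta>)"]) (simp add: G0)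
qed

end

section \<open>Flows of convex curves\<close>

lemma Cinf_cong: "(\<And>t u. t \<in> S \<Longrightarrow> f t u = g t u) \<Longrightarrow> Cinf S f \<Longrightarrow> Cinf S g"
  unfolding Cinf_def using Ck_cong[of S f g] by blast

lemma Cinf_const: "Cinf S (\<lambda>t u. c)" by (simp add: Cinf_def Ck_const)

lemma Cinf_add: "Cinf S f \<Longrightarrow> Cinf S g \<Longrightarrow> Cinf S (\<lambda>t u. f t u + g t u)" by (simp add: Cinf_def Ck_add)

lemma Cinf_diff: "Cinf S f \<Longrightarrow> Cinf S g \<Longrightarrow> Cinf S (\<lambda>t u. f t u - g t u)" by (simp add: Cinf_def Ck_diff)

lemma Cinf_mult: "Cinf S f \<Longrightarrow> Cinf S g \<Longrightarrow> Cinf S (\<lambda>t u. f t u * g t u)" by (simp add: Cinf_def Ck_mult)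

lemma Cinf_power: "Cinf S f \<Longrightarrow> Cinf S (\<lambda>t u. f t u ^ m)" by (simp add: Cinf_def Ck_power)

lemma Cinf_divide: "Cinf S f \<Longrightarrow> Cinf S g \<Longrightarrow> (\<And>t u. t \<in> S \<Longrightarrow> g t u > 0) \<Longrightarrow> Cinf S (\<lambda>t u. f t u / g t u)"
  unfolding Cinf_def using Ck_divide[where f=f and g=g and S=S] by blast

lemma Cinf_cont2: "Cinf S f \<Longrightarrow> cont2 S f" unfolding Cinf_def using Ck_cont2 by blast

lemma Cinf_partialsI:
  assumes p: "partials S f fu ft" and "cont2 S f" "Cinf S fu" "Cinf S ft" shows "Cinf S f"
  unfolding Cinf_def
proof
  fix n
  have "Ck (Suc n) S f" using assms Ck_SucI[of S f fu ft n] by (simp add: Cinf_def)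
  then show "Ck n S f" by (rule Ck_SucD)
qed

text \<open>The derivative of a unit vector is orthogonal to it; the factor is the angular speed,
  written as a cross product.\<close>

lemma unit_vector_derivative:
  assumes d: "(N has_vector_derivative N') (at x within S)" and n: "\<And>y. y \<in> S \<Longrightarrow> norm (N y) = (1::real)" and x: "x \<in> S"
    and nt: "at x within S \<noteq> bot"
  shows "N' = of_real (Re (N x) * Im N' - Im (N x) * Re N') * (\<i> * N x)"
proof -
  have "((\<lambda>y. N y \<bullet> N y) has_real_derivative N x \<bullet> N' + N' \<bullet> N x) (at x within S)"
    by (rule has_real_derivative_inner[OF d d])
  then have "((\<lambda>y. 1) has_real_derivative N x \<bullet> N' + N' \<bullet> N x) (at x within S)"
    by (rule has_field_derivative_transform_within[of _ _ _ _ 1]) (use x n in \<open>auto simp: norm_eq_1\<close>)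
  then have "((\<lambda>y. 1::real) has_vector_derivative N x \<bullet> N' + N' \<bullet> N x) (at x within S)"
    by (simp add: real_derivative_vector)
  then have "N x \<bullet> N' + N' \<bullet> N x = 0"
    using vector_derivative_unique_within[OF nt] has_vector_derivative_const by blast
  then have o: "Re (N x) * Re N' + Im (N x) * Im N' = 0" by (simp add: inner_complex mult.commute)
  have u: "Re (N x) * Re (N x) + Im (N x) * Im (N x) = 1" using n[OF x] by (metis inner_complex norm_eq_1)
  have "Re N' = (Re (N x) * Re (N x) + Im (N x) * Im (N x)) * Re N'" using u by simp
  also have "\<dots> = Re (N x) * (Re (N x) * Re N') + Im (N x) * Im (N x) * Re N'" by (simp add: algebra_simps)
  also have "Re (N x) * Re N' = - (Im (N x) * Im N')" using o by linarith
  finally have 1: "Re N' = - (Re (N x) * Im N' - Im (N x) * Re N') * Im (N x)" by (simp add: algebra_simps)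
  have "Im N' = (Re (N x) * Re (N x) + Im (N x) * Im (N x)) * Im N'" using u by simp
  also have "\<dots> = Im (N x) * (Im (N x) * Im N') + Re (N x) * Re (N x) * Im N'" by (simp add: algebra_simps)
  also have "Im (N x) * Im N' = - (Re (N x) * Re N')" using o by linarith
  finally have 2: "Im N' = (Re (N x) * Im N' - Im (N x) * Re N') * Re (N x)" by (simp add: algebra_simps)
  show ?thesis using 1 2 by (simp add: complex_eq_iff algebra_simps)
qed

text \<open>The product of N with \<open>cis (- \<phi> x)\<close> has derivative 0.\<close>

lemma cis_lift:
  assumes N: "\<And>x. x \<in> S \<Longrightarrow> (N has_vector_derivative of_real (q x) * (\<i> * N x)) (at x within S)"
    and \<phi>: "\<And>x. x \<in> S \<Longrightarrow> (\<phi> has_real_derivative q x) (at x within S)"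
    and S: "convex S" "x0 \<in> S" "x \<in> S" and init: "N x0 = cis (\<phi> x0)"
  shows "N x = cis (\<phi> x)"
proof -
  have "((\<lambda>x. N x * cis (- \<phi> x)) has_vector_derivative 0) (at y within S)" if "y \<in> S" for y
  proof -
    have "((\<lambda>x. - \<phi> x) has_vector_derivative - q y) (at y within S)"
      using DERIV_minus[OF \<phi>[OF that]] by (simp add: real_derivative_vector)
    from vector_diff_chain_within[OF this cis_has_vector_derivative]
    have "((\<lambda>x. cis (- \<phi> x)) has_vector_derivative (- q y) *\<^sub>R (\<i> * cis (- \<phi> y))) (at y within S)" by (simp add: o_def)
    from has_vector_derivative_mult[OF N[OF that] this]
    show ?thesis by (simp add: scaleR_conv_of_real algebra_simps)
  qed
  then have "N x * cis (- \<phi> x) = N x0 * cis (- \<phi> x0)"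
    using has_vector_derivative_zero_constant[OF S(1), of "\<lambda>x. N x * cis (- \<phi> x)"] S(2,3) by metis
  also have "\<dots> = 1" by (simp add: init cis_mult)
  finally have "N x * (cis (- \<phi> x) * cis (\<phi> x)) = cis (\<phi> x)" by (metis mult.assoc mult_1)
  then show ?thesis by (simp add: cis_mult)
qed

locale flow =
  fixes p :: nat and T :: real and x :: "real \<Rightarrow> real \<Rightarrow> complex"
    and D :: "nat \<Rightarrow> nat \<Rightarrow> real \<Rightarrow> real \<Rightarrow> complex" and S :: "real set"
  assumes p: "1 \<le> p" and T: "0 < T" and S_def: "S = {0..<T}"
    and D0: "\<And>t u. t \<in> S \<Longrightarrow> D 0 0 t u = x t u"
    and Dc: "\<And>i j. continuous_on (S \<times> UNIV) (\<lambda>(t, u). D i j t u)"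
    and Du: "\<And>i j t u. t \<in> S \<Longrightarrow> (D i j t has_vector_derivative D (Suc i) j t u) (at u)"
    and Dt: "\<And>i j t u. t \<in> S \<Longrightarrow> ((\<lambda>s. D i j s u) has_vector_derivative D i (Suc j) t u) (at t within S)"
    and conv: "\<And>t. t \<in> S \<Longrightarrow> convex_embedding (x t)"
    and evol: "\<And>t u. t \<in> S \<Longrightarrow> ((\<lambda>s. x s u) has_vector_derivative
           (- (1 / real p) * curvature (x t) u ^ p) *\<^sub>R outward_normal (x t) u) (at t within S)"
begin

lemma time_dom_S: "time_dom S" unfolding S_def by (rule time_dom_atLeastLessThan[OF T])

lemma zero_S: "0 \<in> S" using T by (simp add: S_def)

lemma D_Cinf: "Cinf S (\<lambda>t u. Re (D i j t u))" "Cinf S (\<lambda>t u. Im (D i j t u))"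
proof -
  have "cont2 S (\<lambda>t u. Re (D i j t u))" "cont2 S (\<lambda>t u. Im (D i j t u))" for i j
    unfolding cont2_def using Dc[of i j] by (auto simp: split_beta intro!: continuous_intros)
  then have M: "mixed_partials S (\<lambda>i j t u. Re (D i j t u))" "mixed_partials S (\<lambda>i j t u. Im (D i j t u))"
    using Du Dt unfolding mixed_partials_def partials_def has_vector_derivative_complex_iff by simp_all
  from mixed_partials_Cinf[OF M(1)] mixed_partials_Cinf[OF M(2)]
  show "Cinf S (\<lambda>t u. Re (D i j t u))" "Cinf S (\<lambda>t u. Im (D i j t u))" .
qed

lemma x_D: "t \<in> S \<Longrightarrow> x t = D 0 0 t" using D0 by auto

lemma emb: assumes "t \<in> S" shows "smooth_circle_embedding (x t)" "convex (inside (range (x t)))" "0 < curvature (x t) u"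
  using conv[OF assms] by (auto simp: convex_embedding_def)

lemma dx: "t \<in> S \<Longrightarrow> (x t has_vector_derivative D 1 0 t u) (at u)" using Du[of t 0 0 u] x_D by simp

lemma vd1: "t \<in> S \<Longrightarrow> vector_derivative (x t) (at u) = D 1 0 t u"
  using dx vector_derivative_at by blast

lemma vd2: "t \<in> S \<Longrightarrow> vector_derivative (\<lambda>v. vector_derivative (x t) (at v)) (at u) = D 2 0 t u"
  using Du[of t 1 0 u] by (simp add: vd1 vector_derivative_at numeral_2_eq_2)

lemma D1_nonzero: "t \<in> S \<Longrightarrow> D 1 0 t u \<noteq> 0"
  using emb(1)[of t] vd1[of t u] by (auto simp: smooth_circle_embedding_def)

lemma x_per: "t \<in> S \<Longrightarrow> x t (u + 2 * pi) = x t u" and x_inj: "t \<in> S \<Longrightarrow> inj_on (x t) {0..<2 * pi}"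
  using emb(1)[of t] by (auto simp: smooth_circle_embedding_def)

lemma D_per: assumes t: "t \<in> S" shows "D i 0 t (u + 2 * pi) = D i 0 t u"
proof (induction i arbitrary: u)
  case 0
  then show ?case using x_per[OF t, of u] x_D[OF t] by simp
next
  case (Suc i)
  have s: "((\<lambda>\<theta>. \<theta> + 2 * pi) has_vector_derivative 1) (at u)"
    by (auto simp: real_derivative_vector[symmetric] intro!: derivative_eq_intros)
  have "((\<lambda>u. D i 0 t (u + 2 * pi)) has_vector_derivative D (Suc i) 0 t (u + 2 * pi)) (at u)"
    using vector_diff_chain_at[OF s Du[OF t, of i 0 "u + 2 * pi"]] by (simp add: o_def)
  then have "(D i 0 t has_vector_derivative D (Suc i) 0 t (u + 2 * pi)) (at u)" using Suc.IH by simp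
  then show ?case using vector_derivative_unique_at[OF _ Du[OF t, of i 0 u]] by blast
qed

lemma convex_curve_x: assumes t: "t \<in> S" shows "convex_curve (x t) (D 1 0 t) (closure (inside (range (x t))))"
proof -
  have c: "continuous_on UNIV (x t)"
    using dx[OF t] by (meson continuous_at_imp_continuous_on has_vector_derivative_continuous)
  note I = embedding_inside[OF c x_per[OF t] x_inj[OF t]]
  have cv: "convex (inside (range (x t)))" by (rule emb(2)[OF t])
  show ?thesis
  proof
    show "(x t has_vector_derivative D 1 0 t u) (at u)" "D 1 0 t u \<noteq> 0" for u by (rule dx[OF t], rule D1_nonzero[OF t])
    show "convex (closure (inside (range (x t))))" by (rule convex_closure[OF cv])
    show "compact (closure (inside (range (x t))))" using I(3) by (simp add: compact_closure)
    have "inside (range (x t)) \<subseteq> interior (closure (inside (range (x t))))"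
      by (rule interior_maximal[OF closure_subset I(2)])
    then show "interior (closure (inside (range (x t)))) \<noteq> {}" using I(1) by blast
    show "range (x t) = frontier (closure (inside (range (x t))))"
    proof -
      have "interior (closure (inside (range (x t)))) = inside (range (x t))"
        using convex_interior_closure[OF cv] interior_open[OF I(2)] by simp
      then show ?thesis using I(4) interior_open[OF I(2)] by (simp add: frontier_def)
    qed
  qed
qed

section \<open>Normal, speed and curvature along the flow\<close>

definition N :: "real \<Rightarrow> real \<Rightarrow> complex" where "N t u = outward_normal (x t) u"

definition s :: tfun where "s t u = norm (D 1 0 t u)"

definition k :: tfun where "k t u = curvature (x t) u"

lemma N_unit: assumes t: "t \<in> S" shows "norm (N t u) = 1"
  using convex_curve.outward_normal_supports[OF convex_curve_x[OF t], of u]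
  unfolding N_def convex_curve.supports_def[OF convex_curve_x[OF t]] by blast

lemma N_support: assumes t: "t \<in> S" shows "N t u \<bullet> (x t v - x t u) \<le> 0"
  using convex_curve.outward_normal_supports[OF convex_curve_x[OF t], of u] convex_curve.on_curve(1)[OF convex_curve_x[OF t], of v]
  unfolding N_def convex_curve.supports_def[OF convex_curve_x[OF t]] by blast

lemma s_pos: "t \<in> S \<Longrightarrow> 0 < s t u" using D1_nonzero by (simp add: s_def)

lemma sign_t: assumes t: "t \<in> S"
  shows "\<exists>\<sigma>. (\<sigma> = 1 \<or> \<sigma> = -1) \<and> (\<forall>u. N t u = of_real (\<sigma> / s t u) * (- \<i> * D 1 0 t u))"
proof -
  have "continuous_on UNIV (D 1 0 t)"
    using Du[OF t, of 1 0] by (meson continuous_at_imp_continuous_on has_vector_derivative_continuous)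
  from convex_curve.outward_normal_sign[OF convex_curve_x[OF t] this] show ?thesis by (simp add: N_def s_def)
qed

text \<open>A linear functional attains its minimum over the convex body on the frontier, hence on
  the curve; at an interior point it is already strictly smaller than at
  \<open>x t u\<close>.\<close>

lemma strict_point: assumes t: "t \<in> S" shows "\<exists>v. N t u \<bullet> (x t v - x t u) < 0"
proof -
  let ?K = "closure (inside (range (x t)))"
  interpret C: convex_curve "x t" "D 1 0 t" ?K by (rule convex_curve_x[OF t])
  have sup: "C.supports (N t u) u" unfolding N_def by (rule C.outward_normal_supports)
  obtain z where z: "z \<in> interior ?K" using C.K(3) unfolding ex_in_conv[symmetric] by (elim exE)
  have ne: "?K \<noteq> {}" using C.on_curve(1)[of 0] by (metis empty_iff)
  have co: "continuous_on ?K (\<lambda>w. N t u \<bullet> w)" by (intro continuous_intros)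
  obtain w where w: "w \<in> ?K" "\<And>y. y \<in> ?K \<Longrightarrow> N t u \<bullet> w \<le> N t u \<bullet> y"
    using continuous_attains_inf[OF C.K(2) ne co] by (elim bexE) simp
  have "w \<notin> interior ?K"
  proof
    assume "w \<in> interior ?K"
    then obtain e where e: "0 < e" "ball w e \<subseteq> ?K" unfolding mem_interior by (elim exE conjE)
    have n: "norm (N t u) = 1" by (rule N_unit[OF t])
    then have "w - (e / 2) *\<^sub>R N t u \<in> ?K" using e(1) by (intro subsetD[OF e(2)]) (simp add: dist_norm)
    from w(2)[OF this] have "(e / 2) * (N t u \<bullet> N t u) \<le> 0" by (simp add: inner_diff_right)
    then show False using n e(1) unfolding norm_eq_1 by simp
  qed
  then have "w \<in> frontier ?K" using w(1) by (simp add: frontier_def)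
  then obtain v where v: "w = x t v" unfolding C.frontier[symmetric] by (elim rangeE)
  have "N t u \<bullet> (z - x t u) < 0" by (rule C.supports_strict[OF sup z])
  moreover have "N t u \<bullet> w \<le> N t u \<bullet> z" using w(2) z subsetD[OF interior_subset z] by simp
  ultimately show ?thesis using v by (intro exI[of _ v]) (simp add: inner_diff_right)
qed

definition sig :: "real \<Rightarrow> real" where
  "sig t = (SOME \<sigma>. (\<sigma> = 1 \<or> \<sigma> = -1) \<and> (\<forall>u. N t u = of_real (\<sigma> / s t u) * (- \<i> * D 1 0 t u)))"

lemma sig: assumes "t \<in> S" shows "sig t = 1 \<or> sig t = -1" "N t u = of_real (sig t / s t u) * (- \<i> * D 1 0 t u)"
  using someI_ex[OF sign_t[OF assms]] unfolding sig_def by blast+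

text \<open>The orientation is locally constant in time: \<open>sig t * f t\<close> is never
  positive and is strictly negative at t = a, while f is continuous, so \<open>sig\<close> cannot
  jump.\<close>

lemma sig_const: assumes t: "t \<in> S" shows "sig t = sig 0"
proof (rule connected_local_const[where f=sig and A=S])
  show "connected S" "t \<in> S" "0 \<in> S" using t zero_S by (simp_all add: S_def)
  show "\<forall>a\<in>S. eventually (\<lambda>b. sig a = sig b) (at a within S)"
  proof
    fix a assume a: "a \<in> S"
    obtain v where v: "N a 0 \<bullet> (x a v - x a 0) < 0" using strict_point[OF a] by blast
    define f where "f t = (- \<i> * D 1 0 t 0) \<bullet> (D 0 0 t v - D 0 0 t 0)" for t
    have cD: "continuous_on S (\<lambda>t. D i j t u)" for i j u
      using Dt[of _ i j u] by (meson continuous_on_eq_continuous_within has_vector_derivative_continuous)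
    have cf: "continuous_on S f" unfolding f_def by (intro continuous_intros cD)
    have fN: "sig t * f t = s t 0 * (N t 0 \<bullet> (x t v - x t 0))" if "t \<in> S" for t
    proof -
      have "N t 0 = (sig t / s t 0) *\<^sub>R (- \<i> * D 1 0 t 0)" using sig(2)[OF that, of 0] by (simp only: scaleR_conv_of_real)
      then have "s t 0 * (N t 0 \<bullet> (x t v - x t 0)) = s t 0 * ((sig t / s t 0) * f t)"
        using D0[OF that] by (simp add: f_def)
      then show ?thesis using s_pos[OF that, of 0] by simp
    qed
    have "sig a * f a < 0" using fN[OF a] v s_pos[OF a, of 0] by (simp add: mult_pos_neg)
    moreover have "((\<lambda>t. sig a * f t) \<longlongrightarrow> sig a * f a) (at a within S)"
      using cf a by (intro tendsto_intros) (simp add: continuous_on_def)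
    ultimately have "\<forall>\<^sub>F t in at a within S. sig a * f t < 0" by (intro order_tendstoD(2))
    moreover have "\<forall>\<^sub>F t in at a within S. t \<in> S" by (simp add: eventually_at_filter)
    ultimately show "\<forall>\<^sub>F b in at a within S. sig a = sig b"
    proof eventually_elim
      case (elim t)
      have "sig t * f t \<le> 0" using fN[OF elim(2)] N_support[OF elim(2), of 0 v] s_pos[OF elim(2), of 0]
        by (simp add: mult_nonneg_nonpos)
      then show ?case using elim(1) sig(1)[OF a] sig(1)[OF elim(2)] by auto
    qed
  qed
qed

definition \<sigma> :: real where "\<sigma> = sig 0"

lemma \<sigma>: "\<sigma> = 1 \<or> \<sigma> = -1" "\<sigma> * \<sigma> = 1" using sig(1)[OF zero_S] by (auto simp: \<sigma>_def)

lemma N_eq: "t \<in> S \<Longrightarrow> N t u = of_real (\<sigma> / s t u) * (- \<i> * D 1 0 t u)"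
  using sig(2)[of t u] sig_const[of t] by (simp add: \<sigma>_def)

lemma D1_eq: assumes t: "t \<in> S" shows "D 1 0 t u = of_real (\<sigma> * s t u) * (\<i> * N t u)"
proof -
  have "of_real (\<sigma> * s t u) * (\<i> * N t u) = of_real (\<sigma> * s t u * (\<sigma> / s t u)) * D 1 0 t u"
    unfolding N_eq[OF t] by (simp add: mult_ac)
  also have "\<sigma> * s t u * (\<sigma> / s t u) = 1" using \<sigma>(2) s_pos[OF t, of u] by (simp add: mult_ac)
  finally show ?thesis by simp
qed

lemma s_Cinf: "Cinf S s"
proof -
  have pos: "0 < Re (D 1 0 t u) ^ 2 + Im (D 1 0 t u) ^ 2" if "t \<in> S" for t u
    using D1_nonzero[OF that, of u] by (simp add: complex_neq_0)
  have "Cinf S (\<lambda>t u. sqrt (Re (D 1 0 t u) ^ 2 + Im (D 1 0 t u) ^ 2))"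
    unfolding Cinf_def using Ck_sqrt[where S=S and f="\<lambda>t u. Re (D 1 0 t u) ^ 2 + Im (D 1 0 t u) ^ 2"] pos
      Cinf_add[OF Cinf_power[OF D_Cinf(1)] Cinf_power[OF D_Cinf(2)]] unfolding Cinf_def by blast
  then show ?thesis by (simp add: s_def[abs_def] cmod_def)
qed

lemma N_Cinf: "Cinf S (\<lambda>t u. Re (N t u))" "Cinf S (\<lambda>t u. Im (N t u))"
proof -
  note R = Cinf_divide[OF Cinf_mult[OF Cinf_const[of S \<sigma>] D_Cinf(2)[of 1 0]] s_Cinf s_pos]
  note I = Cinf_divide[OF Cinf_mult[OF Cinf_const[of S "-\<sigma>"] D_Cinf(1)[of 1 0]] s_Cinf s_pos]
  show "Cinf S (\<lambda>t u. Re (N t u))" by (rule Cinf_cong[OF _ R]) (simp_all add: N_eq)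
  show "Cinf S (\<lambda>t u. Im (N t u))" by (rule Cinf_cong[OF _ I]) (simp_all add: N_eq)
qed

lemma k_eq: assumes t: "t \<in> S" shows "k t u = - (D 2 0 t u \<bullet> N t u) / (s t u)\<^sup>2"
  unfolding k_def curvature_def N_def s_def unfolding vd2[OF t] unfolding vd1[OF t] ..

lemma k_pos: "t \<in> S \<Longrightarrow> 0 < k t u" unfolding k_def by (rule emb(3))

lemma k_Cinf: "Cinf S k"
proof -
  have "Cinf S (\<lambda>t u. (-1 * (Re (D 2 0 t u) * Re (N t u) + Im (D 2 0 t u) * Im (N t u))) / (s t u)\<^sup>2)"
    by (rule Cinf_divide[OF Cinf_mult[OF Cinf_const Cinf_add[OF Cinf_mult[OF D_Cinf(1) N_Cinf(1)] Cinf_mult[OF D_Cinf(2) N_Cinf(2)]]]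
        Cinf_power[OF s_Cinf]]) (rule zero_less_power[OF s_pos])
  then show ?thesis by (rule Cinf_cong[rotated]) (simp add: k_eq inner_complex)
qed

lemma k_def': "curvature (x t) u = k t u" and N_def': "outward_normal (x t) u = N t u"
  by (simp_all add: k_def N_def)

text \<open>The angular speed of the normal along the curve; \<open>q\<close> below is its angular
  speed in time at a fixed particle.\<close>

definition g :: tfun where
  "g t u = Re (N t u) * Du (\<lambda>t u. Im (N t u)) t u - Im (N t u) * Du (\<lambda>t u. Re (N t u)) t u"

definition q :: tfun where
  "q t u = Re (N t u) * Dt S (\<lambda>t u. Im (N t u)) t u - Im (N t u) * Dt S (\<lambda>t u. Re (N t u)) t u"

lemmas N_D = Cinf_D[OF time_dom_S N_Cinf(1)] Cinf_D[OF time_dom_S N_Cinf(2)]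

lemma g_Cinf: "Cinf S g" and q_Cinf: "Cinf S q"
proof -
  show "Cinf S g" unfolding g_def[abs_def]
    by (rule Cinf_diff[OF Cinf_mult[OF N_Cinf(1) N_D(4)] Cinf_mult[OF N_Cinf(2) N_D(1)]])
  show "Cinf S q" unfolding q_def[abs_def]
    by (rule Cinf_diff[OF Cinf_mult[OF N_Cinf(1) N_D(5)] Cinf_mult[OF N_Cinf(2) N_D(2)]])
qed

lemma N_du: assumes t: "t \<in> S"
  shows "(N t has_vector_derivative of_real (g t u) * (\<i> * N t u)) (at u)"
proof -
  define N' where "N' = Complex (Du (\<lambda>t u. Re (N t u)) t u) (Du (\<lambda>t u. Im (N t u)) t u)"
  have d: "(N t has_vector_derivative N') (at u)"
    using N_D(3,6) t by (simp add: has_vector_derivative_complex_iff partials_def N'_def)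
  have "N' = of_real (Re (N t u) * Im N' - Im (N t u) * Re N') * (\<i> * N t u)"
    by (rule unit_vector_derivative[OF d]) (use N_unit[OF t] in auto)
  then show ?thesis using d by (simp add: N'_def g_def)
qed

lemma N_dt: assumes t: "t \<in> S"
  shows "((\<lambda>t. N t u) has_vector_derivative of_real (q t u) * (\<i> * N t u)) (at t within S)"
proof -
  define N' where "N' = Complex (Dt S (\<lambda>t u. Re (N t u)) t u) (Dt S (\<lambda>t u. Im (N t u)) t u)"
  have d: "((\<lambda>t. N t u) has_vector_derivative N') (at t within S)"
    using N_D(3,6) t by (simp add: has_vector_derivative_complex_iff partials_def N'_def)
  have "N' = of_real (Re (N t u) * Im N' - Im (N t u) * Re N') * (\<i> * N t u)"
    by (rule unit_vector_derivative[OF d]) (use N_unit t time_dom_not_trivial[OF time_dom_S t] in auto)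
  then show ?thesis using d by (simp add: N'_def q_def)
qed

lemma N_inner [simp]: "t \<in> S \<Longrightarrow> N t u \<bullet> N t u = 1" "N t u \<bullet> (\<i> * N t u) = 0" "(\<i> * N t u) \<bullet> N t u = 0"
  "t \<in> S \<Longrightarrow> (\<i> * N t u) \<bullet> (\<i> * N t u) = 1"
proof -
  assume "t \<in> S"
  then show "N t u \<bullet> N t u = 1" using N_unit norm_eq_1 by blast
  then show "(\<i> * N t u) \<bullet> (\<i> * N t u) = 1" by (simp add: inner_complex)
qed (simp_all add: inner_complex)

lemma D1_N: "t \<in> S \<Longrightarrow> D 1 0 t u \<bullet> N t u = 0" "t \<in> S \<Longrightarrow> D 1 0 t u \<bullet> (\<i> * N t u) = \<sigma> * s t u"
  by (simp_all only: D1_eq of_real_inner N_inner mult_zero_right mult_1_right)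

text \<open>Obtained by differentiating the orthogonality of tangent and normal along the
  curve.\<close>

lemma g_eq: assumes t: "t \<in> S" shows "g t u = \<sigma> * k t u * s t u"
proof -
  have "((\<lambda>u. D 1 0 t u \<bullet> N t u) has_real_derivative D 1 0 t u \<bullet> (of_real (g t u) * (\<i> * N t u)) + D 2 0 t u \<bullet> N t u) (at u)"
    using has_real_derivative_inner[OF Du[OF t, of 1 0 u] N_du[OF t, of u]] by (simp add: numeral_2_eq_2)
  then have "((\<lambda>u. 0) has_real_derivative D 1 0 t u \<bullet> (of_real (g t u) * (\<i> * N t u)) + D 2 0 t u \<bullet> N t u) (at u)"
    by (simp add: D1_N(1)[OF t] del: One_nat_def)
  then have "D 1 0 t u \<bullet> (of_real (g t u) * (\<i> * N t u)) + D 2 0 t u \<bullet> N t u = 0"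
    using DERIV_unique DERIV_const by blast
  then have "D 2 0 t u \<bullet> N t u = - (g t u * (\<sigma> * s t u))" by (simp add: of_real_inner D1_N(2)[OF t] del: One_nat_def)
  then have "k t u = g t u * \<sigma> / s t u" using s_pos[OF t, of u] by (simp add: k_eq[OF t] power2_eq_square field_simps)
  then have "\<sigma> * k t u * s t u = g t u * (\<sigma> * \<sigma>)" using s_pos[OF t, of u] by (simp add: field_simps)
  then show ?thesis by (simp add: \<sigma>(2))
qed

lemma g_nonzero: "t \<in> S \<Longrightarrow> g t u \<noteq> 0"
  using k_pos[of t u] s_pos[of t u] \<sigma>(1) by (auto simp: g_eq)

lemma D01: assumes t: "t \<in> S" shows "D 0 1 t u = of_real (- (1 / p) * k t u ^ p) * N t u"
proof -
  have "((\<lambda>s. D 0 0 s u) has_vector_derivative D 0 1 t u) (at t within S)" using Dt[OF t, of 0 0 u] by simp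
  then have "((\<lambda>s. x s u) has_vector_derivative D 0 1 t u) (at t within S)"
    by (rule has_vector_derivative_transform[OF t, rotated]) (simp add: D0)
  then show ?thesis using evol[OF t, of u] vector_derivative_unique_within[OF time_dom_not_trivial[OF time_dom_S t]]
    by (metis N_def k_def scaleR_conv_of_real)
qed

lemma k_du: "t \<in> S \<Longrightarrow> (k t has_real_derivative Du k t u) (at u)"
  and k_dt: "t \<in> S \<Longrightarrow> ((\<lambda>t. k t u) has_real_derivative Dt S k t u) (at t within S)"
  using Cinf_D(3)[OF time_dom_S k_Cinf] by (auto simp: partials_def)

lemma D11_N: assumes t: "t \<in> S" shows "D 1 1 t u \<bullet> N t u = - (k t u ^ (p - 1) * Du k t u)"
proof -
  have "((\<lambda>u. k t u ^ p) has_real_derivative p * k t u ^ (p - 1) * Du k t u) (at u)"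
    using DERIV_power[OF k_du[OF t, of u], of p] by (simp add: mult_ac)
  from DERIV_cmult[OF this, of "- (1 / p)"]
  have 1: "((\<lambda>u. - (1 / p) * k t u ^ p) has_real_derivative - (k t u ^ (p - 1) * Du k t u)) (at u)"
    using p by simp
  have "((\<lambda>u. complex_of_real (- (1 / p) * k t u ^ p)) has_vector_derivative of_real (- (k t u ^ (p - 1) * Du k t u))) (at u)"
    by (rule has_vector_derivative_of_real[OF 1])
  from has_vector_derivative_mult[OF this N_du[OF t, of u]]
  have "((\<lambda>u. of_real (- (1 / p) * k t u ^ p) * N t u) has_vector_derivative
    of_real (- (1 / p) * k t u ^ p) * (of_real (g t u) * (\<i> * N t u)) + of_real (- (k t u ^ (p - 1) * Du k t u)) * N t u) (at u)" .
  then have "(D 0 1 t has_vector_derivative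
    of_real (- (1 / p) * k t u ^ p) * (of_real (g t u) * (\<i> * N t u)) + of_real (- (k t u ^ (p - 1) * Du k t u)) * N t u) (at u)"
    using D01[OF t, THEN sym] by (simp only:)
  moreover have "(D 0 1 t has_vector_derivative D 1 1 t u) (at u)" using Du[OF t, of 0 1 u] by simp
  ultimately have "D 1 1 t u = of_real (- (1 / p) * k t u ^ p) * (of_real (g t u) * (\<i> * N t u)) + of_real (- (k t u ^ (p - 1) * Du k t u)) * N t u"
    using vector_derivative_unique_at by blast
  then show ?thesis using t by (simp only: inner_add_left of_real_inner N_inner mult_zero_right mult_1_right add_0)
qed

text \<open>The same orthogonality differentiated in time; the tangential derivative of the normal
  speed comes in through \<open>D11_N\<close>.\<close>

lemma q_eq: assumes t: "t \<in> S" shows "q t u * s t u = \<sigma> * (k t u ^ (p - 1) * Du k t u)"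
proof -
  have "((\<lambda>t. D 1 0 t u \<bullet> N t u) has_real_derivative D 1 0 t u \<bullet> (of_real (q t u) * (\<i> * N t u)) + D 1 1 t u \<bullet> N t u) (at t within S)"
    using has_real_derivative_inner[OF Dt[OF t, of 1 0 u] N_dt[OF t, of u]] by simp
  then have "((\<lambda>t. 0) has_real_derivative D 1 0 t u \<bullet> (of_real (q t u) * (\<i> * N t u)) + D 1 1 t u \<bullet> N t u) (at t within S)"
    by (rule has_field_derivative_transform_within[OF _ zero_less_one t]) (simp add: D1_N(1) del: One_nat_def)
  then have "((\<lambda>t. 0) has_vector_derivative D 1 0 t u \<bullet> (of_real (q t u) * (\<i> * N t u)) + D 1 1 t u \<bullet> N t u) (at t within S)"
    by (simp add: real_derivative_vector)
  then have "D 1 0 t u \<bullet> (of_real (q t u) * (\<i> * N t u)) + D 1 1 t u \<bullet> N t u = 0"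
    using vector_derivative_unique_within[OF time_dom_not_trivial[OF time_dom_S t]] has_vector_derivative_const by blast
  then have "q t u * (\<sigma> * s t u) = k t u ^ (p - 1) * Du k t u" by (simp only: of_real_inner D1_N(2)[OF t] D11_N[OF t])
  then have "(\<sigma> * \<sigma>) * (q t u * s t u) = \<sigma> * (k t u ^ (p - 1) * Du k t u)" by (simp only: mult_ac)
  then show ?thesis by (simp add: \<sigma>(2))
qed

section \<open>A jointly smooth lift of the normal angle\<close>

lemma lift_exists: "\<exists>\<Phi>. (\<forall>u. (\<Phi> has_real_derivative g 0 u) (at u)) \<and> cis (\<Phi> 0) = N 0 0"
proof -
  have "continuous_on UNIV (g 0)" by (rule cont2_slice_u[OF Cinf_cont2[OF g_Cinf] zero_S])
  then have c: "isCont (g 0) u" for u by (simp add: continuous_on_eq_continuous_at)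
  obtain F where F: "\<And>u. (F has_real_derivative g 0 u) (at u)"
    using einterval_antiderivative[of "-\<infinity>" "\<infinity>" "g 0"] c
    by (auto simp: real_derivative_vector)
  define \<Phi> where "\<Phi> u = F u + (Arg (N 0 0) - F 0)" for u
  have "(\<Phi> has_real_derivative g 0 u) (at u)" for u unfolding \<Phi>_def
    by (auto intro!: derivative_eq_intros F)
  moreover have "cis (\<Phi> 0) = N 0 0"
  proof -
    have "N 0 0 \<noteq> 0" using N_unit[OF zero_S, of 0] by (metis norm_zero zero_neq_one)
    from cis_Arg[OF this] show ?thesis using N_unit[OF zero_S, of 0] by (simp add: \<Phi>_def sgn_div_norm)
  qed
  ultimately show ?thesis by blast
qed

definition \<Phi> :: "real \<Rightarrow> real" where
  "\<Phi> = (SOME \<Phi>. (\<forall>u. (\<Phi> has_real_derivative g 0 u) (at u)) \<and> cis (\<Phi> 0) = N 0 0)"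

lemma \<Phi>: "(\<Phi> has_real_derivative g 0 u) (at u)" "cis (\<Phi> 0) = N 0 0"
  using someI_ex[OF lift_exists] unfolding \<Phi>_def by blast+

text \<open>The lift at time 0 plus the accumulated rotation of the normal at the particle
  u.\<close>

definition \<phi> :: tfun where "\<phi> t u = \<Phi> u + tint q t u"

lemma cis_\<phi>: assumes t: "t \<in> S" shows "N t u = cis (\<phi> t u)"
proof (rule cis_lift[where N="\<lambda>t. N t u" and \<phi>="\<lambda>t. \<phi> t u" and x=t and S=S and q="\<lambda>t. q t u" and ?x0.0=0])
  show "((\<lambda>t. \<phi> t u) has_real_derivative q t u) (at t within S)" if "t \<in> S" for t
    unfolding \<phi>_def using DERIV_add[OF DERIV_const tint_DERIV_t[OF time_dom_S Cinf_cont2[OF q_Cinf] that]] by simp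
  show "convex S" "0 \<in> S" "t \<in> S" using t zero_S by (simp_all add: S_def)
  have "N 0 u = cis (\<Phi> u)"
    by (rule cis_lift[where S=UNIV and q="g 0" and ?x0.0=0]) (use N_du[OF zero_S] \<Phi> in auto)
  then show "N 0 u = cis (\<phi> 0 u)" by (simp add: \<phi>_def tint_def)
qed (rule N_dt)

lemma \<phi>_dt: assumes "t \<in> S" shows "((\<lambda>t. \<phi> t u) has_real_derivative q t u) (at t within S)"
  unfolding \<phi>_def using DERIV_add[OF DERIV_const tint_DERIV_t[OF time_dom_S Cinf_cont2[OF q_Cinf] assms]] by simp

text \<open>Differentiation under the integral gives some derivative e; comparing the derivatives of
  N and \<open>cis (\<phi> t u)\<close> identifies it as g.\<close>

lemma \<phi>_du: assumes t: "t \<in> S" shows "(\<phi> t has_real_derivative g t u) (at u)"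
proof -
  note Q = Cinf_D[OF time_dom_S q_Cinf]
  have dq: "(q t has_real_derivative Du q t u) (at u)" if "t \<in> S" for t u using Q(3) that by (auto simp: partials_def)
  define e where "e = g 0 u + tint (Du q) t u"
  have d: "(\<phi> t has_real_derivative e) (at u)" unfolding \<phi>_def[abs_def] e_def
    by (rule DERIV_add[OF \<Phi>(1) tint_DERIV_u[OF time_dom_S Cinf_cont2[OF q_Cinf] Cinf_cont2[OF Q(1)] t dq]])
  have eq: "N t = (\<lambda>u. cis (\<phi> t u))" using cis_\<phi>[OF t] by blast
  have "((\<lambda>u. cis (\<phi> t u)) has_vector_derivative e *\<^sub>R (\<i> * cis (\<phi> t u))) (at u)"
    using vector_diff_chain_at[OF d[unfolded real_derivative_vector] cis_has_vector_derivative] by (simp add: o_def)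
  then have "(N t has_vector_derivative of_real e * (\<i> * N t u)) (at u)"
    by (simp add: scaleR_conv_of_real eq)
  then have "of_real e * (\<i> * N t u) = of_real (g t u) * (\<i> * N t u)"
    using N_du[OF t] vector_derivative_unique_at by blast
  then have "e = g t u" using N_unit[OF t, of u] by auto
  then show ?thesis using d by simp
qed

lemma \<phi>_partials: "partials S \<phi> g q" using \<phi>_du \<phi>_dt by (simp add: partials_def)

lemma \<phi>_Cinf: "Cinf S \<phi>"
proof (rule Cinf_partialsI[OF \<phi>_partials _ g_Cinf q_Cinf])
  have "continuous_on UNIV \<Phi>" using \<Phi>(1) by (meson DERIV_isCont continuous_at_imp_continuous_on)
  then have "continuous_on (S \<times> UNIV) (\<lambda>z. \<Phi> (snd z))"
    by (rule continuous_on_compose2) (auto intro: continuous_on_snd continuous_on_id)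
  then show "cont2 S \<phi>" using cont2_tint[OF time_dom_S Cinf_cont2[OF q_Cinf]]
    unfolding cont2_def \<phi>_def by (rule continuous_on_add)
qed

lemma N_periodic: "t \<in> S \<Longrightarrow> N t (u + 2 * pi) = N t u" and s_periodic: "t \<in> S \<Longrightarrow> s t (u + 2 * pi) = s t u"
  and k_periodic: "t \<in> S \<Longrightarrow> k t (u + 2 * pi) = k t u"
  by (simp_all add: N_eq s_def D_per k_eq)

lemma angle_curve_x: assumes t: "t \<in> S" shows "angle_curve (x t) (\<phi> t) (g t) (k t)"
proof
  fix u v
  have "D 1 0 t u = of_real (g t u / k t u) * (\<i> * cis (\<phi> t u))"
  proof -
    have "g t u / k t u = \<sigma> * s t u" using k_pos[OF t, of u] by (simp add: g_eq[OF t])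
    then show ?thesis using D1_eq[OF t, of u] by (simp only: cis_\<phi>[OF t])
  qed
  then show "(x t has_vector_derivative of_real (g t u / k t u) * (\<i> * cis (\<phi> t u))) (at u)"
    using dx[OF t, of u] by simp
  show "(\<phi> t has_real_derivative g t u) (at u)" by (rule \<phi>_du[OF t])
  show "0 < k t u" by (rule k_pos[OF t])
  show "(\<forall>u. 0 < g t u) \<or> (\<forall>u. g t u < 0)"
    using \<sigma>(1) k_pos[OF t] s_pos[OF t] by (auto simp: g_eq[OF t])
  show "g t (u + 2 * pi) = g t u" by (simp add: g_eq[OF t] k_periodic[OF t] s_periodic[OF t])
  show "x t (u + 2 * pi) = x t u" by (rule x_per[OF t])
  show "inj_on (x t) {0..<2 * pi}" by (rule x_inj[OF t])
  show "cis (\<phi> t (u + 2 * pi)) = cis (\<phi> t u)" using N_periodic[OF t, of u] by (simp add: cis_\<phi>[OF t])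
  show "cis (\<phi> t u) \<bullet> (x t v - x t u) \<le> 0" using N_support[OF t, of u v] by (simp add: cis_\<phi>[OF t])
qed

definition kap :: tfun where "kap t = angle_curve.kap (\<phi> t) (k t)"

lemma kap_\<phi>: assumes t: "t \<in> S" shows "kap t (\<phi> t u) = k t u"
  unfolding kap_def by (simp add: angle_curve.kap_def[OF angle_curve_x[OF t]] angle_curve.U\<phi>[OF angle_curve_x[OF t]])

lemma angle_curvature_x: assumes t: "t \<in> S" shows "angle_curvature (x t) \<theta> = kap t \<theta>"
  unfolding angle_curvature_def
proof (rule the_equality)
  interpret A: angle_curve "x t" "\<phi> t" "g t" "k t" by (rule angle_curve_x[OF t])
  show "\<exists>u. outward_normal (x t) u = cis \<theta> \<and> kap t \<theta> = curvature (x t) u"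
    by (rule exI[of _ "A.U \<theta>"]) (simp add: N_def' k_def' cis_\<phi>[OF t] kap_\<phi>[OF t, symmetric])
  fix c assume "\<exists>u. outward_normal (x t) u = cis \<theta> \<and> c = curvature (x t) u"
  then obtain u where u: "outward_normal (x t) u = cis \<theta>" "c = curvature (x t) u" by blast
  then have "cis (\<phi> t u) = cis \<theta>" by (simp add: N_def' cis_\<phi>[OF t])
  from A.curvature_at_normal[OF this] show "c = kap t \<theta>" using u(2) by (simp add: kap_def k_def')
qed

text \<open>The value at time 0, made constant in time in order to fit
  \<open>smooth_of_angle\<close> and \<open>ode_flow\<close>.\<close>

lemma Cinf_initial: "Cinf S f \<Longrightarrow> Cinf {0..} (\<lambda>t. f 0)"
  using Ck_compose[OF time_dom_S, of _ f "{0..}" "\<lambda>t u. 0" "\<lambda>t u. u"] Ck_const Ck_snd zero_S by (simp add: Cinf_def)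

lemma kap_smooth: "\<exists>D. D 0 = kap 0 \<and> (\<forall>j \<theta>. (D j has_real_derivative D (Suc j) \<theta>) (at \<theta>))"
proof -
  interpret A: angle_curve "x 0" "\<phi> 0" "g 0" "k 0" by (rule angle_curve_x[OF zero_S])
  from A.smooth_of_angle[OF Cinf_initial[OF k_Cinf] Cinf_initial[OF g_Cinf]] show ?thesis
    by (simp add: kap_def A.kap_def[abs_def])
qed

end

section \<open>Reconstruction from the support function\<close>

locale support_function =
  fixes H :: "nat \<Rightarrow> real \<Rightarrow> real"
  assumes dH: "\<And>j \<theta>. (H j has_real_derivative H (Suc j) \<theta>) (at \<theta>)"
    and per: "\<And>\<theta>. H 0 (\<theta> + 2 * pi) = H 0 \<theta>" and pos: "\<And>\<theta>. 0 < H 0 \<theta> + H 2 \<theta>"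
begin

text \<open>The radius of curvature as a function of the normal angle.\<close>

definition w :: "real \<Rightarrow> real" where "w \<theta> = H 0 \<theta> + H 2 \<theta>"

text \<open>The envelope of the lines with normal \<open>cis \<theta>\<close> and distance
  \<open>H 0 \<theta>\<close>: the curve with support function \<open>H 0\<close>.\<close>

definition Y :: "real \<Rightarrow> complex" where "Y \<theta> = of_real (H 0 \<theta>) * cis \<theta> + of_real (H 1 \<theta>) * (\<i> * cis \<theta>)"

lemma Y_inner: "Y \<theta> \<bullet> cis \<theta> = H 0 \<theta>" "Y \<theta> \<bullet> (\<i> * cis \<theta>) = H 1 \<theta>"
  by (simp_all add: Y_def inner_add_left of_real_inner)

lemma w_pos: "0 < w \<theta>" using pos by (simp add: w_def)

lemma dY: "(Y has_vector_derivative of_real (w \<theta>) * (\<i> * cis \<theta>)) (at \<theta>)"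
proof -
  have d: "((\<lambda>\<theta>. of_real (H j \<theta>)) has_vector_derivative (of_real (H (Suc j) \<theta>) :: complex)) (at \<theta>)" for j
    by (rule has_vector_derivative_of_real[OF dH])
  have ic: "((\<lambda>\<theta>. \<i> * cis \<theta>) has_vector_derivative \<i> * (\<i> * cis \<theta>)) (at \<theta>)"
    by (rule has_vector_derivative_mult_right[OF cis_has_vector_derivative])
  have "(Y has_vector_derivative (of_real (H 0 \<theta>) * (\<i> * cis \<theta>) + of_real (H (Suc 0) \<theta>) * cis \<theta>)
     + (of_real (H 1 \<theta>) * (\<i> * (\<i> * cis \<theta>)) + of_real (H (Suc 1) \<theta>) * (\<i> * cis \<theta>))) (at \<theta>)"
    unfolding Y_def
    by (rule has_vector_derivative_add[OF has_vector_derivative_mult[OF d cis_has_vector_derivative] has_vector_derivative_mult[OF d ic]])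
  then show ?thesis by (simp add: w_def algebra_simps numeral_2_eq_2)
qed

lemma H_per: "H j (\<theta> + 2 * pi) = H j \<theta>"
proof (induction j arbitrary: \<theta>)
  case 0
  show ?case by (rule per)
next
  case (Suc j)
  have "((\<lambda>\<theta>. H j (\<theta> + 2 * pi)) has_real_derivative H (Suc j) (\<theta> + 2 * pi)) (at \<theta>)"
    using DERIV_shift[of "H j" "H (Suc j) (\<theta> + 2 * pi)" \<theta> "2 * pi"] dH by simp
  then have "(H j has_real_derivative H (Suc j) (\<theta> + 2 * pi)) (at \<theta>)" by (simp add: Suc.IH)
  then show ?case using dH DERIV_unique by blast
qed

lemma Y_per: "Y (\<theta> + 2 * pi) = Y \<theta>"
proof -
  have "cis (\<theta> + 2 * pi) = cis \<theta>" by (simp add: complex_eq_iff)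
  then show ?thesis by (simp only: Y_def H_per)
qed

text \<open>The derivative of \<open>Y \<theta> \<bullet> cis \<alpha>\<close> is w times
  sin(\<alpha> - \<theta>), so within half a turn around \<alpha> this product increases up to
  \<alpha> and decreases afterwards.\<close>

lemma Y_support_less: assumes "cis \<theta> \<noteq> cis \<alpha>" shows "Y \<theta> \<bullet> cis \<alpha> < H 0 \<alpha>"
proof -
  define f where "f \<theta> = Y \<theta> \<bullet> cis \<alpha>" for \<theta>
  have df: "(f has_real_derivative w \<theta> * sin (\<alpha> - \<theta>)) (at \<theta>)" for \<theta>
    using has_real_derivative_inner[OF dY has_vector_derivative_const[of "cis \<alpha>"], of \<theta>]
    unfolding f_def of_real_inner by (simp flip: sin_minus)
  \<comment> \<open>Subtracting full turns brings \<theta> to within half a turn of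
    \<alpha>.\<close>
  define j where "j = \<lfloor>(\<theta> - \<alpha> + pi) / (2 * pi)\<rfloor>"
  define \<beta> where "\<beta> = \<theta> - 2 * pi * of_int j"
  have "of_int j \<le> (\<theta> - \<alpha> + pi) / (2 * pi)" "(\<theta> - \<alpha> + pi) / (2 * pi) < of_int j + 1"
    unfolding j_def by linarith+
  then have b: "\<alpha> - pi \<le> \<beta>" "\<beta> < \<alpha> + pi" by (simp_all add: \<beta>_def field_simps)
  have eq: "\<theta> = \<beta> + 2 * pi * of_int j" by (simp add: \<beta>_def)
  then have "Y \<theta> = Y \<beta>" using periodic_shift[where f=Y, OF Y_per] by simp
  moreover have "\<beta> \<noteq> \<alpha>" using assms eq cis_eq_iff by blast
  moreover have "f \<beta> < f \<alpha>" if lt: "\<beta> < \<alpha>"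
  proof -
    obtain z where z: "\<beta> < z" "z < \<alpha>" "f \<alpha> - f \<beta> = (\<alpha> - \<beta>) * (w z * sin (\<alpha> - z))"
      using MVT2[OF lt df] by blast
    have "0 < sin (\<alpha> - z)" using z b by (intro sin_gt_zero) auto
    then have "0 < f \<alpha> - f \<beta>" unfolding z(3) using lt w_pos by simp
    then show ?thesis by simp
  qed
  moreover have "f \<beta> < f \<alpha>" if lt: "\<alpha> < \<beta>"
  proof -
    obtain z where z: "\<alpha> < z" "z < \<beta>" "f \<beta> - f \<alpha> = (\<beta> - \<alpha>) * (w z * sin (\<alpha> - z))"
      using MVT2[OF lt df] by blast
    have "0 < sin (z - \<alpha>)" using z b by (intro sin_gt_zero) auto
    then have "sin (\<alpha> - z) < 0" by (metis minus_diff_eq neg_less_0_iff_less sin_minus)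
    then have "f \<beta> - f \<alpha> < 0" unfolding z(3) using lt w_pos by (intro mult_pos_neg) auto
    then show ?thesis by simp
  qed
  ultimately show ?thesis by (metis f_def Y_inner(1) linorder_neqE_linordered_idom)
qed

lemma Y_support: "Y \<theta> \<bullet> cis \<alpha> \<le> H 0 \<alpha>"
proof (cases "cis \<theta> = cis \<alpha>")
  case True
  then obtain j :: int where "\<theta> = \<alpha> + 2 * pi * of_int j" using cis_eq_iff by blast
  then have "Y \<theta> = Y \<alpha>" using periodic_shift[where f=Y, OF Y_per] by simp
  then show ?thesis by (simp add: Y_inner)
qed (use Y_support_less in force)

section \<open>The convex body of a support function\<close>

definition K :: "complex set" where "K = {z. \<forall>\<alpha>. z \<bullet> cis \<alpha> \<le> H 0 \<alpha>}"

lemma Y_in_K: "Y \<theta> \<in> K" by (simp add: K_def Y_support)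

lemma contH: "continuous_on A (H j)"
  using dH by (meson DERIV_isCont continuous_at_imp_continuous_on)

lemma convex_K: "convex K"
proof -
  have "K = (\<Inter>\<alpha>. {z. cis \<alpha> \<bullet> z \<le> H 0 \<alpha>})" by (auto simp: K_def inner_commute)
  then show ?thesis by (auto intro!: convex_INT convex_halfspace_le)
qed

lemma reduce_angle: obtains \<beta> where "0 \<le> \<beta>" "\<beta> \<le> 2 * pi" "cis \<beta> = cis \<alpha>" "H 0 \<beta> = H 0 \<alpha>"
proof -
  have "cis (u + 2 * pi) = cis u" for u by (simp add: complex_eq_iff)
  then obtain \<beta> where "\<beta> \<in> {0..2 * pi}" "(cis \<alpha>, H 0 \<alpha>) = (cis \<beta>, H 0 \<beta>)"
    using periodic_Icc[where f="\<lambda>\<theta>. (cis \<theta>, H 0 \<theta>)" and u=\<alpha>] per by metis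
  then show ?thesis using that[of \<beta>] by simp
qed

lemma compact_K: "compact K"
proof -
  have "K = (\<Inter>\<alpha>. {z. cis \<alpha> \<bullet> z \<le> H 0 \<alpha>})" by (auto simp: K_def inner_commute)
  then have "closed K" by (auto intro!: closed_INT closed_halfspace_le)
  moreover have "bounded K"
  proof -
    have "compact (H 0 ` {0..2 * pi})" by (intro compact_continuous_image contH) simp
    then obtain B where B: "\<And>\<beta>. 0 \<le> \<beta> \<Longrightarrow> \<beta> \<le> 2 * pi \<Longrightarrow> \<bar>H 0 \<beta>\<bar> \<le> B"
      unfolding compact_eq_bounded_closed bounded_iff by fastforce
    have "norm z \<le> B" if z: "z \<in> K" for z
    proof -
      obtain r \<alpha> where ra: "z = of_real r * cis \<alpha>" "r = norm z" by (metis rcis_def rcis_cmod_Arg)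
      obtain \<beta> where \<beta>: "0 \<le> \<beta>" "\<beta> \<le> 2 * pi" "cis \<beta> = cis \<alpha>" "H 0 \<beta> = H 0 \<alpha>" by (rule reduce_angle)
      have "norm z = z \<bullet> cis \<alpha>" by (subst ra(1)) (simp add: of_real_inner ra(2))
      also have "\<dots> \<le> H 0 \<alpha>" using z by (simp add: K_def)
      also have "\<dots> \<le> B" using B[OF \<beta>(1,2)] \<beta>(4) by simp
      finally show ?thesis .
    qed
    then show ?thesis unfolding bounded_iff by blast
  qed
  ultimately show ?thesis by (simp add: compact_eq_bounded_closed)
qed

lemma interior_K: assumes s: "\<And>\<alpha>. z \<bullet> cis \<alpha> < H 0 \<alpha>" shows "z \<in> interior K"
proof -
  have "continuous_on {0..2 * pi} (\<lambda>\<alpha>. H 0 \<alpha> - z \<bullet> cis \<alpha>)"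
    by (intro continuous_on_diff contH continuous_intros)
  then obtain m where m: "\<And>\<beta>. 0 \<le> \<beta> \<Longrightarrow> \<beta> \<le> 2 * pi \<Longrightarrow> H 0 m - z \<bullet> cis m \<le> H 0 \<beta> - z \<bullet> cis \<beta>"
    using continuous_attains_inf[of "{0..2 * pi}" "\<lambda>\<alpha>. H 0 \<alpha> - z \<bullet> cis \<alpha>"] by fastforce
  have "ball z (H 0 m - z \<bullet> cis m) \<subseteq> K"
  proof
    fix y assume y: "y \<in> ball z (H 0 m - z \<bullet> cis m)"
    have "y \<bullet> cis \<alpha> \<le> H 0 \<alpha>" for \<alpha>
    proof -
      obtain \<beta> where \<beta>: "0 \<le> \<beta>" "\<beta> \<le> 2 * pi" "cis \<beta> = cis \<alpha>" "H 0 \<beta> = H 0 \<alpha>" by (rule reduce_angle)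
      have "(y - z) \<bullet> cis \<alpha> \<le> norm (y - z) * norm (cis \<alpha>)" by (rule norm_cauchy_schwarz)
      also have "\<dots> \<le> H 0 m - z \<bullet> cis m" using y by (simp add: dist_norm norm_minus_commute)
      also have "\<dots> \<le> H 0 \<alpha> - z \<bullet> cis \<alpha>" using m[OF \<beta>(1,2)] \<beta>(3,4) by simp
      finally show ?thesis by (simp add: inner_diff_left)
    qed
    then show "y \<in> K" by (simp add: K_def)
  qed
  then show ?thesis using s[of m] unfolding mem_interior by (intro exI[of _ "H 0 m - z \<bullet> cis m"]) simp
qed

text \<open>The midpoint of two points with opposite normals: every direction differs from at least
  one of the two normals, so at least one of the support inequalities is strict.\<close>

lemma interior_nonempty: "interior K \<noteq> {}"
proof -
  define z where "z = (1/2) *\<^sub>R (Y 0 + Y pi)"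
  have "z \<bullet> cis \<alpha> < H 0 \<alpha>" for \<alpha>
  proof -
    have "cis 0 \<noteq> cis pi" by simp
    then have "cis 0 \<noteq> cis \<alpha> \<or> cis pi \<noteq> cis \<alpha>" by metis
    then have "Y 0 \<bullet> cis \<alpha> + Y pi \<bullet> cis \<alpha> < 2 * H 0 \<alpha>"
    proof
      assume "cis 0 \<noteq> cis \<alpha>"
      then show ?thesis using Y_support_less[of 0 \<alpha>] Y_support[of pi \<alpha>] by linarith
    next
      assume "cis pi \<noteq> cis \<alpha>"
      then show ?thesis using Y_support_less[of pi \<alpha>] Y_support[of 0 \<alpha>] by linarith
    qed
    then show ?thesis by (simp add: z_def inner_add_left)
  qed
  then have "z \<in> interior K" by (rule interior_K)
  then show ?thesis by blast
qed

text \<open>At a boundary point some constraint is tight, say at \<alpha>. The slack is nonnegative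
  in the direction and has a minimum there, so its derivative vanishes; this gives the second
  coordinate of z, and z = Y \<alpha>. Conversely a step from \<open>Y \<theta>\<close> along
  \<open>cis \<theta>\<close> leaves K.\<close>

lemma frontier_K: "frontier K = range Y"
proof (intro equalityI subsetI)
  fix z assume z: "z \<in> frontier K"
  have zK: "z \<in> K" using z compact_K compact_imp_closed frontier_subset_closed by blast
  have "z \<notin> interior K" using z by (simp add: frontier_def)
  then obtain \<alpha> where "\<not> z \<bullet> cis \<alpha> < H 0 \<alpha>" using interior_K by blast
  then have eq: "z \<bullet> cis \<alpha> = H 0 \<alpha>" using zK by (auto simp: K_def intro: antisym)
  define f where "f \<alpha> = H 0 \<alpha> - z \<bullet> cis \<alpha>" for \<alpha>
  have "(f has_real_derivative H 1 \<alpha> - z \<bullet> (\<i> * cis \<alpha>)) (at \<alpha>)"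
    unfolding f_def using DERIV_diff[OF dH[of 0 \<alpha>] has_real_derivative_inner[OF has_vector_derivative_const[of z] cis_has_vector_derivative]]
    by simp
  moreover have "f \<alpha> \<le> f y" for y using eq zK by (simp add: f_def K_def)
  ultimately have "H 1 \<alpha> - z \<bullet> (\<i> * cis \<alpha>) = 0" using DERIV_local_min[of f _ \<alpha> 1] zero_less_one by blast
  then have "z = Y \<alpha>" using cis_basis[of z \<alpha>] eq by (simp add: Y_def)
  then show "z \<in> range Y" by blast
next
  fix z assume "z \<in> range Y"
  then obtain \<theta> where z: "z = Y \<theta>" by blast
  have "z \<notin> interior K"
  proof
    assume "z \<in> interior K"
    then obtain e where e: "0 < e" "ball z e \<subseteq> K" unfolding mem_interior by (elim exE conjE)
    have "z + (e / 2) *\<^sub>R cis \<theta> \<in> K" using e(1) by (intro subsetD[OF e(2)]) (simp add: dist_norm)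
    then have "(z + (e / 2) *\<^sub>R cis \<theta>) \<bullet> cis \<theta> \<le> H 0 \<theta>" by (simp add: K_def)
    then show False using e(1) by (simp add: inner_add_left z Y_inner)
  qed
  then show "z \<in> frontier K" using Y_in_K[of \<theta>] z closure_subset by (auto simp: frontier_def)
qed

text \<open>The reparametrised curve runs through the whole frontier of K, so
  \<open>convex_curve\<close> computes \<open>outward_normal\<close>. The curvature follows by
  differentiating the orthogonality of tangent and normal.\<close>

lemma reparametrised:
  assumes d\<phi>: "\<And>u. (\<phi> has_real_derivative \<phi>' u) (at u)" "\<And>u. (\<phi>' has_real_derivative \<phi>'' u) (at u)"
    and mono: "(\<forall>u. 0 < \<phi>' u) \<or> (\<forall>u. \<phi>' u < 0)"
    and turn: "\<And>u. \<phi> (u + 2 * pi) = \<phi> u + T" "\<bar>T\<bar> = 2 * pi" and smooth: "smooth_curve (\<lambda>u. Y (\<phi> u))"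
  shows "convex_embedding (\<lambda>u. Y (\<phi> u))" "outward_normal (\<lambda>u. Y (\<phi> u)) u = cis (\<phi> u)"
    "curvature (\<lambda>u. Y (\<phi> u)) u = 1 / w (\<phi> u)"
proof -
  interpret angle_map \<phi> \<phi>' T by unfold_locales (rule d\<phi>(1) mono turn(1))+
  define \<gamma> where "\<gamma> u = Y (\<phi> u)" for u
  define \<gamma>' where "\<gamma>' u = of_real (w (\<phi> u) * \<phi>' u) * (\<i> * cis (\<phi> u))" for u
  have d: "(\<gamma> has_vector_derivative \<gamma>' u) (at u)" for u
    using vector_diff_chain_at[OF d\<phi>(1)[unfolded real_derivative_vector] dY]
    by (simp add: \<gamma>_def[abs_def] \<gamma>'_def o_def scaleR_conv_of_real mult_ac)
  have nz: "\<gamma>' u \<noteq> 0" for u using w_pos[of "\<phi> u"] \<phi>'_nonzero[of u] by (simp add: \<gamma>'_def)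
  have T: "T = 2 * pi \<or> T = - (2 * pi)" using turn(2) by linarith
  have shift_sgn: "\<exists>j'. T * of_int j = 2 * pi * of_int j'" for j
    using T
  proof
    assume "T = - (2 * pi)"
    then show ?thesis by (intro exI[of _ "- j"]) simp
  qed blast
  have \<gamma>_per: "\<gamma> (u + 2 * pi) = \<gamma> u" for u
  proof -
    obtain j' where "T * of_int 1 = 2 * pi * of_int j'" using shift_sgn by blast
    then show ?thesis using periodic_shift[where f=Y, OF Y_per, of "\<phi> u" j'] turn(1) by (simp add: \<gamma>_def)
  qed
  have surj: "range \<gamma> = range Y"
  proof (intro equalityI subsetI)
    fix z assume "z \<in> range Y"
    then obtain \<theta> where z: "z = Y \<theta>" by (elim rangeE)
    obtain u where "\<phi> u = \<theta>" using surj\<phi>[of \<theta>] by (elim exE)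
    then show "z \<in> range \<gamma>" by (intro image_eqI[of _ _ u]) (simp_all add: z \<gamma>_def)
  qed (auto simp: \<gamma>_def)
  interpret C: convex_curve \<gamma> \<gamma>' K
    using d nz convex_K compact_K interior_nonempty surj frontier_K by unfold_locales auto
  have "C.supports (cis (\<phi> u)) u" for u
    unfolding C.supports_def by (auto simp: \<gamma>_def K_def inner_diff_right inner_commute[of "cis (\<phi> u)"] Y_inner)
  from C.outward_normal_eq[OF this] have n: "outward_normal \<gamma> u = cis (\<phi> u)" for u .
  then show "outward_normal (\<lambda>u. Y (\<phi> u)) u = cis (\<phi> u)" unfolding \<gamma>_def .
  obtain D where D: "D 0 = \<gamma>" "\<And>n u. (D n has_vector_derivative D (Suc n) u) (at u)"
    using smooth unfolding smooth_curve_def \<gamma>_def by blast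
  have D1: "D 1 u = \<gamma>' u" for u using D(2)[of 0 u] d[of u] D(1) vector_derivative_unique_at by (metis One_nat_def)
  then have D2: "(\<gamma>' has_vector_derivative D 2 u) (at u)" for u
  proof -
    have "D 1 = \<gamma>'" using D1 by blast
    then show ?thesis using D(2)[of 1 u] by (simp add: numeral_2_eq_2)
  qed
  have c: "curvature \<gamma> u = 1 / w (\<phi> u)" for u
  proof -
    have "((\<lambda>u. cis (\<phi> u)) has_vector_derivative \<phi>' u *\<^sub>R (\<i> * cis (\<phi> u))) (at u)"
      using vector_diff_chain_at[OF d\<phi>(1)[unfolded real_derivative_vector] cis_has_vector_derivative] by (simp add: o_def)
    from has_real_derivative_inner[OF D2 this]
    have "((\<lambda>u. \<gamma>' u \<bullet> cis (\<phi> u)) has_real_derivative \<gamma>' u \<bullet> (\<phi>' u *\<^sub>R (\<i> * cis (\<phi> u))) + D 2 u \<bullet> cis (\<phi> u)) (at u)" .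
    moreover have "\<gamma>' u \<bullet> cis (\<phi> u) = 0" for u unfolding \<gamma>'_def of_real_inner by simp
    ultimately have "((\<lambda>u. 0) has_real_derivative \<gamma>' u \<bullet> (\<phi>' u *\<^sub>R (\<i> * cis (\<phi> u))) + D 2 u \<bullet> cis (\<phi> u)) (at u)" by simp
    then have "\<gamma>' u \<bullet> (\<phi>' u *\<^sub>R (\<i> * cis (\<phi> u))) + D 2 u \<bullet> cis (\<phi> u) = 0" using DERIV_unique DERIV_const by blast
    then have "D 2 u \<bullet> cis (\<phi> u) = - (w (\<phi> u) * (\<phi>' u)\<^sup>2)"
      unfolding \<gamma>'_def of_real_inner by (simp add: power2_eq_square)
    moreover have "(norm (\<gamma>' u))\<^sup>2 = (w (\<phi> u))\<^sup>2 * (\<phi>' u)\<^sup>2" by (simp add: \<gamma>'_def norm_mult power_mult_distrib)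
    moreover have "vector_derivative (\<lambda>v. vector_derivative \<gamma> (at v)) (at u) = D 2 u"
      using D2 by (simp add: C.vector_derivative_eq vector_derivative_at)
    ultimately show ?thesis unfolding curvature_def n C.vector_derivative_eq
      using w_pos[of "\<phi> u"] \<phi>'_nonzero[of u] by (simp add: power2_eq_square)
  qed
  then show "curvature (\<lambda>u. Y (\<phi> u)) u = 1 / w (\<phi> u)" unfolding \<gamma>_def .
  \<comment> \<open>Equal points have equal normals by \<open>Y_support_less\<close>, so the angles
    differ by a multiple of 2 pi; since |T| = 2 pi, the parameters differ by a multiple of the
    period.\<close>
  have "inj_on \<gamma> {0..<2 * pi}"
  proof (rule inj_onI)
    fix u v assume uv: "u \<in> {0..<2 * pi}" "v \<in> {0..<2 * pi}" "\<gamma> u = \<gamma> v"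
    then have "Y (\<phi> u) \<bullet> cis (\<phi> v) = H 0 (\<phi> v)" by (simp add: \<gamma>_def Y_inner)
    then have "cis (\<phi> u) = cis (\<phi> v)" using Y_support_less by (metis less_irrefl)
    then obtain j where j: "\<phi> u = \<phi> v + 2 * pi * of_int j" using cis_eq_iff by blast
    obtain \<epsilon> :: int where "T * of_int \<epsilon> = 2 * pi"
    proof (cases "T = 2 * pi")
      case True
      then show ?thesis using that[of 1] by simp
    next
      case False
      then show ?thesis using that[of "- 1"] T by simp
    qed
    then have "2 * pi * of_int j = T * of_int (\<epsilon> * j)" by (simp flip: mult.assoc)
    then have eq: "\<phi> u = \<phi> (v + 2 * pi * of_int (\<epsilon> * j))" using j \<phi>_shift_int by metis
    have u: "u = v + 2 * pi * of_int (\<epsilon> * j)" using inj\<phi> eq by (rule injD)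
    define m where "m = \<epsilon> * j"
    have u: "u = v + 2 * pi * of_int m" using u unfolding m_def .
    then have "2 * pi * of_int m < 2 * pi * 1" "2 * pi * (-1) < 2 * pi * of_int m"
      using uv(1,2) unfolding atLeastLessThan_iff by linarith+
    then have "of_int m < (1::real)" "(-1::real) < of_int m"
      using mult_less_cancel_left_pos[of "2 * pi" "of_int m" 1] mult_less_cancel_left_pos[of "2 * pi" "-1" "of_int m"]
      by simp_all
    then have "m = 0" by linarith
    then show "u = v" using u by simp
  qed
  moreover have "inside (range \<gamma>) = interior K"
    unfolding C.frontier by (rule inside_frontier_eq_interior[OF compact_imp_bounded[OF compact_K] convex_K])
  moreover have "smooth_curve \<gamma>" using smooth unfolding \<gamma>_def .
  ultimately show "convex_embedding (\<lambda>u. Y (\<phi> u))"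
    using \<gamma>_per nz w_pos convex_interior[OF convex_K] c
    unfolding convex_embedding_def smooth_circle_embedding_def \<gamma>_def[symmetric] by (simp add: C.vector_derivative_eq)
qed

end

section \<open>Ordinary differential equations with parameters\<close>

text \<open>Gronwall's inequality for the square of the difference, which unlike its absolute value
  is differentiable: (f - g)^2 e^(-2 L s) does not increase. With equal initial values it gives
  uniqueness.\<close>

lemma ode_stability:
  fixes a :: tfun
  assumes f: "\<And>s. 0 \<le> s \<Longrightarrow> s \<le> b \<Longrightarrow> (f has_real_derivative a s (f s)) (at s within {0..b})"
    and g: "\<And>s. 0 \<le> s \<Longrightarrow> s \<le> b \<Longrightarrow> (g has_real_derivative a s (g s)) (at s within {0..b})"
    and L: "\<And>s x y. 0 \<le> s \<Longrightarrow> s \<le> b \<Longrightarrow> \<bar>a s x - a s y\<bar> \<le> L * \<bar>x - y\<bar>" and b: "0 \<le> b"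
  shows "\<bar>f b - g b\<bar> \<le> \<bar>f 0 - g 0\<bar> * exp (L * b)"
proof -
  define E where "E s = (f s - g s)\<^sup>2 * exp (- 2 * L * s)" for s
  define E' where "E' s = 2 * (f s - g s) * ((a s (f s) - a s (g s)) - L * (f s - g s)) * exp (- 2 * L * s)" for s
  have dE: "(E has_real_derivative E' s) (at s within {0..b})" if "0 \<le> s" "s \<le> b" for s
    unfolding E_def E'_def
    by (rule derivative_eq_intros f[OF that] g[OF that] refl)+ (simp add: algebra_simps power2_eq_square)
  have "E b \<le> E 0"
  proof (rule DERIV_nonpos_imp_decreasing_open[OF b])
    show "continuous_on {0..b} E"
      using dE by (meson DERIV_continuous atLeastAtMost_iff continuous_on_eq_continuous_within)
    fix s assume s: "0 < s" "s < b"
    have "(f s - g s) * (a s (f s) - a s (g s)) \<le> \<bar>f s - g s\<bar> * \<bar>a s (f s) - a s (g s)\<bar>"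
      by (metis abs_ge_self abs_mult)
    also have "\<dots> \<le> \<bar>f s - g s\<bar> * (L * \<bar>f s - g s\<bar>)" using L s by (intro mult_left_mono) auto
    also have "\<dots> = L * ((f s - g s) * (f s - g s))" by (simp add: mult_ac flip: abs_mult)
    finally have "2 * ((f s - g s) * ((a s (f s) - a s (g s)) - L * (f s - g s))) \<le> 0" by (simp add: algebra_simps)
    then have "2 * ((f s - g s) * ((a s (f s) - a s (g s)) - L * (f s - g s))) * exp (- 2 * L * s) \<le> 0"
      by (rule mult_nonpos_nonneg) simp
    then have "E' s \<le> 0" unfolding E'_def by (simp only: mult.assoc)
    moreover have "(E has_real_derivative E' s) (at s)"
      using dE[of s] s at_within_Icc_at[of 0 s b] by auto
    ultimately show "\<exists>y. DERIV E s :> y \<and> y \<le> 0" by blast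
  qed
  then have "(f b - g b)\<^sup>2 * exp (- 2 * L * b) \<le> (f 0 - g 0)\<^sup>2" by (simp add: E_def)
  then have "(f b - g b)\<^sup>2 * exp (- 2 * L * b) * exp (2 * L * b) \<le> (f 0 - g 0)\<^sup>2 * exp (2 * L * b)" by (rule mult_right_mono) simp
  then have "(f b - g b)\<^sup>2 \<le> (f 0 - g 0)\<^sup>2 * exp (2 * L * b)" by (simp add: mult.assoc flip: exp_add)
  also have "\<dots> = (\<bar>f 0 - g 0\<bar> * exp (L * b))\<^sup>2" by (simp add: power_mult_distrib exp_double[symmetric] mult.assoc)
  finally show ?thesis by (simp add: abs_le_square_iff[symmetric] abs_mult)
qed

text \<open>Picard iteration for all initial values at once, in the weighted norm
  \<open>sup e\<^sup>-\<^sup>2\<^sup>L\<^sup>t \<bar>\<xi> t u\<bar>\<close>, so that the solution is jointly continuous.\<close>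

lemma ode_exists:
  assumes c: "cont2 {0..} a" and B: "\<And>t x. 0 \<le> t \<Longrightarrow> \<bar>a t x\<bar> \<le> B"
    and L: "\<And>t x y. 0 \<le> t \<Longrightarrow> \<bar>a t x - a t y\<bar> \<le> L * \<bar>x - y\<bar>" "0 < L"
    and \<Phi>: "continuous_on UNIV \<Phi>"
  shows "\<exists>\<Theta>. cont2 {0..} \<Theta> \<and> (\<forall>t\<ge>0. \<forall>u. \<Theta> t u = \<Phi> u + tint (\<lambda>t u. a t (\<Theta> t u)) t u)"
proof -
  note S = time_dom_atLeast
  \<comment> \<open>The solution is sought as \<Phi> plus e^(2 L t) times a bounded continuous
    \<eta>; the plain sup norm of \<eta> is then the weighted norm.\<close>
  define r :: "(real \<times> real) \<Rightarrow>\<^sub>C real \<Rightarrow> real \<Rightarrow> real \<Rightarrow> real"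
    where "r \<eta> t u = \<Phi> u + exp (2 * L * t) * apply_bcontfun \<eta> (t, u)" for \<eta> t u
  define A where "A \<eta> t u = a t (r \<eta> t u)" for \<eta> t u
  have cr: "cont2 {0..} (r \<eta>)" for \<eta>
    unfolding cont2_def r_def
  proof (rule continuous_on_add[OF _ continuous_on_mult])
    show "continuous_on ({0..} \<times> UNIV) (\<lambda>z. \<Phi> (snd z))"
      by (rule continuous_on_compose2[OF \<Phi> continuous_on_snd[OF continuous_on_id]]) auto
    show "continuous_on ({0..} \<times> UNIV) (\<lambda>z. exp (2 * L * fst z))" by (intro continuous_intros)
    show "continuous_on ({0..} \<times> UNIV) (\<lambda>z. apply_bcontfun \<eta> (fst z, snd z))" by simp
  qed
  have cA: "cont2 {0..} (A \<eta>)" for \<eta>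
    unfolding A_def by (rule cont2_compose[OF c _ cr]) (simp_all add: cont2_def continuous_on_fst)
  have sliceA: "(\<lambda>s. A \<eta> s u) integrable_on {0..t}" for \<eta> t u
    by (rule integrable_continuous_real[OF continuous_on_subset[OF cont2_slice_t[OF cA]]]) auto
  define F where "F \<eta> = (\<lambda>z. exp (- 2 * L * max 0 (fst z)) * tint (A \<eta>) (max 0 (fst z)) (snd z))" for \<eta>
  \<comment> \<open>The integral in F grows at most linearly in t, and this absorbs the
    growth.\<close>
  have te: "t * exp (- 2 * L * t) \<le> 1 / L" if "0 \<le> t" for t
  proof -
    have "0 \<le> L * t" using that L(2) by simp
    then have "L * t \<le> exp (2 * L * t)" using exp_ge_add_one_self[of "2 * L * t"] unfolding mult.assoc by linarith
    then have "(L * t) * exp (- 2 * L * t) \<le> exp (2 * L * t) * exp (- 2 * L * t)" by (rule mult_right_mono) simp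
    also have "\<dots> = 1" by (simp flip: exp_add)
    finally show ?thesis using L(2) by (simp add: pos_le_divide_eq mult_ac)
  qed
  have F: "F \<eta> \<in> bcontfun" for \<eta>
  proof (rule bcontfun_normI)
    show "continuous_on UNIV (F \<eta>)"
    proof -
      have "continuous_on UNIV (\<lambda>z. (max 0 (fst z), snd z) :: real \<times> real)" by (intro continuous_intros)
      then have "continuous_on UNIV (\<lambda>z. tint (A \<eta>) (max 0 (fst z)) (snd z))"
        using continuous_on_compose2[OF cont2_tint[OF S cA, unfolded cont2_def], of UNIV "\<lambda>z. (max 0 (fst z), snd z)" \<eta>]
        by (simp add: image_subset_iff mem_Times_iff)
      then show ?thesis unfolding F_def by (rule continuous_on_mult[rotated]) (intro continuous_intros)
    qed
    fix z :: "real \<times> real"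
    define t where "t = max 0 (fst z)"
    have t: "0 \<le> t" by (simp add: t_def)
    have "\<bar>tint (A \<eta>) t (snd z)\<bar> \<le> B * (t - 0)"
      unfolding tint_def
      using has_integral_bound_real[OF _ finite.emptyI integrable_integral[OF sliceA[of \<eta> "snd z" t]], of B] t B
      by (simp add: A_def order_trans[OF abs_ge_zero B[of 0]])
    then have "norm (F \<eta> z) \<le> exp (- 2 * L * t) * (B * t)" by (simp add: F_def t_def abs_mult)
    also have "\<dots> = B * (t * exp (- 2 * L * t))" by simp
    also have "\<dots> \<le> B * (1 / L)" using B[of 0 0] by (intro mult_left_mono te t) auto
    finally show "norm (F \<eta> z) \<le> B * (1 / L)" .
  qed
  define G where "G \<eta> = Bcontfun (F \<eta>)" for \<eta>
  have G: "apply_bcontfun (G \<eta>) = F \<eta>" for \<eta> unfolding G_def by (rule Bcontfun_inverse[OF F])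
  have contr: "dist (G \<eta>) (G \<zeta>) \<le> 1 / 2 * dist \<eta> \<zeta>" for \<eta> \<zeta>
  proof (rule dist_bound)
    fix z :: "real \<times> real"
    define t u where "t = max 0 (fst z)" and "u = snd z"
    have t: "0 \<le> t" by (simp add: t_def)
    define d where "d = dist \<eta> \<zeta>"
    have bound: "\<bar>A \<eta> s u - A \<zeta> s u\<bar> \<le> L * exp (2 * L * s) * d" if "s \<in> {0..t}" for s
    proof -
      have "\<bar>A \<eta> s u - A \<zeta> s u\<bar> \<le> L * \<bar>r \<eta> s u - r \<zeta> s u\<bar>" unfolding A_def using L(1) that by auto
      also have "r \<eta> s u - r \<zeta> s u = exp (2 * L * s) * (apply_bcontfun \<eta> (s, u) - apply_bcontfun \<zeta> (s, u))"
        by (simp add: r_def algebra_simps)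
      also have "\<bar>\<dots>\<bar> \<le> exp (2 * L * s) * d" using dist_bounded[of \<eta> "(s, u)" \<zeta>] by (simp add: abs_mult d_def dist_real_def)
      finally show ?thesis using L(2) by (simp add: mult.assoc)
    qed
    \<comment> \<open>The Lipschitz constant L against the weight exponent 2 L produces the
      contraction factor 1/2.\<close>
    have I: "((\<lambda>s. L * exp (2 * L * s) * d) has_integral (exp (2 * L * t) * d / 2 - exp (2 * L * 0) * d / 2)) {0..t}"
      by (rule fundamental_theorem_of_calculus[OF t])
        (auto simp: real_derivative_vector[symmetric] intro!: derivative_eq_intros)
    have "\<bar>tint (A \<eta>) t u - tint (A \<zeta>) t u\<bar> = \<bar>integral {0..t} (\<lambda>s. A \<eta> s u - A \<zeta> s u)\<bar>"
      by (simp add: tint_def integral_diff[OF sliceA sliceA])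
    also have "\<dots> \<le> integral {0..t} (\<lambda>s. L * exp (2 * L * s) * d)"
      using integral_norm_bound_integral[OF integrable_diff[OF sliceA sliceA] has_integral_integrable[OF I]] bound by auto
    also have "\<dots> = (exp (2 * L * t) - 1) * d / 2" using integral_unique[OF I] by (simp add: algebra_simps diff_divide_distrib)
    also have "\<dots> \<le> exp (2 * L * t) * d / 2" by (simp add: d_def mult_right_mono)
    finally have "exp (- 2 * L * t) * \<bar>tint (A \<eta>) t u - tint (A \<zeta>) t u\<bar> \<le> exp (- 2 * L * t) * (exp (2 * L * t) * d / 2)"
      by (intro mult_left_mono) auto
    also have "\<dots> = 1 / 2 * d" by (simp flip: mult.assoc exp_add)
    finally show "dist (apply_bcontfun (G \<eta>) z) (apply_bcontfun (G \<zeta>) z) \<le> 1 / 2 * dist \<eta> \<zeta>"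
      by (simp add: G F_def dist_real_def d_def t_def u_def abs_mult flip: right_diff_distrib)
  qed
  have "\<exists>!\<eta>. G \<eta> = \<eta>"
    by (rule banach_fix_type[where c="1/2"]) (use contr in auto)
  then obtain \<eta> where \<eta>: "G \<eta> = \<eta>" by blast
  have "r \<eta> t u = \<Phi> u + tint (A \<eta>) t u" if t: "0 \<le> t" for t u
  proof -
    have "apply_bcontfun \<eta> (t, u) = exp (- 2 * L * t) * tint (A \<eta>) t u" using fun_cong[OF G[of \<eta>], of "(t, u)"] t by (simp add: \<eta> F_def)
    then show ?thesis by (simp add: r_def flip: mult.assoc exp_add)
  qed
  moreover have "A \<eta> = (\<lambda>t u. a t (r \<eta> t u))" by (intro ext) (simp add: A_def)
  ultimately show ?thesis using cr by (intro exI[of _ "r \<eta>"]) simp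
qed

lemma Du_periodic:
  assumes "\<And>u. f t (u + 2 * pi) = f t u" "\<And>u. (f t has_real_derivative Du f t u) (at u)"
  shows "Du f t (u + 2 * pi) = Du f t u"
proof -
  have "((\<lambda>u. f t (u + 2 * pi)) has_real_derivative Du f t (u + 2 * pi)) (at u)"
    using DERIV_shift[of "f t" "Du f t (u + 2 * pi)" u "2 * pi"] assms(2) by simp
  then show ?thesis using assms DERIV_unique by (metis (no_types, lifting) ext)
qed

lemma periodic_bounded:
  fixes f :: tfun
  assumes c: "cont2 S f" and T: "{0..T1} \<subseteq> S"
    and per: "\<And>t u. t \<in> S \<Longrightarrow> f t (u + 2 * pi) = f t u"
  shows "\<exists>B>0. \<forall>t\<in>{0..T1}. \<forall>u. \<bar>f t u\<bar> \<le> B"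
proof -
  have "continuous_on ({0..T1} \<times> {0..2 * pi}) (\<lambda>z. f (fst z) (snd z))"
    using c unfolding cont2_def by (rule continuous_on_subset) (use T in auto)
  then have "compact ((\<lambda>z. f (fst z) (snd z)) ` ({0..T1} \<times> {0..2 * pi}))"
    by (rule compact_continuous_image) (intro compact_Times compact_Icc)
  then obtain B where B: "\<And>t u. t \<in> {0..T1} \<Longrightarrow> u \<in> {0..2 * pi} \<Longrightarrow> \<bar>f t u\<bar> \<le> B"
    unfolding compact_eq_bounded_closed bounded_iff by fastforce
  have "\<bar>f t u\<bar> \<le> B" if t: "t \<in> {0..T1}" for t u
  proof -
    have "t \<in> S" using t T by blast
    from periodic_Icc[where f="f t", OF per[OF this]] obtain x where "x \<in> {0..2 * pi}" "f t u = f t x" .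
    then show ?thesis using B[OF t] by simp
  qed
  then show ?thesis by (intro exI[of _ "max B 1"]) (auto simp: le_max_iff_disj)
qed

lemma Cinf_lipschitz:
  assumes S: "time_dom S" and a: "Cinf S a" and T: "{0..T1} \<subseteq> S"
    and per: "\<And>t u. t \<in> S \<Longrightarrow> a t (u + 2 * pi) = a t u"
  shows "\<exists>L>0. \<forall>t\<in>{0..T1}. (\<forall>u. \<bar>Du a t u\<bar> \<le> L) \<and> (\<forall>x y. \<bar>a t x - a t y\<bar> \<le> L * \<bar>x - y\<bar>)"
proof -
  have d: "(a t has_real_derivative Du a t u) (at u)" if "t \<in> S" for t u
    using Cinf_D(3)[OF S a] that by (auto simp: partials_def)
  have per1: "Du a t (u + 2 * pi) = Du a t u" if t: "t \<in> S" for t u by (rule Du_periodic[OF per[OF t] d[OF t]])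
  obtain L where L: "0 < L" "\<And>t u. t \<in> {0..T1} \<Longrightarrow> \<bar>Du a t u\<bar> \<le> L"
    using periodic_bounded[OF Cinf_cont2[OF Cinf_D(1)[OF S a]] T per1] by blast
  have "\<bar>a t x - a t y\<bar> \<le> L * \<bar>x - y\<bar>" if t: "t \<in> {0..T1}" for t x y
    using field_differentiable_bound[OF convex_UNIV d[OF subsetD[OF T t]], of L x y] L(2)[OF t] by simp
  with L show ?thesis by (intro exI[of _ L] conjI ballI allI)
qed

lemma DERIV_zero_of_quadratic:
  fixes R g :: "real \<Rightarrow> real"
  assumes g: "(g has_real_derivative g') (at x)" "g x = 0" and R: "\<And>u. \<bar>R u\<bar> \<le> C * (g u)\<^sup>2"
  shows "(R has_real_derivative 0) (at x)"
proof -
  have R0: "R x = 0" using R[of x] g(2) by simp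
  have "((\<lambda>y. (g y - g x) / (y - x)) \<longlongrightarrow> g') (at x)" using g(1) by (simp add: has_field_derivative_iff)
  moreover have "(g \<longlongrightarrow> g x) (at x)" using DERIV_isCont[OF g(1)] by (simp add: isCont_def)
  ultimately have "((\<lambda>y. \<bar>C * ((g y - g x) / (y - x) * g y)\<bar>) \<longlongrightarrow> \<bar>C * (g' * g x)\<bar>) (at x)" by (intro tendsto_intros)
  then have l: "((\<lambda>y. \<bar>C * ((g y - g x) / (y - x) * g y)\<bar>) \<longlongrightarrow> 0) (at x)" by (simp add: g(2))
  have "((\<lambda>y. (R y - R x) / (y - x)) \<longlongrightarrow> 0) (at x)"
  proof (rule Lim_null_comparison[OF always_eventually l], rule allI)
    fix y
    have "\<bar>R y\<bar> \<le> \<bar>C\<bar> * (g y)\<^sup>2" using R[of y] by (meson abs_ge_self mult_right_mono order_trans zero_le_power2)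
    then have "\<bar>R y\<bar> / \<bar>y - x\<bar> \<le> \<bar>C\<bar> * (g y)\<^sup>2 / \<bar>y - x\<bar>" by (rule divide_right_mono) simp
    then show "norm ((R y - R x) / (y - x)) \<le> \<bar>C * ((g y - g x) / (y - x) * g y)\<bar>"
      by (simp add: R0 g(2) abs_mult power2_eq_square)
  qed
  then show ?thesis by (simp add: has_field_derivative_iff)
qed

text \<open>The field lives on the half-open interval up to Ts; staying below T1 < Ts makes it
  bounded and Lipschitz, by periodicity. The derivative in the initial value is \<Phi>' E, where E
  solves the linearised equation along the solution.\<close>

lemma ode_flow:
  assumes a: "Cinf {0..<Ts} a" and per: "\<And>t u. t \<in> {0..<Ts} \<Longrightarrow> a t (u + 2 * pi) = a t u"
    and T1: "0 < T1" "T1 < Ts" and \<Phi>: "Cinf {0..} (\<lambda>t. \<Phi>)"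
  shows "\<exists>\<Theta> E. Cinf {0..<T1} \<Theta> \<and> (\<forall>u. \<Theta> 0 u = \<Phi> u) \<and>
    (\<forall>t\<in>{0..<T1}. \<forall>u. ((\<lambda>s. \<Theta> s u) has_real_derivative a t (\<Theta> t u)) (at t within {0..<T1})) \<and>
    (\<forall>t\<in>{0..<T1}. \<forall>u. (\<Theta> t has_real_derivative Du (\<lambda>t. \<Phi>) 0 u * E t u) (at u)) \<and> (\<forall>t u. 0 < E t u)"
proof -
  have Ts: "time_dom {0..<Ts}" using T1 by (intro time_dom_atLeastLessThan) auto
  have sub: "{0..T1} \<subseteq> {0..<Ts}" "{0..<T1} \<subseteq> {0..<Ts}" using T1 by auto
  note D = Cinf_D[OF Ts a]
  note D2 = Cinf_D[OF Ts D(1)]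
  have da: "(a t has_real_derivative Du a t u) (at u)" "(Du a t has_real_derivative Du (Du a) t u) (at u)" if "t \<in> {0..<Ts}" for t u
    using D(3) D2(3) that by (auto simp: partials_def)
  have per1: "Du a t (u + 2 * pi) = Du a t u" if "t \<in> {0..<Ts}" for t u
    by (rule Du_periodic[OF per[OF that] da(1)[OF that]])
  obtain B where B: "0 < B" "\<And>t u. t \<in> {0..T1} \<Longrightarrow> \<bar>a t u\<bar> \<le> B"
    using periodic_bounded[OF Cinf_cont2[OF a] sub(1) per] by blast
  obtain L where L: "0 < L" "\<And>t u. t \<in> {0..T1} \<Longrightarrow> \<bar>Du a t u\<bar> \<le> L" "\<And>t x y. t \<in> {0..T1} \<Longrightarrow> \<bar>a t x - a t y\<bar> \<le> L * \<bar>x - y\<bar>"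
    using Cinf_lipschitz[OF Ts a sub(1) per] by blast
  obtain M where M: "0 < M" "\<And>t x y. t \<in> {0..T1} \<Longrightarrow> \<bar>Du a t x - Du a t y\<bar> \<le> M * \<bar>x - y\<bar>"
    using Cinf_lipschitz[OF Ts D(1) sub(1) per1] by blast
  \<comment> \<open>The field is frozen after T1, which gives a field with global bounds on
    \<open>{0..}\<close> as \<open>ode_exists\<close> requires.\<close>
  define ac where "ac t u = a (min t T1) u" for t u
  have min: "min t T1 \<in> {0..T1}" if "0 \<le> t" for t using that T1 by auto
  have cmin: "cont2 {0..} (\<lambda>t u. min t T1)" unfolding cont2_def by (intro continuous_intros)
  have csnd: "cont2 {0..} (\<lambda>t u. u)" unfolding cont2_def by (intro continuous_intros)
  have cac: "cont2 {0..} ac" unfolding ac_def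
    by (rule cont2_compose[OF Cinf_cont2[OF a] cmin csnd]) (use T1 in auto)
  have acB: "\<bar>ac t x\<bar> \<le> B" if "0 \<le> t" for t x unfolding ac_def by (rule B(2)[OF min[OF that]])
  have acL: "\<bar>ac t x - ac t y\<bar> \<le> L * \<bar>x - y\<bar>" if "0 \<le> t" for t x y unfolding ac_def by (rule L(3)[OF min[OF that]])
  have c\<Phi>: "continuous_on UNIV \<Phi>" using cont2_slice_u[OF Cinf_cont2[OF \<Phi>], of 0] by simp
  obtain \<Theta> where \<Theta>: "cont2 {0..} \<Theta>" "\<And>t u. 0 \<le> t \<Longrightarrow> \<Theta> t u = \<Phi> u + tint (\<lambda>t u. ac t (\<Theta> t u)) t u"
    using ode_exists[OF cac acB acL L(1) c\<Phi>] by blast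
  have cA: "cont2 {0..} (\<lambda>t u. ac t (\<Theta> t u))"
    by (rule cont2_compose[OF cac _ \<Theta>(1)]) (simp_all add: cont2_def continuous_on_fst)
  have \<Theta>0: "\<Theta> 0 u = \<Phi> u" for u using \<Theta>(2)[of 0 u] by (simp add: tint_def)
  have d\<Theta>: "((\<lambda>s. \<Theta> s u) has_real_derivative a t (\<Theta> t u)) (at t within X)" if t: "t \<in> {0..T1}" and X: "X \<subseteq> {0..}" for t u X
  proof -
    have t0: "t \<in> {0..}" using t by simp
    have "((\<lambda>s. \<Phi> u + tint (\<lambda>t u. ac t (\<Theta> t u)) s u) has_real_derivative ac t (\<Theta> t u)) (at t within {0..})"
      using DERIV_add[OF DERIV_const[of "\<Phi> u"] tint_DERIV_t[OF time_dom_atLeast cA t0]] by simp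
    then have "((\<lambda>s. \<Theta> s u) has_real_derivative ac t (\<Theta> t u)) (at t within {0..})"
      by (rule has_field_derivative_transform_within[OF _ zero_less_one t0]) (simp add: \<Theta>(2))
    then show ?thesis using DERIV_subset[OF _ X] t by (simp add: ac_def min_absorb1)
  qed
  define e where "e t u = Du a (min t T1) (\<Theta> t u)" for t u
  have ce: "cont2 {0..} e" unfolding e_def
    by (rule cont2_compose[OF Cinf_cont2[OF D(1)] cmin \<Theta>(1)]) (use T1 in auto)
  define E where "E t u = exp (tint e t u)" for t u
  \<comment> \<open>Composed of a bound for E, the Taylor constant M with two factors from
    \<open>ode_stability\<close>, a bound for 1 / E, and the length of the time interval.\<close>
  define C where "C = exp (L * T1) * (M * (exp (L * T1))\<^sup>2 * exp (L * T1) * T1)"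
  \<comment> \<open>First-order expansion in the initial value with quadratic error;
    \<open>E t v\<close> solves the linearised equation with initial value 1.\<close>
  have main: "\<bar>\<Theta> t u - \<Theta> t v - (\<Phi> u - \<Phi> v) * E t v\<bar> \<le> C * (\<Phi> u - \<Phi> v)\<^sup>2" if t: "t \<in> {0..T1}" for t u v
  proof -
    define \<delta> where "\<delta> = \<Phi> u - \<Phi> v"
    \<comment> \<open>Dividing by the linearised solution leaves a derivative that consists only of
      the Taylor remainder of the field, which is quadratic in the difference.\<close>
    define W where "W s = (\<Theta> s u - \<Theta> s v) * exp (- tint e s v)" for s
    have tintb: "\<bar>tint e s v\<bar> \<le> L * T1" if s: "s \<in> {0..t}" for s
    proof -
      have i: "(\<lambda>r. e r v) integrable_on {0..s}"
        by (rule integrable_continuous_real[OF continuous_on_subset[OF cont2_slice_t[OF ce]]]) auto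
      have "\<bar>tint e s v\<bar> \<le> L * (s - 0)" unfolding tint_def
        using has_integral_bound_real[OF _ finite.emptyI integrable_integral[OF i], of L] s t L(1,2) min by (simp add: e_def)
      also have "\<dots> \<le> L * T1" using s t L(1) by simp
      finally show ?thesis .
    qed
    have diff: "\<bar>\<Theta> s u - \<Theta> s v\<bar> \<le> \<bar>\<delta>\<bar> * exp (L * T1)" if s: "s \<in> {0..t}" for s
    proof -
      have "\<bar>\<Theta> s u - \<Theta> s v\<bar> \<le> \<bar>\<Theta> 0 u - \<Theta> 0 v\<bar> * exp (L * s)"
        by (rule ode_stability[where a=a]) (use d\<Theta> L(3) s t in auto)
      also have "\<dots> \<le> \<bar>\<delta>\<bar> * exp (L * T1)" using s t L(1) by (auto simp: \<Theta>0 \<delta>_def intro!: mult_left_mono)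
      finally show ?thesis .
    qed
    define W' where "W' s = (a s (\<Theta> s u) - a s (\<Theta> s v) - Du a s (\<Theta> s v) * (\<Theta> s u - \<Theta> s v)) * exp (- tint e s v)" for s
    have dW: "(W has_real_derivative W' s) (at s within {0..t})" if s: "s \<in> {0..t}" for s
    proof -
      have "((\<lambda>s. tint e s v) has_real_derivative e s v) (at s within {0..t})"
        using DERIV_subset[OF tint_DERIV_t[OF time_dom_atLeast ce, of s v]] s by auto
      moreover have "e s v = Du a s (\<Theta> s v)" using s t by (simp add: e_def min_absorb1)
      moreover have "((\<lambda>s. \<Theta> s w) has_real_derivative a s (\<Theta> s w)) (at s within {0..t})" for w
        using s t by (intro d\<Theta>) auto
      ultimately show ?thesis unfolding W_def W'_def
        by (auto intro!: derivative_eq_intros simp: algebra_simps)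
    qed
    have W'b: "norm (W' s) \<le> M * (exp (L * T1))\<^sup>2 * exp (L * T1) * \<delta>\<^sup>2" if s: "s \<in> {0..t}" for s
    proof -
      have sT: "s \<in> {0..T1}" using s t by auto
      define x y where "x = \<Theta> s u" and "y = \<Theta> s v"
      have "\<bar>a s x - a s y - Du a s y * (x - y)\<bar> \<le> M * \<bar>x - y\<bar> * \<bar>x - y\<bar>"
      proof -
        have "((\<lambda>z. a s z - Du a s y * z) has_real_derivative Du a s z - Du a s y) (at z within closed_segment y x)" for z
          using da(1)[of s z] sT T1 by (auto intro!: derivative_eq_intros intro: has_field_derivative_at_within)
        moreover have "norm (Du a s z - Du a s y) \<le> M * \<bar>x - y\<bar>" if "z \<in> closed_segment y x" for z
        proof -
          have "\<bar>z - y\<bar> \<le> \<bar>x - y\<bar>" using segment_bound1[OF that] by simp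
          then have "M * \<bar>z - y\<bar> \<le> M * \<bar>x - y\<bar>" using M(1) by simp
          then show ?thesis using M(2)[OF sT, of z y] by simp
        qed
        ultimately have "norm ((a s x - Du a s y * x) - (a s y - Du a s y * y)) \<le> M * \<bar>x - y\<bar> * norm (x - y)"
          by (intro field_differentiable_bound[of "closed_segment y x"]) auto
        then show ?thesis by (simp add: algebra_simps)
      qed
      also have "M * \<bar>x - y\<bar> * \<bar>x - y\<bar> \<le> M * (\<bar>\<delta>\<bar> * exp (L * T1)) * (\<bar>\<delta>\<bar> * exp (L * T1))"
        using diff[OF s] M(1) by (intro mult_mono) (auto simp: x_def y_def)
      finally have n: "\<bar>a s x - a s y - Du a s y * (x - y)\<bar> \<le> M * (\<bar>\<delta>\<bar> * exp (L * T1)) * (\<bar>\<delta>\<bar> * exp (L * T1))" .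
      have "exp (- tint e s v) \<le> exp (L * T1)" using tintb[OF s] by simp
      then have "norm (W' s) \<le> M * (\<bar>\<delta>\<bar> * exp (L * T1)) * (\<bar>\<delta>\<bar> * exp (L * T1)) * exp (L * T1)"
        unfolding W'_def norm_mult using n by (intro mult_mono) (auto simp: x_def y_def)
      also have "\<dots> = M * (exp (L * T1))\<^sup>2 * exp (L * T1) * \<delta>\<^sup>2" by (simp add: power2_eq_square mult_ac flip: abs_mult)
      finally show ?thesis .
    qed
    have "norm (W t - W 0) \<le> M * (exp (L * T1))\<^sup>2 * exp (L * T1) * \<delta>\<^sup>2 * norm (t - 0)"
      by (rule field_differentiable_bound[OF convex_real_interval(5)[of 0 t] dW W'b]) (use t in auto)
    also have "\<dots> \<le> M * (exp (L * T1))\<^sup>2 * exp (L * T1) * \<delta>\<^sup>2 * T1" using t M(1) by (intro mult_left_mono) auto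
    finally have w: "\<bar>W t - \<delta>\<bar> \<le> M * (exp (L * T1))\<^sup>2 * exp (L * T1) * \<delta>\<^sup>2 * T1" by (simp add: W_def tint_def \<Theta>0 \<delta>_def)
    have "E t v * (W t - \<delta>) = \<Theta> t u - \<Theta> t v - \<delta> * E t v"
      by (simp add: W_def E_def right_diff_distrib exp_minus)
    then have "\<bar>\<Theta> t u - \<Theta> t v - \<delta> * E t v\<bar> = E t v * \<bar>W t - \<delta>\<bar>" by (metis E_def abs_exp_cancel abs_mult)
    also have "\<dots> \<le> exp (L * T1) * (M * (exp (L * T1))\<^sup>2 * exp (L * T1) * \<delta>\<^sup>2 * T1)"
      using w tintb[of t] t by (intro mult_mono) (auto simp: E_def)
    also have "\<dots> = C * \<delta>\<^sup>2" by (simp add: C_def mult_ac)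
    finally show ?thesis unfolding \<delta>_def .
  qed
  note D\<Phi> = Cinf_D[OF time_dom_atLeast \<Phi>]
  have d\<Phi>: "(\<Phi> has_real_derivative Du (\<lambda>t. \<Phi>) 0 u) (at u)" for u using D\<Phi>(3) by (auto simp: partials_def)
  have du: "(\<Theta> t has_real_derivative Du (\<lambda>t. \<Phi>) 0 v * E t v) (at v)" if t: "t \<in> {0..<T1}" for t v
  proof -
    have t': "t \<in> {0..T1}" using t by auto
    define R where "R u = \<Theta> t u - \<Theta> t v - (\<Phi> u - \<Phi> v) * E t v" for u
    have "((\<lambda>u. \<Phi> u - \<Phi> v) has_real_derivative Du (\<lambda>t. \<Phi>) 0 v) (at v)"
      using DERIV_diff[OF d\<Phi> DERIV_const[of "\<Phi> v"]] by simp
    from DERIV_zero_of_quadratic[OF this, of R C] have "(R has_real_derivative 0) (at v)" using main[OF t'] by (simp add: R_def)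
    from DERIV_add[OF DERIV_add[OF this DERIV_const[of "\<Theta> t v - \<Phi> v * E t v"]] DERIV_cmult_right[OF d\<Phi>, of "E t v"]]
    have "((\<lambda>u. R u + (\<Theta> t v - \<Phi> v * E t v) + \<Phi> u * E t v) has_real_derivative 0 + 0 + Du (\<lambda>t. \<Phi>) 0 v * E t v) (at v)" .
    moreover have "(\<lambda>u. R u + (\<Theta> t v - \<Phi> v * E t v) + \<Phi> u * E t v) = \<Theta> t" by (rule ext) (simp add: R_def algebra_simps)
    ultimately show ?thesis by simp
  qed
  have S1: "time_dom {0..<T1}" by (rule time_dom_atLeastLessThan[OF T1(1)])
  have dt: "((\<lambda>s. \<Theta> s u) has_real_derivative a t (\<Theta> t u)) (at t within {0..<T1})" if "t \<in> {0..<T1}" for t u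
    by (rule d\<Theta>) (use that in auto)
  have P: "partials {0..<T1} \<Theta> (\<lambda>t u. Du (\<lambda>t. \<Phi>) 0 u * E t u) (\<lambda>t u. a t (\<Theta> t u))"
    unfolding partials_def using du dt by simp
  have c1: "cont2 {0..<T1} \<Theta>" using \<Theta>(1) unfolding cont2_def by (rule continuous_on_subset) auto
  \<comment> \<open>Bootstrap: both partial derivatives of \<Theta> are built from \<Theta> by
    composition and time integration, so they are as smooth as \<Theta> is known to be, which gains
    one order.\<close>
  have "Ck n {0..<T1} \<Theta>" for n
  proof (induction n)
    case 0
    then show ?case using c1 by simp
  next
    case (Suc n)
    have 1: "Ck n {0..<T1} (\<lambda>t u. a t (\<Theta> t u))"
      by (rule Ck_compose[OF Ts _ Ck_fst Suc.IH]) (use a sub in \<open>auto simp: Cinf_def\<close>)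
    have "Ck n {0..<T1} (\<lambda>t u. Du a t (\<Theta> t u))"
      by (rule Ck_compose[OF Ts _ Ck_fst Suc.IH]) (use D(1) sub in \<open>auto simp: Cinf_def\<close>)
    then have "Ck n {0..<T1} e" by (rule Ck_cong[rotated]) (simp add: e_def min_absorb1)
    then have 2: "Ck n {0..<T1} E" unfolding E_def by (intro Ck_exp Ck_tint[OF S1])
    have "Ck n {0..} (Du (\<lambda>t. \<Phi>))" using D\<Phi>(1) by (simp add: Cinf_def)
    then have 3: "Ck n {0..<T1} (\<lambda>t u. Du (\<lambda>t. \<Phi>) 0 u)"
      using Ck_compose[OF time_dom_atLeast _ Ck_const[of n "{0..<T1}" 0] Ck_snd] by fastforce
    show ?case by (rule Ck_SucI[OF c1 P Ck_mult[OF 3 2] 1])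
  qed
  then have "Cinf {0..<T1} \<Theta>" by (simp add: Cinf_def)
  moreover have "0 < E t u" for t u by (simp add: E_def)
  moreover have "\<forall>t\<in>{0..<T1}. \<forall>u. ((\<lambda>s. \<Theta> s u) has_real_derivative a t (\<Theta> t u)) (at t within {0..<T1})"
    using dt by simp
  ultimately show ?thesis using \<Theta>0 du by blast
qed

section \<open>Comparison of support functions\<close>

text \<open>The differential inequality M is asked for only at points that look like positive
  spatial maxima. In this form it suits a nonlinear comparison, since drift terms vanish at such
  points.\<close>

lemma maximum_principle:
  fixes d du duu dt :: tfun
  assumes du: "\<And>t u. t \<in> {0..b} \<Longrightarrow> (d t has_real_derivative du t u) (at u)"
    and duu: "\<And>t u. t \<in> {0..b} \<Longrightarrow> (du t has_real_derivative duu t u) (at u)"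
    and dt: "\<And>t u. t \<in> {0..b} \<Longrightarrow> ((\<lambda>s. d s u) has_real_derivative dt t u) (at t within {0..b})"
    and c: "cont2 {0..b} d" and per: "\<And>t u. t \<in> {0..b} \<Longrightarrow> d t (u + 2 * pi) = d t u"
    and init: "\<And>u. d 0 u \<le> 0"
    and M: "\<And>t u. t \<in> {0..b} \<Longrightarrow> 0 < d t u \<Longrightarrow> du t u = 0 \<Longrightarrow> duu t u \<le> 0 \<Longrightarrow> dt t u \<le> M * d t u"
    and t: "t \<in> {0..b}"
  shows "d t u \<le> 0"
proof (rule ccontr)
  assume neg: "\<not> d t u \<le> 0"
  \<comment> \<open>With M + 1 in place of M the time derivative of G is strictly negative at a
    positive maximum, so G would have been larger shortly before.\<close>
  define G where "G t u = exp (- (M + 1) * t) * d t u" for t u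
  have "continuous_on ({0..b} \<times> {0..2 * pi}) (\<lambda>z. d (fst z) (snd z))"
    using c unfolding cont2_def by (rule continuous_on_subset) auto
  then have "continuous_on ({0..b} \<times> {0..2 * pi}) (\<lambda>z. G (fst z) (snd z))"
    unfolding G_def by (rule continuous_on_mult[rotated]) (intro continuous_intros)
  moreover have "compact ({0..b} \<times> {0..2 * pi})" "{0..b} \<times> {0..2 * pi} \<noteq> {}"
    using t by (auto intro: compact_Times)
  ultimately obtain z where z: "z \<in> {0..b} \<times> {0..2 * pi}"
    "\<And>y. y \<in> {0..b} \<times> {0..2 * pi} \<Longrightarrow> G (fst y) (snd y) \<le> G (fst z) (snd z)"
    using continuous_attains_sup[of "{0..b} \<times> {0..2 * pi}" "\<lambda>z. G (fst z) (snd z)"] by blast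
  define t0 u0 where "t0 = fst z" and "u0 = snd z"
  have t0: "t0 \<in> {0..b}" using z(1) by (auto simp: t0_def)
  have max: "G s v \<le> G t0 u0" if s: "s \<in> {0..b}" for s v
  proof -
    obtain y where y: "y \<in> {0..2 * pi}" "d s v = d s y" by (rule periodic_Icc[where f="d s", OF per[OF s]])
    have "G s v = G s y" by (simp add: G_def y(2))
    also have "\<dots> \<le> G t0 u0" using z(2)[of "(s, y)"] s y(1) by (simp add: t0_def u0_def)
    finally show ?thesis .
  qed
  have "0 < G t u" using neg by (simp add: G_def)
  also have "G t u \<le> G t0 u0" by (rule max[OF t])
  finally have pos: "0 < d t0 u0" by (simp add: G_def zero_less_mult_iff)
  then have "t0 \<noteq> 0" using init[of u0] by (metis not_less)
  then have t0p: "0 < t0" using t0 by simp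
  have dmax: "d t0 v \<le> d t0 u0" for v using max[OF t0, of v] by (simp add: G_def)
  have d0: "du t0 u0 = 0" using DERIV_local_max[OF du[OF t0], of 1] dmax by simp
  \<comment> \<open>Otherwise the first derivative would be positive just to the right of u0, and d
    would exceed its maximum there.\<close>
  have "duu t0 u0 \<le> 0"
  proof (rule ccontr)
    assume "\<not> duu t0 u0 \<le> 0"
    then obtain e where e: "0 < e" "\<And>h. 0 < h \<Longrightarrow> h < e \<Longrightarrow> du t0 u0 < du t0 (u0 + h)"
      using DERIV_pos_inc_right[OF duu[OF t0, of u0]] by auto
    obtain z where z: "u0 < z" "z < u0 + e / 2" "d t0 (u0 + e / 2) - d t0 u0 = (u0 + e / 2 - u0) * du t0 z"
      using MVT2[of u0 "u0 + e / 2" "d t0" "du t0"] e(1) du[OF t0] by auto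
    have "0 < du t0 z" using e(2)[of "z - u0"] z(1,2) e(1) d0 by simp
    then have "0 < (u0 + e / 2 - u0) * du t0 z" using e(1) by simp
    then show False using dmax[of "u0 + e / 2"] z(3) by linarith
  qed
  from M[OF t0 pos d0 this] have dtM: "dt t0 u0 \<le> M * d t0 u0" .
  have "((\<lambda>s. G s u0) has_real_derivative exp (- (M + 1) * t0) * (dt t0 u0 - (M + 1) * d t0 u0)) (at t0 within {0..b})"
    unfolding G_def by (rule derivative_eq_intros dt[OF t0] refl)+ (simp add: algebra_simps)
  moreover have "exp (- (M + 1) * t0) * (dt t0 u0 - (M + 1) * d t0 u0) < 0"
    using dtM pos by (intro mult_pos_neg) (auto simp: algebra_simps)
  ultimately obtain e where e: "0 < e" "\<And>h. 0 < h \<Longrightarrow> t0 - h \<in> {0..b} \<Longrightarrow> h < e \<Longrightarrow> G t0 u0 < G (t0 - h) u0"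
    using has_real_derivative_neg_dec_left by blast
  define h where "h = min (e / 2) t0"
  have h: "0 < h" "t0 - h \<in> {0..b}" "h < e" using e(1) t0 t0p by (auto simp: h_def)
  show False using e(2)[OF h] max[OF h(2), of u0] by simp
qed

text \<open>With y = k2 e the hypothesis says k1 \<ge> k2 / (1 + y), and Bernoulli's inequality
  bounds the p-th power from below. The constant involves k2 only.\<close>

lemma power_difference_bound:
  fixes k1 k2 e :: real
  assumes k: "0 < k1" "0 < k2" "0 \<le> e" "1 / k1 \<le> 1 / k2 + e"
  shows "k2 ^ p - k1 ^ p \<le> p * (k2 ^ (p + 1) * e)"
proof -
  define y where "y = k2 * e"
  have y: "0 \<le> y" using k by (simp add: y_def)
  have "k2 \<le> k1 * (1 + y)" using k by (simp add: y_def field_simps)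
  then have 1: "k2 / (1 + y) \<le> k1" using y by (simp add: divide_le_eq)
  have "-1 \<le> 1 / (1 + y) - 1" using y by simp
  from Bernoulli_inequality[OF this, of p] have 2: "1 + p * (1 / (1 + y) - 1) \<le> (1 / (1 + y)) ^ p" by simp
  have "- y \<le> 1 / (1 + y) - 1" using y by (simp add: field_simps)
  then have "p * - y \<le> p * (1 / (1 + y) - 1)" by (rule mult_left_mono) simp
  then have "1 - p * y \<le> (1 / (1 + y)) ^ p" using 2 by linarith
  then have "k2 ^ p * (1 - p * y) \<le> k2 ^ p * (1 / (1 + y)) ^ p" using k by (intro mult_left_mono) auto
  also have "\<dots> = (k2 / (1 + y)) ^ p" by (simp add: power_divide)
  also have "\<dots> \<le> k1 ^ p" using 1 k y by (intro power_mono) auto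
  finally show ?thesis by (simp add: y_def algebra_simps)
qed

text \<open>A solution of the curvature equation in the angle variable, together with the support
  function h0 of a curve whose curvature is the initial value, and its derivative h1.\<close>

locale target =
  fixes p :: nat and Ts :: real and \<kappa> :: tfun and h0 h1 :: "real \<Rightarrow> real"
  assumes p: "1 \<le> p" and Ts: "0 < Ts" and \<kappa>_Cinf: "Cinf {0..<Ts} \<kappa>"
    and \<kappa>_pos: "\<And>t \<theta>. t \<in> {0..<Ts} \<Longrightarrow> 0 < \<kappa> t \<theta>"
    and \<kappa>_per: "\<And>t \<theta>. t \<in> {0..<Ts} \<Longrightarrow> \<kappa> t (\<theta> + 2 * pi) = \<kappa> t \<theta>"
    and \<kappa>_evol: "\<And>t \<theta>. t \<in> {0..<Ts} \<Longrightarrow> ((\<lambda>t. \<kappa> t \<theta>) has_real_derivative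
      1 / p * (\<kappa> t \<theta>)\<^sup>2 * (Du (Du (\<lambda>t \<theta>. \<kappa> t \<theta> ^ p)) t \<theta> + \<kappa> t \<theta> ^ p)) (at t within {0..<Ts})"
    and dh0: "\<And>\<theta>. (h0 has_real_derivative h1 \<theta>) (at \<theta>)"
    and dh1: "\<And>\<theta>. (h1 has_real_derivative 1 / \<kappa> 0 \<theta> - h0 \<theta>) (at \<theta>)"
    and h0_per: "\<And>\<theta>. h0 (\<theta> + 2 * pi) = h0 \<theta>"
begin

lemma time_dom_Ts: "time_dom {0..<Ts}" by (rule time_dom_atLeastLessThan[OF Ts])

lemma zero_Ts: "0 \<in> {0..<Ts}" using Ts by simp

definition f :: tfun where "f t \<theta> = \<kappa> t \<theta> ^ p"

lemma f_Cinf: "Cinf {0..<Ts} f" unfolding f_def[abs_def] by (rule Cinf_power[OF \<kappa>_Cinf])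

lemmas f_D = Cinf_D[OF time_dom_Ts f_Cinf]
lemmas f_D2 = Cinf_D[OF time_dom_Ts f_D(1)]

lemma f_du: "t \<in> {0..<Ts} \<Longrightarrow> (f t has_real_derivative Du f t \<theta>) (at \<theta>)"
  and f_du2: "t \<in> {0..<Ts} \<Longrightarrow> (Du f t has_real_derivative Du (Du f) t \<theta>) (at \<theta>)"
  using f_D(3) f_D2(3) by (simp_all add: partials_def)

text \<open>A normal speed of \<kappa>^p / p decreases the support function at a fixed angle at
  exactly this rate.\<close>

definition h :: tfun where "h t \<theta> = h0 \<theta> + - (1 / p) * tint f t \<theta>"

text \<open>Bootstrap through the system h0' = h1, h1' = 1 / \<kappa> - h0, whose inhomogeneity is
  smooth.\<close>

lemma h0_Cinf: "Cinf {0..<Ts} (\<lambda>t. h0)"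
proof -
  have "continuous_on UNIV h0" "continuous_on UNIV h1"
    using dh0 dh1 by (meson DERIV_isCont continuous_at_imp_continuous_on)+
  then have c: "cont2 {0..<Ts} (\<lambda>t. h0)" "cont2 {0..<Ts} (\<lambda>t. h1)"
    unfolding cont2_def by (auto intro: continuous_on_compose2[OF _ continuous_on_snd[OF continuous_on_id]])
  have P: "partials {0..<Ts} (\<lambda>t. h0) (\<lambda>t. h1) (\<lambda>t u. 0)"
    "partials {0..<Ts} (\<lambda>t. h1) (\<lambda>t \<theta>. 1 / \<kappa> 0 \<theta> - h0 \<theta>) (\<lambda>t u. 0)"
    using dh0 dh1 by (simp_all add: partials_def)
  have "Ck n {0..<Ts} (\<lambda>t. h0) \<and> Ck n {0..<Ts} (\<lambda>t. h1)" for n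
  proof (induction n)
    case (Suc n)
    have "Ck n {0..<Ts} (\<lambda>t \<theta>. \<kappa> 0 \<theta>)"
      by (rule Ck_compose[OF time_dom_Ts _ Ck_const Ck_snd]) (use \<kappa>_Cinf zero_Ts in \<open>auto simp: Cinf_def\<close>)
    from Ck_diff[OF Ck_inverse[OF this \<kappa>_pos[OF zero_Ts]] conjunct1[OF Suc.IH]]
    have "Ck n {0..<Ts} (\<lambda>t \<theta>. 1 / \<kappa> 0 \<theta> - h0 \<theta>)" .
    then show ?case using Ck_SucI[OF c(1) P(1)] Ck_SucI[OF c(2) P(2)] Suc.IH Ck_const by blast
  qed (use c in simp)
  then show ?thesis by (simp add: Cinf_def)
qed

lemma h_Cinf: "Cinf {0..<Ts} h"
proof -
  have "Cinf {0..<Ts} (tint f)" using f_Cinf Ck_tint[OF time_dom_Ts] by (simp add: Cinf_def)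
  then show ?thesis unfolding h_def[abs_def] by (rule Cinf_add[OF h0_Cinf Cinf_mult[OF Cinf_const]])
qed

lemmas h_D = Cinf_D[OF time_dom_Ts h_Cinf]

lemma h_du: assumes t: "t \<in> {0..<Ts}"
  shows "(h t has_real_derivative h1 \<theta> + - (1 / p) * tint (Du f) t \<theta>) (at \<theta>)"
  unfolding h_def[abs_def]
  by (rule DERIV_add[OF dh0 DERIV_cmult[OF tint_DERIV_u[OF time_dom_Ts Cinf_cont2[OF f_Cinf] Cinf_cont2[OF f_D(1)] t f_du]]])

lemma Du_h: "t \<in> {0..<Ts} \<Longrightarrow> Du h t \<theta> = h1 \<theta> + - (1 / p) * tint (Du f) t \<theta>"
  unfolding Du_def[of h] by (rule DERIV_imp_deriv[OF h_du])

lemma h_du2: assumes t: "t \<in> {0..<Ts}"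
  shows "(Du h t has_real_derivative (1 / \<kappa> 0 \<theta> - h0 \<theta>) + - (1 / p) * tint (Du (Du f)) t \<theta>) (at \<theta>)"
proof -
  have "Du h t = (\<lambda>\<theta>. h1 \<theta> + - (1 / p) * tint (Du f) t \<theta>)" using Du_h[OF t] by blast
  then show ?thesis
    using DERIV_add[OF dh1 DERIV_cmult[OF tint_DERIV_u[OF time_dom_Ts Cinf_cont2[OF f_D(1)] Cinf_cont2[OF f_D2(1)] t f_du2]]]
    by (simp only:)
qed

lemma h_dt: assumes t: "t \<in> {0..<Ts}"
  shows "((\<lambda>s. h s \<theta>) has_real_derivative - (1 / p) * f t \<theta>) (at t within {0..<Ts})"
    and "((\<lambda>s. Du h s \<theta>) has_real_derivative - (1 / p) * Du f t \<theta>) (at t within {0..<Ts})"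
proof -
  show "((\<lambda>s. h s \<theta>) has_real_derivative - (1 / p) * f t \<theta>) (at t within {0..<Ts})"
    unfolding h_def using DERIV_add[OF DERIV_const DERIV_cmult[OF tint_DERIV_t[OF time_dom_Ts Cinf_cont2[OF f_Cinf] t]]]
    unfolding add_0_left .
  have "((\<lambda>s. h1 \<theta> + - (1 / p) * tint (Du f) s \<theta>) has_real_derivative - (1 / p) * Du f t \<theta>) (at t within {0..<Ts})"
    using DERIV_add[OF DERIV_const DERIV_cmult[OF tint_DERIV_t[OF time_dom_Ts Cinf_cont2[OF f_D(1)] t]]]
    unfolding add_0_left .
  then show "((\<lambda>s. Du h s \<theta>) has_real_derivative - (1 / p) * Du f t \<theta>) (at t within {0..<Ts})"
    by (rule has_field_derivative_transform_within[OF _ zero_less_one t]) (simp add: Du_h)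
qed

text \<open>The relation h'' + h = 1 / \<kappa> holds at time 0, and the evolution equation says
  that both sides have the same time derivative.\<close>

lemma curvature_equation: assumes t: "t \<in> {0..<Ts}"
  shows "h t \<theta> + ((1 / \<kappa> 0 \<theta> - h0 \<theta>) + - (1 / p) * tint (Du (Du f)) t \<theta>) = 1 / \<kappa> t \<theta>"
proof -
  have d: "((\<lambda>t. 1 / \<kappa> t \<theta>) has_real_derivative - (1 / p) * (Du (Du f) t \<theta> + f t \<theta>)) (at t within {0..<Ts})"
    if "t \<in> {0..<Ts}" for t
  proof -
    have n: "\<kappa> t \<theta> \<noteq> 0" using \<kappa>_pos[OF that, of \<theta>] by simp
    have "((\<lambda>t. inverse (\<kappa> t \<theta>)) has_real_derivative
      - (1 / p * (\<kappa> t \<theta>)\<^sup>2 * (Du (Du f) t \<theta> + f t \<theta>) * inverse (\<kappa> t \<theta> ^ Suc (Suc 0)))) (at t within {0..<Ts})"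
      using DERIV_inverse_fun[OF \<kappa>_evol[OF that] n] by (simp only: f_def[abs_def])
    moreover have "1 / p * (\<kappa> t \<theta>)\<^sup>2 * y * inverse (\<kappa> t \<theta> ^ Suc (Suc 0)) = 1 / p * y" for y
      using n by (simp add: power2_eq_square field_simps)
    ultimately show ?thesis by (simp add: inverse_eq_divide)
  qed
  have c: "cont2 {0..<Ts} (\<lambda>t \<theta>. - (1 / p) * (Du (Du f) t \<theta> + f t \<theta>))"
    by (rule Cinf_cont2[OF Cinf_mult[OF Cinf_const Cinf_add[OF f_D2(1) f_Cinf]]])
  have "1 / \<kappa> t \<theta> = 1 / \<kappa> 0 \<theta> + tint (\<lambda>t \<theta>. - (1 / p) * (Du (Du f) t \<theta> + f t \<theta>)) t \<theta>"
    by (rule tint_fundamental[where f="\<lambda>t \<theta>. 1 / \<kappa> t \<theta>", OF time_dom_Ts t c d])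
  moreover have "tint (\<lambda>t \<theta>. - (1 / p) * (Du (Du f) t \<theta> + f t \<theta>)) t \<theta> = - (1 / p) * (tint (Du (Du f)) t \<theta> + tint f t \<theta>)"
  proof -
    have "(\<lambda>s. g s \<theta>) integrable_on {0..t}" if "Cinf {0..<Ts} g" for g
      by (rule integrable_continuous_real[OF continuous_on_subset[OF cont2_slice_t[OF Cinf_cont2[OF that]]]]) (use t in auto)
    from integral_add[OF this[OF f_D2(1)] this[OF f_Cinf]] show ?thesis unfolding tint_def integral_mult_right by simp
  qed
  ultimately show ?thesis by (simp add: h_def algebra_simps)
qed

lemma h_du2': assumes t: "t \<in> {0..<Ts}" shows "(Du h t has_real_derivative 1 / \<kappa> t \<theta> - h t \<theta>) (at \<theta>)"
proof -
  have "(1 / \<kappa> 0 \<theta> - h0 \<theta>) + - (1 / p) * tint (Du (Du f)) t \<theta> = 1 / \<kappa> t \<theta> - h t \<theta>"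
    using curvature_equation[OF t, of \<theta>] by linarith
  then show ?thesis using h_du2[OF t, of \<theta>] by (simp only:)
qed

lemma h_du': assumes t: "t \<in> {0..<Ts}" shows "(h t has_real_derivative Du h t \<theta>) (at \<theta>)"
  using h_du[OF t] Du_h[OF t] by simp

lemma h_per: assumes t: "t \<in> {0..<Ts}" shows "h t (\<theta> + 2 * pi) = h t \<theta>"
proof -
  have "integral {0..t} (\<lambda>s. f s (\<theta> + 2 * pi)) = integral {0..t} (\<lambda>s. f s \<theta>)"
    by (rule integral_cong) (use t in \<open>simp add: f_def \<kappa>_per\<close>)
  then show ?thesis by (simp add: h_def tint_def h0_per)
qed

lemma support_function_h: assumes t: "t \<in> {0..<Ts}" shows "support_function (\<lambda>j. (Du ^^ j) h t)"
proof
  fix j \<theta>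
  have "Cinf {0..<Ts} ((Du ^^ j) h)" by (rule Cinf_Du_pow[OF time_dom_Ts h_Cinf])
  from Cinf_D(3)[OF time_dom_Ts this] show "((Du ^^ j) h t has_real_derivative (Du ^^ Suc j) h t \<theta>) (at \<theta>)"
    using t by (simp add: partials_def)
  show "(Du ^^ 0) h t (\<theta> + 2 * pi) = (Du ^^ 0) h t \<theta>" using h_per[OF t] by simp
  have "Du (Du h) t \<theta> = 1 / \<kappa> t \<theta> - h t \<theta>" unfolding Du_def[of "Du h"] by (rule DERIV_imp_deriv[OF h_du2'[OF t]])
  then show "0 < (Du ^^ 0) h t \<theta> + (Du ^^ 2) h t \<theta>" using \<kappa>_pos[OF t] by (simp add: numeral_2_eq_2)
qed

end

lemma cont2_subset: "cont2 S f \<Longrightarrow> A \<subseteq> S \<Longrightarrow> cont2 A f"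
  unfolding cont2_def by (rule continuous_on_subset) auto

locale comparison = flow p T x D S + B: target p Ts \<kappa> h0 h1
  for p T x D S Ts \<kappa> h0 h1 +
  assumes match: "\<And>u. x 0 u \<bullet> N 0 u = h0 (\<phi> 0 u)"
begin

text \<open>At the particle u: \<open>d\<close> below compares the support functions of the flow and
  of the target, and \<open>e\<close> their angle derivatives, so the derivative of d along the
  curve is g e.\<close>

definition e :: tfun where
  "e t u = x t u \<bullet> (\<i> * N t u) - Du B.h t (\<phi> t u)"

definition d :: tfun where
  "d t u = x t u \<bullet> N t u - B.h t (\<phi> t u)"

lemma d_du: assumes t: "t \<in> S" "t < Ts"
  shows "(d t has_real_derivative g t u * e t u) (at u)"
proof -
  have tB: "t \<in> {0..<Ts}" using t by (simp add: S_def)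
  have "((\<lambda>u. x t u \<bullet> N t u) has_real_derivative x t u \<bullet> (of_real (g t u) * (\<i> * N t u)) + D 1 0 t u \<bullet> N t u) (at u)"
    by (rule has_real_derivative_inner[OF dx[OF t(1)] N_du[OF t(1)]])
  from DERIV_diff[OF this DERIV_chain2[OF B.h_du'[OF tB] \<phi>_du[OF t(1)]]]
  have "(d t has_real_derivative x t u \<bullet> (of_real (g t u) * (\<i> * N t u)) + D 1 0 t u \<bullet> N t u - Du B.h t (\<phi> t u) * g t u) (at u)"
    unfolding d_def .
  moreover have "x t u \<bullet> (of_real (g t u) * (\<i> * N t u)) + D 1 0 t u \<bullet> N t u - Du B.h t (\<phi> t u) * g t u = g t u * e t u"
    unfolding of_real_inner D1_N(1)[OF t(1)] e_def by (simp add: algebra_simps)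
  ultimately show ?thesis by (simp only:)
qed

lemma e_du: assumes t: "t \<in> S" "t < Ts"
  shows "(e t has_real_derivative g t u * (1 / k t u - 1 / \<kappa> t (\<phi> t u) - d t u)) (at u)"
proof -
  have tB: "t \<in> {0..<Ts}" using t by (simp add: S_def)
  have "((\<lambda>u. \<i> * N t u) has_vector_derivative \<i> * (of_real (g t u) * (\<i> * N t u))) (at u)"
    by (rule has_vector_derivative_mult_right[OF N_du[OF t(1)]])
  moreover have "\<i> * (of_real (g t u) * (\<i> * N t u)) = of_real (- g t u) * N t u"
    by (simp add: complex_eq_iff)
  ultimately have "((\<lambda>u. \<i> * N t u) has_vector_derivative of_real (- g t u) * N t u) (at u)" by (simp only:)
  from has_real_derivative_inner[OF dx[OF t(1)] this]
  have "((\<lambda>u. x t u \<bullet> (\<i> * N t u)) has_real_derivative x t u \<bullet> (of_real (- g t u) * N t u) + D 1 0 t u \<bullet> (\<i> * N t u)) (at u)" .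
  from DERIV_diff[OF this DERIV_chain2[OF B.h_du2'[OF tB] \<phi>_du[OF t(1)]]]
  have "(e t has_real_derivative x t u \<bullet> (of_real (- g t u) * N t u) + D 1 0 t u \<bullet> (\<i> * N t u)
      - (1 / \<kappa> t (\<phi> t u) - B.h t (\<phi> t u)) * g t u) (at u)" unfolding e_def .
  moreover have "\<sigma> * s t u = g t u / k t u" using k_pos[OF t(1), of u] by (simp add: g_eq[OF t(1)])
  then have "x t u \<bullet> (of_real (- g t u) * N t u) + D 1 0 t u \<bullet> (\<i> * N t u)
      - (1 / \<kappa> t (\<phi> t u) - B.h t (\<phi> t u)) * g t u = g t u * (1 / k t u - 1 / \<kappa> t (\<phi> t u) - d t u)"
    unfolding of_real_inner D1_N(2)[OF t(1)] d_def by (simp add: algebra_simps)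
  ultimately show ?thesis by (simp only:)
qed

text \<open>The drift q e appears because the angle of a fixed particle moves; it vanishes at
  spatial extrema of d.\<close>

lemma d_dt: assumes b: "b \<in> S" "b < Ts" and t: "t \<in> {0..b}"
  shows "((\<lambda>s. d s u) has_real_derivative 1 / p * (\<kappa> t (\<phi> t u) ^ p - k t u ^ p) + q t u * e t u) (at t within {0..b})"
proof -
  have tS: "t \<in> S" and bS: "{0..b} \<subseteq> S" and bT: "{0..b} \<subseteq> {0..<Ts}" using t b by (auto simp: S_def)
  have "((\<lambda>s. x s u) has_vector_derivative of_real (- (1 / p) * k t u ^ p) * N t u) (at t within {0..b})"
    using has_vector_derivative_within_subset[OF evol[OF tS, of u] bS] by (simp add: k_def' N_def' scaleR_conv_of_real)
  from has_real_derivative_inner[OF this has_vector_derivative_within_subset[OF N_dt[OF tS] bS]]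
  have 1: "((\<lambda>s. x s u \<bullet> N s u) has_real_derivative x t u \<bullet> (of_real (q t u) * (\<i> * N t u)) + (of_real (- (1 / p) * k t u ^ p) * N t u) \<bullet> N t u) (at t within {0..b})" .
  have P: "partials {0..<Ts} B.h (Du B.h) (\<lambda>t \<theta>. - (1 / p) * B.f t \<theta>)"
    unfolding partials_def using B.h_du' B.h_dt(1) by simp
  have 2: "((\<lambda>s. B.h s (\<phi> s u)) has_real_derivative - (1 / p) * B.f t (\<phi> t u) * 1 + Du B.h t (\<phi> t u) * q t u) (at t within {0..b})"
    by (rule partials_chain[OF B.time_dom_Ts P Cinf_cont2[OF B.h_D(1)] DERIV_ident DERIV_subset[OF \<phi>_dt[OF tS] bS]])
      (use bT t in auto)
  have "x t u \<bullet> (of_real (q t u) * (\<i> * N t u)) + (of_real (- (1 / p) * k t u ^ p) * N t u) \<bullet> N t u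
     - (- (1 / p) * B.f t (\<phi> t u) * 1 + Du B.h t (\<phi> t u) * q t u) = 1 / p * (\<kappa> t (\<phi> t u) ^ p - k t u ^ p) + q t u * e t u"
    unfolding of_real_inner N_inner(1)[OF tS] by (simp add: e_def B.f_def algebra_simps)
  then show ?thesis using DERIV_diff[OF 1 2] by (simp only: d_def)
qed

lemma d_per: assumes t: "t \<in> S" "t < Ts" shows "d t (u + 2 * pi) = d t u"
proof -
  have tB: "t \<in> {0..<Ts}" using t by (simp add: S_def)
  interpret A: angle_curve "x t" "\<phi> t" "g t" "k t" by (rule angle_curve_x[OF t(1)])
  have "B.h t (\<phi> t (u + 2 * pi)) = B.h t (\<phi> t u)"
  proof (cases "A.turn = 2 * pi")
    case True
    then show ?thesis using B.h_per[OF tB, of "\<phi> t u"] by (simp add: A.\<phi>_shift)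
  next
    case False
    then have "A.turn = - 2 * pi" using A.turn_2pi by linarith
    then show ?thesis using B.h_per[OF tB, of "\<phi> t u - 2 * pi"] by (simp add: A.\<phi>_shift)
  qed
  then show ?thesis by (simp add: d_def x_per[OF t(1)] N_periodic[OF t(1)])
qed

lemma d_cont: assumes b: "b \<in> S" "b < Ts" shows "cont2 {0..b} d"
proof -
  have sub: "{0..b} \<subseteq> S" "{0..b} \<subseteq> {0..<Ts}" using b by (auto simp: S_def)
  have "Cinf S (\<lambda>t u. Re (D 0 0 t u) * Re (N t u) + Im (D 0 0 t u) * Im (N t u))"
    by (rule Cinf_add[OF Cinf_mult[OF D_Cinf(1) N_Cinf(1)] Cinf_mult[OF D_Cinf(2) N_Cinf(2)]])
  from cont2_subset[OF Cinf_cont2[OF this] sub(1)]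
  have c: "cont2 {0..b} (\<lambda>t u. Re (D 0 0 t u) * Re (N t u) + Im (D 0 0 t u) * Im (N t u))" .
  have "cont2 {0..b} (\<lambda>t u. B.h t (\<phi> t u))"
    by (rule cont2_compose[OF Cinf_cont2[OF B.h_Cinf] _ cont2_subset[OF Cinf_cont2[OF \<phi>_Cinf] sub(1)]])
      (use sub in \<open>auto simp: cont2_def intro: continuous_on_fst continuous_on_id\<close>)
  then have "cont2 {0..b} (\<lambda>t u. Re (D 0 0 t u) * Re (N t u) + Im (D 0 0 t u) * Im (N t u) - B.h t (\<phi> t u))"
    using c unfolding cont2_def by (rule continuous_on_diff[rotated])
  then show ?thesis by (rule cont2_cong[rotated]) (use sub in \<open>auto simp: d_def inner_complex D0\<close>)
qed

text \<open>Where \<open>d\<close> has a spatial extremum, \<open>e\<close> vanishes and the sign of \<open>1/k - 1/\<kappa> - d\<close> is known, which bounds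
  the time derivative \<open>(\<kappa>\<^sup>p - k\<^sup>p) / p\<close> of \<open>d\<close> by a multiple of \<open>d\<close>.\<close>

lemma d_zero: assumes b: "b \<in> S" "b < Ts" shows "d b u = 0"
proof -
  have sub: "{0..b} \<subseteq> S" "{0..b} \<subseteq> {0..<Ts}" using b by (auto simp: S_def)
  have lt: "t \<in> S" "t < Ts" if "t \<in> {0..b}" for t using that sub by auto
  have pR: "0 < real p" using p by simp
  define duu where "duu t u = Du g t u * e t u + g t u * (g t u * (1 / k t u - 1 / \<kappa> t (\<phi> t u) - d t u))" for t u
  define dt where "dt t u = 1 / p * (\<kappa> t (\<phi> t u) ^ p - k t u ^ p) + q t u * e t u" for t u
  have g_du: "(g t has_real_derivative Du g t u) (at u)" if "t \<in> S" for t u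
    using Cinf_D(3)[OF time_dom_S g_Cinf] that by (simp add: partials_def)
  have duu: "((\<lambda>u. g t u * e t u) has_real_derivative duu t u) (at u)" if t: "t \<in> {0..b}" for t u
    using DERIV_mult[OF g_du[OF lt(1)[OF t]] e_du[OF lt[OF t]]] by (simp add: duu_def mult.commute add.commute)
  have crit: "e t u = 0" "duu t u = (g t u)\<^sup>2 * (1 / k t u - 1 / \<kappa> t (\<phi> t u) - d t u)"
    "dt t u = 1 / p * (\<kappa> t (\<phi> t u) ^ p - k t u ^ p)" "0 < (g t u)\<^sup>2" if t: "t \<in> {0..b}" "g t u * e t u = 0" for t u
    using t(2) g_nonzero[OF lt(1)[OF t(1)], of u] by (simp_all add: duu_def dt_def mult_ac power2_eq_square[of "g t u"] zero_less_mult_iff linorder_neq_iff disj_commute)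
  have pos: "0 < k t u" "0 < \<kappa> t (\<phi> t u)" if t: "t \<in> {0..b}" for t u
    using k_pos[OF lt(1)[OF t]] B.\<kappa>_pos[of t] t sub by auto
  have pow: "t \<in> {0..<Ts} \<Longrightarrow> \<kappa> t (u + 2 * pi) ^ (p + 1) = \<kappa> t u ^ (p + 1)" "t \<in> S \<Longrightarrow> k t (u + 2 * pi) ^ (p + 1) = k t u ^ (p + 1)" for t u
    by (simp_all add: B.\<kappa>_per k_periodic)
  \<comment> \<open>In \<open>power_difference_bound\<close> the constant involves the curvature
    playing the role of k2: the target's for the upper estimate (M1), the flow's for the lower one
    (M2).\<close>
  obtain M1 where M1: "\<And>t \<theta>. t \<in> {0..b} \<Longrightarrow> \<bar>\<kappa> t \<theta> ^ (p + 1)\<bar> \<le> M1"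
    using periodic_bounded[OF Cinf_cont2[OF Cinf_power[OF B.\<kappa>_Cinf, where m="p + 1"]] sub(2) pow(1)] by blast
  obtain M2 where M2: "\<And>t u. t \<in> {0..b} \<Longrightarrow> \<bar>k t u ^ (p + 1)\<bar> \<le> M2"
    using periodic_bounded[OF Cinf_cont2[OF Cinf_power[OF k_Cinf, where m="p + 1"]] sub(1) pow(2)] by blast
  have init: "d 0 u = 0" for u using match by (simp add: d_def B.h_def tint_def)
  have "d b u \<le> 0"
  proof (rule maximum_principle[where d=d and du="\<lambda>t u. g t u * e t u" and duu=duu and dt=dt and b=b and M=M1])
    fix t u assume t: "t \<in> {0..b}" and dp: "0 < d t u" and c: "g t u * e t u = 0" "duu t u \<le> 0"
    note cr = crit[OF t c(1)]
    have "1 / k t u - 1 / \<kappa> t (\<phi> t u) - d t u \<le> 0" using c(2) cr(4) unfolding cr(2) by (simp add: mult_le_0_iff)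
    then have "\<kappa> t (\<phi> t u) ^ p - k t u ^ p \<le> p * (\<kappa> t (\<phi> t u) ^ (p + 1) * d t u)"
      using pos[OF t] dp by (intro power_difference_bound) auto
    also have "\<dots> \<le> p * (M1 * d t u)" using M1[OF t, of "\<phi> t u"] dp by (intro mult_left_mono mult_right_mono) auto
    finally have "1 / p * (\<kappa> t (\<phi> t u) ^ p - k t u ^ p) \<le> 1 / p * (p * (M1 * d t u))" by (rule mult_left_mono) simp
    then show "dt t u \<le> M1 * d t u" using pR by (simp add: cr(3))
  qed (use b d_du[OF lt] d_dt[OF b] duu d_cont[OF b] d_per[OF lt] init in \<open>auto simp: dt_def S_def\<close>)
  moreover have "- d b u \<le> 0"
  proof (rule maximum_principle[where d="\<lambda>t u. - d t u" and du="\<lambda>t u. - (g t u * e t u)" and duu="\<lambda>t u. - duu t u" and dt="\<lambda>t u. - dt t u" and b=b and M=M2])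
    fix t u assume t: "t \<in> {0..b}" and dp: "0 < - d t u" and c: "- (g t u * e t u) = 0" "- duu t u \<le> 0"
    have c1: "g t u * e t u = 0" using c(1) by simp
    note cr = crit[OF t c1]
    have "0 \<le> 1 / k t u - 1 / \<kappa> t (\<phi> t u) - d t u" using c(2) cr(4) unfolding cr(2) by (simp add: zero_le_mult_iff)
    then have "k t u ^ p - \<kappa> t (\<phi> t u) ^ p \<le> p * (k t u ^ (p + 1) * (- d t u))"
      using pos[OF t] dp by (intro power_difference_bound) auto
    also have "\<dots> \<le> p * (M2 * (- d t u))" using M2[OF t, of u] dp by (intro mult_left_mono mult_right_mono) auto
    finally have "1 / p * (k t u ^ p - \<kappa> t (\<phi> t u) ^ p) \<le> 1 / p * (p * (M2 * (- d t u)))" by (rule mult_left_mono) simp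
    then show "- dt t u \<le> M2 * - d t u" using pR by (simp add: cr(3) field_simps)
  qed (use b DERIV_minus[OF d_du[OF lt]] DERIV_minus[OF d_dt[OF b]] DERIV_minus[OF duu] continuous_on_minus[OF d_cont[OF b, unfolded cont2_def]] d_per[OF lt] init
      in \<open>auto simp: dt_def S_def cont2_def\<close>)
  ultimately show ?thesis by simp
qed

text \<open>The identity d = 0 is differentiated twice along the curve; g never vanishes.\<close>

lemma support_eq: assumes t: "t \<in> S" "t < Ts"
  shows "x t u \<bullet> N t u = B.h t (\<phi> t u)" "x t u \<bullet> (\<i> * N t u) = Du B.h t (\<phi> t u)" "k t u = \<kappa> t (\<phi> t u)"
proof -
  show "x t u \<bullet> N t u = B.h t (\<phi> t u)" using d_zero[OF t] by (simp add: d_def)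
  have "d t = (\<lambda>u. 0)" using d_zero[OF t] by blast
  then have "g t u * e t u = 0" for u using d_du[OF t, of u] DERIV_unique DERIV_const by metis
  then have e0: "e t u = 0" for u using g_nonzero[OF t(1), of u] by (metis mult_eq_0_iff)
  then show "x t u \<bullet> (\<i> * N t u) = Du B.h t (\<phi> t u)" by (simp add: e_def)
  have "e t = (\<lambda>u. 0)" using e0 by blast
  then have "g t u * (1 / k t u - 1 / \<kappa> t (\<phi> t u) - d t u) = 0" using e_du[OF t, of u] DERIV_unique DERIV_const by metis
  then have "1 / k t u = 1 / \<kappa> t (\<phi> t u)" using g_nonzero[OF t(1), of u] d_zero[OF t, of u] by simp
  then show "k t u = \<kappa> t (\<phi> t u)" using k_pos[OF t(1), of u] by (metis inverse_eq_divide inverse_inverse_eq)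
qed

end

section \<open>The profile in the original time\<close>

context rescaled_solution
begin

text \<open>The lifetime of the circle of radius a; see \<open>r_0\<close>.\<close>

definition Ts :: real where "Ts = real p / (real p + 1) * a ^ (p + 1)"

text \<open>The curvature of the shrinking circle that vanishes at time Ts.\<close>

definition r :: "real \<Rightarrow> real" where
  "r t = (real p / (real p + 1)) powr (1 / (real p + 1)) * (Ts - t) powr (- (1 / (real p + 1)))"

definition \<tau> :: "real \<Rightarrow> real" where "\<tau> t = - (1 / (real p + 1)) * ln (1 - t / Ts)"

definition \<kappa> :: tfun where "\<kappa> t \<theta> = r t * (1 + V 0 (\<tau> t) \<theta>)"

lemma Ts_pos: "0 < Ts" using a p1 by (simp add: Ts_def)

lemma r_pos: "t < Ts \<Longrightarrow> 0 < r t" using p1 by (simp add: r_def)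

lemma r_power: assumes "t < Ts" shows "r t ^ (p + 1) = (real p / (real p + 1)) / (Ts - t)"
proof -
  have n: "real (p + 1) = real p + 1" by simp
  have "((real p / (real p + 1)) powr (1 / (real p + 1))) ^ (p + 1) = real p / (real p + 1)"
    using p1 powr_realpow[of "(real p / (real p + 1)) powr (1 / (real p + 1))" "p + 1"] unfolding powr_powr n by simp
  moreover have "((Ts - t) powr (- (1 / (real p + 1)))) ^ (p + 1) = 1 / (Ts - t)"
    using assms powr_realpow[of "(Ts - t) powr (- (1 / (real p + 1)))" "p + 1"] unfolding powr_powr n
    by (simp add: powr_minus_divide)
  ultimately show ?thesis unfolding r_def power_mult_distrib by simp
qed

lemma r_0: "r 0 = 1 / a"
proof (rule power_inject_base[where n=p])
  have c: "real p / (real p + 1) \<noteq> 0" using p1 by simp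
  have "r 0 ^ Suc p = (real p / (real p + 1)) / Ts" using r_power[OF Ts_pos] by simp
  also have "\<dots> = 1 / a ^ Suc p" unfolding Ts_def nonzero_divide_mult_cancel_left[OF c] by simp
  finally show "r 0 ^ Suc p = (1 / a) ^ Suc p" by (simp add: power_divide)
qed (use r_pos[OF Ts_pos] a in auto)

lemma \<tau>_nonneg: assumes "t \<in> {0..<Ts}" shows "0 \<le> \<tau> t"
proof -
  have "0 < 1 - t / Ts" "1 - t / Ts \<le> 1" using assms Ts_pos by (auto simp: field_simps)
  then have "ln (1 - t / Ts) \<le> 0" using ln_le_zero_iff by blast
  then show ?thesis unfolding \<tau>_def by (intro mult_nonpos_nonpos) auto
qed

lemma \<kappa>_pos: assumes t: "t \<in> {0..<Ts}" shows "r t / 2 \<le> \<kappa> t \<theta>" "0 < \<kappa> t \<theta>"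
proof -
  have "1 / 2 \<le> 1 + V 0 (\<tau> t) \<theta>" using V_small[OF \<tau>_nonneg[OF t], of \<theta>] by linarith
  then have "r t * (1 / 2) \<le> \<kappa> t \<theta>" unfolding \<kappa>_def using r_pos[of t] t by (intro mult_left_mono) auto
  then show "r t / 2 \<le> \<kappa> t \<theta>" by simp
  then show "0 < \<kappa> t \<theta>" using r_pos[of t] t by simp
qed

lemma dr: assumes t: "t < Ts" shows "(r has_real_derivative 1 / p * r t ^ (p + 2)) (at t within X)"
proof -
  define \<beta> where "\<beta> = 1 / (real p + 1)"
  have "((\<lambda>t. (Ts - t) powr (- \<beta>)) has_real_derivative (\<beta> / (Ts - t)) * (Ts - t) powr (- \<beta>)) (at t within X)"
    using t by (auto intro!: derivative_eq_intros simp: powr_diff)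
  from DERIV_cmult[OF this, of "(real p / (real p + 1)) powr \<beta>"]
  have "(r has_real_derivative r t * (\<beta> / (Ts - t))) (at t within X)"
    unfolding r_def[abs_def] \<beta>_def by (simp add: mult_ac)
  moreover have "1 / p * r t ^ (p + 1) = \<beta> / (Ts - t)" unfolding r_power[OF t] using p1 by (simp add: \<beta>_def)
  moreover have "1 / p * r t ^ (p + 2) = r t * (1 / p * r t ^ (p + 1))" by (simp add: mult_ac)
  ultimately show ?thesis by (simp only:)
qed

lemma d\<tau>: assumes t: "t < Ts" shows "(\<tau> has_real_derivative 1 / p * r t ^ (p + 1)) (at t within X)"
proof -
  define \<beta> where "\<beta> = 1 / (real p + 1)"
  have "0 < 1 - t / Ts" using t Ts_pos by simp
  then have "((\<lambda>t. - \<beta> * ln (1 - t / Ts)) has_real_derivative - \<beta> * (- (1 / Ts) / (1 - t / Ts))) (at t within X)"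
    using Ts_pos by (auto intro!: derivative_eq_intros)
  moreover have "- \<beta> * (- (1 / Ts) / (1 - t / Ts)) = 1 / p * r t ^ (p + 1)"
    unfolding r_power[OF t] using p1 t Ts_pos by (simp add: \<beta>_def field_simps)
  ultimately show ?thesis unfolding \<tau>_def[abs_def] \<beta>_def by simp
qed

lemma \<kappa>_Cinf: "Cinf {0..<Ts} \<kappa>"
  unfolding Cinf_def
proof
  fix n
  have "Ck n {0..<Ts} (\<lambda>t u. (Ts - t) powr (- (1 / (real p + 1))))"
    by (rule Ck_powr[OF Ck_diff[OF Ck_const Ck_fst]]) simp
  from Ck_mult[OF Ck_const[of _ _ "(real p / (real p + 1)) powr (1 / (real p + 1))"] this]
  have 1: "Ck n {0..<Ts} (\<lambda>t u. r t)" unfolding r_def .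
  have "Ck n {0..<Ts} (\<lambda>t u. 1 - t * (1 / Ts))"
    by (rule Ck_diff[OF Ck_const Ck_mult[OF Ck_fst Ck_const]])
  from Ck_mult[OF Ck_const[of _ _ "- (1 / (real p + 1))"] Ck_ln[OF this]]
  have "Ck n {0..<Ts} (\<lambda>t u. \<tau> t)" using Ts_pos by (simp add: \<tau>_def)
  from Ck_compose[OF time_dom_atLeast V_Cinf[of 0, unfolded Cinf_def, THEN spec] this Ck_snd]
  have "Ck n {0..<Ts} (\<lambda>t \<theta>. V 0 (\<tau> t) \<theta>)" using \<tau>_nonneg by simp
  from Ck_mult[OF 1 Ck_add[OF Ck_const[of _ _ 1] this]] show "Ck n {0..<Ts} \<kappa>" unfolding \<kappa>_def .
qed

lemma Du_\<kappa>_power: assumes t: "t \<in> {0..<Ts}"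
  shows "Du (Du (\<lambda>t \<theta>. \<kappa> t \<theta> ^ p)) t \<theta> = r t ^ p * Ypart p (V 0 (\<tau> t) \<theta>) (V 1 (\<tau> t) \<theta>) (V 2 (\<tau> t) \<theta>)"
proof -
  define v where "v j = V j (\<tau> t)" for j
  have dv: "(v j has_real_derivative v (Suc j) \<theta>) (at \<theta>)" for j \<theta> unfolding v_def by (rule V_du[OF \<tau>_nonneg[OF t]])
  have dv': "(v 1 has_real_derivative v 2 \<theta>) (at \<theta>)" for \<theta> using dv[of 1 \<theta>] by (simp add: numeral_2_eq_2)
  note Y = Ypart_derivative[OF dv[of 0, folded One_nat_def] dv', where p=p, THEN DERIV_cmult, of "r t ^ p"]
  have "((\<lambda>\<theta>. \<kappa> t \<theta> ^ p) has_real_derivative r t ^ p * (real p * (1 + v 0 \<theta>) ^ (p - 1) * v 1 \<theta>)) (at \<theta>)" for \<theta>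
    using Y(1) unfolding \<kappa>_def power_mult_distrib v_def .
  then have "Du (\<lambda>t \<theta>. \<kappa> t \<theta> ^ p) t = (\<lambda>\<theta>. r t ^ p * (real p * (1 + v 0 \<theta>) ^ (p - 1) * v 1 \<theta>))"
    unfolding Du_def by (intro ext DERIV_imp_deriv)
  then show ?thesis unfolding Du_def[of "Du _"] using DERIV_imp_deriv[OF Y(2)] by (simp add: v_def)
qed

lemma \<kappa>_evol: assumes t: "t \<in> {0..<Ts}"
  shows "((\<lambda>t. \<kappa> t \<theta>) has_real_derivative
      1 / p * (\<kappa> t \<theta>)\<^sup>2 * (Du (Du (\<lambda>t \<theta>. \<kappa> t \<theta> ^ p)) t \<theta> + \<kappa> t \<theta> ^ p)) (at t within {0..<Ts})"
proof -
  have tT: "t < Ts" using t by simp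
  define v where "v j = V j (\<tau> t) \<theta>" for j
  define Y where "Y = Ypart p (v 0) (v 1) (v 2)"
  have "((\<lambda>s. V 0 s \<theta>) has_real_derivative Gpart p (v 0) (v 1) (v 2)) (at (\<tau> t) within \<tau> ` {0..<Ts})"
    unfolding v_def by (rule DERIV_subset[OF V_dt[OF \<tau>_nonneg[OF t]]]) (use \<tau>_nonneg in auto)
  from DERIV_image_chain[OF this d\<tau>[OF tT]]
  have "((\<lambda>t. V 0 (\<tau> t) \<theta>) has_real_derivative Gpart p (v 0) (v 1) (v 2) * (1 / p * r t ^ (p + 1))) (at t within {0..<Ts})"
    by (simp add: o_def)
  from DERIV_mult[OF dr[OF tT] DERIV_add[OF DERIV_const[of 1] this]]
  have D: "((\<lambda>t. \<kappa> t \<theta>) has_real_derivative 1 / p * r t ^ (p + 2) * (1 + v 0)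
     + (0 + Gpart p (v 0) (v 1) (v 2) * (1 / p * r t ^ (p + 1))) * r t) (at t within {0..<Ts})"
    unfolding \<kappa>_def v_def .
  have "1 / p * r t ^ (p + 2) * (1 + v 0) + (0 + Gpart p (v 0) (v 1) (v 2) * (1 / p * r t ^ (p + 1))) * r t
    = 1 / p * (r t ^ (p + 2) * ((1 + v 0) + Gpart p (v 0) (v 1) (v 2)))" by (simp add: algebra_simps add_divide_distrib)
  also have "(1 + v 0) + Gpart p (v 0) (v 1) (v 2) = (1 + v 0)\<^sup>2 * (Y + (1 + v 0) ^ p)"
    by (simp add: Gpart_def Y_def power_add power2_eq_square algebra_simps)
  also have "1 / p * (r t ^ (p + 2) * ((1 + v 0)\<^sup>2 * (Y + (1 + v 0) ^ p)))
    = 1 / p * (r t * (1 + v 0))\<^sup>2 * (r t ^ p * Y + (r t * (1 + v 0)) ^ p)"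
    unfolding power_add power_mult_distrib by (simp add: algebra_simps add_divide_distrib)
  finally show ?thesis using D unfolding Du_\<kappa>_power[OF t] unfolding Y_def v_def \<kappa>_def by (simp only:)
qed

lemma target:
  assumes "\<And>\<theta>. (h0 has_real_derivative h1 \<theta>) (at \<theta>)"
    and "\<And>\<theta>. (h1 has_real_derivative 1 / \<psi> \<theta> - h0 \<theta>) (at \<theta>)" and "\<And>\<theta>. h0 (\<theta> + 2 * pi) = h0 \<theta>"
  shows "target p Ts \<kappa> h0 h1"
proof
  have "\<tau> 0 = 0" by (simp add: \<tau>_def)
  then have "\<kappa> 0 \<theta> = \<psi> \<theta>" for \<theta> using V_init[of \<theta>, symmetric] a by (simp add: \<kappa>_def r_0)
  then show "(h1 has_real_derivative 1 / \<kappa> 0 \<theta> - h0 \<theta>) (at \<theta>)" for \<theta> using assms(2) by simp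
qed (use p1 Ts_pos \<kappa>_Cinf \<kappa>_pos \<kappa>_evol assms in \<open>auto simp: \<kappa>_def V_per\<close>)

text \<open>The profile blows up at \<open>Ts\<close>, so it cannot be the curvature of a flow that lives longer.\<close>

lemma \<kappa>_unbounded: "\<exists>t\<in>{0..<Ts}. \<forall>\<theta>. B < \<kappa> t \<theta>"
proof -
  define B' where "B' = 1 + \<bar>B\<bar>"
  define c where "c = real p / (real p + 1)"
  \<comment> \<open>At time Ts - \<delta> the circle has curvature r at least 2 B', and \<kappa> is
    at least r / 2.\<close>
  define \<delta> where "\<delta> = min Ts (c / (2 * B') ^ (p + 1))"
  have c: "0 < c" using p1 by (simp add: c_def)
  have B': "0 < B'" "B < B'" by (auto simp: B'_def)
  have \<delta>: "0 < \<delta>" "\<delta> \<le> Ts" "\<delta> \<le> c / (2 * B') ^ (p + 1)" using Ts_pos c B' by (auto simp: \<delta>_def)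
  have t: "Ts - \<delta> \<in> {0..<Ts}" using \<delta> by auto
  have "(2 * B') ^ (p + 1) \<le> c / \<delta>" using \<delta>(1,3) zero_less_power[of "2 * B'" "p + 1"] B'(1)
    by (simp only: pos_le_divide_eq mult.commute zero_less_mult_iff zero_less_numeral simp_thms)
  also have "\<dots> = r (Ts - \<delta>) ^ (p + 1)" using r_power[of "Ts - \<delta>"] \<delta>(1) by (simp add: c_def)
  finally have "2 * B' \<le> r (Ts - \<delta>)" using r_pos[of "Ts - \<delta>"] \<delta>(1) by (auto intro: power_le_imp_le_base[of _ p])
  then have "B < \<kappa> (Ts - \<delta>) \<theta>" for \<theta> using \<kappa>_pos(1)[OF t, of \<theta>] B'(2) by linarith
  then show ?thesis using t by blast
qed

end

section \<open>Continuation of the flow\<close>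

lemma smooth_family_complex:
  assumes T: "0 < T" and re: "Cinf {0..<T} (\<lambda>t u. Re (y t u))" and im: "Cinf {0..<T} (\<lambda>t u. Im (y t u))"
  shows "smooth_family T y" "t \<in> {0..<T} \<Longrightarrow> smooth_curve (y t)"
proof -
  note S = time_dom_atLeastLessThan[OF T]
  define D where "D i j t u = Complex ((Du ^^ i) ((Dt {0..<T} ^^ j) (\<lambda>t u. Re (y t u))) t u)
    ((Du ^^ i) ((Dt {0..<T} ^^ j) (\<lambda>t u. Im (y t u))) t u)" for i j t u
  note M = Cinf_mixed_partials[OF S re] Cinf_mixed_partials[OF S im]
  have D0: "D 0 0 t u = y t u" for t u by (simp add: D_def)
  have c: "continuous_on ({0..<T} \<times> UNIV) (\<lambda>(t, u). D i j t u)" for i j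
  proof -
    have "continuous_on ({0..<T} \<times> UNIV) (\<lambda>z. (Du ^^ i) ((Dt {0..<T} ^^ j) (\<lambda>t u. Re (y t u))) (fst z) (snd z))"
      "continuous_on ({0..<T} \<times> UNIV) (\<lambda>z. (Du ^^ i) ((Dt {0..<T} ^^ j) (\<lambda>t u. Im (y t u))) (fst z) (snd z))"
      using M by (simp_all add: mixed_partials_def cont2_def)
    note this[THEN continuous_on_of_real, where 'a=complex]
    from continuous_on_add[OF this(1) continuous_on_mult_left[OF this(2), of \<i>]]
    show ?thesis by (simp add: D_def Complex_eq split_beta)
  qed
  have du: "(D i j t has_vector_derivative D (Suc i) j t u) (at u)"
    and dt: "((\<lambda>s. D i j s u) has_vector_derivative D i (Suc j) t u) (at t within {0..<T})" if "t \<in> {0..<T}" for i j t u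
    using M that unfolding mixed_partials_def partials_def D_def has_vector_derivative_complex_iff by simp_all
  show "smooth_family T y" unfolding smooth_family_def by (intro exI[of _ D]) (use D0 c du dt in blast)
  show "smooth_curve (y t)" if t: "t \<in> {0..<T}"
    unfolding smooth_curve_def by (intro exI[of _ "\<lambda>n. D n 0 t"]) (use D0 du[OF t] in auto)
qed

context comparison
begin

lemma x_Y: assumes t: "t \<in> S" "t < Ts"
  shows "x t u = support_function.Y (\<lambda>j. (Du ^^ j) B.h t) (\<phi> t u)"
proof -
  have "t \<in> {0..<Ts}" using t by (simp add: S_def)
  note Y = support_function.Y_def[OF B.support_function_h[OF this]]
  show ?thesis using cis_basis[of "x t u" "\<phi> t u"] support_eq(1,2)[OF t, of u]
    unfolding Y cis_\<phi>[OF t(1)] by simp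
qed

text \<open>A dilated curve is not a member of the flow, so its curvature is computed from the
  support function c h, whose curve \<open>Y\<close> it is up to the parametrisation by
  \<phi>.\<close>

lemma scaled_angle_curvature:
  assumes t: "t \<in> S" "t < Ts" and c: "0 < c"
  shows "angle_curvature (\<lambda>u. c *\<^sub>R x t u) \<theta> = \<kappa> t \<theta> / c"
proof -
  have tB: "t \<in> {0..<Ts}" using t by (simp add: S_def)
  interpret A: angle_curve "x t" "\<phi> t" "g t" "k t" by (rule angle_curve_x[OF t(1)])
  interpret H: support_function "\<lambda>j. (Du ^^ j) B.h t" by (rule B.support_function_h[OF tB])
  interpret C: support_function "\<lambda>j \<theta>. c * (Du ^^ j) B.h t \<theta>"
  proof
    show "((\<lambda>\<theta>. c * (Du ^^ j) B.h t \<theta>) has_real_derivative c * (Du ^^ Suc j) B.h t \<theta>) (at \<theta>)" for j \<theta>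
      by (rule DERIV_cmult[OF H.dH])
    show "c * (Du ^^ 0) B.h t (\<theta> + 2 * pi) = c * (Du ^^ 0) B.h t \<theta>" for \<theta> by (simp only: H.per)
    show "0 < c * (Du ^^ 0) B.h t \<theta> + c * (Du ^^ 2) B.h t \<theta>" for \<theta>
      using mult_pos_pos[OF c H.pos[of \<theta>]] by (simp only: distrib_left)
  qed
  have Y: "(\<lambda>u. c *\<^sub>R x t u) = (\<lambda>u. C.Y (\<phi> t u))"
    by (rule ext) (simp add: x_Y[OF t] C.Y_def H.Y_def scaleR_conv_of_real algebra_simps)
  have g_du: "(g t has_real_derivative Du g t u) (at u)" for u
    using Cinf_D(3)[OF time_dom_S g_Cinf] t(1) by (simp add: partials_def)
  have sm: "smooth_curve (\<lambda>u. C.Y (\<phi> t u))"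
    unfolding Y[symmetric] smooth_curve_def
  proof (intro exI[of _ "\<lambda>n u. c *\<^sub>R D n 0 t u"] conjI allI)
    show "(\<lambda>u. c *\<^sub>R D 0 0 t u) = (\<lambda>u. c *\<^sub>R x t u)" using D0[OF t(1)] by simp
    show "((\<lambda>u. c *\<^sub>R D n 0 t u) has_vector_derivative c *\<^sub>R D (Suc n) 0 t u) (at u)" for n u
      by (rule bounded_linear.has_vector_derivative[OF bounded_linear_scaleR_right Du[OF t(1)]])
  qed
  note R = C.reparametrised[OF \<phi>_du[OF t(1)] g_du A.mono A.\<phi>_shift A.turn_2pi sm]
  have w: "C.w \<theta> = c / \<kappa> t \<theta>" for \<theta>
  proof -
    have "B.h t \<theta> + Du (Du B.h) t \<theta> = 1 / \<kappa> t \<theta>"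
      using DERIV_imp_deriv[OF B.h_du2'[OF tB, of \<theta>]] by (simp add: Du_def[of "Du _"])
    then show ?thesis by (simp add: C.w_def numeral_2_eq_2 flip: distrib_left)
  qed
  show ?thesis unfolding angle_curvature_def Y R(2,3)
  proof (rule the_equality)
    show "\<exists>u. cis (\<phi> t u) = cis \<theta> \<and> \<kappa> t \<theta> / c = 1 / C.w (\<phi> t u)"
      by (rule exI[of _ "A.U \<theta>"]) (simp add: w)
    fix \<kappa>' assume "\<exists>u. cis (\<phi> t u) = cis \<theta> \<and> \<kappa>' = 1 / C.w (\<phi> t u)"
    then obtain u where u: "cis (\<phi> t u) = cis \<theta>" "\<kappa>' = 1 / C.w (\<phi> t u)" by blast
    obtain j :: int where j: "\<phi> t u = \<theta> + 2 * pi * of_int j" using u(1) cis_eq_iff by blast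
    have "\<kappa> t (\<phi> t u) = \<kappa> t \<theta>" unfolding j by (rule periodic_shift[where f="\<kappa> t", OF B.\<kappa>_per[OF tB]])
    then show "\<kappa>' = \<kappa> t \<theta> / c" using u(2) by (simp add: w)
  qed
qed

text \<open>The tangential speed of the normal flow in terms of the angle: it transports the angle
  \<open>\<phi> t u\<close> of a fixed particle \<open>u\<close>.\<close>

definition v :: tfun where "v t \<theta> = \<kappa> t \<theta> * (1 / p * Du B.f t \<theta>)"

lemma v_Cinf: "Cinf {0..<Ts} v" unfolding v_def[abs_def]
  by (rule Cinf_mult[OF B.\<kappa>_Cinf Cinf_mult[OF Cinf_const B.f_D(1)]])

lemma v_per: assumes t: "t \<in> {0..<Ts}" shows "v t (\<theta> + 2 * pi) = v t \<theta>"
proof -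
  have "B.f t (u + 2 * pi) = B.f t u" for u by (simp add: B.f_def B.\<kappa>_per[OF t])
  from Du_periodic[OF this B.f_du[OF t]] show ?thesis by (simp add: v_def B.\<kappa>_per[OF t])
qed

text \<open>Since the curvature is a function of time and angle, so is the rotation rate of a
  particle; the angles \<phi> t u therefore solve an ordinary differential equation that continues
  to make sense after T.\<close>

lemma q_v: assumes t: "t \<in> S" "t < Ts" shows "q t u = v t (\<phi> t u)"
proof -
  have tB: "t \<in> {0..<Ts}" using t by (simp add: S_def)
  have kf: "(\<lambda>u. k t u ^ p) = (\<lambda>u. B.f t (\<phi> t u))" by (rule ext) (simp add: B.f_def support_eq(3)[OF t])
  have "((\<lambda>u. k t u ^ p) has_real_derivative Du B.f t (\<phi> t u) * g t u) (at u)"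
    unfolding kf by (rule DERIV_chain2[OF B.f_du[OF tB] \<phi>_du[OF t(1)]])
  moreover have "((\<lambda>u. k t u ^ p) has_real_derivative p * (k t u ^ (p - 1) * Du k t u)) (at u)"
    using DERIV_power[OF k_du[OF t(1), of u], of p] by (simp add: mult_ac)
  ultimately have "Du B.f t (\<phi> t u) * g t u = p * (k t u ^ (p - 1) * Du k t u)" using DERIV_unique by blast
  then have "k t u ^ (p - 1) * Du k t u = 1 / p * (Du B.f t (\<phi> t u) * (\<sigma> * k t u * s t u))"
    using p by (simp add: g_eq[OF t(1)])
  then have "q t u * s t u = (\<sigma> * \<sigma>) * (v t (\<phi> t u) * s t u)"
    unfolding q_eq[OF t(1)] by (simp add: v_def support_eq(3)[OF t] mult_ac)
  then show ?thesis using s_pos[OF t(1), of u] by (simp add: \<sigma>(2))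
qed

lemma \<Phi>_Cinf: "Cinf {0..} (\<lambda>t. \<Phi>)"
proof -
  have "continuous_on UNIV \<Phi>" using \<Phi>(1) by (meson DERIV_isCont continuous_at_imp_continuous_on)
  then have c: "cont2 {0..} (\<lambda>t. \<Phi>)" unfolding cont2_def
    by (rule continuous_on_compose2[OF _ continuous_on_snd[OF continuous_on_id]]) simp
  have P: "partials {0..} (\<lambda>t. \<Phi>) (\<lambda>t. g 0) (\<lambda>t u. 0)" using \<Phi>(1) by (simp add: partials_def)
  have "Ck n {0..} (\<lambda>t. \<Phi>)" for n
    by (rule Ck_SucD[OF Ck_SucI[OF c P _ Ck_const]]) (use Cinf_initial[OF g_Cinf] in \<open>simp add: Cinf_def\<close>)
  then show ?thesis by (simp add: Cinf_def)
qed

text \<open>The angles of the particles are continued beyond T as solutions \<Theta> of the equation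
  with field v, and the new curves are the points of the target with these angles. Their velocity is
  purely normal, as the flow demands.\<close>

lemma not_maximal:
  assumes TTs: "T < Ts"
  shows "\<exists>T'>T. \<exists>y. p_curve_shortening_flow p T' y \<and> (\<forall>t\<in>{0..<T}. \<forall>u. y t u = x t u)"
proof -
  \<comment> \<open>Strictly below Ts, because \<open>ode_flow\<close> needs the field to be smooth
    up to and including T1.\<close>
  define T1 where "T1 = (T + Ts) / 2"
  have T1: "T < T1" "T1 < Ts" "0 < T1" using TTs T by (auto simp: T1_def)
  have sub: "{0..<T1} \<subseteq> {0..<Ts}" "{0..T1} \<subseteq> {0..<Ts}" "S \<subseteq> {0..<T1}" using T1 by (auto simp: S_def)
  interpret A: angle_curve "x 0" "\<phi> 0" "g 0" "k 0" by (rule angle_curve_x[OF zero_S])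
  obtain \<Theta> E where \<Theta>: "Cinf {0..<T1} \<Theta>" "\<And>u. \<Theta> 0 u = \<Phi> u"
    "\<And>t u. t \<in> {0..<T1} \<Longrightarrow> ((\<lambda>s. \<Theta> s u) has_real_derivative v t (\<Theta> t u)) (at t within {0..<T1})"
    "\<And>t u. t \<in> {0..<T1} \<Longrightarrow> (\<Theta> t has_real_derivative Du (\<lambda>t. \<Phi>) 0 u * E t u) (at u)" and E: "\<And>t u. 0 < E t u"
    using ode_flow[OF v_Cinf v_per T1(3,2) \<Phi>_Cinf] by metis
  obtain L where L: "\<And>t a b. t \<in> {0..T1} \<Longrightarrow> \<bar>v t a - v t b\<bar> \<le> L * \<bar>a - b\<bar>"
    using Cinf_lipschitz[OF B.time_dom_Ts v_Cinf sub(2) v_per] by blast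
  have \<phi>0: "\<phi> 0 u = \<Phi> u" for u by (simp add: \<phi>_def tint_def)
  have d\<Theta>: "((\<lambda>s. \<Theta> s u) has_real_derivative v s (\<Theta> s u)) (at s within {0..t})" if "t < T1" "0 \<le> s" "s \<le> t" for s t u
    by (rule DERIV_subset[OF \<Theta>(3)]) (use that in auto)
  \<comment> \<open>Both solve the same equation with the same initial angle.\<close>
  have \<Theta>\<phi>: "\<Theta> t u = \<phi> t u" if t: "t \<in> S" for t u
  proof -
    have tsub: "{0..t} \<subseteq> S" using t by (auto simp: S_def)
    have "\<bar>\<Theta> t u - \<phi> t u\<bar> \<le> \<bar>\<Theta> 0 u - \<phi> 0 u\<bar> * exp (L * t)"
    proof (rule ode_stability[where a=v])
      fix s assume s: "0 \<le> s" "s \<le> t"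
      then have sS: "s \<in> S" "s < Ts" using t T1 by (auto simp: S_def)
      show "((\<lambda>s. \<Theta> s u) has_real_derivative v s (\<Theta> s u)) (at s within {0..t})"
        by (rule d\<Theta>) (use s t sub in auto)
      show "((\<lambda>s. \<phi> s u) has_real_derivative v s (\<phi> s u)) (at s within {0..t})"
        using DERIV_subset[OF \<phi>_dt[OF sS(1), of u] tsub] by (simp only: q_v[OF sS])
      show "\<bar>v s a - v s b\<bar> \<le> L * \<bar>a - b\<bar>" for a b by (rule L) (use s t T1 in \<open>auto simp: S_def\<close>)
    qed (use t in \<open>simp add: S_def\<close>)
    then show ?thesis by (simp add: \<Theta>(2) \<phi>0)
  qed
  \<comment> \<open>The field is periodic in the angle, so shifting a solution by a full turn gives
    a solution again, and both sides agree at time 0.\<close>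
  have turn: "\<Theta> t (u + 2 * pi) = \<Theta> t u + A.turn" if t: "t \<in> {0..<T1}" for t u
  proof -
    have vturn: "v s (\<theta> + A.turn) = v s \<theta>" if "s \<in> {0..<Ts}" for s \<theta>
    proof (cases "A.turn = 2 * pi")
      case True
      then show ?thesis using v_per[OF that, of \<theta>] by simp
    next
      case False
      then have "A.turn = - 2 * pi" using A.turn_2pi by linarith
      then show ?thesis using v_per[OF that, of "\<theta> - 2 * pi"] by simp
    qed
    have "\<bar>\<Theta> t (u + 2 * pi) - (\<Theta> t u + A.turn)\<bar> \<le> \<bar>\<Theta> 0 (u + 2 * pi) - (\<Theta> 0 u + A.turn)\<bar> * exp (L * t)"
    proof (rule ode_stability[where a=v])
      fix s assume s: "0 \<le> s" "s \<le> t"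
      show "((\<lambda>s. \<Theta> s (u + 2 * pi)) has_real_derivative v s (\<Theta> s (u + 2 * pi))) (at s within {0..t})"
        by (rule d\<Theta>) (use s t in auto)
      show "((\<lambda>s. \<Theta> s u + A.turn) has_real_derivative v s (\<Theta> s u + A.turn)) (at s within {0..t})"
        using DERIV_add[OF d\<Theta>[of t s u] DERIV_const[of A.turn]] s t T1 by (simp add: vturn)
      show "\<bar>v s a - v s b\<bar> \<le> L * \<bar>a - b\<bar>" for a b by (rule L) (use s t in auto)
    qed (use t in simp)
    then show ?thesis using A.\<phi>_shift[of u] by (simp add: \<Theta>(2) \<phi>0)
  qed
  define y where "y t u = support_function.Y (\<lambda>j. (Du ^^ j) B.h t) (\<Theta> t u)" for t u
  have y: "y t u = of_real (B.h t (\<Theta> t u)) * cis (\<Theta> t u) + of_real (Du B.h t (\<Theta> t u)) * (\<i> * cis (\<Theta> t u))"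
    if "t \<in> {0..<T1}" for t u
    using support_function.Y_def[OF B.support_function_h[of t]] that sub by (auto simp: y_def)
  have comp: "Cinf {0..<T1} (\<lambda>t u. F t (\<Theta> t u))" if "Cinf {0..<Ts} F" for F
    unfolding Cinf_def
  proof
    fix n show "Ck n {0..<T1} (\<lambda>t u. F t (\<Theta> t u))"
      by (rule Ck_compose[OF B.time_dom_Ts _ Ck_fst]) (use that \<Theta>(1) sub in \<open>auto simp: Cinf_def\<close>)
  qed
  have sc: "Cinf {0..<T1} (\<lambda>t u. cos (\<Theta> t u))" "Cinf {0..<T1} (\<lambda>t u. sin (\<Theta> t u))"
    using \<Theta>(1) by (simp_all add: Cinf_def Ck_cos Ck_sin)
  have "Cinf {0..<T1} (\<lambda>t u. Re (y t u))"
    by (rule Cinf_cong[OF _ Cinf_diff[OF Cinf_mult[OF comp[OF B.h_Cinf] sc(1)] Cinf_mult[OF comp[OF B.h_D(1)] sc(2)]]]) (simp add: y)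
  moreover have "Cinf {0..<T1} (\<lambda>t u. Im (y t u))"
    by (rule Cinf_cong[OF _ Cinf_add[OF Cinf_mult[OF comp[OF B.h_Cinf] sc(2)] Cinf_mult[OF comp[OF B.h_D(1)] sc(1)]]]) (simp add: y)
  ultimately have sm: "smooth_family T1 y" "\<And>t. t \<in> {0..<T1} \<Longrightarrow> smooth_curve (y t)"
    using smooth_family_complex[OF T1(3)] by blast+
  have P: "partials {0..<T1} \<Theta> (Du \<Theta>) (Dt {0..<T1} \<Theta>)" "partials {0..<T1} (Du \<Theta>) (Du (Du \<Theta>)) (Dt {0..<T1} (Du \<Theta>))"
    using Cinf_D[OF time_dom_atLeastLessThan[OF T1(3)]] \<Theta>(1) by blast+
  have "Du (\<lambda>t. \<Phi>) 0 u = g 0 u" for u unfolding Du_def by (rule DERIV_imp_deriv[OF \<Phi>(1)])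
  then have Du\<Theta>: "Du \<Theta> t u = g 0 u * E t u" if "t \<in> {0..<T1}" for t u
    using DERIV_imp_deriv[OF \<Theta>(4)[OF that]] by (simp add: Du_def[of \<Theta>])
  have w: "support_function.w (\<lambda>j. (Du ^^ j) B.h t) \<theta> = 1 / \<kappa> t \<theta>" if "t \<in> {0..<Ts}" for t \<theta>
    using DERIV_imp_deriv[OF B.h_du2'[OF that, of \<theta>]]
    by (simp add: support_function.w_def[OF B.support_function_h[OF that]] numeral_2_eq_2 Du_def[of "Du _"])
  have geo: "convex_embedding (y t)" "outward_normal (y t) u = cis (\<Theta> t u)" "curvature (y t) u = \<kappa> t (\<Theta> t u)"
    if t: "t \<in> {0..<T1}" for t u
  proof -
    have tB: "t \<in> {0..<Ts}" using t sub by blast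
    interpret H: support_function "\<lambda>j. (Du ^^ j) B.h t" by (rule B.support_function_h[OF tB])
    \<comment> \<open>The factor E is positive, so \<Theta> keeps the orientation of the initial
      parametrisation.\<close>
    have "(\<forall>u. 0 < Du \<Theta> t u) \<or> (\<forall>u. Du \<Theta> t u < 0)"
      using A.mono E by (auto simp: Du\<Theta>[OF t] zero_less_mult_iff mult_less_0_iff dest: less_asym)
    moreover have "(\<Theta> t has_real_derivative Du \<Theta> t u) (at u)" "(Du \<Theta> t has_real_derivative Du (Du \<Theta>) t u) (at u)" for u
      using P t by (simp_all add: partials_def)
    ultimately have R: "convex_embedding (\<lambda>u. H.Y (\<Theta> t u))" "outward_normal (\<lambda>u. H.Y (\<Theta> t u)) u = cis (\<Theta> t u)"
      "curvature (\<lambda>u. H.Y (\<Theta> t u)) u = 1 / H.w (\<Theta> t u)"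
      using H.reparametrised[OF _ _ _ turn[OF t] A.turn_2pi sm(2)[OF t, unfolded y_def]] by blast+
    show "convex_embedding (y t)" "outward_normal (y t) u = cis (\<Theta> t u)" "curvature (y t) u = \<kappa> t (\<Theta> t u)"
      using R by (simp_all add: y_def[abs_def] w[OF tB])
  qed
  have evol: "((\<lambda>s. y s u) has_vector_derivative (- (1 / real p) * curvature (y t) u ^ p) *\<^sub>R outward_normal (y t) u) (at t within {0..<T1})"
    if t: "t \<in> {0..<T1}" for t u
  proof -
    have tB: "t \<in> {0..<Ts}" using t sub by blast
    define \<theta> where "\<theta> = \<Theta> t u"
    note d = \<Theta>(3)[OF t, of u]
    have P1: "partials {0..<Ts} B.h (Du B.h) (\<lambda>t \<theta>. - (1 / p) * B.f t \<theta>)"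
      "partials {0..<Ts} (Du B.h) (\<lambda>t \<theta>. 1 / \<kappa> t \<theta> - B.h t \<theta>) (\<lambda>t \<theta>. - (1 / p) * Du B.f t \<theta>)"
      unfolding partials_def using B.h_du' B.h_du2' B.h_dt by simp_all
    have "Cinf {0..<Ts} (\<lambda>t \<theta>. 1 / \<kappa> t \<theta> - B.h t \<theta>)"
      by (rule Cinf_diff[OF Cinf_divide[OF Cinf_const B.\<kappa>_Cinf B.\<kappa>_pos] B.h_Cinf])
    note c1 = Cinf_cont2[OF B.h_D(1)] Cinf_cont2[OF this]
    have dh: "((\<lambda>s. B.h s (\<Theta> s u)) has_real_derivative - (1 / p) * B.f t \<theta> * 1 + Du B.h t \<theta> * v t \<theta>) (at t within {0..<T1})"
      unfolding \<theta>_def by (rule partials_chain[OF B.time_dom_Ts P1(1) c1(1) DERIV_ident d]) (use sub t in auto)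
    have dh1: "((\<lambda>s. Du B.h s (\<Theta> s u)) has_real_derivative - (1 / p) * Du B.f t \<theta> * 1 + (1 / \<kappa> t \<theta> - B.h t \<theta>) * v t \<theta>) (at t within {0..<T1})"
      unfolding \<theta>_def by (rule partials_chain[OF B.time_dom_Ts P1(2) c1(2) DERIV_ident d]) (use sub t in auto)
    have dc: "((\<lambda>s. cis (\<Theta> s u)) has_vector_derivative v t \<theta> *\<^sub>R (\<i> * cis \<theta>)) (at t within {0..<T1})"
      using vector_diff_chain_within[OF d[unfolded real_derivative_vector] cis_has_vector_derivative]
      by (simp add: o_def \<theta>_def)
    have "((\<lambda>s. of_real (B.h s (\<Theta> s u)) * cis (\<Theta> s u) + of_real (Du B.h s (\<Theta> s u)) * (\<i> * cis (\<Theta> s u))) has_vector_derivative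
      (of_real (B.h t \<theta>) * (v t \<theta> *\<^sub>R (\<i> * cis \<theta>)) + of_real (- (1 / p) * B.f t \<theta> * 1 + Du B.h t \<theta> * v t \<theta>) * cis \<theta>)
      + (of_real (Du B.h t \<theta>) * (\<i> * (v t \<theta> *\<^sub>R (\<i> * cis \<theta>)))
        + of_real (- (1 / p) * Du B.f t \<theta> * 1 + (1 / \<kappa> t \<theta> - B.h t \<theta>) * v t \<theta>) * (\<i> * cis \<theta>))) (at t within {0..<T1})"
      unfolding \<theta>_def
      by (rule has_vector_derivative_add[OF has_vector_derivative_mult[OF has_vector_derivative_of_real[OF dh] dc]
        has_vector_derivative_mult[OF has_vector_derivative_of_real[OF dh1] has_vector_derivative_mult_right[OF dc]], unfolded \<theta>_def])
    moreover have "(of_real (B.h t \<theta>) * (v t \<theta> *\<^sub>R (\<i> * cis \<theta>)) + of_real (- (1 / p) * B.f t \<theta> * 1 + Du B.h t \<theta> * v t \<theta>) * cis \<theta>)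
      + (of_real (Du B.h t \<theta>) * (\<i> * (v t \<theta> *\<^sub>R (\<i> * cis \<theta>)))
        + of_real (- (1 / p) * Du B.f t \<theta> * 1 + (1 / \<kappa> t \<theta> - B.h t \<theta>) * v t \<theta>) * (\<i> * cis \<theta>))
      = of_real (- (1 / p) * B.f t \<theta>) * cis \<theta> + of_real (1 / \<kappa> t \<theta> * v t \<theta> - 1 / p * Du B.f t \<theta>) * (\<i> * cis \<theta>)"
      by (simp add: scaleR_conv_of_real complex_eq_iff algebra_simps)
    \<comment> \<open>The field v is defined so that the tangential component of the velocity
      cancels.\<close>
    moreover have "1 / \<kappa> t \<theta> * v t \<theta> - 1 / p * Du B.f t \<theta> = 0"
      using B.\<kappa>_pos[OF tB, of \<theta>] by (simp add: v_def)
    ultimately have "((\<lambda>s. of_real (B.h s (\<Theta> s u)) * cis (\<Theta> s u) + of_real (Du B.h s (\<Theta> s u)) * (\<i> * cis (\<Theta> s u))) has_vector_derivative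
      (- (1 / p) * B.f t \<theta>) *\<^sub>R cis \<theta>) (at t within {0..<T1})" by (simp only: of_real_0 mult_zero_left add_0_right scaleR_conv_of_real)
    then have "((\<lambda>s. y s u) has_vector_derivative (- (1 / p) * B.f t \<theta>) *\<^sub>R cis \<theta>) (at t within {0..<T1})"
      by (rule has_vector_derivative_transform[OF t, rotated]) (simp add: y)
    then show ?thesis by (simp add: geo[OF t] B.f_def \<theta>_def)
  qed
  have "p_curve_shortening_flow p T1 y"
    unfolding p_curve_shortening_flow_def using sm(1) geo(1) evol by blast
  moreover have "y t u = x t u" if "t \<in> {0..<T}" for t u
  proof -
    have t: "t \<in> S" "t < Ts" using that TTs by (auto simp: S_def)
    show ?thesis unfolding y_def \<Theta>\<phi>[OF t(1)] x_Y[OF t] ..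
  qed
  ultimately show ?thesis using T1(1) by blast
qed

end

section \<open>Convergence\<close>

lemma Cl_norm_le:
  assumes d: "\<And>j \<theta>. (W j has_real_derivative W (Suc j) \<theta>) (at \<theta>)" and B: "\<And>j \<theta>. j \<le> l \<Longrightarrow> \<bar>W j \<theta>\<bar> \<le> B"
  shows "Cl_norm l (W 0) \<le> B"
proof -
  have W: "(deriv ^^ j) (W 0) = W j" for j
  proof (induction j)
    case (Suc j)
    then show ?case using DERIV_imp_deriv[OF d] by auto
  qed simp
  have "(SUP \<theta>. \<bar>W j \<theta>\<bar>) \<le> B" if "j \<le> l" for j
    by (rule cSUP_least) (use B that in auto)
  then show ?thesis unfolding Cl_norm_def W by (intro Max.boundedI) auto
qed

lemma flow_exists:
  assumes "1 \<le> p" "0 < T" and F: "p_curve_shortening_flow p T x"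
  shows "\<exists>D. flow p T x D {0..<T}"
proof -
  obtain D where D: "\<forall>t\<in>{0..<T}. \<forall>u. D 0 0 t u = x t u" "\<forall>i j. continuous_on ({0..<T} \<times> UNIV) (\<lambda>(t, u). D i j t u)"
    "\<forall>i j. \<forall>t\<in>{0..<T}. \<forall>u. (D i j t has_vector_derivative D (Suc i) j t u) (at u) \<and>
           ((\<lambda>s. D i j s u) has_vector_derivative D i (Suc j) t u) (at t within {0..<T})"
    using F unfolding p_curve_shortening_flow_def smooth_family_def by blast
  show ?thesis by (intro exI[of _ D] flow.intro)
    (use assms D in \<open>simp_all add: p_curve_shortening_flow_def\<close>)
qed

context flow
begin

lemma initial_curvature:
  fixes \<psi> assumes \<psi>: "\<psi> = angle_curvature (x 0)"
  shows "\<exists>D. D 0 = \<psi> \<and> (\<forall>j u. (D j has_real_derivative D (Suc j) u) (at u))" "\<psi> (u + 2 * pi) = \<psi> u" "0 < \<psi> u"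
    "integral {0..2 * pi} (\<lambda>\<theta>. sin (\<theta> + r) / \<psi> \<theta>) = 0"
proof -
  interpret A: angle_curve "x 0" "\<phi> 0" "g 0" "k 0" by (rule angle_curve_x[OF zero_S])
  have \<psi>k: "\<psi> = kap 0" unfolding \<psi> using angle_curvature_x[OF zero_S] by blast
  show "\<exists>D. D 0 = \<psi> \<and> (\<forall>j u. (D j has_real_derivative D (Suc j) u) (at u))" unfolding \<psi>k by (rule kap_smooth)
  show "\<psi> (u + 2 * pi) = \<psi> u" "0 < \<psi> u" "integral {0..2 * pi} (\<lambda>\<theta>. sin (\<theta> + r) / \<psi> \<theta>) = 0"
    unfolding \<psi>k kap_def by (rule A.kap_periodic A.kap_pos A.closing)+
qed

lemma comparison_rescaled:
  assumes R: "rescaled_solution p a \<psi> V" and \<psi>: "\<psi> = angle_curvature (x 0)"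
  shows "\<exists>h0 h1. comparison p T x D S (rescaled_solution.Ts p a) (rescaled_solution.\<kappa> p a V) h0 h1"
proof -
  interpret A: angle_curve "x 0" "\<phi> 0" "g 0" "k 0" by (rule angle_curve_x[OF zero_S])
  have \<psi>k: "\<psi> = A.kap" unfolding \<psi> using angle_curvature_x[OF zero_S] by (auto simp: kap_def)
  have "target p (rescaled_solution.Ts p a) (rescaled_solution.\<kappa> p a V) A.h A.h1"
    by (rule rescaled_solution.target[OF R]) (use A.dh A.dh1 A.h_periodic \<psi>k in auto)
  moreover have "x 0 u \<bullet> N 0 u = A.h (\<phi> 0 u)" for u
    by (simp add: A.h_def cis_\<phi>[OF zero_S] flip: A.\<gamma>_X)
  ultimately show ?thesis by (intro exI comparison.intro comparison_axioms.intro) (rule flow_axioms)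
qed

text \<open>An earlier end contradicts maximality. A later end would bound the curvature on the
  compact interval up to Ts, where it agrees with the unbounded profile.\<close>

lemma maximal_time:
  assumes R: "rescaled_solution p a \<psi> V" and \<psi>: "\<psi> = angle_curvature (x 0)"
    and max: "maximal_p_curve_shortening_flow p T x"
  shows "T = rescaled_solution.Ts p a"
proof -
  interpret R: rescaled_solution p a \<psi> V by (rule R)
  obtain h0 h1 where "comparison p T x D S R.Ts R.\<kappa> h0 h1" using comparison_rescaled[OF R \<psi>] by blast
  then interpret C: comparison p T x D S R.Ts R.\<kappa> h0 h1 .
  have "\<not> T < R.Ts" using C.not_maximal max unfolding maximal_p_curve_shortening_flow_def by blast
  moreover have "\<not> R.Ts < T"
  proof
    assume lt: "R.Ts < T"
    then have sub: "{0..R.Ts} \<subseteq> S" by (auto simp: S_def)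
    obtain B where B: "\<And>t u. t \<in> {0..R.Ts} \<Longrightarrow> \<bar>k t u\<bar> \<le> B"
      using periodic_bounded[OF Cinf_cont2[OF k_Cinf] sub k_periodic] by blast
    obtain t where t: "t \<in> {0..<R.Ts}" "\<And>\<theta>. B < R.\<kappa> t \<theta>" using R.\<kappa>_unbounded by blast
    then have tS: "t \<in> S" "t < R.Ts" using lt by (auto simp: S_def)
    show False using B[of t 0] t(1) t(2)[of "\<phi> t 0"] C.support_eq(3)[OF tS, of 0] by auto
  qed
  ultimately show ?thesis by linarith
qed

text \<open>Once T = Ts, the dilation in \<open>rescaled_flow\<close> is by the circle curvature r,
  which divides out of \<kappa> = r (1 + v), and the two time changes are inverse to each
  other.\<close>

lemma rescaled_curvature:
  assumes R: "rescaled_solution p a \<psi> V" and \<psi>: "\<psi> = angle_curvature (x 0)"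
    and max: "maximal_p_curve_shortening_flow p T x" and \<tau>: "0 \<le> \<tau>"
  shows "(\<lambda>\<theta>. angle_curvature (rescaled_flow p T x \<tau>) \<theta> - 1) = V 0 \<tau>"
proof
  fix \<theta>
  interpret R: rescaled_solution p a \<psi> V by (rule R)
  obtain h0 h1 where "comparison p T x D S R.Ts R.\<kappa> h0 h1" using comparison_rescaled[OF R \<psi>] by blast
  then interpret C: comparison p T x D S R.Ts R.\<kappa> h0 h1 .
  have T_eq: "T = R.Ts" by (rule maximal_time[OF R \<psi> max])
  define t where "t = original_time p T \<tau>"
  have t: "t \<in> S" "t < R.Ts" using original_time_in[OF T \<tau>, of p] by (simp_all add: t_def S_def flip: T_eq)
  have "R.\<tau> t = \<tau>" using original_time_iff[of T t \<tau> p] T t(2) unfolding R.\<tau>_def T_eq[symmetric] t_def by simp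
  moreover have "rescaled_flow p T x \<tau> = (\<lambda>u. R.r t *\<^sub>R x t u)"
    by (rule ext) (simp add: rescaled_flow_def R.r_def Let_def t_def T_eq)
  ultimately show "angle_curvature (rescaled_flow p T x \<tau>) \<theta> - 1 = V 0 \<tau> \<theta>"
    using C.scaled_angle_curvature[OF t R.r_pos[OF t(2)], of \<theta>] R.r_pos[OF t(2)] by (simp add: R.\<kappa>_def)
qed

end

text \<open>The constants may depend on \<psi> but not on the flow. The solution V is therefore
  chosen once from \<psi>, and every flow with this initial curvature is identified with it; without
  any such flow the claim is vacuous.\<close>

lemma convergence_constants:
  assumes p: "1 \<le> p"
    and solution: "\<forall>\<psi> D. D 0 = \<psi> \<and> (\<forall>j u. (D j has_real_derivative D (Suc j) u) (at u)) \<and> (\<forall>u. \<psi> (u + 2 * pi) = \<psi> u) \<and>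
    (\<forall>u. 0 < \<psi> u) \<and> (\<forall>r. integral {0..2 * pi} (\<lambda>\<theta>. sin (\<theta> + r) / \<psi> \<theta>) = 0) \<and>
    c * fourier_seminorm 2 \<psi> \<le> Re (fourier_coeff \<psi> 0) \<longrightarrow>
    (\<exists>a V. rescaled_solution p a \<psi> V \<and> (\<forall>j. \<exists>A. \<forall>\<tau>\<ge>0. \<forall>\<theta>. \<bar>V j \<tau> \<theta>\<bar> \<le> A * exp (- mu p * \<tau>)))"
  shows "\<exists>C :: nat \<Rightarrow> real. \<forall>T x. 0 < T \<and> maximal_p_curve_shortening_flow p T x \<and> \<psi> = angle_curvature (x 0) \<and>
      Re (fourier_coeff \<psi> 0) \<ge> c * fourier_seminorm 2 \<psi> \<longrightarrow>
      (\<forall>l. \<forall>\<tau>\<ge>0. Cl_norm l (\<lambda>\<theta>. angle_curvature (rescaled_flow p T x \<tau>) \<theta> - 1) \<le> C l * exp (- (3 * real p - 1) * \<tau>))"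
proof (cases "\<exists>T x. 0 < T \<and> maximal_p_curve_shortening_flow p T x \<and> \<psi> = angle_curvature (x 0) \<and>
      Re (fourier_coeff \<psi> 0) \<ge> c * fourier_seminorm 2 \<psi>")
  case True
  then obtain T0 x0 where x0: "0 < T0" "maximal_p_curve_shortening_flow p T0 x0" "\<psi> = angle_curvature (x0 0)"
    "c * fourier_seminorm 2 \<psi> \<le> Re (fourier_coeff \<psi> 0)" by blast
  have fl: "\<exists>D. flow p T x D {0..<T}" if "0 < T" "maximal_p_curve_shortening_flow p T x" for T x
    using flow_exists[OF p that(1)] that(2) unfolding maximal_p_curve_shortening_flow_def by blast
  obtain D0 where D0: "flow p T0 x0 D0 {0..<T0}" using fl[OF x0(1,2)] by blast
  obtain D where D: "D 0 = \<psi>" "\<And>j u. (D j has_real_derivative D (Suc j) u) (at u)"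
    using flow.initial_curvature(1)[OF D0 x0(3)] by blast
  obtain a V where V: "rescaled_solution p a \<psi> V" "\<And>j. \<exists>A. \<forall>\<tau>\<ge>0. \<forall>\<theta>. \<bar>V j \<tau> \<theta>\<bar> \<le> A * exp (- mu p * \<tau>)"
    using solution D flow.initial_curvature(2,3,4)[OF D0 x0(3)] x0(4) by blast
  obtain A where A: "\<And>j \<tau> \<theta>. 0 \<le> \<tau> \<Longrightarrow> \<bar>V j \<tau> \<theta>\<bar> \<le> A j * exp (- mu p * \<tau>)" using V(2) by metis
  show ?thesis
  \<comment> \<open>The sum of absolute values dominates all the bounds \<open>A j\<close> with j
    \<le> l at once.\<close>
  proof (intro exI[of _ "\<lambda>l. \<Sum>j\<le>l. \<bar>A j\<bar>"] allI impI, elim conjE)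
    fix T x l and \<tau> :: real
    assume x: "0 < T" "maximal_p_curve_shortening_flow p T x" "\<psi> = angle_curvature (x 0)" and \<tau>: "0 \<le> \<tau>"
    obtain D where D: "flow p T x D {0..<T}" using fl[OF x(1,2)] by blast
    have "Cl_norm l (V 0 \<tau>) \<le> (\<Sum>j\<le>l. \<bar>A j\<bar>) * exp (- (3 * real p - 1) * \<tau>)"
    proof (rule Cl_norm_le[where W="\<lambda>j. V j \<tau>"])
      show "(V j \<tau> has_real_derivative V (Suc j) \<tau> \<theta>) (at \<theta>)" for j \<theta>
        by (rule rescaled_solution.V_du[OF V(1) \<tau>])
      fix j \<theta> assume j: "j \<le> l"
      have "\<bar>V j \<tau> \<theta>\<bar> \<le> A j * exp (- mu p * \<tau>)" by (rule A[OF \<tau>])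
      also have "\<dots> \<le> (\<Sum>j\<le>l. \<bar>A j\<bar>) * exp (- mu p * \<tau>)"
        using member_le_sum[of j "{..l}" "\<lambda>j. \<bar>A j\<bar>"] j by (intro mult_right_mono) auto
      finally show "\<bar>V j \<tau> \<theta>\<bar> \<le> (\<Sum>j\<le>l. \<bar>A j\<bar>) * exp (- (3 * real p - 1) * \<tau>)" by (simp add: mu_def)
    qed
    then show "Cl_norm l (\<lambda>\<theta>. angle_curvature (rescaled_flow p T x \<tau>) \<theta> - 1) \<le> (\<Sum>j\<le>l. \<bar>A j\<bar>) * exp (- (3 * real p - 1) * \<tau>)"
      unfolding flow.rescaled_curvature[OF D V(1) x(3,2) \<tau>] .
  qed
qed blast

theorem theorem1:
  fixes p :: nat
  assumes "p \<ge> 1"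
  shows "\<exists>c>0. \<exists>C :: nat \<Rightarrow> (real \<Rightarrow> real) \<Rightarrow> real.
    \<forall>(T::real) (x :: real \<Rightarrow> real \<Rightarrow> complex) \<psi>.
      0 < T \<and> maximal_p_curve_shortening_flow p T x \<and>
      \<psi> = angle_curvature (x 0) \<and>
      Re (fourier_coeff \<psi> 0) \<ge> c * fourier_seminorm 2 \<psi> \<longrightarrow>
      (\<forall>l. \<forall>\<tau>\<ge>0.
         Cl_norm l (\<lambda>\<theta>. angle_curvature (rescaled_flow p T x \<tau>) \<theta> - 1)
           \<le> C l \<psi> * exp (- (3 * real p - 1) * \<tau>))"
  using rescaled_solution_exists[OF assms]
proof (elim exE conjE, goal_cases)
  case (1 c)
  from convergence_constants[OF assms 1(2)] obtain C where "\<forall>\<psi> T x. 0 < T \<and> maximal_p_curve_shortening_flow p T x \<and>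
      \<psi> = angle_curvature (x 0) \<and> Re (fourier_coeff \<psi> 0) \<ge> c * fourier_seminorm 2 \<psi> \<longrightarrow>
      (\<forall>l. \<forall>\<tau>\<ge>0. Cl_norm l (\<lambda>\<theta>. angle_curvature (rescaled_flow p T x \<tau>) \<theta> - 1)
        \<le> C \<psi> l * exp (- (3 * real p - 1) * \<tau>))"
    by metis
  then show ?case using 1(1) by (intro exI[of _ c] conjI exI[of _ "\<lambda>l \<psi>. C \<psi> l"]) blast+
qed

end
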